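(* Let $\Gamma$ be a finite connected graph that is not homeomorphic to the generalized theta graph $\Theta_m$ for any $m \geq 0$. If the graph braid group $B_3(\Gamma)$ is hyperbolic, then $B_3(\Gamma) \cong H \ast \mathbb{Z}$ for some group $H$.
   Context: For a finite graph $\Gamma$ (regarded as a 1-dimensional CW complex) and a positive integer $n$, let $C_n^{\mathrm{top}}(\Gamma)=\{(x_1,\dots,x_n)\in\Gamma^n : x_i\neq x_j \text{ for } i\neq j\}$ and $UC_n^{\mathrm{top}}(\Gamma)=C_n^{\mathrm{top}}(\Gamma)/S_n$, where $S_n$ permutes coordinates. The graph braid group is $B_n(\Gamma,S)=\pi_1(UC_n^{\mathrm{top}}(\Gamma),S)$, where $S\in UC_n^{\mathrm{top}}(\Gamma)$ is a base point; when $\Gamma$ is connected it does not depend on the base point up to isomorphism and is written $B_n(\Gamma)$. The generalized theta graph $\Theta_m$ is the graph obtained by gluing $m$ cycles along a fixed non-trivial segment (so $\Theta_0$ is a segment, $\Theta_1$ is a cycle, and for $m\ge 1$, $\Theta_m$ is homeomorphic to two vertices joined by $m+1$ edges). "Hyperbolic" means Gromov hyperbolic. The group $H$ is allowed to be trivial. *)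

theory Defs
  imports "HOL-Analysis.Analysis" "HOL-Algebra.Elementary_Groups"
begin

definition quotient_topology :: "'a topology \<Rightarrow> ('a \<Rightarrow> 'b) \<Rightarrow> 'b topology" where
  "quotient_topology X f =
     topology (\<lambda>U. U \<subseteq> f ` topspace X \<and> openin X {x \<in> topspace X. f x \<in> U})"

lemma istopology_quotient_topology:
  "istopology (\<lambda>U. U \<subseteq> f ` topspace X \<and> openin X {x \<in> topspace X. f x \<in> U})"
proof -
  have 1: "{x \<in> topspace X. f x \<in> S \<inter> T} =
      {x \<in> topspace X. f x \<in> S} \<inter> {x \<in> topspace X. f x \<in> T}" for S T
    by auto
  have 2: "{x \<in> topspace X. f x \<in> \<Union>\<K>} = (\<Union>K\<in>\<K>. {x \<in> topspace X. f x \<in> K})" for \<K>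
    by auto
  show ?thesis
    unfolding istopology_def 1 2 by (auto intro!: openin_Union)
qed

lemma openin_quotient_topology:
  "openin (quotient_topology X f) U \<longleftrightarrow>
     U \<subseteq> f ` topspace X \<and> openin X {x \<in> topspace X. f x \<in> U}"
  unfolding quotient_topology_def
  by (subst topology_inverse'[OF istopology_quotient_topology]) simp

lemma topspace_quotient_topology [simp]: "topspace (quotient_topology X f) = f ` topspace X"
proof -
  have "{x \<in> topspace X. f x \<in> f ` topspace X} = topspace X" by auto
  then have "openin (quotient_topology X f) (f ` topspace X)"
    by (simp add: openin_quotient_topology)
  moreover have "topspace (quotient_topology X f) \<subseteq> f ` topspace X"
    using openin_topspace[of "quotient_topology X f"] by (simp only: openin_quotient_topology)
  ultimately show ?thesis
    by (simp add: openin_subset subset_antisym)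
qed

lemma quotient_map_quotient_topology: "quotient_map X (quotient_topology X f) f"
  by (auto simp: quotient_map_def openin_quotient_topology)

text \<open>
  A Hausdorff space with a finite CW structure of dimension at most one. \<open>V\<close> is the set of
  vertices, \<open>E\<close> the set of characteristic maps of the edges. Loops and multiple edges are
  allowed. As there are finitely many cells and the space is Hausdorff, the topology is the weak
  one and each characteristic map is a homeomorphism from the open interval to the open edge.
\<close>

definition finite_graph :: "'a topology \<Rightarrow> bool" where
  "finite_graph X \<longleftrightarrow>
     Hausdorff_space X \<and>
     (\<exists>V (E :: (real \<Rightarrow> 'a) set).
        finite V \<and> V \<subseteq> topspace X \<and>
        finite E \<and>
        (\<forall>e\<in>E. pathin X e \<and> e 0 \<in> V \<and> e 1 \<in> V \<and>
                inj_on e {0<..<1} \<and> disjnt (e ` {0<..<1}) V) \<and>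
        pairwise (\<lambda>e e'. disjnt (e ` {0<..<1}) (e' ` {0<..<1})) E \<and>
        topspace X = V \<union> (\<Union>e\<in>E. e ` {0<..<1}))"

text \<open>
  The disjoint union of a segment (summand \<open>0\<close>, the closed upper half of the unit circle) and
  of \<open>m\<close> cycles (summands \<open>1, \<dots>, m\<close>, copies of the unit circle); the upper half of every
  cycle is glued to the segment.
\<close>

definition theta_graph :: "nat \<Rightarrow> (nat \<times> complex) topology" where
  "theta_graph m =
     quotient_topology
       (sum_topology
          (\<lambda>i. if i = 0 then top_of_set {z \<in> sphere 0 1. 0 \<le> Im z} else top_of_set (sphere 0 1))
          {..m})
       (\<lambda>(i, z). if 0 \<le> Im z then (0, z) else (i, z))"

definition configuration_space :: "nat \<Rightarrow> 'a topology \<Rightarrow> (nat \<Rightarrow> 'a) topology" where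
  "configuration_space n X =
     subtopology (product_topology (\<lambda>_. X) {..<n}) {x. inj_on x {..<n}}"

definition permutation_orbit :: "nat \<Rightarrow> (nat \<Rightarrow> 'a) \<Rightarrow> (nat \<Rightarrow> 'a) set" where
  "permutation_orbit n x = {x \<circ> \<sigma> |\<sigma>. \<sigma> permutes {..<n}}"

definition unordered_configuration_space :: "nat \<Rightarrow> 'a topology \<Rightarrow> (nat \<Rightarrow> 'a) set topology" where
  "unordered_configuration_space n X =
     quotient_topology (configuration_space n X) (permutation_orbit n)"

definition loops :: "'a topology \<Rightarrow> 'a \<Rightarrow> (real \<Rightarrow> 'a) set" where
  "loops X x = {p. pathin X p \<and> p 0 = x \<and> p 1 = x}"

definition loop_join :: "(real \<Rightarrow> 'a) \<Rightarrow> (real \<Rightarrow> 'a) \<Rightarrow> real \<Rightarrow> 'a" where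
  "loop_join p q = (\<lambda>t. if t \<le> 1/2 then p (2 * t) else q (2 * t - 1))"

definition loop_homotopic :: "'a topology \<Rightarrow> 'a \<Rightarrow> (real \<Rightarrow> 'a) \<Rightarrow> (real \<Rightarrow> 'a) \<Rightarrow> bool" where
  "loop_homotopic X x = homotopic_with (\<lambda>r. r 0 = x \<and> r 1 = x) (top_of_set {0..1}) X"

definition loop_class :: "'a topology \<Rightarrow> 'a \<Rightarrow> (real \<Rightarrow> 'a) \<Rightarrow> (real \<Rightarrow> 'a) set" where
  "loop_class X x p = {q. loop_homotopic X x p q}"

definition fundamental_group :: "'a topology \<Rightarrow> 'a \<Rightarrow> (real \<Rightarrow> 'a) set monoid" where
  "fundamental_group X x =
     \<lparr>carrier = loop_class X x ` loops X x,
      monoid.mult = (\<lambda>A B. \<Union>p\<in>A. \<Union>q\<in>B. loop_class X x (loop_join p q)),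
      one = loop_class X x (\<lambda>_. x)\<rparr>"

lemma loop_homotopic_refl: "p \<in> loops X x \<Longrightarrow> loop_homotopic X x p p"
  by (simp add: loops_def loop_homotopic_def pathin_def)

lemma loop_homotopic_sym: "loop_homotopic X x p q \<Longrightarrow> loop_homotopic X x q p"
  by (simp add: loop_homotopic_def homotopic_with_sym)

lemma loop_homotopic_trans:
  "loop_homotopic X x p q \<Longrightarrow> loop_homotopic X x q r \<Longrightarrow> loop_homotopic X x p r"
  unfolding loop_homotopic_def by (rule homotopic_with_trans)

lemma loop_homotopic_loops:
  assumes "loop_homotopic X x p q"
  shows "p \<in> loops X x" "q \<in> loops X x"
  using homotopic_with_imp_continuous_maps[OF assms[unfolded loop_homotopic_def]]
    homotopic_with_imp_property[OF assms[unfolded loop_homotopic_def]]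
  by (auto simp: loops_def pathin_def)

lemma loop_class_eq: "loop_homotopic X x p q \<Longrightarrow> loop_class X x p = loop_class X x q"
  unfolding loop_class_def by (blast intro: loop_homotopic_sym loop_homotopic_trans)

lemma loop_homotopic_reparam:
  assumes p: "pathin X p"
    and f: "continuous_on {0..1} f" "\<And>t. t \<in> {0..1} \<Longrightarrow> f t \<in> {0..1}"
    and g: "continuous_on {0..1} g" "\<And>t. t \<in> {0..1} \<Longrightarrow> g t \<in> {0..1}"
    and eq: "f 0 = g 0" "f 1 = g 1"
    and x: "p (f 0) = x" "p (f 1) = x"
  shows "loop_homotopic X x (\<lambda>t. p (f t)) (\<lambda>t. p (g t))"
proof -
  have "homotopic_paths {0..1} f g"
  proof (rule homotopic_paths_linear)
    fix t :: real assume "t \<in> {0..1}"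
    then show "closed_segment (f t) (g t) \<subseteq> {0..1}"
      using f g by (intro closed_segment_subset) auto
  qed (use f g eq in \<open>auto simp: path_def pathstart_def pathfinish_def\<close>)
  then have "homotopic_with (\<lambda>r. r 0 = x \<and> r 1 = x) (top_of_set {0..1}) X (p \<circ> f) (p \<circ> g)"
    unfolding homotopic_paths_def
    by (rule homotopic_with_compose_continuous_map_left)
       (use p x in \<open>auto simp: pathin_def pathstart_def pathfinish_def\<close>)
  then show ?thesis
    by (simp add: loop_homotopic_def comp_def)
qed

lemma loop_homotopic_join:
  assumes "loop_homotopic X x p p'" "loop_homotopic X x q q'"
  shows "loop_homotopic X x (loop_join p q) (loop_join p' q')"
proof -
  let ?I = "top_of_set {0..1::real}"
  obtain h where h: "continuous_map (prod_topology ?I ?I) X h" "\<And>s. h (0, s) = p s"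
      "\<And>s. h (1, s) = p' s" "\<And>t. t \<in> {0..1} \<Longrightarrow> h (t, 0) = x \<and> h (t, 1) = x"
    using assms(1) unfolding loop_homotopic_def homotopic_with_def by metis
  obtain k where k: "continuous_map (prod_topology ?I ?I) X k" "\<And>s. k (0, s) = q s"
      "\<And>s. k (1, s) = q' s" "\<And>t. t \<in> {0..1} \<Longrightarrow> k (t, 0) = x \<and> k (t, 1) = x"
    using assms(2) unfolding loop_homotopic_def homotopic_with_def by metis
  define H where "H = (\<lambda>z. if snd z \<le> 1/2 then h (fst z, 2 * snd z) else k (fst z, 2 * snd z - 1))"
  have II: "prod_topology ?I ?I = top_of_set ({0..1} \<times> {0..1})"
    by (simp add: prod_topology_subtopology_eu)
  have "continuous_map (prod_topology ?I ?I) X H"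
    unfolding H_def
  proof (rule continuous_map_cases_le)
    show "continuous_map (prod_topology ?I ?I) euclideanreal snd"
      unfolding II by (simp add: continuous_on_snd)
    show "continuous_map (subtopology (prod_topology ?I ?I)
            {z \<in> topspace (prod_topology ?I ?I). snd z \<le> 1/2}) X (\<lambda>z. h (fst z, 2 * snd z))"
      by (rule continuous_map_compose[OF _ h(1), unfolded comp_def])
         (auto simp: II subtopology_subtopology intro!: continuous_intros)
    show "continuous_map (subtopology (prod_topology ?I ?I)
            {z \<in> topspace (prod_topology ?I ?I). 1/2 \<le> snd z}) X (\<lambda>z. k (fst z, 2 * snd z - 1))"
      by (rule continuous_map_compose[OF _ k(1), unfolded comp_def])
         (auto simp: II subtopology_subtopology intro!: continuous_intros)
  next
    fix z assume z: "z \<in> topspace (prod_topology ?I ?I)" "snd z = 1/2"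
    then have "2 * snd z = 1" "2 * snd z - 1 = 0" "fst z \<in> {0..1}"
      by (auto simp: II)
    then show "h (fst z, 2 * snd z) = k (fst z, 2 * snd z - 1)"
      using h(4) k(4) by metis
  qed simp
  then show ?thesis
    unfolding loop_homotopic_def homotopic_with_def
    by (intro exI[of _ H]) (use h k in \<open>auto simp: H_def loop_join_def\<close>)
qed

lemma loop_join_loops: "p \<in> loops X x \<Longrightarrow> q \<in> loops X x \<Longrightarrow> loop_join p q \<in> loops X x"
  by (meson loop_homotopic_join loop_homotopic_loops(1) loop_homotopic_refl)

lemma fundamental_group_mult:
  assumes "p \<in> loops X x" "q \<in> loops X x"
  shows "loop_class X x p \<otimes>\<^bsub>fundamental_group X x\<^esub> loop_class X x q
          = loop_class X x (loop_join p q)"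
proof -
  have "loop_class X x (loop_join p' q') = loop_class X x (loop_join p q)"
    if "p' \<in> loop_class X x p" "q' \<in> loop_class X x q" for p' q'
    using that loop_class_eq loop_homotopic_join loop_homotopic_sym
    by (metis loop_class_def mem_Collect_eq)
  moreover have "p \<in> loop_class X x p" "q \<in> loop_class X x q"
    using assms by (simp_all add: loop_class_def loop_homotopic_refl)
  ultimately have "(\<Union>p'\<in>loop_class X x p. \<Union>q'\<in>loop_class X x q. loop_class X x (loop_join p' q'))
      = loop_class X x (loop_join p q)"
    by blast
  then show ?thesis
    by (simp add: fundamental_group_def)
qed

lemma group_fundamental_group:
  assumes x: "x \<in> topspace X"
  shows "group (fundamental_group X x)"
proof (rule groupI)
  let ?G = "fundamental_group X x"
  have car: "carrier ?G = loop_class X x ` loops X x"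
    and one: "\<one>\<^bsub>?G\<^esub> = loop_class X x (\<lambda>_. x)"
    by (simp_all add: fundamental_group_def)
  have c: "(\<lambda>_. x) \<in> loops X x"
    using x by (simp add: loops_def pathin_def)
  show "\<one>\<^bsub>?G\<^esub> \<in> carrier ?G"
    using c by (auto simp: car one)
  fix A assume "A \<in> carrier ?G"
  then obtain p where p: "p \<in> loops X x" and A: "A = loop_class X x p"
    by (auto simp: car)
  have p': "pathin X p" "p 0 = x" "p 1 = x"
    using p by (auto simp: loops_def)
  show "\<one>\<^bsub>?G\<^esub> \<otimes>\<^bsub>?G\<^esub> A = A"
  proof -
    have "loop_homotopic X x (\<lambda>t. p (max 0 (2 * t - 1))) (\<lambda>t. p t)"
      by (rule loop_homotopic_reparam) (use p' in \<open>auto intro!: continuous_intros\<close>)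
    moreover have "max 0 (2 * t - 1) = (if t \<le> 1/2 then 0 else 2 * t - 1)" for t :: real
      by (simp add: max_def)
    then have "(\<lambda>t. p (max 0 (2 * t - 1))) = loop_join (\<lambda>_. x) p"
      using p' by (intro ext) (simp add: loop_join_def)
    ultimately show ?thesis
      using c p by (simp add: A one fundamental_group_mult loop_class_eq)
  qed
  show "\<exists>B\<in>carrier ?G. B \<otimes>\<^bsub>?G\<^esub> A = \<one>\<^bsub>?G\<^esub>"
  proof -
    let ?q = "\<lambda>t. p (1 - t)"
    have "loop_homotopic X x (\<lambda>t. p \<bar>2 * t - 1\<bar>) (\<lambda>t. p 1)"
      by (rule loop_homotopic_reparam) (use p' in \<open>auto intro!: continuous_intros\<close>)
    moreover have "\<bar>2 * t - 1\<bar> = (if t \<le> 1/2 then 1 - 2 * t else 2 * t - 1)" for t :: real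
      by (simp add: abs_if)
    then have "(\<lambda>t. p \<bar>2 * t - 1\<bar>) = loop_join ?q p"
      by (intro ext) (simp add: loop_join_def)
    moreover have "pathin X (p \<circ> (\<lambda>t. 1 - t))"
      unfolding pathin_def
      by (rule continuous_map_compose[OF _ p'(1)[unfolded pathin_def]])
         (auto intro!: continuous_intros)
    then have "?q \<in> loops X x"
      using p' by (auto simp: loops_def comp_def)
    ultimately show ?thesis
      using p p' by (intro bexI[of _ "loop_class X x ?q"])
        (auto simp: A one car fundamental_group_mult loop_class_eq)
  qed
  fix B assume "B \<in> carrier ?G"
  then obtain q where q: "q \<in> loops X x" and B: "B = loop_class X x q"
    by (auto simp: car)
  show "A \<otimes>\<^bsub>?G\<^esub> B \<in> carrier ?G"
    using p q by (auto simp: A B car fundamental_group_mult loop_join_loops)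
  fix C assume "C \<in> carrier ?G"
  then obtain r where r: "r \<in> loops X x" and C: "C = loop_class X x r"
    by (auto simp: car)
  define f :: "real \<Rightarrow> real" where "f = (\<lambda>t. min (2 * t) (min (t + 1/4) (t / 2 + 1/2)))"
  define f' :: "real \<Rightarrow> real" where
    "f' = (\<lambda>t. if t \<le> 1/2 then min (2 * t) (t + 1/4) else t / 2 + 1/2)"
  have ff': "f = f'" by (auto simp: f_def f'_def min_def)
  let ?j = "loop_join p (loop_join q r)"
  have j: "?j \<in> loops X x" using p q r by (simp add: loop_join_loops)
  have "loop_homotopic X x (\<lambda>t. ?j (f t)) (\<lambda>t. ?j t)"
    by (rule loop_homotopic_reparam)
       (use j in \<open>auto simp: f_def loops_def intro!: continuous_intros\<close>)
  moreover have "?j (f t) = loop_join (loop_join p q) r t" for t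
  proof -
    consider "t \<le> 1/4" | "1/4 < t" "t \<le> 1/2" | "1/2 < t" by linarith
    then show ?thesis
    proof cases
      case 2
      then have "f t = t + 1/4" by (simp add: ff' f'_def)
      with 2 show ?thesis by (simp add: loop_join_def)
    qed (simp_all add: ff' f'_def loop_join_def min_def field_simps)
  qed
  ultimately show "A \<otimes>\<^bsub>?G\<^esub> B \<otimes>\<^bsub>?G\<^esub> C = A \<otimes>\<^bsub>?G\<^esub> (B \<otimes>\<^bsub>?G\<^esub> C)"
    using p q r by (simp add: A B C fundamental_group_mult loop_join_loops loop_class_eq)
qed

definition graph_braid_group ::
    "nat \<Rightarrow> 'a topology \<Rightarrow> (nat \<Rightarrow> 'a) set \<Rightarrow> (real \<Rightarrow> (nat \<Rightarrow> 'a) set) set monoid" where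
  "graph_braid_group n \<Gamma> S = fundamental_group (unordered_configuration_space n \<Gamma>) S"

definition gromov_product :: "('a \<Rightarrow> 'a \<Rightarrow> real) \<Rightarrow> 'a \<Rightarrow> 'a \<Rightarrow> 'a \<Rightarrow> real" where
  "gromov_product d w x y = (d x w + d y w - d x y) / 2"

definition gromov_hyperbolic :: "'a set \<Rightarrow> ('a \<Rightarrow> 'a \<Rightarrow> real) \<Rightarrow> bool" where
  "gromov_hyperbolic M d \<longleftrightarrow>
     (\<exists>\<delta>. \<forall>w\<in>M. \<forall>x\<in>M. \<forall>y\<in>M. \<forall>z\<in>M.
        min (gromov_product d w x y) (gromov_product d w y z) - \<delta> \<le> gromov_product d w x z)"

definition word_length :: "('a, 'b) monoid_scheme \<Rightarrow> 'a set \<Rightarrow> 'a \<Rightarrow> nat" where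
  "word_length G A g =
     (LEAST n. \<exists>ws. length ws = n \<and> set ws \<subseteq> A \<union> m_inv G ` A \<and>
                    foldr (\<otimes>\<^bsub>G\<^esub>) ws \<one>\<^bsub>G\<^esub> = g)"

definition word_metric :: "('a, 'b) monoid_scheme \<Rightarrow> 'a set \<Rightarrow> 'a \<Rightarrow> 'a \<Rightarrow> real" where
  "word_metric G A g h = real (word_length G A (inv\<^bsub>G\<^esub> g \<otimes>\<^bsub>G\<^esub> h))"

definition hyperbolic_group :: "('a, 'b) monoid_scheme \<Rightarrow> bool" where
  "hyperbolic_group G \<longleftrightarrow>
     group G \<and>
     (\<exists>A. finite A \<and> A \<subseteq> carrier G \<and> generate G A = carrier G \<and>
          gromov_hyperbolic (carrier G) (word_metric G A))"

definition free_product_words ::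
    "('a, 'm) monoid_scheme \<Rightarrow> ('b, 'n) monoid_scheme \<Rightarrow> ('a + 'b) list set" where
  "free_product_words G H = lists (carrier G <+> carrier H)"

inductive free_product_equiv ::
    "('a, 'm) monoid_scheme \<Rightarrow> ('b, 'n) monoid_scheme \<Rightarrow>
     ('a + 'b) list \<Rightarrow> ('a + 'b) list \<Rightarrow> bool"
  for G H where
    refl: "w \<in> free_product_words G H \<Longrightarrow> free_product_equiv G H w w"
  | sym: "free_product_equiv G H v w \<Longrightarrow> free_product_equiv G H w v"
  | trans: "free_product_equiv G H u v \<Longrightarrow> free_product_equiv G H v w \<Longrightarrow>
            free_product_equiv G H u w"
  | one_left: "u \<in> free_product_words G H \<Longrightarrow> v \<in> free_product_words G H \<Longrightarrow>
            free_product_equiv G H (u @ Inl \<one>\<^bsub>G\<^esub> # v) (u @ v)"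
  | one_right: "u \<in> free_product_words G H \<Longrightarrow> v \<in> free_product_words G H \<Longrightarrow>
            free_product_equiv G H (u @ Inr \<one>\<^bsub>H\<^esub> # v) (u @ v)"
  | mult_left: "u \<in> free_product_words G H \<Longrightarrow> v \<in> free_product_words G H \<Longrightarrow>
            a \<in> carrier G \<Longrightarrow> b \<in> carrier G \<Longrightarrow>
            free_product_equiv G H (u @ Inl a # Inl b # v) (u @ Inl (a \<otimes>\<^bsub>G\<^esub> b) # v)"
  | mult_right: "u \<in> free_product_words G H \<Longrightarrow> v \<in> free_product_words G H \<Longrightarrow>
            a \<in> carrier H \<Longrightarrow> b \<in> carrier H \<Longrightarrow>
            free_product_equiv G H (u @ Inr a # Inr b # v) (u @ Inr (a \<otimes>\<^bsub>H\<^esub> b) # v)"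

definition free_product_class ::
    "('a, 'm) monoid_scheme \<Rightarrow> ('b, 'n) monoid_scheme \<Rightarrow>
     ('a + 'b) list \<Rightarrow> ('a + 'b) list set" where
  "free_product_class G H w = {v. free_product_equiv G H w v}"

definition free_product ::
    "('a, 'm) monoid_scheme \<Rightarrow> ('b, 'n) monoid_scheme \<Rightarrow> ('a + 'b) list set monoid" where
  "free_product G H =
     \<lparr>carrier = free_product_class G H ` free_product_words G H,
      monoid.mult = (\<lambda>A B. \<Union>u\<in>A. \<Union>v\<in>B. free_product_class G H (u @ v)),
      one = free_product_class G H []\<rparr>"

lemma free_product_equiv_words:
  assumes "group G" "group H" "free_product_equiv G H u v"
  shows "u \<in> free_product_words G H" "v \<in> free_product_words G H"
proof -
  interpret G: group G by fact
  interpret H: group H by fact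
  from assms(3) have "u \<in> free_product_words G H \<and> v \<in> free_product_words G H"
    by induction (auto simp: free_product_words_def)
  then show "u \<in> free_product_words G H" "v \<in> free_product_words G H" by auto
qed

lemma free_product_equiv_context:
  assumes "free_product_equiv G H u v" "a \<in> free_product_words G H" "b \<in> free_product_words G H"
  shows "free_product_equiv G H (a @ u @ b) (a @ v @ b)"
  using assms(1)
proof induction
  case (refl w)
  then show ?case
    using assms(2,3) by (intro free_product_equiv.refl) (auto simp: free_product_words_def)
next
  case (sym v w)
  then show ?case by (blast intro: free_product_equiv.sym)
next
  case (trans u v w)
  then show ?case by (blast intro: free_product_equiv.trans)
next
  case (one_left u v)
  then show ?case
    using free_product_equiv.one_left[of "a @ u" G H "v @ b"] assms(2,3)
    by (simp add: free_product_words_def)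
next
  case (one_right u v)
  then show ?case
    using free_product_equiv.one_right[of "a @ u" G H "v @ b"] assms(2,3)
    by (simp add: free_product_words_def)
next
  case (mult_left u v c d)
  then show ?case
    using free_product_equiv.mult_left[of "a @ u" G H "v @ b" c d] assms(2,3)
    by (simp add: free_product_words_def)
next
  case (mult_right u v c d)
  then show ?case
    using free_product_equiv.mult_right[of "a @ u" G H "v @ b" c d] assms(2,3)
    by (simp add: free_product_words_def)
qed

lemma free_product_class_eq:
  "free_product_equiv G H u v \<Longrightarrow> free_product_class G H u = free_product_class G H v"
  unfolding free_product_class_def
  by (blast intro: free_product_equiv.sym free_product_equiv.trans)

lemma free_product_mult:
  assumes "group G" "group H" "u \<in> free_product_words G H" "v \<in> free_product_words G H"
  shows "free_product_class G H u \<otimes>\<^bsub>free_product G H\<^esub> free_product_class G H v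
          = free_product_class G H (u @ v)"
proof -
  have "free_product_class G H (u' @ v') = free_product_class G H (u @ v)"
    if u': "free_product_equiv G H u u'" and v': "free_product_equiv G H v v'" for u' v'
  proof -
    note w = free_product_equiv_words[OF assms(1,2)]
    have "free_product_equiv G H (u @ v) (u' @ v)"
      using free_product_equiv_context[OF u', of "[]" v] assms(4)
      by (simp add: free_product_words_def)
    moreover have "free_product_equiv G H (u' @ v) (u' @ v')"
      using free_product_equiv_context[OF v', of u' "[]"] w(2)[OF u']
      by (simp add: free_product_words_def)
    ultimately show ?thesis
      by (metis free_product_class_eq)
  qed
  moreover have "free_product_equiv G H u u" "free_product_equiv G H v v"
    using assms by (simp_all add: free_product_equiv.refl)
  ultimately have "(\<Union>u'\<in>{u'. free_product_equiv G H u u'}. \<Union>v'\<in>{v'. free_product_equiv G H v v'}.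
      free_product_class G H (u' @ v')) = free_product_class G H (u @ v)"
    by blast
  then show ?thesis
    by (simp add: free_product_def free_product_class_def[of G H u] free_product_class_def[of G H v])
qed

lemma group_free_product:
  assumes "group G" "group H"
  shows "group (free_product G H)"
proof (rule groupI)
  interpret G: group G by fact
  interpret H: group H by fact
  let ?F = "free_product G H" and ?W = "free_product_words G H" and ?c = "free_product_class G H"
  note mult = free_product_mult[OF assms]
  have car: "carrier ?F = ?c ` ?W" and one: "\<one>\<^bsub>?F\<^esub> = ?c []"
    by (simp_all add: free_product_def)
  have nil: "[] \<in> ?W" and app: "\<And>u v. u \<in> ?W \<Longrightarrow> v \<in> ?W \<Longrightarrow> u @ v \<in> ?W"
    by (simp_all add: free_product_words_def)
  show "\<one>\<^bsub>?F\<^esub> \<in> carrier ?F"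
    using nil by (auto simp: car one)
  fix A assume "A \<in> carrier ?F"
  then obtain u where u: "u \<in> ?W" and A: "A = ?c u" by (auto simp: car)
  show "\<one>\<^bsub>?F\<^esub> \<otimes>\<^bsub>?F\<^esub> A = A"
    using mult[OF nil u] by (simp add: A one)
  have "\<exists>v\<in>?W. free_product_equiv G H (v @ u) []"
    using u
  proof (induction u)
    case Nil
    show ?case using nil free_product_equiv.refl[OF nil] by (intro bexI[of _ "[]"]) auto
  next
    case (Cons l u)
    then have u: "u \<in> ?W" and l: "l \<in> carrier G <+> carrier H"
      by (auto simp: free_product_words_def)
    then obtain v where v: "v \<in> ?W" "free_product_equiv G H (v @ u) []"
      using Cons.IH by blast
    show ?case
    proof (cases l)
      case (Inl a)
      then have a: "a \<in> carrier G" using l by auto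
      have "free_product_equiv G H (v @ Inl (inv\<^bsub>G\<^esub> a) # Inl a # u) (v @ Inl \<one>\<^bsub>G\<^esub> # u)"
        using free_product_equiv.mult_left[OF v(1) u G.inv_closed[OF a] a] a by simp
      then have "free_product_equiv G H ((v @ [Inl (inv\<^bsub>G\<^esub> a)]) @ l # u) []"
        using free_product_equiv.one_left[OF v(1) u] v(2) Inl
        by simp (blast intro: free_product_equiv.trans)
      then show ?thesis
        using v(1) a by (intro bexI[of _ "v @ [Inl (inv\<^bsub>G\<^esub> a)]"])
          (auto simp: free_product_words_def)
    next
      case (Inr a)
      then have a: "a \<in> carrier H" using l by auto
      have "free_product_equiv G H (v @ Inr (inv\<^bsub>H\<^esub> a) # Inr a # u) (v @ Inr \<one>\<^bsub>H\<^esub> # u)"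
        using free_product_equiv.mult_right[OF v(1) u H.inv_closed[OF a] a] a by simp
      then have "free_product_equiv G H ((v @ [Inr (inv\<^bsub>H\<^esub> a)]) @ l # u) []"
        using free_product_equiv.one_right[OF v(1) u] v(2) Inr
        by simp (blast intro: free_product_equiv.trans)
      then show ?thesis
        using v(1) a by (intro bexI[of _ "v @ [Inr (inv\<^bsub>H\<^esub> a)]"])
          (auto simp: free_product_words_def)
    qed
  qed
  then obtain v where "v \<in> ?W" "free_product_equiv G H (v @ u) []" by blast
  then show "\<exists>B\<in>carrier ?F. B \<otimes>\<^bsub>?F\<^esub> A = \<one>\<^bsub>?F\<^esub>"
    using u by (intro bexI[of _ "?c v"]) (auto simp: car A one mult free_product_class_eq)
  fix B assume "B \<in> carrier ?F"
  then obtain v where v: "v \<in> ?W" and B: "B = ?c v" by (auto simp: car)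
  show "A \<otimes>\<^bsub>?F\<^esub> B \<in> carrier ?F"
    using u v by (auto simp: A B car mult app)
  fix C assume "C \<in> carrier ?F"
  then obtain w where w: "w \<in> ?W" and C: "C = ?c w" by (auto simp: car)
  show "A \<otimes>\<^bsub>?F\<^esub> B \<otimes>\<^bsub>?F\<^esub> C = A \<otimes>\<^bsub>?F\<^esub> (B \<otimes>\<^bsub>?F\<^esub> C)"
    using u v w by (simp add: A B C mult app)
qed

end

theory Submission
  imports Defs
begin

text \<open>
  Take a cell structure with the fewest vertices, so that no vertex can be smoothed.

  If there is a leaf edge, or a loop, \<open>e\<close> at a vertex \<open>v\<close> with at least two further edges \<open>f\<close>
  and \<open>g\<close> at \<open>v\<close>, consider the configurations with two particles on \<open>e\<close> and the third one on
  \<open>f\<close>, closer to \<open>v\<close> than both. They form a contractible open set that is cut in two by a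
  contractible wall, and removing the wall leaves the configuration space connected, because the
  particles can be rearranged through \<open>g\<close>. Hence the wall splits off a free factor \<open>\<int>\<close>.

  Otherwise, unless the graph is a theta graph, some edge \<open>e\<close> lies on a cycle that misses a vertex
  \<open>w\<close> of valence at least three: take \<open>e\<close> at the end of a longest path of distinct vertices.
  Moving one particle around the cycle commutes with exchanging the two others at \<open>w\<close>. Signed
  crossings of the midpoint of \<open>e\<close> give a homomorphism to \<open>\<int>\<close> that is nonzero on the first
  element and zero on the second, while crossings of \<open>w\<close>, labelled by reflections of \<open>\<int>\<close>,
  show that the second has infinite order. This is impossible in a hyperbolic group.
\<close>

section \<open>Path calculus: concatenation, reversal and reparametrization up to homotopy\<close>

section \<open>Homotopy of paths with fixed end points\<close>

text \<open>Both halves use one device, functors from the fundamental groupoid of a space to a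
  group, glued over an open cover. Base points would be in the way: the collar of the wall meets the
  complement of the wall in two pieces, so van Kampen with a connected overlap does not apply, and
  the generator of \<int> is exactly the mismatch between the two pieces. The same gluing yields the
  crossing homomorphisms, over the cover by configurations with no particle at a given point and
  configurations with one particle strictly nearest to it. The obstruction takes all three
  particles: one runs round a cycle while two are exchanged. In the exchange every lane label occurs
  once with either sign, so abelian labels see nothing; noncommuting reflections see a translation.
  Fewest vertices matter because a bivalent vertex has no room for an exchange: smoothing makes
  every vertex a leaf, the base of a loop, or of valence at least three. Theta graphs are exempt
  since each of their cycles contains both vertices, and no vertex is left for the exchange.\<close>

definition path_homotopic :: "'a topology \<Rightarrow> (real \<Rightarrow> 'a) \<Rightarrow> (real \<Rightarrow> 'a) \<Rightarrow> bool" where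
  "path_homotopic X p q =
     homotopic_with (\<lambda>r. r 0 = p 0 \<and> r 1 = p 1) (top_of_set {0..1}) X p q"

lemma path_homotopicD:
  assumes "path_homotopic X p q"
  shows "pathin X p" "pathin X q" "q 0 = p 0" "q 1 = p 1"
  using homotopic_with_imp_continuous_maps[OF assms[unfolded path_homotopic_def]]
    homotopic_with_imp_property[OF assms[unfolded path_homotopic_def]]
  by (auto simp: pathin_def)

lemma path_homotopic_sym: "path_homotopic X p q \<Longrightarrow> path_homotopic X q p"
  using path_homotopicD(3,4)[of X p q] by (simp add: path_homotopic_def homotopic_with_sym)

lemma path_homotopic_trans [trans]:
  assumes "path_homotopic X p q" "path_homotopic X q r"
  shows "path_homotopic X p r"
proof -
  have "homotopic_with (\<lambda>r. r 0 = p 0 \<and> r 1 = p 1) (top_of_set {0..1}) X q r"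
    using assms(2) path_homotopicD(3,4)[OF assms(1)] unfolding path_homotopic_def by simp
  with assms(1) show ?thesis unfolding path_homotopic_def by (rule homotopic_with_trans)
qed

lemma path_homotopic_cong:
  assumes "pathin X p" "\<And>t. t \<in> {0..1} \<Longrightarrow> p t = q t"
  shows "path_homotopic X p q"
proof -
  have "pathin X q"
    using assms unfolding pathin_def by (metis (no_types, lifting) continuous_map_eq topspace_euclidean_subtopology)
  then show ?thesis
    unfolding path_homotopic_def using assms(1) assms(2)[of 0] assms(2)[of 1]
    by (intro homotopic_with_equal) (simp_all add: pathin_def assms(2))
qed

lemma path_homotopic_refl: "pathin X p \<Longrightarrow> path_homotopic X p p"
  by (rule path_homotopic_cong) auto

lemma path_homotopic_loop: "p 0 = x \<Longrightarrow> p 1 = x \<Longrightarrow> path_homotopic X p q \<longleftrightarrow> loop_homotopic X x p q"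
  by (simp add: path_homotopic_def loop_homotopic_def)

lemma path_homotopic_continuous_image:
  assumes "path_homotopic X p q" "continuous_map X Y f"
  shows "path_homotopic Y (f \<circ> p) (f \<circ> q)"
  using assms unfolding path_homotopic_def
  by (auto intro!: homotopic_with_compose_continuous_map_left)

lemma path_homotopic_subtopology:
  assumes "path_homotopic (subtopology X A) p q" "A \<subseteq> B"
  shows "path_homotopic (subtopology X B) p q"
proof -
  have "continuous_map (subtopology X A) (subtopology X B) id"
    using assms(2) by (auto simp: continuous_map_in_subtopology continuous_map_from_subtopology)
  from path_homotopic_continuous_image[OF assms(1) this] show ?thesis by simp
qed

lemma path_homotopic_from_subtopology:
  "path_homotopic (subtopology X A) p q \<Longrightarrow> path_homotopic X p q"
  using path_homotopic_subtopology[of X A p q UNIV] by simp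

text \<open>The straight-line homotopy in \<open>K\<close>, pushed forward along \<open>h\<close>.
  Reparametrizations, triangle relations and charts all get their homotopies from this source, with
  \<open>K\<close> an interval, a square or a set of chart parameters.\<close>

lemma path_homotopic_convex:
  fixes u v :: "real \<Rightarrow> 'b::real_normed_vector"
  assumes K: "convex K" and h: "continuous_map (top_of_set K) X h"
    and u: "path u" "path_image u \<subseteq> K" and v: "path v" "path_image v \<subseteq> K"
    and eq: "u 0 = v 0" "u 1 = v 1"
  shows "path_homotopic X (h \<circ> u) (h \<circ> v)"
proof -
  have "homotopic_paths K u v"
  proof (rule homotopic_paths_linear)
    fix t :: real assume "t \<in> {0..1}"
    then have "u t \<in> K" "v t \<in> K" using u v by (auto simp: path_image_def)
    then show "closed_segment (u t) (v t) \<subseteq> K"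
      using K by (simp add: closed_segment_subset)
  qed (use u v eq in \<open>auto simp: pathstart_def pathfinish_def\<close>)
  then show ?thesis
    unfolding homotopic_paths_def path_homotopic_def
    by (rule homotopic_with_compose_continuous_map_left)
       (use h eq in \<open>auto simp: pathstart_def pathfinish_def\<close>)
qed

lemma loop_join_0 [simp]: "loop_join p q 0 = p 0"
  and loop_join_1 [simp]: "loop_join p q 1 = q 1"
  by (simp_all add: loop_join_def)

lemma path_homotopic_join:
  assumes "path_homotopic X p p'" "path_homotopic X q q'" "p 1 = q 0"
  shows "path_homotopic X (loop_join p q) (loop_join p' q')"
proof -
  let ?I = "top_of_set {0..1::real}"
  obtain h where h: "continuous_map (prod_topology ?I ?I) X h" "\<And>s. h (0, s) = p s"
      "\<And>s. h (1, s) = p' s" "\<And>t. t \<in> {0..1} \<Longrightarrow> h (t, 0) = p 0 \<and> h (t, 1) = p 1"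
    using assms(1) unfolding path_homotopic_def homotopic_with_def by metis
  obtain k where k: "continuous_map (prod_topology ?I ?I) X k" "\<And>s. k (0, s) = q s"
      "\<And>s. k (1, s) = q' s" "\<And>t. t \<in> {0..1} \<Longrightarrow> k (t, 0) = q 0 \<and> k (t, 1) = q 1"
    using assms(2) unfolding path_homotopic_def homotopic_with_def by metis
  define H where "H = (\<lambda>z. if snd z \<le> 1/2 then h (fst z, 2 * snd z) else k (fst z, 2 * snd z - 1))"
  have II: "prod_topology ?I ?I = top_of_set ({0..1} \<times> {0..1})"
    by (simp add: prod_topology_subtopology_eu)
  have "continuous_map (prod_topology ?I ?I) X H"
    unfolding H_def
  proof (rule continuous_map_cases_le)
    show "continuous_map (prod_topology ?I ?I) euclideanreal snd"
      unfolding II by (simp add: continuous_on_snd)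
    show "continuous_map (subtopology (prod_topology ?I ?I)
            {z \<in> topspace (prod_topology ?I ?I). snd z \<le> 1/2}) X (\<lambda>z. h (fst z, 2 * snd z))"
      by (rule continuous_map_compose[OF _ h(1), unfolded comp_def])
         (auto simp: II subtopology_subtopology intro!: continuous_intros)
    show "continuous_map (subtopology (prod_topology ?I ?I)
            {z \<in> topspace (prod_topology ?I ?I). 1/2 \<le> snd z}) X (\<lambda>z. k (fst z, 2 * snd z - 1))"
      by (rule continuous_map_compose[OF _ k(1), unfolded comp_def])
         (auto simp: II subtopology_subtopology intro!: continuous_intros)
  next
    fix z assume z: "z \<in> topspace (prod_topology ?I ?I)" "snd z = 1/2"
    then have "2 * snd z = 1" "2 * snd z - 1 = 0" "fst z \<in> {0..1}"
      by (auto simp: II)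
    then show "h (fst z, 2 * snd z) = k (fst z, 2 * snd z - 1)"
      using h(4) k(4) assms(3) by metis
  qed simp
  then show ?thesis
    unfolding path_homotopic_def homotopic_with_def
    by (intro exI[of _ H]) (use h k in \<open>auto simp: H_def loop_join_def\<close>)
qed

lemma pathin_join:
  "pathin X p \<Longrightarrow> pathin X q \<Longrightarrow> p 1 = q 0 \<Longrightarrow> pathin X (loop_join p q)"
  by (meson path_homotopicD(1) path_homotopic_join path_homotopic_refl)

lemma pathin_compose_real:
  assumes "pathin X p" "continuous_on {0..1} f" "\<And>t. t \<in> {0..1} \<Longrightarrow> f t \<in> {0..1::real}"
  shows "pathin X (\<lambda>t. p (f t))"
proof -
  have "continuous_map (top_of_set {0..1}) (top_of_set {0..1}) f"
    using assms by auto
  from continuous_map_compose[OF this assms(1)[unfolded pathin_def]] show ?thesis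
    by (simp add: pathin_def comp_def)
qed

lemma path_homotopic_reparam:
  assumes p: "pathin X p"
    and f: "continuous_on {0..1} f" "\<And>t. t \<in> {0..1} \<Longrightarrow> f t \<in> {0..1::real}"
    and g: "continuous_on {0..1} g" "\<And>t. t \<in> {0..1} \<Longrightarrow> g t \<in> {0..1}"
    and eq: "f 0 = g 0" "f 1 = g 1"
  shows "path_homotopic X (\<lambda>t. p (f t)) (\<lambda>t. p (g t))"
proof -
  have "path_homotopic X (p \<circ> f) (p \<circ> g)"
    by (rule path_homotopic_convex[of "{0..1}"])
       (use assms in \<open>auto simp: pathin_def path_def path_image_def\<close>)
  then show ?thesis by (simp add: comp_def)
qed

definition path_rev :: "(real \<Rightarrow> 'a) \<Rightarrow> real \<Rightarrow> 'a" where
  "path_rev p = (\<lambda>t. p (1 - t))"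

lemma path_rev_0 [simp]: "path_rev p 0 = p 1"
  and path_rev_1 [simp]: "path_rev p 1 = p 0"
  and path_rev_rev [simp]: "path_rev (path_rev p) = p"
  by (simp_all add: path_rev_def)

lemma pathin_rev [simp]: "pathin X (path_rev p) = pathin X p"
proof -
  have *: "pathin X p \<Longrightarrow> pathin X (path_rev p)" for p
    unfolding path_rev_def by (rule pathin_compose_real) (auto intro!: continuous_intros)
  from *[of p] *[of "path_rev p"] show ?thesis by auto
qed

lemma path_homotopic_assoc:
  assumes "pathin X p" "pathin X q" "pathin X r" "p 1 = q 0" "q 1 = r 0"
  shows "path_homotopic X (loop_join (loop_join p q) r) (loop_join p (loop_join q r))"
proof -
  \<comment> \<open>The reparametrization must send the breakpoints 1/4 and 1/2 of the left
    bracketing to 1/2 and 3/4. Its slopes 2, 1, 1/2 decrease, so it is a minimum of three affine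
    functions and continuity is immediate; \<open>f'\<close> is the same map by cases, for
    computing.\<close>
  define f :: "real \<Rightarrow> real" where "f = (\<lambda>t. min (2 * t) (min (t + 1/4) (t / 2 + 1/2)))"
  define f' :: "real \<Rightarrow> real" where
    "f' = (\<lambda>t. if t \<le> 1/2 then min (2 * t) (t + 1/4) else t / 2 + 1/2)"
  have ff': "f = f'" by (auto simp: f_def f'_def min_def)
  let ?j = "loop_join p (loop_join q r)"
  have "path_homotopic X (\<lambda>t. ?j (f t)) (\<lambda>t. ?j t)"
    by (rule path_homotopic_reparam)
       (use assms in \<open>auto simp: f_def pathin_join intro!: continuous_intros pathin_join\<close>)
  moreover have "?j (f t) = loop_join (loop_join p q) r t" for t
  proof -
    consider "t \<le> 1/4" | "1/4 < t" "t \<le> 1/2" | "1/2 < t" by linarith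
    then show ?thesis
    proof cases
      case 2
      then have "f t = t + 1/4" by (simp add: ff' f'_def)
      with 2 show ?thesis by (simp add: loop_join_def)
    qed (simp_all add: ff' f'_def loop_join_def min_def field_simps)
  qed
  ultimately show ?thesis by simp
qed

lemma path_homotopic_const_left:
  assumes "pathin X p" "x = p 0"
  shows "path_homotopic X (loop_join (\<lambda>_. x) p) p"
proof -
  have "path_homotopic X (\<lambda>t. p (max 0 (2 * t - 1))) (\<lambda>t. p t)"
    by (rule path_homotopic_reparam) (use assms in \<open>auto intro!: continuous_intros\<close>)
  moreover have "max 0 (2 * t - 1) = (if t \<le> 1/2 then 0 else 2 * t - 1)" for t :: real
    by (simp add: max_def)
  then have "(\<lambda>t. p (max 0 (2 * t - 1))) = loop_join (\<lambda>_. x) p"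
    using assms by (intro ext) (simp add: loop_join_def)
  ultimately show ?thesis by simp
qed

lemma path_homotopic_const_right:
  assumes "pathin X p" "x = p 1"
  shows "path_homotopic X (loop_join p (\<lambda>_. x)) p"
proof -
  have "path_homotopic X (\<lambda>t. p (min 1 (2 * t))) (\<lambda>t. p t)"
    by (rule path_homotopic_reparam) (use assms in \<open>auto intro!: continuous_intros\<close>)
  moreover have "min 1 (2 * t) = (if t \<le> 1/2 then 2 * t else 1)" for t :: real
    by (simp add: min_def)
  then have "(\<lambda>t. p (min 1 (2 * t))) = loop_join p (\<lambda>_. x)"
    using assms by (intro ext) (simp add: loop_join_def)
  ultimately show ?thesis by simp
qed

lemma path_homotopic_rev_left:
  assumes "pathin X p" "x = p 1"
  shows "path_homotopic X (loop_join (path_rev p) p) (\<lambda>_. x)"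
proof -
  have "path_homotopic X (\<lambda>t. p \<bar>2 * t - 1\<bar>) (\<lambda>t. p 1)"
    by (rule path_homotopic_reparam) (use assms in \<open>auto intro!: continuous_intros\<close>)
  moreover have "\<bar>2 * t - 1\<bar> = (if t \<le> 1/2 then 1 - 2 * t else 2 * t - 1)" for t :: real
    by (simp add: abs_if)
  then have "(\<lambda>t. p \<bar>2 * t - 1\<bar>) = loop_join (path_rev p) p"
    by (intro ext) (simp add: loop_join_def path_rev_def)
  ultimately show ?thesis using assms by simp
qed

lemma path_homotopic_rev_right:
  "pathin X p \<Longrightarrow> x = p 0 \<Longrightarrow> path_homotopic X (loop_join p (path_rev p)) (\<lambda>_. x)"
  using path_homotopic_rev_left[of X "path_rev p" x] by simp

lemma pathin_linepath:
  fixes K :: "'b::real_normed_vector set"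
  assumes "convex K" "continuous_map (top_of_set K) X H" "a \<in> K" "b \<in> K"
    "H ` closed_segment a b \<subseteq> S"
  shows "pathin (subtopology X S) (H \<circ> linepath a b)"
proof -
  have "continuous_map (top_of_set {0..1}) (top_of_set K) (linepath a b)"
    using assms(1,3,4) closed_segment_subset[of a K b]
    by (auto simp: linepath_image_01[symmetric] intro!: continuous_on_linepath)
  from continuous_map_compose[OF this assms(2)] show ?thesis
    using assms(5)[folded linepath_image_01]
    by (auto simp: pathin_def continuous_map_in_subtopology)
qed

text \<open>A convex set contains the whole triangle, so two sides can be deformed to the third. For
  transports this becomes a cocycle identity on short segments.\<close>

lemma path_homotopic_linepath_join:
  fixes K :: "'b::real_normed_vector set"
  assumes "convex K" "continuous_map (top_of_set K) X H" "a \<in> K" "b \<in> K" "c \<in> K"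
  shows "path_homotopic X (loop_join (H \<circ> linepath a b) (H \<circ> linepath b c)) (H \<circ> linepath a c)"
proof -
  have "closed_segment a b \<union> closed_segment b c \<subseteq> K" "closed_segment a c \<subseteq> K"
    using assms by (simp_all add: closed_segment_subset)
  then have "path_image (linepath a b +++ linepath b c) \<subseteq> K" "path_image (linepath a c) \<subseteq> K"
    by (simp_all add: path_image_join)
  moreover have "path (linepath a b +++ linepath b c)" by simp
  ultimately have "path_homotopic X (H \<circ> (linepath a b +++ linepath b c)) (H \<circ> linepath a c)"
    using assms by (intro path_homotopic_convex[of K]) (auto simp: joinpaths_def linepath_0' linepath_1')
  moreover have "H \<circ> (linepath a b +++ linepath b c) = loop_join (H \<circ> linepath a b) (H \<circ> linepath b c)"
    by (auto simp: joinpaths_def loop_join_def)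
  ultimately show ?thesis by simp
qed

section \<open>Functors on fundamental groupoids and a van Kampen gluing theorem\<close>

section \<open>Transports and their gluing\<close>

text \<open>A transport is a functor from the fundamental groupoid of a space to a group.\<close>

definition transport ::
    "'a topology \<Rightarrow> ('q, 'm) monoid_scheme \<Rightarrow> ((real \<Rightarrow> 'a) \<Rightarrow> 'q) \<Rightarrow> bool" where
  "transport Y Q T \<longleftrightarrow>
     (\<forall>p. pathin Y p \<longrightarrow> T p \<in> carrier Q) \<and>
     (\<forall>p q. pathin Y p \<longrightarrow> pathin Y q \<longrightarrow> p 1 = q 0 \<longrightarrow> T (loop_join p q) = T p \<otimes>\<^bsub>Q\<^esub> T q) \<and>
     (\<forall>p q. path_homotopic Y p q \<longrightarrow> T p = T q)"

lemma transport_closed: "transport Y Q T \<Longrightarrow> pathin Y p \<Longrightarrow> T p \<in> carrier Q"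
  and transport_join: "transport Y Q T \<Longrightarrow> pathin Y p \<Longrightarrow> pathin Y q \<Longrightarrow> p 1 = q 0 \<Longrightarrow>
    T (loop_join p q) = T p \<otimes>\<^bsub>Q\<^esub> T q"
  and transport_homotopic: "transport Y Q T \<Longrightarrow> path_homotopic Y p q \<Longrightarrow> T p = T q"
  by (auto simp: transport_def)

lemma transport_cong:
  "transport Y Q T \<Longrightarrow> pathin Y p \<Longrightarrow> (\<And>t. t \<in> {0..1} \<Longrightarrow> p t = q t) \<Longrightarrow> T p = T q"
  by (meson path_homotopic_cong transport_homotopic)

text \<open>A constant path is its own concatenation with itself, so its value is idempotent in a
  group.\<close>

lemma transport_const:
  assumes "transport Y Q T" "group Q" "x \<in> topspace Y"
  shows "T (\<lambda>_. x) = \<one>\<^bsub>Q\<^esub>"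
proof -
  interpret group Q by fact
  have "loop_join (\<lambda>_. x) (\<lambda>_. x) = (\<lambda>_. x)" by (auto simp: loop_join_def)
  then have "T (\<lambda>_. x) = T (\<lambda>_. x) \<otimes>\<^bsub>Q\<^esub> T (\<lambda>_. x)"
    using transport_join[OF assms(1), of "\<lambda>_. x" "\<lambda>_. x"] assms(3) by simp
  moreover have "T (\<lambda>_. x) \<in> carrier Q" using assms(1,3) by (simp add: transport_closed)
  ultimately show ?thesis by (metis l_cancel_one')
qed

lemma transport_subtopology:
  assumes "transport (subtopology X B) Q T" "A \<subseteq> B"
  shows "transport (subtopology X A) Q T"
  using assms path_homotopic_subtopology[of X A _ _ B] unfolding transport_def pathin_subtopology
  by blast

text \<open>The input of a van Kampen theorem: local functors that agree on the overlaps of an open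
  cover. Working with all paths rather than loops at a base point admits overlaps with several
  components, which is where free factors come from.\<close>

locale glue_data = group Q for Q (structure) +
  fixes X :: "'a topology" and I :: "'i set" and U :: "'i \<Rightarrow> 'a set"
    and T :: "'i \<Rightarrow> (real \<Rightarrow> 'a) \<Rightarrow> 'b"
  assumes open_U: "i \<in> I \<Longrightarrow> openin X (U i)"
    and cover: "topspace X \<subseteq> (\<Union>i\<in>I. U i)"
    and transport_T: "i \<in> I \<Longrightarrow> transport (subtopology X (U i)) Q (T i)"
    and agree: "i \<in> I \<Longrightarrow> j \<in> I \<Longrightarrow> pathin (subtopology X (U i \<inter> U j)) p \<Longrightarrow> T i p = T j p"
begin

lemma lebesgue_number:
  fixes K :: "'k::euclidean_space set"
  assumes "compact K" "continuous_map (top_of_set K) X H"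
  obtains \<delta> where "\<delta> > 0"
    "\<And>S. S \<subseteq> K \<Longrightarrow> S \<noteq> {} \<Longrightarrow> (\<And>a b. a \<in> S \<Longrightarrow> b \<in> S \<Longrightarrow> dist a b < \<delta>) \<Longrightarrow> \<exists>i\<in>I. H ` S \<subseteq> U i"
proof -
  have "\<forall>i\<in>I. \<exists>N. open N \<and> {z \<in> K. H z \<in> U i} = K \<inter> N"
    using openin_continuous_map_preimage[OF assms(2)] open_U by (fastforce simp: openin_open)
  then obtain N where N: "\<And>i. i \<in> I \<Longrightarrow> open (N i)" "\<And>i. i \<in> I \<Longrightarrow> {z \<in> K. H z \<in> U i} = K \<inter> N i"
    by metis
  have cov: "K \<subseteq> \<Union>(N ` I)"
  proof
    fix z assume "z \<in> K"
    then have "H z \<in> topspace X" using assms(2) by (auto simp: continuous_map_def)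
    then obtain i where "i \<in> I" "H z \<in> U i" using cover by auto
    then show "z \<in> \<Union>(N ` I)" using N(2)[of i] \<open>z \<in> K\<close> by blast
  qed
  obtain e where e: "e > 0" "\<And>x. x \<in> K \<Longrightarrow> \<exists>G \<in> N ` I. ball x e \<subseteq> G"
    using Heine_Borel_lemma[OF assms(1) cov] N(1) by auto
  show ?thesis
  proof
    fix S assume S: "S \<subseteq> K" "S \<noteq> {}" "\<And>a b. a \<in> S \<Longrightarrow> b \<in> S \<Longrightarrow> dist a b < e"
    then obtain a where "a \<in> S" by auto
    with S e obtain i where "i \<in> I" "ball a e \<subseteq> N i" by (metis imageE subsetD)
    moreover have "S \<subseteq> ball a e" using S \<open>a \<in> S\<close> by auto
    ultimately show "\<exists>i\<in>I. H ` S \<subseteq> U i" using N(2)[of i] S(1) by blast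
  qed (use e in auto)
qed

text \<open>Over a compact convex set the local functors are simultaneously a coboundary:
  \<open>F z\<close> is the ordered product of local values along a finely subdivided ray from a
  fixed point to \<open>z\<close>. The rule is claimed for nearby points only, where the rays to
  both points can be compared step by step.\<close>

lemma developing_map:
  fixes K :: "'k::euclidean_space set"
  assumes K: "compact K" "convex K" and H: "continuous_map (top_of_set K) X H"
  obtains F \<epsilon> where "\<epsilon> > 0" "\<And>z. z \<in> K \<Longrightarrow> F z \<in> carrier Q"
    "\<And>z z' i. z \<in> K \<Longrightarrow> z' \<in> K \<Longrightarrow> dist z z' < \<epsilon> \<Longrightarrow> i \<in> I \<Longrightarrow> H ` closed_segment z z' \<subseteq> U i \<Longrightarrow>
       F z' = F z \<otimes> T i (H \<circ> linepath z z')"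
proof (cases "K = {}")
  case True
  then show ?thesis using that[of 1 "\<lambda>_. \<one>"] by auto
next
  case False
  then obtain z0 where z0: "z0 \<in> K" by auto
  obtain \<delta> where \<delta>: "\<delta> > 0"
    "\<And>S. S \<subseteq> K \<Longrightarrow> S \<noteq> {} \<Longrightarrow> (\<And>a b. a \<in> S \<Longrightarrow> b \<in> S \<Longrightarrow> dist a b < \<delta>) \<Longrightarrow> \<exists>i\<in>I. H ` S \<subseteq> U i"
    using lebesgue_number[OF K(1) H] by blast
  \<comment> \<open>A ball of radius \<delta>/3 has diameter less than \<delta>, so the image of its
    part in \<open>K\<close> lies in one member of the cover.\<close>
  define r where "r = \<delta> / 3"
  have r: "r > 0" using \<delta>(1) by (simp add: r_def)
  \<comment> \<open>Some member containing the image of the segment is chosen; \<open>agree\<close>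
    makes the value independent of the choice.\<close>
  define g where "g a b = T (SOME i. i \<in> I \<and> H ` closed_segment a b \<subseteq> U i) (H \<circ> linepath a b)" for a b
  have g_eq: "g a b = T i (H \<circ> linepath a b)"
    if "a \<in> K" "b \<in> K" "i \<in> I" "H ` closed_segment a b \<subseteq> U i" for a b i
  proof -
    define j where "j = (SOME i. i \<in> I \<and> H ` closed_segment a b \<subseteq> U i)"
    have j: "j \<in> I" "H ` closed_segment a b \<subseteq> U j"
      unfolding j_def using someI[of "\<lambda>i. i \<in> I \<and> H ` closed_segment a b \<subseteq> U i" i] that by auto
    then have "pathin (subtopology X (U j \<inter> U i)) (H \<circ> linepath a b)"
      using that by (intro pathin_linepath[OF K(2) H]) auto
    then show ?thesis unfolding g_def j_def[symmetric] using agree j that by blast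
  qed
  have ball: "\<exists>i\<in>I. H ` (K \<inter> cball a r) \<subseteq> U i" if "a \<in> K" for a
  proof (rule \<delta>(2))
    fix b c assume "b \<in> K \<inter> cball a r" "c \<in> K \<inter> cball a r"
    then have "dist a b \<le> r" "dist a c \<le> r" by auto
    then have "dist b c \<le> r + r" using dist_triangle3[of b c a] by (simp add: dist_commute)
    then show "dist b c < \<delta>" using \<delta>(1) by (simp add: r_def)
  qed (use that r in auto)
  have sub: "closed_segment b c \<subseteq> K \<inter> cball a r" if "b \<in> K \<inter> cball a r" "c \<in> K \<inter> cball a r" for a b c
    using that K(2) by (intro closed_segment_subset) (auto intro: convex_Int)
  have g_closed: "g a b \<in> carrier Q" if ab: "a \<in> K" "b \<in> K" "dist a b \<le> r" for a b
  proof -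
    obtain i where i: "i \<in> I" "H ` (K \<inter> cball a r) \<subseteq> U i" using ball[OF ab(1)] by blast
    have s: "H ` closed_segment a b \<subseteq> U i" using sub[of a a b] ab i r by (auto simp: subset_iff)
    show ?thesis
      using g_eq[OF ab(1,2) i(1) s] transport_closed[OF transport_T[OF i(1)] pathin_linepath[OF K(2) H ab(1,2) s]]
      by simp
  qed
  have cocycle: "g a b \<otimes> g b c = g a c"
    if abc: "a \<in> K" "b \<in> K" "c \<in> K" "dist a b \<le> r" "dist a c \<le> r" for a b c
  proof -
    obtain i where i: "i \<in> I" "H ` (K \<inter> cball a r) \<subseteq> U i" using ball[OF abc(1)] by blast
    let ?C = "K \<inter> cball a r"
    have C: "a \<in> ?C" "b \<in> ?C" "c \<in> ?C" using abc r by auto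
    have s: "H ` closed_segment x y \<subseteq> U i" if "x \<in> ?C" "y \<in> ?C" for x y
      using sub[OF that] i(2) by auto
    have p: "pathin (subtopology X (U i)) (H \<circ> linepath x y)" if "x \<in> ?C" "y \<in> ?C" for x y
      using that by (intro pathin_linepath[OF K(2) H] s) auto
    have "continuous_map (top_of_set ?C) (subtopology X (U i)) H"
      using continuous_map_from_subtopology[OF H, of "cball a r"] i(2)
      by (auto simp: continuous_map_in_subtopology subtopology_subtopology Int_commute)
    then have "path_homotopic (subtopology X (U i))
        (loop_join (H \<circ> linepath a b) (H \<circ> linepath b c)) (H \<circ> linepath a c)"
      using C K(2) by (intro path_homotopic_linepath_join[of ?C]) (auto intro: convex_Int)
    moreover have "T i (loop_join (H \<circ> linepath a b) (H \<circ> linepath b c))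
        = T i (H \<circ> linepath a b) \<otimes> T i (H \<circ> linepath b c)"
      by (rule transport_join[OF transport_T[OF i(1)]]) (use p C in \<open>auto simp: linepath_def\<close>)
    ultimately have "T i (H \<circ> linepath a b) \<otimes> T i (H \<circ> linepath b c) = T i (H \<circ> linepath a c)"
      using transport_homotopic[OF transport_T[OF i(1)]] by metis
    then show ?thesis using g_eq[OF _ _ i(1) s] C by auto
  qed
  have g_refl: "g a a = \<one>" if "a \<in> K" for a
    using cocycle[of a a a] g_closed[of a a] that r by (simp add: l_cancel_one)
  obtain B where B: "\<And>z. z \<in> K \<Longrightarrow> dist z0 z \<le> B"
    using compact_imp_bounded[OF K(1)] unfolding bounded_any_center[where a=z0] by auto
  \<comment> \<open>Fine enough that consecutive points on every ray are within r/2 of each other;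
    \<open>B\<close> bounds the lengths of all rays at once.\<close>
  obtain n :: nat where n: "n > 0" "B / real n < r / 2"
  proof -
    obtain n :: nat where "real n > max 1 (2 * B / r)" using reals_Archimedean2 by blast
    then have "real n > 1" "real n * r > 2 * B" using r by (auto simp: field_simps)
    then show ?thesis using r by (intro that[of n]) (auto simp: field_simps)
  qed
  define y where "y j z = z0 + (real j / real n) *\<^sub>R (z - z0)" for j z
  have yK: "y j z \<in> K" if "z \<in> K" "j \<le> n" for j z
  proof -
    have "y j z = (1 - real j / real n) *\<^sub>R z0 + (real j / real n) *\<^sub>R z"
      by (simp add: y_def algebra_simps)
    then show ?thesis using convexD_alt[OF K(2) z0 that(1), of "real j / real n"] that(2) n by simp
  qed
  have ystep: "dist (y j z) (y (Suc j) z) \<le> r / 2" if "z \<in> K" for j z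
  proof -
    have "y (Suc j) z - y j z = (1 / real n) *\<^sub>R (z - z0)"
      by (simp add: y_def add_divide_distrib scaleR_left_distrib)
    then have "dist (y j z) (y (Suc j) z) = dist z0 z / real n"
      by (metis (no_types) abs_of_nonneg dist_commute dist_norm divide_inverse_commute inverse_eq_divide norm_scaleR of_nat_0_le_iff zero_le_divide_1_iff)
    also have "\<dots> \<le> B / real n" using B[OF that] by (simp add: divide_right_mono)
    finally show ?thesis using n(2) by linarith
  qed
  have ydist: "dist (y j z) (y j z') \<le> dist z z'" if "j \<le> n" for j z z'
  proof -
    have "y j z - y j z' = (real j / real n) *\<^sub>R (z - z')" by (simp add: y_def algebra_simps)
    then have "dist (y j z) (y j z') = (real j / real n) * dist z z'" by (simp add: dist_norm)
    also have "\<dots> \<le> 1 * dist z z'" using that n by (intro mult_right_mono) auto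
    finally show ?thesis by simp
  qed
  define P where "P z = rec_nat \<one> (\<lambda>j a. a \<otimes> g (y j z) (y (Suc j) z))" for z
  have P0: "P z 0 = \<one>" and PS: "P z (Suc j) = P z j \<otimes> g (y j z) (y (Suc j) z)" for z j
    by (simp_all add: P_def)
  have gs: "g (y j z) (y (Suc j) z) \<in> carrier Q" if "z \<in> K" "Suc j \<le> n" for z j
    using that ystep[of z j] yK r by (intro g_closed) (auto simp del: of_nat_Suc)
  have PC: "j \<le> n \<Longrightarrow> P z j \<in> carrier Q" if "z \<in> K" for z j
    by (induction j) (use that gs in \<open>auto simp: P0 PS\<close>)
  \<comment> \<open>Two neighbouring rays are compared rung by rung. Each quadrilateral between them
    is cut by the diagonal from \<open>?a\<close> to \<open>?b'\<close>, and the cocycle identity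
    holds on both triangles because all their vertices are within r of \<open>?a\<close>.\<close>
  have ladder: "j \<le> n \<Longrightarrow> P z j \<otimes> g (y j z) (y j z') = P z' j"
    if zz: "z \<in> K" "z' \<in> K" "dist z z' < r / 2" for z z' j
  proof (induction j)
    case 0
    have "y 0 z = z0" "y 0 z' = z0" by (auto simp: y_def)
    then show ?case by (simp add: P0 g_refl z0)
  next
    case (Suc j)
    let ?a = "y j z" and ?b = "y (Suc j) z" and ?a' = "y j z'" and ?b' = "y (Suc j) z'"
    have K4: "?a \<in> K" "?b \<in> K" "?a' \<in> K" "?b' \<in> K" using Suc.prems zz by (auto intro: yK)
    have d: "dist ?a ?b \<le> r/2" "dist ?a' ?b' \<le> r/2" "dist ?a ?a' \<le> r/2" "dist ?b ?b' \<le> r/2"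
      using ystep zz ydist[of j z z'] ydist[of "Suc j" z z'] Suc.prems
      by (auto simp del: of_nat_Suc intro: order_trans)
    have d2: "dist ?a ?b' \<le> r" using dist_triangle[of ?a ?b' ?b] d by linarith
    have c: "P z j \<in> carrier Q" "g ?a ?b \<in> carrier Q" "g ?b ?b' \<in> carrier Q" "g ?a ?a' \<in> carrier Q"
      "g ?a' ?b' \<in> carrier Q"
      using PC Suc.prems zz K4 d r by (auto intro!: g_closed)
    have "P z (Suc j) \<otimes> g ?b ?b' = P z j \<otimes> (g ?a ?b \<otimes> g ?b ?b')" using c by (simp add: PS m_assoc)
    also have "\<dots> = P z j \<otimes> (g ?a ?a' \<otimes> g ?a' ?b')"
      using cocycle[of ?a ?b ?b'] cocycle[of ?a ?a' ?b'] K4 d d2 r by simp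
    also have "\<dots> = P z' (Suc j)" using c Suc by (simp add: PS m_assoc[symmetric])
    finally show ?case .
  qed
  have yn: "y n z = z" for z using n by (simp add: y_def)
  show ?thesis
  proof (rule that[of "r/2" "\<lambda>z. P z n"])
    fix z z' i assume a: "z \<in> K" "z' \<in> K" "dist z z' < r/2" "i \<in> I" "H ` closed_segment z z' \<subseteq> U i"
    show "P z' n = P z n \<otimes> T i (H \<circ> linepath z z')"
      using ladder[OF a(1-3), of n] g_eq[OF a(1,2,4,5)] by (simp add: yn)
  qed (use r PC in auto)
qed

text \<open>The developing map of a single path, kept as a predicate: it is determined only up to a
  left factor, and the admissible mesh depends on the path.\<close>

definition develops :: "(real \<Rightarrow> 'a) \<Rightarrow> (real \<Rightarrow> 'b) \<Rightarrow> bool" where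
  "develops p F \<longleftrightarrow> (\<forall>z\<in>{0..1}. F z \<in> carrier Q) \<and>
     (\<exists>\<epsilon>>0. \<forall>a\<in>{0..1}. \<forall>b\<in>{0..1}. \<forall>i\<in>I. dist a b < \<epsilon> \<longrightarrow> p ` closed_segment a b \<subseteq> U i \<longrightarrow>
        F b = F a \<otimes> T i (p \<circ> linepath a b))"

lemma locally_constant_unit_interval:
  fixes c :: "real \<Rightarrow> 'z"
  assumes "\<eta> > 0" "\<And>a b. a \<in> {0..1} \<Longrightarrow> b \<in> {0..1} \<Longrightarrow> dist a b < \<eta> \<Longrightarrow> c a = c b"
  shows "c 0 = c 1"
proof -
  obtain n :: nat where "real n > max 1 (1 / \<eta>)" using reals_Archimedean2 by blast
  then have n: "n > 0" "1 / real n < \<eta>" using assms(1) by (auto simp: field_simps)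
  have "k \<le> n \<Longrightarrow> c (real k / real n) = c 0" for k
  proof (induction k)
    case (Suc k)
    have "c (real k / real n) = c (real (Suc k) / real n)"
      using Suc.prems n by (intro assms(2)) (auto simp: dist_real_def diff_divide_distrib[symmetric])
    then show ?case using Suc by simp
  qed simp
  from this[of n] n show ?thesis by simp
qed

lemma develops_unique:
  assumes p: "pathin X p" and F: "develops p F" and F': "develops p F'"
  shows "inv (F 0) \<otimes> F 1 = inv (F' 0) \<otimes> F' 1"
proof -
  obtain \<delta> where \<delta>: "\<delta> > 0"
    "\<And>S. S \<subseteq> {0..1} \<Longrightarrow> S \<noteq> {} \<Longrightarrow> (\<And>a b. a \<in> S \<Longrightarrow> b \<in> S \<Longrightarrow> dist a b < \<delta>) \<Longrightarrow> \<exists>i\<in>I. p ` S \<subseteq> U i"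
    using lebesgue_number[OF compact_Icc p[unfolded pathin_def]] by blast
  obtain e where e: "e > 0" "\<And>a b i. a\<in>{0..1} \<Longrightarrow> b\<in>{0..1} \<Longrightarrow> i\<in>I \<Longrightarrow> dist a b < e \<Longrightarrow>
     p ` closed_segment a b \<subseteq> U i \<Longrightarrow> F b = F a \<otimes> T i (p \<circ> linepath a b)"
    using F unfolding develops_def by blast
  obtain e' where e': "e' > 0" "\<And>a b i. a\<in>{0..1} \<Longrightarrow> b\<in>{0..1} \<Longrightarrow> i\<in>I \<Longrightarrow> dist a b < e' \<Longrightarrow>
     p ` closed_segment a b \<subseteq> U i \<Longrightarrow> F' b = F' a \<otimes> T i (p \<circ> linepath a b)"
    using F' unfolding develops_def by blast
  have FC: "\<And>z. z \<in> {0..1} \<Longrightarrow> F z \<in> carrier Q" "\<And>z. z \<in> {0..1} \<Longrightarrow> F' z \<in> carrier Q"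
    using F F' by (auto simp: develops_def)
  \<comment> \<open>The local factor multiplies both functions on the right and cancels in
    \<open>F' a \<otimes> inv (F a)\<close>, so this product is locally constant on the
    interval.\<close>
  have "F' 0 \<otimes> inv (F 0) = F' 1 \<otimes> inv (F 1)"
  proof (rule locally_constant_unit_interval)
    show "min (min e e') \<delta> > 0" using e e' \<delta> by simp
    fix a b :: real assume ab: "a \<in> {0..1}" "b \<in> {0..1}" "dist a b < min (min e e') \<delta>"
    have "\<exists>i\<in>I. p ` closed_segment a b \<subseteq> U i"
    proof (rule \<delta>(2))
      fix x y assume "x \<in> closed_segment a b" "y \<in> closed_segment a b"
      then show "dist x y < \<delta>"
        using ab by (auto simp: closed_segment_eq_real_ivl dist_real_def split: if_splits)
    qed (use ab in \<open>auto simp: closed_segment_eq_real_ivl split: if_splits\<close>)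
    then obtain i where i: "i \<in> I" "p ` closed_segment a b \<subseteq> U i" by blast
    let ?x = "T i (p \<circ> linepath a b)"
    have x: "?x \<in> carrier Q"
      using transport_closed[OF transport_T[OF i(1)] pathin_linepath[OF _ _ ab(1,2) i(2)]] p
      by (auto simp: pathin_def)
    have "F b = F a \<otimes> ?x" "F' b = F' a \<otimes> ?x" using e e' ab i by auto
    then show "F' a \<otimes> inv (F a) = F' b \<otimes> inv (F b)"
      using FC ab x by (simp add: inv_mult_group m_assoc[symmetric]) (simp add: m_assoc)
  qed
  then have "F' 0 = F' 1 \<otimes> inv (F 1) \<otimes> F 0" using FC by (metis atLeastAtMost_iff inv_closed inv_solve_right' m_closed order_refl zero_le_one)
  then show ?thesis using FC by (simp add: inv_mult_group m_assoc)
qed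

lemma develops_exists:
  assumes "pathin X p"
  shows "\<exists>F. develops p F"
  using developing_map[of "{0..1::real}" p] assms unfolding develops_def pathin_def
  by (metis (full_types) compact_Icc convex_real_interval(5))

definition glued :: "(real \<Rightarrow> 'a) \<Rightarrow> 'b" where
  "glued p = (let F = SOME F. develops p F in inv (F 0) \<otimes> F 1)"

lemma glued_eq:
  assumes "pathin X p" "develops p F"
  shows "glued p = inv (F 0) \<otimes> F 1"
  using develops_unique[OF assms(1) _ assms(2)] someI[of "develops p", OF assms(2)]
  by (simp add: glued_def)

lemma develops_const:
  assumes "x \<in> topspace X"
  shows "develops (\<lambda>_. x) (\<lambda>_. \<one>)"
proof -
  have "T i ((\<lambda>_. x) \<circ> linepath a b) = \<one>" if "i \<in> I" "x \<in> U i" for i and a b :: real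
    using transport_const[OF transport_T[OF that(1)] is_group] that assms by (simp add: comp_def)
  then show ?thesis by (auto simp: develops_def intro!: exI[of _ 1])
qed

text \<open>A functor on the whole space develops a path through its values on initial segments.
  With uniqueness of developments, this identifies any global extension of the local functors with
  the glued one.\<close>

lemma transport_develops:
  assumes T': "transport X Q T'" and p: "pathin X p"
    and eq: "\<And>i q. i \<in> I \<Longrightarrow> pathin (subtopology X (U i)) q \<Longrightarrow> T' q = T i q"
  shows "develops p (\<lambda>a. T' (p \<circ> linepath 0 a))"
  unfolding develops_def
proof (intro conjI ballI exI[of _ 1] impI)
  have pl: "pathin X (p \<circ> linepath a b)" if "a \<in> {0..1}" "b \<in> {0..1}" for a b
    using pathin_linepath[of "{0..1}" X p a b UNIV] p that by (auto simp: pathin_def)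
  fix a b :: real and i assume ab: "a \<in> {0..1}" "b \<in> {0..1}" "i \<in> I" "p ` closed_segment a b \<subseteq> U i"
  have "pathin (subtopology X (U i)) (p \<circ> linepath a b)"
    using pathin_linepath[of "{0..1}" X p a b "U i"] p ab by (auto simp: pathin_def)
  then have "T i (p \<circ> linepath a b) = T' (p \<circ> linepath a b)" using eq ab by simp
  moreover have "T' (p \<circ> linepath 0 a) \<otimes> T' (p \<circ> linepath a b)
      = T' (loop_join (p \<circ> linepath 0 a) (p \<circ> linepath a b))"
    using pl[of 0 a] pl[of a b] ab by (intro transport_join[OF T', symmetric]) (auto simp: linepath_0' linepath_1')
  moreover have "path_homotopic X (loop_join (p \<circ> linepath 0 a) (p \<circ> linepath a b)) (p \<circ> linepath 0 b)"
    using ab p by (intro path_homotopic_linepath_join[of "{0..1}"]) (auto simp: pathin_def)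
  ultimately show "T' (p \<circ> linepath 0 b) = T' (p \<circ> linepath 0 a) \<otimes> T i (p \<circ> linepath a b)"
    using transport_homotopic[OF T'] by metis
next
  fix z :: real assume "z \<in> {0..1}"
  then show "T' (p \<circ> linepath 0 z) \<in> carrier Q"
    using pathin_linepath[of "{0..1}" X p 0 z UNIV] p
    by (intro transport_closed[OF T']) (auto simp: pathin_def)
qed auto

lemma transport_unique:
  assumes T': "transport X Q T'" and p: "pathin X p"
    and eq: "\<And>i q. i \<in> I \<Longrightarrow> pathin (subtopology X (U i)) q \<Longrightarrow> T' q = T i q"
  shows "glued p = T' p"
proof -
  have "p \<circ> linepath 0 0 = (\<lambda>_. p 0)" "p \<circ> linepath 0 1 = p"
    by (auto simp: linepath_def)
  moreover have "p 0 \<in> topspace X" "T' p \<in> carrier Q"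
    using p transport_closed[OF T' p] by (auto simp: pathin_def continuous_map_def)
  ultimately show ?thesis
    using glued_eq[OF p transport_develops[OF assms]] transport_const[OF T' is_group] by simp
qed

lemma glued_restrict:
  assumes i: "i \<in> I" and p: "pathin (subtopology X (U i)) p"
  shows "glued p = T i p"
proof -
  have pX: "pathin X p" using p by (simp add: pathin_subtopology)
  \<comment> \<open>The traces of the cover on \<open>U i\<close> are again gluing data. There
    \<open>T i\<close> is a global functor extending all local ones, so uniqueness applies, and a
    development in the whole space is also one for the traces.\<close>
  interpret loc: glue_data Q "subtopology X (U i)" I "\<lambda>j. U i \<inter> U j" T
  proof
    show "j \<in> I \<Longrightarrow> openin (subtopology X (U i)) (U i \<inter> U j)" for j
      using open_U by (simp add: openin_subtopology_Int2)
    show "topspace (subtopology X (U i)) \<subseteq> (\<Union>j\<in>I. U i \<inter> U j)" using cover by auto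
    show "j \<in> I \<Longrightarrow> transport (subtopology (subtopology X (U i)) (U i \<inter> U j)) Q (T j)" for j
      using transport_subtopology[OF transport_T[of j], of "U i \<inter> U j"]
      by (simp add: subtopology_subtopology Int_commute Int_left_commute)
    show "T j p = T k p" if "j \<in> I" "k \<in> I"
      "pathin (subtopology (subtopology X (U i)) (U i \<inter> U j \<inter> (U i \<inter> U k))) p" for j k p
      using that agree[of j k p] by (auto simp: pathin_subtopology)
  qed
  have 1: "loc.glued p = T i p"
    using transport_T[OF i] p agree[OF i]
    by (intro loc.transport_unique) (auto simp: pathin_subtopology)
  obtain F where F: "develops p F" using develops_exists[OF pX] by blast
  have sub: "p ` closed_segment a b \<subseteq> U i" if "a \<in> {0..1}" "b \<in> {0..1}" for a b
    using that p by (auto simp: pathin_subtopology closed_segment_eq_real_ivl split: if_splits)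
  then have "loc.develops p F"
    using F unfolding develops_def loc.develops_def by (meson Int_subset_iff)
  then show ?thesis using 1 loc.glued_eq[OF p] glued_eq[OF pX F] by simp
qed

theorem transport_glued: "transport X Q glued"
  unfolding transport_def
proof (intro conjI allI impI)
  show "glued p \<in> carrier Q" if p: "pathin X p" for p
  proof -
    obtain F where F: "develops p F" using develops_exists[OF p] by blast
    then have "F 0 \<in> carrier Q" "F 1 \<in> carrier Q" by (simp_all add: develops_def)
    then show ?thesis using glued_eq[OF p F] by simp
  qed
  show "glued (loop_join p q) = glued p \<otimes> glued q"
    if p: "pathin X p" and q: "pathin X q" and pq: "p 1 = q 0" for p q
  proof -
    let ?j = "loop_join p q"
    have j: "pathin X ?j" using pathin_join[OF p q pq] .
    obtain F where F: "develops ?j F" using develops_exists[OF j] by blast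
    then obtain e where e: "e > 0" "\<And>a b i. a\<in>{0..1} \<Longrightarrow> b\<in>{0..1} \<Longrightarrow> i\<in>I \<Longrightarrow> dist a b < e \<Longrightarrow>
       ?j ` closed_segment a b \<subseteq> U i \<Longrightarrow> F b = F a \<otimes> T i (?j \<circ> linepath a b)"
      unfolding develops_def by blast
    have FC: "\<And>z. z \<in> {0..1} \<Longrightarrow> F z \<in> carrier Q" using F by (auto simp: develops_def)
    \<comment> \<open>A development of the concatenation restricts to both halves: the affine map
      \<open>s\<close> embeds the interval as one half, sends segments to segments and does not
      increase distances, so the same mesh works.\<close>
    have half: "develops r (\<lambda>t. F (s t))"
      if r: "pathin X r" and s: "\<And>t. t \<in> {0..1} \<Longrightarrow> s t \<in> {0..1}" "\<And>a b. dist (s a) (s b) \<le> dist a b"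
        "\<And>a b t. linepath (s a) (s b) t = s (linepath a b t)" "\<And>t. t \<in> {0..1} \<Longrightarrow> ?j (s t) = r t" for r s
      unfolding develops_def
    proof (intro conjI ballI exI[of _ e] impI)
      fix a b i assume ab: "a \<in> {0..1}" "b \<in> {0..1}" "i \<in> I" "dist a b < e" "r ` closed_segment a b \<subseteq> U i"
      have seg: "closed_segment (s a) (s b) = s ` closed_segment a b"
        unfolding linepath_image_01[symmetric] image_image s(3) ..
      have sub: "closed_segment a b \<subseteq> {0..1}" using ab by (simp add: closed_segment_subset)
      have "?j ` closed_segment (s a) (s b) \<subseteq> U i"
        using ab(5) s(4) sub unfolding seg by (force simp: image_image)
      then have 1: "F (s b) = F (s a) \<otimes> T i (?j \<circ> linepath (s a) (s b))"
        using ab s(1) le_less_trans[OF s(2)[of a b] ab(4)] by (intro e(2)) auto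
      have 2: "T i (r \<circ> linepath a b) = T i (?j \<circ> linepath (s a) (s b))"
      proof (rule transport_cong[OF transport_T[OF ab(3)]])
        show "pathin (subtopology X (U i)) (r \<circ> linepath a b)"
          using pathin_linepath[of "{0..1}" X r a b "U i"] r ab by (auto simp: pathin_def)
        show "(r \<circ> linepath a b) t = (?j \<circ> linepath (s a) (s b)) t" if "t \<in> {0..1}" for t
        proof -
          have "linepath a b t \<in> {0..1}" using sub that unfolding linepath_image_01[symmetric] by blast
          then show ?thesis using s(3,4) by simp
        qed
      qed
      show "F (s b) = F (s a) \<otimes> T i (r \<circ> linepath a b)" using 1 2 by simp
    qed (use FC s e in auto)
    have d: "dist (a / 2) (b / 2) \<le> dist a b" "dist ((a + 1) / 2) ((b + 1) / 2) \<le> dist a b" for a b :: real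
      by (simp_all add: dist_real_def diff_divide_distrib[symmetric])
    have 1: "develops p (\<lambda>t. F (t / 2))"
      by (rule half[OF p, of "\<lambda>t. t / 2", OF _ d(1)]) (auto simp: loop_join_def linepath_def field_simps)
    have 2: "develops q (\<lambda>t. F ((t + 1) / 2))"
      by (rule half[OF q, of "\<lambda>t. (t + 1) / 2", OF _ d(2)])
         (auto simp: loop_join_def linepath_def field_simps pq)
    have "glued p = inv (F 0) \<otimes> F (1/2)" "glued q = inv (F (1/2)) \<otimes> F 1"
      using glued_eq[OF p 1] glued_eq[OF q 2] by simp_all
    moreover have "inv (F 0) \<otimes> F 1 = (inv (F 0) \<otimes> F (1/2)) \<otimes> (inv (F (1/2)) \<otimes> F 1)"
      using FC[of 0] FC[of 1] FC[of "1/2"] by (simp add: m_assoc inv_solve_left') (simp add: m_assoc[symmetric])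
    ultimately show ?thesis using glued_eq[OF j F] by simp
  qed
  show "glued p = glued q" if pq: "path_homotopic X p q" for p q
  proof -
    let ?I = "top_of_set {0..1::real}" and ?K = "{0..1::real} \<times> {0..1::real}"
    note P = path_homotopicD[OF pq]
    have II: "prod_topology ?I ?I = top_of_set ?K" by (simp add: prod_topology_subtopology_eu)
    have "\<exists>h. continuous_map (top_of_set ?K) X h \<and> (\<forall>s. h (0, s) = p s) \<and> (\<forall>s. h (1, s) = q s) \<and>
        (\<forall>t\<in>{0..1}. h (t, 0) = p 0 \<and> h (t, 1) = p 1)"
      using pq unfolding path_homotopic_def homotopic_with_def II .
    then obtain h where h: "continuous_map (top_of_set ?K) X h" "\<And>s. h (0, s) = p s"
        "\<And>s. h (1, s) = q s" "\<And>t. t \<in> {0..1} \<Longrightarrow> h (t, 0) = p 0 \<and> h (t, 1) = p 1"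
      by blast
    have K: "compact ?K" "convex ?K" by (simp_all add: compact_Times convex_Times)
    obtain F e where e: "e > 0" and FC: "\<And>z. z \<in> ?K \<Longrightarrow> F z \<in> carrier Q"
      and F: "\<And>z z' i. z \<in> ?K \<Longrightarrow> z' \<in> ?K \<Longrightarrow> dist z z' < e \<Longrightarrow> i \<in> I \<Longrightarrow> h ` closed_segment z z' \<subseteq> U i \<Longrightarrow>
         F z' = F z \<otimes> T i (h \<circ> linepath z z')"
    proof (rule developing_map[OF K h(1)])
      fix F e assume "e > 0" "\<And>z. z \<in> ?K \<Longrightarrow> F z \<in> carrier Q"
        "\<And>z z' i. z \<in> ?K \<Longrightarrow> z' \<in> ?K \<Longrightarrow> dist z z' < e \<Longrightarrow> i \<in> I \<Longrightarrow>
           h ` closed_segment z z' \<subseteq> U i \<Longrightarrow> F z' = F z \<otimes> T i (h \<circ> linepath z z')"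
      then show thesis by (rule that)
    qed
    \<comment> \<open>The homotopy is developed over the whole square and then restricted to its
      four sides; each inclusion \<open>s\<close> of a side is an affine isometry.\<close>
    have side: "develops r (\<lambda>t. F (s t))"
      if r: "pathin X r" and s: "\<And>t. t \<in> {0..1} \<Longrightarrow> s t \<in> ?K" "\<And>a b. dist (s a) (s b) = dist a b"
        "\<And>a b t. linepath (s a) (s b) t = s (linepath a b t)" "\<And>t. t \<in> {0..1} \<Longrightarrow> h (s t) = r t"
      for r and s :: "real \<Rightarrow> real \<times> real"
      unfolding develops_def
    proof (intro conjI ballI exI[of _ e] impI)
      fix a b i assume ab: "a \<in> {0..1}" "b \<in> {0..1}" "i \<in> I" "dist a b < e" "r ` closed_segment a b \<subseteq> U i"
      have seg: "closed_segment (s a) (s b) = s ` closed_segment a b"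
        unfolding linepath_image_01[symmetric] image_image s(3) ..
      have sub: "closed_segment a b \<subseteq> {0..1}" using ab by (simp add: closed_segment_subset)
      have "h ` closed_segment (s a) (s b) \<subseteq> U i"
        using ab(5) s(4) sub unfolding seg by (force simp: image_image)
      then have 1: "F (s b) = F (s a) \<otimes> T i (h \<circ> linepath (s a) (s b))"
        using ab s(1,2) by (intro F) auto
      have 2: "T i (r \<circ> linepath a b) = T i (h \<circ> linepath (s a) (s b))"
      proof (rule transport_cong[OF transport_T[OF ab(3)]])
        show "pathin (subtopology X (U i)) (r \<circ> linepath a b)"
          using pathin_linepath[of "{0..1}" X r a b "U i"] r ab by (auto simp: pathin_def)
        show "(r \<circ> linepath a b) t = (h \<circ> linepath (s a) (s b)) t" if "t \<in> {0..1}" for t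
        proof -
          have "linepath a b t \<in> {0..1}" using sub that unfolding linepath_image_01[symmetric] by blast
          then show ?thesis using s(3,4) by simp
        qed
      qed
      show "F (s b) = F (s a) \<otimes> T i (r \<circ> linepath a b)" using 1 2 by simp
    qed (use FC s e in auto)
    have top: "p 0 \<in> topspace X" "p 1 \<in> topspace X" using P(1) by (auto simp: pathin_def continuous_map_def)
    have 1: "develops p (\<lambda>t. F (0, t))"
      by (rule side[OF P(1), of "\<lambda>t. (0, t)"]) (auto simp: dist_Pair_Pair h linepath_def)
    have 2: "develops q (\<lambda>t. F (1, t))"
      by (rule side[OF P(2), of "\<lambda>t. (1, t)"]) (auto simp: dist_Pair_Pair h linepath_def)
    have 3: "develops (\<lambda>_. p 0) (\<lambda>t. F (t, 0))"
      by (rule side[of "\<lambda>_. p 0" "\<lambda>t. (t, 0)"]) (use top in \<open>auto simp: dist_Pair_Pair h linepath_def\<close>)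
    have 4: "develops (\<lambda>_. p 1) (\<lambda>t. F (t, 1))"
      by (rule side[of "\<lambda>_. p 1" "\<lambda>t. (t, 1)"]) (use top in \<open>auto simp: dist_Pair_Pair h linepath_def\<close>)
    \<comment> \<open>Two sides of the square carry constant paths, whose developments do not change
      from end to end. So \<open>F\<close> has the same corner values along \<open>p\<close> and
      along \<open>q\<close>.\<close>
    have u: "inv (F (0, 0)) \<otimes> F (1, 0) = \<one>" "inv (F (0, 1)) \<otimes> F (1, 1) = \<one>"
      using develops_unique[OF _ 3 develops_const] develops_unique[OF _ 4 develops_const] top
      by simp_all
    have aux: "y = x" if "inv x \<otimes> y = \<one>" "x \<in> carrier Q" "y \<in> carrier Q" for x y
      using that by (metis inv_closed inv_equality inv_inv)
    have "F (1, 0) = F (0, 0)" "F (1, 1) = F (0, 1)"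
      by (rule aux[OF u(1) FC FC], simp_all) (rule aux[OF u(2) FC FC], simp_all)
    then show ?thesis using glued_eq[OF P(1) 1] glued_eq[OF P(2) 2] by simp
  qed
qed

end

section \<open>Retraction of the fundamental groupoid onto the fundamental group\<close>

section \<open>The fundamental group as a transport\<close>

notation loop_join (infixr "\<diamondop>" 70)

lemma pathin_topspace: "pathin X p \<Longrightarrow> t \<in> {0..1} \<Longrightarrow> p t \<in> topspace X"
  by (auto simp: pathin_def continuous_map_def)

lemma path_homotopic_join_left:
  "path_homotopic X p p' \<Longrightarrow> pathin X q \<Longrightarrow> p 1 = q 0 \<Longrightarrow> path_homotopic X (p \<diamondop> q) (p' \<diamondop> q)"
  by (simp add: path_homotopic_join path_homotopic_refl)

lemma path_homotopic_join_right:
  "path_homotopic X q q' \<Longrightarrow> pathin X p \<Longrightarrow> p 1 = q 0 \<Longrightarrow> path_homotopic X (p \<diamondop> q) (p \<diamondop> q')"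
  by (simp add: path_homotopic_join path_homotopic_refl)

lemma path_homotopic_cancel:
  assumes "pathin X b" "pathin X q" "b 1 = q 0"
  shows "path_homotopic X (path_rev b \<diamondop> (b \<diamondop> q)) q"
proof -
  have "path_homotopic X (path_rev b \<diamondop> (b \<diamondop> q)) ((path_rev b \<diamondop> b) \<diamondop> q)"
    by (rule path_homotopic_sym, rule path_homotopic_assoc) (use assms in auto)
  also have "path_homotopic X \<dots> ((\<lambda>_. q 0) \<diamondop> q)"
    by (rule path_homotopic_join_left, rule path_homotopic_rev_left) (use assms in auto)
  also have "path_homotopic X \<dots> q"
    by (rule path_homotopic_const_left) (use assms in auto)
  finally show ?thesis .
qed

lemma path_homotopic_rev:
  assumes "path_homotopic X p q"
  shows "path_homotopic X (path_rev p) (path_rev q)"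
proof -
  note P = path_homotopicD[OF assms]
  have "path_homotopic X (path_rev p) (path_rev p \<diamondop> (\<lambda>_. p 0))"
    by (rule path_homotopic_sym, rule path_homotopic_const_right) (use P in auto)
  also have "path_homotopic X \<dots> (path_rev p \<diamondop> (q \<diamondop> path_rev q))"
    using path_homotopic_sym[OF path_homotopic_rev_right[OF P(2)], of "p 0"] P
    by (intro path_homotopic_join_right) auto
  also have "path_homotopic X \<dots> (path_rev p \<diamondop> (p \<diamondop> path_rev q))"
    using P path_homotopic_sym[OF assms]
    by (intro path_homotopic_join_right path_homotopic_join_left) (auto intro: pathin_join)
  also have "path_homotopic X \<dots> (path_rev q)"
    by (rule path_homotopic_cancel) (use P in auto)
  finally show ?thesis .
qed

lemma path_rev_join:
  assumes "p 1 = q 0"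
  shows "path_rev (p \<diamondop> q) = path_rev q \<diamondop> path_rev p"
proof
  fix t :: real
  consider "t < 1/2" | "t = 1/2" | "t > 1/2" by linarith
  then show "path_rev (p \<diamondop> q) t = (path_rev q \<diamondop> path_rev p) t"
    by cases (use assms in \<open>auto simp: path_rev_def loop_join_def algebra_simps\<close>)
qed

text \<open>The return along \<open>b\<close> and the departure along \<open>b\<close> in the middle
  cancel. This is the multiplicativity of \<open>framed\<close>.\<close>

lemma path_homotopic_conj_join:
  assumes "pathin X a" "pathin X p" "pathin X b" "pathin X q" "pathin X c"
    "a 1 = p 0" "p 1 = b 1" "b 1 = q 0" "q 1 = c 1"
  shows "path_homotopic X (((a \<diamondop> p) \<diamondop> path_rev b) \<diamondop> ((b \<diamondop> q) \<diamondop> path_rev c)) ((a \<diamondop> (p \<diamondop> q)) \<diamondop> path_rev c)"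
proof -
  have "path_homotopic X (path_rev b \<diamondop> ((b \<diamondop> q) \<diamondop> path_rev c)) ((path_rev b \<diamondop> (b \<diamondop> q)) \<diamondop> path_rev c)"
    by (rule path_homotopic_sym, rule path_homotopic_assoc) (use assms in \<open>auto intro: pathin_join\<close>)
  also have "path_homotopic X \<dots> (q \<diamondop> path_rev c)"
    using assms by (intro path_homotopic_join_left path_homotopic_cancel) auto
  finally have 1: "path_homotopic X (path_rev b \<diamondop> ((b \<diamondop> q) \<diamondop> path_rev c)) (q \<diamondop> path_rev c)" .
  have "path_homotopic X (((a \<diamondop> p) \<diamondop> path_rev b) \<diamondop> ((b \<diamondop> q) \<diamondop> path_rev c))
      ((a \<diamondop> p) \<diamondop> (path_rev b \<diamondop> ((b \<diamondop> q) \<diamondop> path_rev c)))"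
    using assms by (intro path_homotopic_assoc) (auto intro: pathin_join)
  also have "path_homotopic X \<dots> ((a \<diamondop> p) \<diamondop> (q \<diamondop> path_rev c))"
    using assms 1 by (intro path_homotopic_join_right) (auto intro: pathin_join)
  also have "path_homotopic X \<dots> (((a \<diamondop> p) \<diamondop> q) \<diamondop> path_rev c)"
    by (rule path_homotopic_sym, rule path_homotopic_assoc) (use assms in \<open>auto intro: pathin_join\<close>)
  also have "path_homotopic X \<dots> ((a \<diamondop> (p \<diamondop> q)) \<diamondop> path_rev c)"
    using assms by (intro path_homotopic_join_left path_homotopic_assoc) auto
  finally show ?thesis .
qed

lemma loop_class_in_carrier: "p \<in> loops X x \<Longrightarrow> loop_class X x p \<in> carrier (fundamental_group X x)"
  by (simp add: fundamental_group_def)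

lemma carrier_fundamental_groupE:
  assumes "A \<in> carrier (fundamental_group X x)"
  obtains p where "p \<in> loops X x" "A = loop_class X x p"
  using assms by (auto simp: fundamental_group_def)

lemma one_fundamental_group: "\<one>\<^bsub>fundamental_group X x\<^esub> = loop_class X x (\<lambda>_. x)"
  by (simp add: fundamental_group_def)

lemma loop_class_eqI:
  "path_homotopic X p q \<Longrightarrow> p 0 = x \<Longrightarrow> p 1 = x \<Longrightarrow> loop_class X x p = loop_class X x q"
  by (simp add: path_homotopic_loop loop_class_eq)

lemma loop_class_eqD:
  assumes "loop_class X x p = loop_class X x q" "p \<in> loops X x"
  shows "path_homotopic X p q"
proof -
  have "loop_homotopic X x q p"
    using assms loop_homotopic_refl[of p X x] by (auto simp: loop_class_def)
  then show ?thesis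
    using assms(2) loop_homotopic_sym by (fastforce simp: path_homotopic_loop loops_def)
qed

lemma inv_fundamental_group:
  assumes "p \<in> loops X x"
  shows "inv\<^bsub>fundamental_group X x\<^esub> (loop_class X x p) = loop_class X x (path_rev p)"
proof -
  have p: "pathin X p" "p 0 = x" "p 1 = x" using assms by (auto simp: loops_def)
  then have x: "x \<in> topspace X" using pathin_topspace[of X p 0] by auto
  interpret group "fundamental_group X x" by (rule group_fundamental_group[OF x])
  have r: "path_rev p \<in> loops X x" using p by (auto simp: loops_def)
  have "loop_class X x (path_rev p) \<otimes>\<^bsub>fundamental_group X x\<^esub> loop_class X x p = \<one>\<^bsub>fundamental_group X x\<^esub>"
    using path_homotopic_rev_left[OF p(1), of x] p
    by (simp add: fundamental_group_mult[OF r assms] one_fundamental_group loop_class_eqI)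
  then show ?thesis using assms r by (intro inv_equality) (auto simp: loop_class_in_carrier)
qed

text \<open>A retraction of the fundamental groupoid onto its vertex group at \<open>x\<close>:
  every end point \<open>y\<close> is joined to \<open>x\<close> by its own path \<open>g y\<close>,
  and these paths are chosen independently of each other.\<close>

definition framed :: "'a topology \<Rightarrow> 'a \<Rightarrow> ('a \<Rightarrow> real \<Rightarrow> 'a) \<Rightarrow> (real \<Rightarrow> 'a) \<Rightarrow> (real \<Rightarrow> 'a) set" where
  "framed X x g p = loop_class X x ((g (p 0) \<diamondop> p) \<diamondop> path_rev (g (p 1)))"

definition frame :: "'a topology \<Rightarrow> 'a \<Rightarrow> ('a \<Rightarrow> real \<Rightarrow> 'a) \<Rightarrow> bool" where
  "frame X x g \<longleftrightarrow> (\<forall>y\<in>topspace X. pathin X (g y) \<and> g y 0 = x \<and> g y 1 = y)"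

lemma frame_loops:
  assumes "frame X x g" "pathin X p"
  shows "(g (p 0) \<diamondop> p) \<diamondop> path_rev (g (p 1)) \<in> loops X x"
  using assms pathin_topspace[OF assms(2), of 0] pathin_topspace[OF assms(2), of 1]
  by (auto simp: loops_def frame_def intro!: pathin_join)

lemma transport_framed:
  assumes g: "frame X x g"
  shows "transport X (fundamental_group X x) (framed X x g)"
  unfolding transport_def
proof (intro conjI allI impI)
  have gp: "pathin X (g y)" "g y 0 = x" "g y 1 = y" if "y \<in> topspace X" for y
    using g that by (auto simp: frame_def)
  note top = pathin_topspace[of X _ 0] pathin_topspace[of X _ 1]
  show "framed X x g p \<in> carrier (fundamental_group X x)" if "pathin X p" for p
    using frame_loops[OF g that] by (simp add: framed_def loop_class_in_carrier)
  show "framed X x g (p \<diamondop> q) = framed X x g p \<otimes>\<^bsub>fundamental_group X x\<^esub> framed X x g q"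
    if "pathin X p" "pathin X q" "p 1 = q 0" for p q
    unfolding framed_def fundamental_group_mult[OF frame_loops[OF g that(1)] frame_loops[OF g that(2)]]
    using that gp top by (intro loop_class_eqI[symmetric]) (auto intro!: path_homotopic_conj_join[of X "g (p 0)" p "g (p 1)" q "g (q 1)", simplified])
  show "framed X x g p = framed X x g q" if "path_homotopic X p q" for p q
    unfolding framed_def path_homotopicD(3,4)[OF that]
    using that path_homotopicD(1)[OF that] gp top
    by (intro loop_class_eqI path_homotopic_join_left path_homotopic_join_right) auto
qed

text \<open>The loop made from \<open>p\<close> goes out along \<open>g (p 0)\<close> and
  \<open>p\<close> and comes back along \<open>g (p 1)\<close>; if the two ways are homotopic, it
  cancels. A frame adapted to a piece of the space thus kills every path in that piece.\<close>

lemma framed_one: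
  assumes g: "frame X x g" and p: "pathin X p" and h: "path_homotopic X (g (p 0) \<diamondop> p) (g (p 1))"
  shows "framed X x g p = \<one>\<^bsub>fundamental_group X x\<^esub>"
proof -
  have gp: "pathin X (g y)" "g y 0 = x" "g y 1 = y" if "y \<in> topspace X" for y
    using g that by (auto simp: frame_def)
  note top = pathin_topspace[OF p, of 0] pathin_topspace[OF p, of 1]
  have "path_homotopic X ((g (p 0) \<diamondop> p) \<diamondop> path_rev (g (p 1))) (g (p 1) \<diamondop> path_rev (g (p 1)))"
    using h gp top by (intro path_homotopic_join_left) auto
  also have "path_homotopic X \<dots> (\<lambda>_. x)"
    using gp top by (intro path_homotopic_rev_right) auto
  finally show ?thesis
    unfolding framed_def one_fundamental_group using gp top by (intro loop_class_eqI) auto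
qed

lemma framed_loop:
  assumes p: "p \<in> loops X x" and g: "path_homotopic X (g x) (\<lambda>_. x)"
  shows "framed X x g p = loop_class X x p"
proof -
  have p': "pathin X p" "p 0 = x" "p 1 = x" using p by (auto simp: loops_def)
  note G = path_homotopicD[OF g]
  have "path_homotopic X ((g x \<diamondop> p) \<diamondop> path_rev (g x)) (((\<lambda>_. x) \<diamondop> p) \<diamondop> path_rev (\<lambda>_. x))"
    using g G p' by (intro path_homotopic_join path_homotopic_rev path_homotopic_refl) auto
  also have "path_homotopic X \<dots> ((\<lambda>_. x) \<diamondop> p)"
    using p' by (simp add: path_rev_def) (rule path_homotopic_const_right, auto intro: pathin_join simp: pathin_topspace[of X p 0])
  also have "path_homotopic X \<dots> p" using p' by (intro path_homotopic_const_left) auto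
  finally show ?thesis unfolding framed_def p'(2,3) using G by (intro loop_class_eqI) auto
qed

lemma transport_hom_fundamental_group:
  assumes "transport X Q T"
  obtains \<Theta> where "\<Theta> \<in> hom (fundamental_group X x) Q" "\<And>p. p \<in> loops X x \<Longrightarrow> \<Theta> (loop_class X x p) = T p"
proof -
  \<comment> \<open>Homotopic loops have equal values, so it does not matter which representative is
    picked.\<close>
  define \<Theta> where "\<Theta> A = T (SOME p. p \<in> A)" for A
  have \<Theta>: "\<Theta> (loop_class X x p) = T p" if p: "p \<in> loops X x" for p
  proof -
    have "p \<in> loop_class X x p" using loop_homotopic_refl[OF p] by (simp add: loop_class_def)
    then have "(SOME q. q \<in> loop_class X x p) \<in> loop_class X x p" by (rule someI[where P="\<lambda>q. q \<in> loop_class X x p"])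
    then have "path_homotopic X p (SOME q. q \<in> loop_class X x p)"
      using p by (simp add: loop_class_def loops_def path_homotopic_loop)
    from transport_homotopic[OF assms this] show ?thesis by (simp add: \<Theta>_def)
  qed
  have "\<Theta> \<in> hom (fundamental_group X x) Q"
  proof (rule homI)
    fix A assume "A \<in> carrier (fundamental_group X x)"
    then obtain p where p: "p \<in> loops X x" "A = loop_class X x p" by (rule carrier_fundamental_groupE)
    then show "\<Theta> A \<in> carrier Q" using transport_closed[OF assms] \<Theta> by (auto simp: loops_def)
    fix B assume "B \<in> carrier (fundamental_group X x)"
    then obtain q where q: "q \<in> loops X x" "B = loop_class X x q" by (rule carrier_fundamental_groupE)
    show "\<Theta> (A \<otimes>\<^bsub>fundamental_group X x\<^esub> B) = \<Theta> A \<otimes>\<^bsub>Q\<^esub> \<Theta> B"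
      using p q loop_join_loops[OF p(1) q(1)] transport_join[OF assms, of p q]
      by (simp add: fundamental_group_mult \<Theta> loops_def)
  qed
  then show ?thesis using that \<Theta> by blast
qed

lemma transport_hom:
  assumes "transport Y Q T" "\<phi> \<in> hom Q R"
  shows "transport Y R (\<lambda>p. \<phi> (T p))"
  using assms unfolding transport_def hom_def by (auto simp: Pi_iff)

text \<open>Functors given by a potential: the value depends on the end points alone, so homotopy
  invariance is free. The potential may jump; glued to a functor that is trivial on the overlap, its
  jumps record crossings.\<close>

lemma transport_coboundary:
  assumes "group Q" "\<And>y. y \<in> topspace Y \<Longrightarrow> \<tau> y \<in> carrier Q"
  shows "transport Y Q (\<lambda>p. inv\<^bsub>Q\<^esub> (\<tau> (p 0)) \<otimes>\<^bsub>Q\<^esub> \<tau> (p 1))"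
proof -
  interpret group Q by fact
  have c: "\<tau> (p 0) \<in> carrier Q" "\<tau> (p 1) \<in> carrier Q" if "pathin Y p" for p
    using assms(2) pathin_topspace[OF that, of 0] pathin_topspace[OF that, of 1] by auto
  show ?thesis
    unfolding transport_def
  proof (intro conjI allI impI)
    fix p q assume p: "pathin Y p" "pathin Y q" "p 1 = q 0"
    show "inv\<^bsub>Q\<^esub> (\<tau> ((p \<diamondop> q) 0)) \<otimes>\<^bsub>Q\<^esub> \<tau> ((p \<diamondop> q) 1)
      = (inv\<^bsub>Q\<^esub> (\<tau> (p 0)) \<otimes>\<^bsub>Q\<^esub> \<tau> (p 1)) \<otimes>\<^bsub>Q\<^esub> (inv\<^bsub>Q\<^esub> (\<tau> (q 0)) \<otimes>\<^bsub>Q\<^esub> \<tau> (q 1))"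
      using c[OF p(1)] c[OF p(2)] p(3)
      by (simp add: m_assoc inv_solve_left') (simp add: m_assoc[symmetric])
  next
    show "inv\<^bsub>Q\<^esub> (\<tau> (p 0)) \<otimes>\<^bsub>Q\<^esub> \<tau> (p 1) = inv\<^bsub>Q\<^esub> (\<tau> (q 0)) \<otimes>\<^bsub>Q\<^esub> \<tau> (q 1)"
      if "path_homotopic Y p q" for p q
      using path_homotopicD(3,4)[OF that] by simp
  qed (use c in auto)
qed

text \<open>The restrictions of \<open>T\<close> to the cover are gluing data, and both functors
  extend them; uniqueness of the extension identifies the two.\<close>

lemma transport_eqI:
  assumes "group Q" "\<And>i. i \<in> I \<Longrightarrow> openin X (U i)" "topspace X \<subseteq> (\<Union>i\<in>I. U i)"
    "transport X Q T" "transport X Q T'"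
    "\<And>i p. i \<in> I \<Longrightarrow> pathin (subtopology X (U i)) p \<Longrightarrow> T p = T' p" "pathin X p"
  shows "T p = T' p"
proof -
  interpret glue_data Q X I U "\<lambda>_. T"
    unfolding glue_data_def glue_data_axioms_def
    using assms(1-4) transport_subtopology[of X UNIV Q T] by auto
  have "glued p = T p" "glued p = T' p"
    using assms(4-7) by (intro transport_unique; simp)+
  then show ?thesis by simp
qed

text \<open>Simple connectedness without connectedness: every path component has a trivial
  fundamental group.\<close>

definition path_unique :: "'a topology \<Rightarrow> bool" where
  "path_unique Y \<longleftrightarrow> (\<forall>p q. pathin Y p \<longrightarrow> pathin Y q \<longrightarrow> p 0 = q 0 \<longrightarrow> p 1 = q 1 \<longrightarrow> path_homotopic Y p q)"

lemma path_in_open_union: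
  assumes p: "pathin (subtopology X (A \<union> B)) p" and AB: "openin X A" "openin X B" "A \<inter> B = {}"
  shows "pathin (subtopology X A) p \<or> pathin (subtopology X B) p"
proof -
  have pX: "pathin X p" and pAB: "\<And>t. t \<in> {0..1} \<Longrightarrow> p t \<in> A \<union> B"
    using p by (auto simp: pathin_subtopology)
  have o: "openin (top_of_set {0..1}) {t \<in> {0..1}. p t \<in> C}" if "openin X C" for C
    using openin_continuous_map_preimage[OF pX[unfolded pathin_def] that] by simp
  have "{t \<in> {0..1}. p t \<in> A} \<inter> {t \<in> {0..1}. p t \<in> B} = {}"
    "{0..1} \<subseteq> {t \<in> {0..1}. p t \<in> A} \<union> {t \<in> {0..1}. p t \<in> B}"
    using AB(3) pAB by (auto, blast)
  moreover have "connected {0..1::real}" by simp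
  ultimately have "{t \<in> {0..1}. p t \<in> A} = {} \<or> {t \<in> {0..1}. p t \<in> B} = {}"
    using o[OF AB(1)] o[OF AB(2)] unfolding connected_openin by blast
  then show ?thesis
    using pX pAB unfolding pathin_subtopology by blast
qed

section \<open>The universal property of the free product\<close>

section \<open>Free products with the integers\<close>

lemma free_product_left_hom:
  assumes "group G" "group H"
  shows "(\<lambda>a. free_product_class G H [Inl a]) \<in> hom G (free_product G H)"
proof -
  interpret G: group G by fact
  show ?thesis
  proof (rule homI)
    fix a b assume ab: "a \<in> carrier G" "b \<in> carrier G"
    have w: "[Inl a] \<in> free_product_words G H" "[Inl b] \<in> free_product_words G H"
      using ab by (auto simp: free_product_words_def)
    then show "free_product_class G H [Inl a] \<in> carrier (free_product G H)"
      by (simp add: free_product_def)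
    show "free_product_class G H [Inl (a \<otimes>\<^bsub>G\<^esub> b)]
        = free_product_class G H [Inl a] \<otimes>\<^bsub>free_product G H\<^esub> free_product_class G H [Inl b]"
      using free_product_equiv.mult_left[of "[]" G H "[]" a b] ab w
      by (simp add: free_product_mult[OF assms] free_product_class_eq free_product_words_def)
  qed
qed

lemma free_product_right_hom:
  assumes "group G" "group H"
  shows "(\<lambda>a. free_product_class G H [Inr a]) \<in> hom H (free_product G H)"
proof -
  interpret H: group H by fact
  show ?thesis
  proof (rule homI)
    fix a b assume ab: "a \<in> carrier H" "b \<in> carrier H"
    have w: "[Inr a] \<in> free_product_words G H" "[Inr b] \<in> free_product_words G H"
      using ab by (auto simp: free_product_words_def)
    then show "free_product_class G H [Inr a] \<in> carrier (free_product G H)"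
      by (simp add: free_product_def)
    show "free_product_class G H [Inr (a \<otimes>\<^bsub>H\<^esub> b)]
        = free_product_class G H [Inr a] \<otimes>\<^bsub>free_product G H\<^esub> free_product_class G H [Inr b]"
      using free_product_equiv.mult_right[of "[]" G H "[]" a b] ab w
      by (simp add: free_product_mult[OF assms] free_product_class_eq free_product_words_def)
  qed
qed

lemma free_product_universal:
  assumes GH: "group G" "group H" and K: "group K" and \<alpha>: "\<alpha> \<in> hom G K" and \<beta>: "\<beta> \<in> hom H K"
  obtains \<psi> where "\<psi> \<in> hom (free_product G H) K"
    "\<And>a. a \<in> carrier G \<Longrightarrow> \<psi> (free_product_class G H [Inl a]) = \<alpha> a"
    "\<And>b. b \<in> carrier H \<Longrightarrow> \<psi> (free_product_class G H [Inr b]) = \<beta> b"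
proof -
  interpret K: group K by fact
  interpret a: group_hom G K \<alpha> using GH K \<alpha> by (simp add: group_hom_def group_hom_axioms_def)
  interpret b: group_hom H K \<beta> using GH K \<beta> by (simp add: group_hom_def group_hom_axioms_def)
  let ?W = "free_product_words G H"
  \<comment> \<open>Evaluation of a word: each letter is mapped by the homomorphism of its factor
    and the results are multiplied. Every generating relation of \<open>free_product_equiv\<close>
    preserves the value.\<close>
  define ev where "ev w = foldr (\<lambda>l k. case_sum \<alpha> \<beta> l \<otimes>\<^bsub>K\<^esub> k) w \<one>\<^bsub>K\<^esub>" for w
  have ev0: "ev [] = \<one>\<^bsub>K\<^esub>" and ev1: "ev (l # w) = case_sum \<alpha> \<beta> l \<otimes>\<^bsub>K\<^esub> ev w" for l w
    by (simp_all add: ev_def)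
  have l: "case_sum \<alpha> \<beta> l \<in> carrier K" if "l \<in> carrier G <+> carrier H" for l
    using that by auto
  have evc: "ev w \<in> carrier K" if "w \<in> ?W" for w
    using that by (induction w) (auto simp: ev0 ev1 free_product_words_def l)
  have eva: "ev (u @ v) = ev u \<otimes>\<^bsub>K\<^esub> ev v" if "u \<in> ?W" "v \<in> ?W" for u v
    using that(1)
  proof (induction u)
    case (Cons x u)
    then have "x \<in> carrier G <+> carrier H" "u \<in> ?W" by (auto simp: free_product_words_def)
    then show ?case using Cons.IH evc l that(2) by (simp add: ev1 K.m_assoc)
  qed (use evc that in \<open>simp add: ev0\<close>)
  have mem: "u @ v \<in> ?W \<longleftrightarrow> u \<in> ?W \<and> v \<in> ?W" "Inl a # v \<in> ?W \<longleftrightarrow> a \<in> carrier G \<and> v \<in> ?W"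
    "Inr b # v \<in> ?W \<longleftrightarrow> b \<in> carrier H \<and> v \<in> ?W" for u v a b
    by (auto simp: free_product_words_def)
  have eve: "ev u = ev v" if "free_product_equiv G H u v" for u v
    using that
    by induction (auto simp: eva evc ev0 ev1 mem K.m_assoc)
  define \<psi> where "\<psi> A = ev (SOME w. w \<in> A)" for A
  have \<psi>: "\<psi> (free_product_class G H w) = ev w" if "w \<in> ?W" for w
  proof -
    have "w \<in> free_product_class G H w"
      using that by (simp add: free_product_class_def free_product_equiv.refl)
    then have "(SOME v. v \<in> free_product_class G H w) \<in> free_product_class G H w"
      by (rule someI[where P="\<lambda>v. v \<in> free_product_class G H w"])
    then show ?thesis using eve by (simp add: \<psi>_def free_product_class_def)
  qed
  have "\<psi> \<in> hom (free_product G H) K"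
  proof (rule homI)
    fix A assume "A \<in> carrier (free_product G H)"
    then obtain u where u: "u \<in> ?W" "A = free_product_class G H u" by (auto simp: free_product_def)
    then show "\<psi> A \<in> carrier K" by (simp add: \<psi> evc)
    fix B assume "B \<in> carrier (free_product G H)"
    then obtain v where v: "v \<in> ?W" "B = free_product_class G H v" by (auto simp: free_product_def)
    show "\<psi> (A \<otimes>\<^bsub>free_product G H\<^esub> B) = \<psi> A \<otimes>\<^bsub>K\<^esub> \<psi> B"
      using u v by (simp add: free_product_mult[OF GH] \<psi> eva mem)
  qed
  moreover have "[] \<in> ?W" by (simp add: free_product_words_def)
  ultimately show ?thesis using that by (auto simp: \<psi> mem ev1 ev0)
qed

text \<open>Every class is a product of classes of one-letter words, so an endomorphism fixing those
  fixes everything. This checks one of the two compositions in the splitting theorem.\<close>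

lemma free_product_hom_id:
  assumes GH: "group G" "group H" and \<eta>: "\<eta> \<in> hom (free_product G H) (free_product G H)"
    and l: "\<And>a. a \<in> carrier G \<Longrightarrow> \<eta> (free_product_class G H [Inl a]) = free_product_class G H [Inl a]"
    and r: "\<And>b. b \<in> carrier H \<Longrightarrow> \<eta> (free_product_class G H [Inr b]) = free_product_class G H [Inr b]"
    and A: "A \<in> carrier (free_product G H)"
  shows "\<eta> A = A"
proof -
  interpret F: group "free_product G H" by (rule group_free_product[OF GH])
  interpret group_hom "free_product G H" "free_product G H" \<eta>
    using \<eta> by (simp add: group_hom_def group_hom_axioms_def F.is_group)
  let ?c = "free_product_class G H" and ?W = "free_product_words G H"
  obtain w where w: "w \<in> ?W" "A = ?c w" using A by (auto simp: free_product_def)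
  from w(1) have "\<eta> (?c w) = ?c w"
  proof (induction w)
    case Nil
    then show ?case using hom_one by (simp add: free_product_def)
  next
    case (Cons x w)
    then have W: "[x] \<in> ?W" "w \<in> ?W" and x: "x \<in> carrier G <+> carrier H"
      by (auto simp: free_product_words_def)
    have e: "?c (x # w) = ?c [x] \<otimes>\<^bsub>free_product G H\<^esub> ?c w"
      using free_product_mult[OF GH W] by simp
    have "?c [x] \<in> carrier (free_product G H)" "?c w \<in> carrier (free_product G H)"
      using W by (auto simp: free_product_def)
    moreover have "\<eta> (?c [x]) = ?c [x]" using x l r by auto
    ultimately show ?case using Cons.IH W by (simp add: e)
  qed
  then show ?thesis using w by simp
qed

section \<open>A simply connected wall with connected complement gives an infinite cyclic free
  factor\<close>

section \<open>Splitting off an infinite cyclic free factor\<close>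

lemma pathin_subtopology_mono: "pathin (subtopology X A) p \<Longrightarrow> A \<subseteq> B \<Longrightarrow> pathin (subtopology X B) p"
  by (auto simp: pathin_subtopology)

lemma path_uniqueD:
  "path_unique (subtopology X A) \<Longrightarrow> pathin (subtopology X A) p \<Longrightarrow> pathin (subtopology X A) q \<Longrightarrow>
   p 0 = q 0 \<Longrightarrow> p 1 = q 1 \<Longrightarrow> A \<subseteq> B \<Longrightarrow> path_homotopic (subtopology X B) p q"
  unfolding path_unique_def using path_homotopic_subtopology by blast

lemma path_connected_spaceD:
  assumes "path_connected_space (subtopology X A)" "x \<in> topspace X \<inter> A" "y \<in> topspace X \<inter> A"
  shows "\<exists>p. pathin (subtopology X A) p \<and> p 0 = x \<and> p 1 = y"
  using assms unfolding path_connected_space_def by auto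

text \<open>
  The open set \<open>W\<close> is a two-sided collar of a wall; \<open>A\<close> and \<open>B\<close> are its two sides. A path picks
  up a generator of \<open>\<int>\<close> when it crosses the wall.
\<close>

theorem fundamental_group_split:
  assumes U: "openin X U" and W: "openin X W" and A: "openin X A" and B: "openin X B"
    and cov: "topspace X \<subseteq> U \<union> W" and UW: "U \<inter> W = A \<union> B" and AB: "A \<inter> B = {}"
    and x0: "x0 \<in> A" and x1: "x1 \<in> B"
    and pcU: "path_connected_space (subtopology X U)"
    and pcW: "path_connected_space (subtopology X W)" and puW: "path_unique (subtopology X W)"
    and pcA: "path_connected_space (subtopology X A)" and puA: "path_unique (subtopology X A)"
    and pcB: "path_connected_space (subtopology X B)" and puB: "path_unique (subtopology X B)"
  shows "fundamental_group X x0 \<cong>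
    free_product (fundamental_group (subtopology X U) x0) integer_group"
proof -
  have top: "U \<subseteq> topspace X" "W \<subseteq> topspace X" "A \<subseteq> topspace X" "B \<subseteq> topspace X"
    using U W A B by (auto dest: openin_subset)
  have sub: "A \<subseteq> U" "A \<subseteq> W" "B \<subseteq> U" "B \<subseteq> W" using UW by auto
  let ?U = "subtopology X U" and ?W = "subtopology X W"
  let ?H = "fundamental_group ?U x0" and ?G = "fundamental_group X x0"
  let ?Q = "free_product ?H integer_group"
  let ?l = "\<lambda>a. free_product_class ?H integer_group [Inl a]"
  let ?r = "\<lambda>n. free_product_class ?H integer_group [Inr n]"
  have gH: "group ?H" using x0 sub top by (intro group_fundamental_group) auto
  have gG: "group ?G" using x0 top by (intro group_fundamental_group) auto
  have gZ: "group integer_group" by (rule group_integer_group)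
  have gQ: "group ?Q" by (rule group_free_product[OF gH gZ])
  interpret H: group ?H by (rule gH)
  interpret G: group ?G by (rule gG)
  interpret Q: group ?Q by (rule gQ)
  have lhom: "?l \<in> hom ?H ?Q" by (rule free_product_left_hom[OF gH gZ])
  have rhom: "?r \<in> hom integer_group ?Q" by (rule free_product_right_hom[OF gH gZ])
  define t where "t = ?r 1"
  have t: "t \<in> carrier ?Q" using hom_carrier[OF rhom] by (auto simp: t_def)
  have "\<forall>w\<in>A. \<exists>p. pathin (subtopology X A) p \<and> p 0 = x0 \<and> p 1 = w"
    using path_connected_spaceD[OF pcA] x0 top by blast
  then obtain a where a: "\<And>w. w \<in> A \<Longrightarrow> pathin (subtopology X A) (a w)" "\<And>w. w \<in> A \<Longrightarrow> a w 0 = x0"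
      "\<And>w. w \<in> A \<Longrightarrow> a w 1 = w" by metis
  have "\<forall>w\<in>B. \<exists>p. pathin (subtopology X B) p \<and> p 0 = x1 \<and> p 1 = w"
    using path_connected_spaceD[OF pcB] x1 top by blast
  then obtain b where b: "\<And>w. w \<in> B \<Longrightarrow> pathin (subtopology X B) (b w)" "\<And>w. w \<in> B \<Longrightarrow> b w 0 = x1"
      "\<And>w. w \<in> B \<Longrightarrow> b w 1 = w" by metis
  have "\<forall>w\<in>W. \<exists>p. pathin ?W p \<and> p 0 = x0 \<and> p 1 = w"
    using path_connected_spaceD[OF pcW] x0 sub top by blast
  then obtain c where c: "\<And>w. w \<in> W \<Longrightarrow> pathin ?W (c w)" "\<And>w. w \<in> W \<Longrightarrow> c w 0 = x0"
      "\<And>w. w \<in> W \<Longrightarrow> c w 1 = w" by metis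
  have "\<forall>w\<in>U. \<exists>p. pathin ?U p \<and> p 0 = x0 \<and> p 1 = w"
    using path_connected_spaceD[OF pcU] x0 sub top by blast
  then obtain u where u: "\<And>w. w \<in> U \<Longrightarrow> pathin ?U (u w)" "\<And>w. w \<in> U \<Longrightarrow> u w 0 = x0"
      "\<And>w. w \<in> U \<Longrightarrow> u w 1 = w" by metis
  define \<gamma> where "\<gamma> = u x1"
  have x1U: "x1 \<in> U" "x1 \<in> W" using x1 sub by auto
  have x0U: "x0 \<in> U" "x0 \<in> W" using x0 sub by auto
  have \<gamma>: "pathin ?U \<gamma>" "\<gamma> 0 = x0" "\<gamma> 1 = x1" using u[OF x1U(1)] by (auto simp: \<gamma>_def)
  define \<delta> where "\<delta> = path_rev (c x1)"
  have \<delta>: "pathin ?W \<delta>" "\<delta> 0 = x1" "\<delta> 1 = x0" using c[OF x1U(2)] by (auto simp: \<delta>_def)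
  \<comment> \<open>The frame reaches points of \<open>A\<close> inside \<open>A\<close>, and points
    of \<open>B\<close> by first going over in \<open>U\<close> along \<gamma>. With this choice
    every path inside \<open>A\<close> or inside \<open>B\<close> is framed trivially.\<close>
  define g where "g w = (if w \<in> A then a w else if w \<in> B then \<gamma> \<diamondop> b w else if w \<in> W then c w else u w)" for w
  have gA: "g w = a w" if "w \<in> A" for w using that by (simp add: g_def)
  have gB: "g w = \<gamma> \<diamondop> b w" if "w \<in> B" for w using that AB by (auto simp: g_def)
  have bU: "pathin ?U (b w)" "pathin ?W (b w)" "pathin X (b w)" if "w \<in> B" for w
    using b(1)[OF that] sub by (auto simp: pathin_subtopology)
  have aU: "pathin ?U (a w)" "pathin ?W (a w)" "pathin X (a w)" if "w \<in> A" for w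
    using a(1)[OF that] sub by (auto simp: pathin_subtopology)
  have frU: "frame ?U x0 g"
    unfolding frame_def
  proof
    fix w assume w: "w \<in> topspace ?U"
    then have wU: "w \<in> U" by simp
    consider "w \<in> A" | "w \<in> B" | "w \<notin> W" using wU UW by auto
    then show "pathin ?U (g w) \<and> g w 0 = x0 \<and> g w 1 = w"
    proof cases
      case 1 then show ?thesis using a aU by (simp add: gA)
    next
      case 2 then show ?thesis using b bU \<gamma> by (auto simp: gB intro!: pathin_join)
    next
      case 3 then show ?thesis using u wU sub by (auto simp: g_def)
    qed
  qed
  have frX: "frame X x0 g"
    unfolding frame_def
  proof
    fix w assume w: "w \<in> topspace X"
    consider "w \<in> U" | "w \<in> W" "w \<notin> U" using w cov by auto
    then show "pathin X (g w) \<and> g w 0 = x0 \<and> g w 1 = w"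
    proof cases
      case 1 then show ?thesis using frU w unfolding frame_def by (auto simp: pathin_subtopology)
    next
      case 2 then show ?thesis using c sub by (auto simp: g_def pathin_subtopology)
    qed
  qed
  have gx0: "path_homotopic ?U (g x0) (\<lambda>_. x0)"
    unfolding gA[OF x0] using a[OF x0] x0 top by (intro path_uniqueD[OF puA _ _ _ _ sub(1)]) auto
  have gx0X: "path_homotopic X (g x0) (\<lambda>_. x0)" by (rule path_homotopic_from_subtopology[OF gx0])
  have gx1: "path_homotopic ?U (g x1) \<gamma>"
  proof -
    have "path_homotopic ?U (b x1) (\<lambda>_. x1)"
      using b[OF x1] x1 top by (intro path_uniqueD[OF puB _ _ _ _ sub(3)]) auto
    then have "path_homotopic ?U (g x1) (\<gamma> \<diamondop> (\<lambda>_. x1))"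
      unfolding gB[OF x1] using \<gamma> b[OF x1] by (intro path_homotopic_join_right) auto
    also have "path_homotopic ?U \<dots> \<gamma>" using \<gamma> by (intro path_homotopic_const_right) auto
    finally show ?thesis .
  qed
  have frA: "framed ?U x0 g p = \<one>\<^bsub>?H\<^esub>" if p: "pathin (subtopology X A) p" for p
  proof (rule framed_one[OF frU pathin_subtopology_mono[OF p sub(1)]])
    have "p 0 \<in> A" "p 1 \<in> A" using p by (auto simp: pathin_subtopology)
    then show "path_homotopic ?U (g (p 0) \<diamondop> p) (g (p 1))"
      using a p by (intro path_uniqueD[OF puA _ _ _ _ sub(1)]) (auto simp: gA intro!: pathin_join)
  qed
  have frB: "framed ?U x0 g p = \<one>\<^bsub>?H\<^esub>" if p: "pathin (subtopology X B) p" for p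
  proof (rule framed_one[OF frU pathin_subtopology_mono[OF p sub(3)]])
    have B01: "p 0 \<in> B" "p 1 \<in> B" using p by (auto simp: pathin_subtopology)
    have "path_homotopic ?U (b (p 0) \<diamondop> p) (b (p 1))"
      using b p B01 by (intro path_uniqueD[OF puB _ _ _ _ sub(3)]) (auto intro!: pathin_join)
    then have 1: "path_homotopic ?U (\<gamma> \<diamondop> (b (p 0) \<diamondop> p)) (\<gamma> \<diamondop> b (p 1))"
      using \<gamma> b B01 by (intro path_homotopic_join_right) auto
    have "path_homotopic ?U ((\<gamma> \<diamondop> b (p 0)) \<diamondop> p) (\<gamma> \<diamondop> (b (p 0) \<diamondop> p))"
      using \<gamma> b B01 bU pathin_subtopology_mono[OF p sub(3)] by (intro path_homotopic_assoc) auto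
    from path_homotopic_trans[OF this 1] show "path_homotopic ?U (g (p 0) \<diamondop> p) (g (p 1))"
      using B01 by (simp add: gB)
  qed
  \<comment> \<open>The potential on the collar \<open>W\<close>: it differs by \<open>t\<close>
    between the two sides. Wall points, outside \<open>A\<close> and \<open>B\<close>, get the
    default value one; agreement with the functor on \<open>U\<close> is tested on \<open>A\<close>
    and \<open>B\<close> only.\<close>
  define \<tau> where "\<tau> w = (if w \<in> B then t else \<one>\<^bsub>?Q\<^esub>)" for w
  define T where "T i = (if i then (\<lambda>p. ?l (framed ?U x0 g p))
      else (\<lambda>p. inv\<^bsub>?Q\<^esub> (\<tau> (p 0)) \<otimes>\<^bsub>?Q\<^esub> \<tau> (p 1)))" for i :: bool
  define V where "V i = (if i then U else W)" for i :: bool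
  have agree: "T True p = T False p" if "pathin (subtopology X (U \<inter> W)) p" for p
  proof -
    have p: "pathin (subtopology X A) p \<or> pathin (subtopology X B) p"
      using path_in_open_union[OF _ A B AB] that UW by simp
    then have "framed ?U x0 g p = \<one>\<^bsub>?H\<^esub>" using frA frB by blast
    moreover have "\<tau> (p 0) = \<tau> (p 1)" using p AB by (auto simp: pathin_subtopology \<tau>_def)
    moreover have "\<tau> w \<in> carrier ?Q" for w using t by (simp add: \<tau>_def)
    moreover have "?l \<one>\<^bsub>?H\<^esub> = \<one>\<^bsub>?Q\<^esub>" using hom_one[OF lhom gH gQ] .
    ultimately show ?thesis by (simp add: T_def)
  qed
  interpret D: glue_data ?Q X UNIV V T
  proof
    show "openin X (V i)" for i using U W by (simp add: V_def)
    show "topspace X \<subseteq> (\<Union>i\<in>UNIV. V i)" using cov by (auto simp: V_def split: if_splits)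
    show "transport (subtopology X (V i)) ?Q (T i)" for i
    proof (cases i)
      case True
      then show ?thesis
        using transport_hom[OF transport_framed[OF frU] lhom] by (simp add: V_def T_def)
    next
      case False
      then show ?thesis
        using t by (simp add: V_def T_def) (rule transport_coboundary[OF gQ], simp add: \<tau>_def)
    qed
    show "T i p = T j p" if "pathin (subtopology X (V i \<inter> V j)) p" for i j p
      using agree[of p] that by (cases i; cases j) (auto simp: V_def Int_commute)
  qed
  have gl: "transport X ?Q D.glued" by (rule D.transport_glued)
  have glU: "D.glued p = ?l (framed ?U x0 g p)" if "pathin ?U p" for p
    using D.glued_restrict[of True p] that by (simp add: V_def T_def)
  have glW: "D.glued p = inv\<^bsub>?Q\<^esub> (\<tau> (p 0)) \<otimes>\<^bsub>?Q\<^esub> \<tau> (p 1)" if "pathin ?W p" for p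
    using D.glued_restrict[of False p] that by (simp add: V_def T_def)
  obtain \<Theta> where \<Theta>: "\<Theta> \<in> hom ?G ?Q" "\<And>p. p \<in> loops X x0 \<Longrightarrow> \<Theta> (loop_class X x0 p) = D.glued p"
    using transport_hom_fundamental_group[OF gl] by blast
  interpret \<Theta>: group_hom ?G ?Q \<Theta> using \<Theta> gG gQ by (simp add: group_hom_def group_hom_axioms_def)
  have tU: "transport ?U ?G (framed X x0 g)"
    using transport_subtopology[of X UNIV ?G "framed X x0 g" U] transport_framed[OF frX] by simp
  obtain \<alpha> where \<alpha>: "\<alpha> \<in> hom ?H ?G" "\<And>p. p \<in> loops ?U x0 \<Longrightarrow> \<alpha> (loop_class ?U x0 p) = framed X x0 g p"
    using transport_hom_fundamental_group[OF tU] by blast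
  have loopsU: "p \<in> loops X x0" if "p \<in> loops ?U x0" for p
    using that by (auto simp: loops_def pathin_subtopology)
  have \<alpha>': "\<alpha> (loop_class ?U x0 p) = loop_class X x0 p" if "p \<in> loops ?U x0" for p
    using \<alpha>(2)[OF that] framed_loop[where g=g, OF loopsU[OF that] gx0X] by simp
  \<comment> \<open>The loop dual to the wall: through \<open>U\<close> from \<open>x0\<close> to
    \<open>x1\<close> and back inside \<open>W\<close>. It crosses from \<open>B\<close> to
    \<open>A\<close>, against the direction counted by \<open>t\<close>, which is why \<psi> sends
    \<open>t\<close> to the inverse of \<open>k\<close>.\<close>
  define k where "k = loop_class X x0 (\<gamma> \<diamondop> \<delta>)"
  have \<gamma>X: "pathin X \<gamma>" and \<delta>X: "pathin X \<delta>" using \<gamma> \<delta> by (auto simp: pathin_subtopology)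
  have kl: "\<gamma> \<diamondop> \<delta> \<in> loops X x0" using \<gamma> \<delta> \<gamma>X \<delta>X by (auto simp: loops_def intro!: pathin_join)
  have k: "k \<in> carrier ?G" unfolding k_def by (rule loop_class_in_carrier[OF kl])
  have \<beta>: "pow ?G (inv\<^bsub>?G\<^esub> k) \<in> hom integer_group ?G"
    by (rule G.hom_integer_group_pow) (use k in simp)
  obtain \<psi> where \<psi>: "\<psi> \<in> hom ?Q ?G" "\<And>a. a \<in> carrier ?H \<Longrightarrow> \<psi> (?l a) = \<alpha> a"
    "\<And>n. \<psi> (?r n) = (inv\<^bsub>?G\<^esub> k) [^]\<^bsub>?G\<^esub> n"
    using free_product_universal[OF gH gZ gG \<alpha>(1) \<beta>] by auto
  interpret \<psi>: group_hom ?Q ?G \<psi> using \<psi> gG gQ by (simp add: group_hom_def group_hom_axioms_def)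
  have \<psi>t: "\<psi> t = inv\<^bsub>?G\<^esub> k" unfolding t_def \<psi>(3) using k by (simp add: G.int_pow_1)
  have \<Theta>k: "\<Theta> k = inv\<^bsub>?Q\<^esub> t"
  proof -
    have "path_homotopic ?U (g x0 \<diamondop> \<gamma>) ((\<lambda>_. x0) \<diamondop> \<gamma>)"
      using gx0 \<gamma> path_homotopicD(4)[OF gx0] by (intro path_homotopic_join_left) auto
    also have "path_homotopic ?U \<dots> \<gamma>" using \<gamma> by (intro path_homotopic_const_left) auto
    also have "path_homotopic ?U \<dots> (g x1)" by (rule path_homotopic_sym[OF gx1])
    finally have "framed ?U x0 g \<gamma> = \<one>\<^bsub>?H\<^esub>" using framed_one[OF frU \<gamma>(1)] \<gamma> by simp
    then have "D.glued \<gamma> = \<one>\<^bsub>?Q\<^esub>" using glU[OF \<gamma>(1)] hom_one[OF lhom gH gQ] by simp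
    moreover have "D.glued \<delta> = inv\<^bsub>?Q\<^esub> t"
      using glW[OF \<delta>(1)] \<delta> x0 x1 AB t by (auto simp: \<tau>_def)
    ultimately show ?thesis
      using \<Theta>(2)[OF kl] transport_join[OF gl \<gamma>X \<delta>X] \<gamma> \<delta> t by (simp add: k_def)
  qed
  have rt: "?r n = t [^]\<^bsub>?Q\<^esub> n" for n :: int
  proof -
    have "pow integer_group 1 n = n" by simp
    then show ?thesis using hom_int_pow[OF rhom _ gZ gQ, of 1 n] by (simp add: t_def)
  qed
  have \<Theta>\<psi>Q: "\<Theta> (\<psi> y) = y" if "y \<in> carrier ?Q" for y
  proof -
    have comp: "(\<lambda>y. \<Theta> (\<psi> y)) \<in> hom ?Q ?Q" using hom_compose[OF \<psi>(1) \<Theta>(1)] by (simp add: comp_def)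
    show ?thesis
    proof (rule free_product_hom_id[OF gH gZ comp _ _ that])
      fix x assume x: "x \<in> carrier ?H"
      then obtain p where p: "p \<in> loops ?U x0" "x = loop_class ?U x0 p" by (rule carrier_fundamental_groupE)
      then have "\<Theta> (\<psi> (?l x)) = D.glued p" using \<psi>(2)[OF x] \<alpha>' \<Theta>(2) loopsU by simp
      also have "\<dots> = ?l x" using glU[of p] framed_loop[where g=g, OF p(1) gx0] p by (simp add: loops_def)
      finally show "\<Theta> (\<psi> (?l x)) = ?l x" .
    next
      fix n :: int
      show "\<Theta> (\<psi> (?r n)) = ?r n"
        unfolding \<psi>(3) using k t \<Theta>k by (simp add: \<Theta>.hom_int_pow rt)
    qed
  qed
  \<comment> \<open>The loop compares the frame with the path chosen inside \<open>W\<close>. The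
    two are homotopic except on \<open>B\<close>, where the frame took the detour along \<gamma> and
    the loop becomes \<open>k\<close>.\<close>
  have \<kappa>: "loop_class X x0 (g w \<diamondop> path_rev (c w)) = \<psi> (inv\<^bsub>?Q\<^esub> (\<tau> w))" if w: "w \<in> W" for w
  proof (cases "w \<in> B")
    case True
    have "path_homotopic ?W (b w \<diamondop> path_rev (c w)) \<delta>"
      using bU[OF True] b[OF True] c[OF w] \<delta> by (intro path_uniqueD[OF puW]) (auto intro!: pathin_join)
    then have 1: "path_homotopic X (\<gamma> \<diamondop> (b w \<diamondop> path_rev (c w))) (\<gamma> \<diamondop> \<delta>)"
      using \<gamma> \<gamma>X b[OF True] by (intro path_homotopic_join_right path_homotopic_from_subtopology[of X W]) auto
    have "path_homotopic X ((\<gamma> \<diamondop> b w) \<diamondop> path_rev (c w)) (\<gamma> \<diamondop> (b w \<diamondop> path_rev (c w)))"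
      using \<gamma> \<gamma>X b[OF True] bU[OF True] c[OF w] by (intro path_homotopic_assoc) (auto simp: pathin_subtopology)
    from path_homotopic_trans[OF this 1] have "loop_class X x0 (g w \<diamondop> path_rev (c w)) = k"
      unfolding k_def gB[OF True] using \<gamma> c[OF w] by (intro loop_class_eqI) auto
    then show ?thesis using True t k \<psi>t by (simp add: \<tau>_def)
  next
    case False
    have gw: "pathin ?W (g w)" "g w 0 = x0" "g w 1 = w"
      using False w a aU c by (auto simp: g_def)
    have cX: "pathin X (c w)" using c[OF w] by (simp add: pathin_subtopology)
    have "path_homotopic X (g w) (c w)"
      using gw c[OF w] puW by (intro path_homotopic_from_subtopology[of X W] path_uniqueD[OF puW]) auto
    then have "path_homotopic X (g w \<diamondop> path_rev (c w)) (c w \<diamondop> path_rev (c w))"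
      using gw c[OF w] cX by (intro path_homotopic_join_left) auto
    also have "path_homotopic X \<dots> (\<lambda>_. x0)" using c[OF w] cX by (intro path_homotopic_rev_right) auto
    finally have "loop_class X x0 (g w \<diamondop> path_rev (c w)) = \<one>\<^bsub>?G\<^esub>"
      unfolding one_fundamental_group using gw c[OF w] by (intro loop_class_eqI) auto
    then show ?thesis using False by (simp add: \<tau>_def)
  qed
  have frW: "framed X x0 g p = \<psi> (D.glued p)" if p: "pathin ?W p" for p
  proof -
    have W01: "p 0 \<in> W" "p 1 \<in> W" using p by (auto simp: pathin_subtopology)
    then have t01: "p 0 \<in> topspace X" "p 1 \<in> topspace X" using top by auto
    note c0 = c[OF W01(1)] and c1 = c[OF W01(2)]
    have cX: "pathin X (c (p 0))" "pathin X (c (p 1))" using c0 c1 by (auto simp: pathin_subtopology)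
    have g0: "pathin X (g (p 0))" "g (p 0) 0 = x0" "g (p 0) 1 = p 0"
      "pathin X (g (p 1))" "g (p 1) 0 = x0" "g (p 1) 1 = p 1"
      using frX t01 by (auto simp: frame_def)
    let ?m0 = "g (p 0) \<diamondop> path_rev (c (p 0))" and ?m1 = "g (p 1) \<diamondop> path_rev (c (p 1))"
    have m: "?m0 \<in> loops X x0" "?m1 \<in> loops X x0"
      using g0 c0 c1 cX by (auto simp: loops_def intro!: pathin_join)
    have \<tau>c: "\<tau> w \<in> carrier ?Q" for w using t by (simp add: \<tau>_def)
    have "path_homotopic ?W p (path_rev (c (p 0)) \<diamondop> c (p 1))"
      using p c0 c1 by (intro path_uniqueD[OF puW]) (auto intro!: pathin_join)
    then have 1: "path_homotopic X p (path_rev (c (p 0)) \<diamondop> c (p 1))" by (rule path_homotopic_from_subtopology)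
    have "path_homotopic X ((g (p 0) \<diamondop> p) \<diamondop> path_rev (g (p 1)))
        ((g (p 0) \<diamondop> (path_rev (c (p 0)) \<diamondop> c (p 1))) \<diamondop> path_rev (g (p 1)))"
      using 1 g0 by (intro path_homotopic_join_left path_homotopic_join_right) auto
    also have "path_homotopic X \<dots> ((?m0 \<diamondop> c (p 1)) \<diamondop> path_rev (g (p 1)))"
      using g0 c0 c1 cX
      by (intro path_homotopic_join_left path_homotopic_sym[OF path_homotopic_assoc]) auto
    also have "path_homotopic X \<dots> (?m0 \<diamondop> (c (p 1) \<diamondop> path_rev (g (p 1))))"
      using g0 c0 c1 cX by (intro path_homotopic_assoc) (auto intro!: pathin_join)
    also have "c (p 1) \<diamondop> path_rev (g (p 1)) = path_rev ?m1"
      using g0 c1 by (simp add: path_rev_join)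
    finally have "framed X x0 g p = loop_class X x0 (?m0 \<diamondop> path_rev ?m1)"
      unfolding framed_def using g0 by (intro loop_class_eqI) auto
    also have "\<dots> = loop_class X x0 ?m0 \<otimes>\<^bsub>?G\<^esub> loop_class X x0 (path_rev ?m1)"
      using m by (intro fundamental_group_mult[symmetric]) (auto simp: loops_def)
    also have "\<dots> = \<psi> (inv\<^bsub>?Q\<^esub> (\<tau> (p 0))) \<otimes>\<^bsub>?G\<^esub> inv\<^bsub>?G\<^esub> (\<psi> (inv\<^bsub>?Q\<^esub> (\<tau> (p 1))))"
      using inv_fundamental_group[OF m(2)] \<kappa>[OF W01(1)] \<kappa>[OF W01(2)] by simp
    also have "\<dots> = \<psi> (D.glued p)"
      using \<tau>c by (simp add: glW[OF p])
    finally show ?thesis .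
  qed
  have frUX: "framed X x0 g p = \<psi> (D.glued p)" if p: "pathin ?U p" for p
  proof -
    have L: "(g (p 0) \<diamondop> p) \<diamondop> path_rev (g (p 1)) \<in> loops ?U x0" by (rule frame_loops[OF frU p])
    have "\<psi> (D.glued p) = \<alpha> (framed ?U x0 g p)"
      using glU[OF p] \<psi>(2) transport_closed[OF transport_framed[OF frU] p] by simp
    also have "\<dots> = framed X x0 g p" unfolding framed_def by (rule \<alpha>'[OF L])
    finally show ?thesis by simp
  qed
  \<comment> \<open>The framed functor and the image under \<psi> of the glued one agree over
    \<open>U\<close> and over \<open>W\<close>, hence everywhere. On loops at \<open>x0\<close> this
    says that \<psi> undoes \<Theta>.\<close>
  have all: "framed X x0 g p = \<psi> (D.glued p)" if p: "pathin X p" for p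
  proof (rule transport_eqI[OF gG, of UNIV X V])
    show "transport X ?G (framed X x0 g)" by (rule transport_framed[OF frX])
    show "transport X ?G (\<lambda>p. \<psi> (D.glued p))" by (rule transport_hom[OF gl \<psi>(1)])
    show "framed X x0 g p = \<psi> (D.glued p)" if "pathin (subtopology X (V i)) p" for i p
      using that frUX frW by (cases i) (auto simp: V_def)
  qed (use p D.open_U D.cover in auto)
  have \<psi>\<Theta>: "\<psi> (\<Theta> y) = y" if y: "y \<in> carrier ?G" for y
  proof -
    obtain p where p: "p \<in> loops X x0" "y = loop_class X x0 p" using y by (rule carrier_fundamental_groupE)
    have "pathin X p" using p(1) by (simp add: loops_def)
    from all[OF this] show ?thesis
      using framed_loop[where g=g, OF p(1) gx0X] \<Theta>(2)[OF p(1)] unfolding p(2) by simp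
  qed
  have "bij_betw \<Theta> (carrier ?G) (carrier ?Q)"
    by (rule bij_betw_byWitness[of _ \<psi>]) (auto simp: \<psi>\<Theta> \<Theta>\<psi>Q)
  then have "\<Theta> \<in> iso ?G ?Q" using \<Theta>(1) by (simp add: iso_def)
  then show ?thesis by (auto simp: is_iso_def)
qed

lemma path_homotopic_conj_conj:
  assumes "pathin X s" "pathin X p" "s 1 = p 0" "p 1 = p 0"
  shows "path_homotopic X ((path_rev s \<diamondop> ((s \<diamondop> p) \<diamondop> path_rev s)) \<diamondop> s) p"
proof -
  have "path_homotopic X ((path_rev s \<diamondop> ((s \<diamondop> p) \<diamondop> path_rev s)) \<diamondop> s) ((path_rev s \<diamondop> (s \<diamondop> (p \<diamondop> path_rev s))) \<diamondop> s)"
    using assms by (intro path_homotopic_join_left path_homotopic_join_right path_homotopic_assoc) auto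
  also have "path_homotopic X \<dots> ((p \<diamondop> path_rev s) \<diamondop> s)"
    using assms by (intro path_homotopic_join_left path_homotopic_cancel pathin_join) auto
  also have "path_homotopic X \<dots> (p \<diamondop> (path_rev s \<diamondop> s))"
    using assms by (intro path_homotopic_assoc) auto
  also have "path_homotopic X \<dots> (p \<diamondop> (\<lambda>_. p 1))"
    using assms by (intro path_homotopic_join_right path_homotopic_rev_left) auto
  also have "path_homotopic X \<dots> p"
    using assms by (intro path_homotopic_const_right) auto
  finally show ?thesis .
qed

text \<open>On loops at \<open>y\<close> the framed functor is conjugation by the path
  \<open>s\<close>, and conjugating back along \<open>s\<close> inverts it.\<close>

lemma fundamental_group_base_change:
  assumes pc: "path_connected_space X" and x: "x \<in> topspace X" and y: "y \<in> topspace X"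
  shows "fundamental_group X y \<cong> fundamental_group X x"
proof -
  let ?Gx = "fundamental_group X x" and ?Gy = "fundamental_group X y"
  have gx: "group ?Gx" and gy: "group ?Gy" using x y by (auto intro: group_fundamental_group)
  have "\<forall>w\<in>topspace X. \<exists>p. pathin X p \<and> p 0 = x \<and> p 1 = w"
    using pc x unfolding path_connected_space_def by auto
  then obtain g where "\<And>w. w \<in> topspace X \<Longrightarrow> pathin X (g w) \<and> g w 0 = x \<and> g w 1 = w" by metis
  then have fr: "frame X x g" by (auto simp: frame_def)
  define s where "s = g y"
  have s: "pathin X s" "s 0 = x" "s 1 = y" using fr y by (auto simp: frame_def s_def)
  obtain \<Theta> where \<Theta>: "\<Theta> \<in> hom ?Gy ?Gx" "\<And>p. p \<in> loops X y \<Longrightarrow> \<Theta> (loop_class X y p) = framed X x g p"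
    using transport_hom_fundamental_group[OF transport_framed[OF fr]] by blast
  have \<Theta>': "\<Theta> (loop_class X y p) = loop_class X x ((s \<diamondop> p) \<diamondop> path_rev s)" if "p \<in> loops X y" for p
    using \<Theta>(2)[OF that] that by (simp add: framed_def s_def loops_def)
  have "inj_on \<Theta> (carrier ?Gy)"
  proof (rule inj_onI)
    fix A B assume "A \<in> carrier ?Gy" "B \<in> carrier ?Gy" and eq: "\<Theta> A = \<Theta> B"
    then obtain p q where p: "p \<in> loops X y" "A = loop_class X y p" and q: "q \<in> loops X y" "B = loop_class X y q"
      by (metis carrier_fundamental_groupE)
    have pq: "pathin X p" "p 0 = y" "p 1 = y" "pathin X q" "q 0 = y" "q 1 = y"
      using p q by (auto simp: loops_def)
    have "(s \<diamondop> p) \<diamondop> path_rev s \<in> loops X x" using pq s by (auto simp: loops_def intro!: pathin_join)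
    then have h: "path_homotopic X ((s \<diamondop> p) \<diamondop> path_rev s) ((s \<diamondop> q) \<diamondop> path_rev s)"
      using eq p q \<Theta>' by (intro loop_class_eqD) auto
    have "path_homotopic X p ((path_rev s \<diamondop> ((s \<diamondop> p) \<diamondop> path_rev s)) \<diamondop> s)"
      using pq s by (intro path_homotopic_sym[OF path_homotopic_conj_conj]) auto
    also have "path_homotopic X \<dots> ((path_rev s \<diamondop> ((s \<diamondop> q) \<diamondop> path_rev s)) \<diamondop> s)"
      using pq s by (intro path_homotopic_join_left[OF path_homotopic_join_right[OF h]]) auto
    also have "path_homotopic X \<dots> q"
      using pq s by (intro path_homotopic_conj_conj) auto
    finally show "A = B" unfolding p q using pq by (intro loop_class_eqI) auto
  qed
  moreover have "\<Theta> ` carrier ?Gy = carrier ?Gx"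
  proof
    show "\<Theta> ` carrier ?Gy \<subseteq> carrier ?Gx" using \<Theta>(1) by (auto simp: hom_def)
    show "carrier ?Gx \<subseteq> \<Theta> ` carrier ?Gy"
    proof
      fix A assume "A \<in> carrier ?Gx"
      then obtain q where q: "q \<in> loops X x" "A = loop_class X x q" by (rule carrier_fundamental_groupE)
      have q': "pathin X q" "q 0 = x" "q 1 = x" using q by (auto simp: loops_def)
      let ?p = "(path_rev s \<diamondop> q) \<diamondop> s"
      have p: "?p \<in> loops X y" using q' s by (auto simp: loops_def intro!: pathin_join)
      have "path_homotopic X ((s \<diamondop> ?p) \<diamondop> path_rev s) q"
        using path_homotopic_conj_conj[of X "path_rev s" q] q' s by simp
      then have "\<Theta> (loop_class X y ?p) = A"
        unfolding \<Theta>'[OF p] q using s by (intro loop_class_eqI) auto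
      then show "A \<in> \<Theta> ` carrier ?Gy" using loop_class_in_carrier[OF p] by blast
    qed
  qed
  ultimately have "\<Theta> \<in> iso ?Gy ?Gx" using \<Theta>(1) by (simp add: iso_def bij_betw_def)
  then show ?thesis by (auto simp: is_iso_def)
qed

section \<open>Word metrics, the four-point inequality and commuting elements\<close>

section \<open>Commuting elements in hyperbolic groups\<close>

text \<open>Once the Gromov products are written out, distances common to both sides cancel. What
  remains compares the three ways of splitting four points into two pairs, which suits
  quadrilaterals of group elements.\<close>

lemma gromov_four_point:
  assumes hyp: "\<forall>w\<in>M. \<forall>x\<in>M. \<forall>y\<in>M. \<forall>z\<in>M.
        min (gromov_product d w x y) (gromov_product d w y z) - \<delta> \<le> gromov_product d w x z"
    and M: "w \<in> M" "x \<in> M" "y \<in> M" "z \<in> M"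
  shows "d x z + d y w \<le> max (d x y + d z w) (d y z + d x w) + 2 * \<delta>"
proof -
  have "min (gromov_product d w x y) (gromov_product d w y z) - \<delta> \<le> gromov_product d w x z"
    using hyp M by blast
  then have "gromov_product d w x y - \<delta> \<le> gromov_product d w x z \<or>
      gromov_product d w y z - \<delta> \<le> gromov_product d w x z"
    by (auto simp: min_def split: if_splits)
  moreover have "d x y + d z w \<le> max (d x y + d z w) (d y z + d x w)"
    "d y z + d x w \<le> max (d x y + d z w) (d y z + d x w)" by simp_all
  ultimately show ?thesis unfolding gromov_product_def by argo
qed

locale finitely_generated = group G for G (structure) +
  fixes A :: "'a set"
  assumes finite_A: "finite A" and A_carrier: "A \<subseteq> carrier G" and gen_A: "generate G A = carrier G"
begin

definition letters :: "'a set" where "letters = A \<union> m_inv G ` A"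

abbreviation word_prod :: "'a list \<Rightarrow> 'a" where "word_prod ws \<equiv> foldr (\<otimes>) ws \<one>"

abbreviation len :: "'a \<Rightarrow> nat" where "len \<equiv> word_length G A"

lemma letters_carrier: "letters \<subseteq> carrier G"
  using A_carrier by (auto simp: letters_def)

lemma finite_letters: "finite letters"
  using finite_A by (simp add: letters_def)

lemma inv_letters: "y \<in> letters \<Longrightarrow> inv y \<in> letters"
  using A_carrier by (auto simp: letters_def)

lemma word_prod_closed: "set ws \<subseteq> letters \<Longrightarrow> word_prod ws \<in> carrier G"
  by (induction ws) (use letters_carrier in auto)

lemma word_prod_append:
  "set ws \<subseteq> letters \<Longrightarrow> set vs \<subseteq> letters \<Longrightarrow> word_prod (ws @ vs) = word_prod ws \<otimes> word_prod vs"
  by (induction ws) (use letters_carrier word_prod_closed in \<open>auto simp: m_assoc subset_iff\<close>)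

lemma word_prod_inv:
  "set ws \<subseteq> letters \<Longrightarrow> word_prod (rev (map (m_inv G) ws)) = inv (word_prod ws)"
proof (induction ws)
  case (Cons x ws)
  have x: "x \<in> carrier G" "word_prod ws \<in> carrier G" using Cons.prems letters_carrier word_prod_closed by auto
  have "word_prod (rev (map (m_inv G) (x # ws))) = word_prod (rev (map (m_inv G) ws)) \<otimes> word_prod [inv x]"
    using Cons.prems inv_letters by (simp only: list.map rev.simps) (intro word_prod_append; auto)
  then show ?case using Cons x by (simp add: inv_mult_group)
qed simp

lemma word_exists: "g \<in> carrier G \<Longrightarrow> \<exists>ws. set ws \<subseteq> letters \<and> word_prod ws = g"
  unfolding gen_A[symmetric]
proof (induction rule: generate.induct)
  case one
  show ?case by (intro exI[of _ "[]"]) simp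
next
  case (incl h)
  then show ?case using A_carrier by (intro exI[of _ "[h]"]) (auto simp: letters_def)
next
  case (inv h)
  then show ?case using A_carrier by (intro exI[of _ "[inv h]"]) (auto simp: letters_def)
next
  case (eng g h)
  then obtain u v where "set u \<subseteq> letters" "word_prod u = g" "set v \<subseteq> letters" "word_prod v = h" by blast
  then show ?case using word_prod_append by (intro exI[of _ "u @ v"]) auto
qed

lemma word_length_realize:
  assumes "g \<in> carrier G"
  obtains ws where "length ws = len g" "set ws \<subseteq> letters" "word_prod ws = g"
proof -
  have "\<exists>n. \<exists>ws. length ws = n \<and> set ws \<subseteq> A \<union> m_inv G ` A \<and> word_prod ws = g"
    using word_exists[OF assms] by (auto simp: letters_def)
  from LeastI_ex[OF this] show ?thesis using that by (auto simp: word_length_def letters_def)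
qed

lemma word_length_le: "set ws \<subseteq> letters \<Longrightarrow> word_prod ws = g \<Longrightarrow> len g \<le> length ws"
  unfolding word_length_def letters_def by (intro Least_le) blast

lemma word_length_inv:
  assumes "g \<in> carrier G"
  shows "len (inv g) = len g"
proof -
  have le: "len (inv h) \<le> len h" if h: "h \<in> carrier G" for h
  proof -
    obtain ws where ws: "length ws = len h" "set ws \<subseteq> letters" "word_prod ws = h"
      using word_length_realize[OF h] by blast
    have "set (rev (map (m_inv G) ws)) \<subseteq> letters" using ws(2) inv_letters by auto
    from word_length_le[OF this word_prod_inv[OF ws(2)]] show ?thesis using ws by simp
  qed
  from le[OF assms] le[of "inv g"] assms show ?thesis by simp
qed

lemma finite_word_ball: "finite {g \<in> carrier G. len g \<le> n}"
proof -
  have "{g \<in> carrier G. len g \<le> n} \<subseteq> word_prod ` {ws. set ws \<subseteq> letters \<and> length ws \<le> n}"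
  proof
    fix g assume "g \<in> {g \<in> carrier G. len g \<le> n}"
    then have g: "g \<in> carrier G" "len g \<le> n" by auto
    obtain ws where "length ws = len g" "set ws \<subseteq> letters" "word_prod ws = g"
      using word_length_realize[OF g(1)] by blast
    then show "g \<in> word_prod ` {ws. set ws \<subseteq> letters \<and> length ws \<le> n}" using g by auto
  qed
  then show ?thesis by (rule finite_subset) (simp add: finite_lists_length_le[OF finite_letters])
qed

text \<open>A homomorphism to the integers is Lipschitz for the word metric, with the sum of its
  absolute values over the letters as a constant. Read backwards, it bounds word length from
  below.\<close>

lemma hom_integer_word_length:
  assumes \<phi>: "\<phi> \<in> hom G integer_group"
  obtains C where "C \<ge> 0" "\<And>g. g \<in> carrier G \<Longrightarrow> \<bar>real_of_int (\<phi> g)\<bar> \<le> C * real (len g)"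
proof -
  interpret \<phi>: group_hom G integer_group \<phi> using \<phi> is_group by (simp add: group_hom_def group_hom_axioms_def)
  define C where "C = (\<Sum>r\<in>letters. \<bar>real_of_int (\<phi> r)\<bar>)"
  have C0: "C \<ge> 0" by (simp add: C_def sum_nonneg)
  have Cr: "\<bar>real_of_int (\<phi> r)\<bar> \<le> C" if "r \<in> letters" for r
    unfolding C_def using that by (intro member_le_sum finite_letters) auto
  have w: "set ws \<subseteq> letters \<Longrightarrow> \<bar>real_of_int (\<phi> (word_prod ws))\<bar> \<le> C * real (length ws)" for ws
  proof (induction ws)
    case Nil
    show ?case using \<phi>.hom_one by simp
  next
    case (Cons r ws)
    have "\<phi> (word_prod (r # ws)) = \<phi> r + \<phi> (word_prod ws)"
      using Cons.prems letters_carrier word_prod_closed by auto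
    then have "\<bar>real_of_int (\<phi> (word_prod (r # ws)))\<bar> \<le> \<bar>real_of_int (\<phi> r)\<bar> + \<bar>real_of_int (\<phi> (word_prod ws))\<bar>"
      by simp
    also have "\<dots> \<le> C + C * real (length ws)" using Cons Cr[of r] by auto
    finally show ?case by (simp add: algebra_simps)
  qed
  show ?thesis
  proof (rule that[OF C0])
    fix g assume g: "g \<in> carrier G"
    obtain ws where "length ws = len g" "set ws \<subseteq> letters" "word_prod ws = g"
      using word_length_realize[OF g] by blast
    then show "\<bar>real_of_int (\<phi> g)\<bar> \<le> C * real (len g)" using w[of ws] by simp
  qed
qed

end

text \<open>Squares serve as the go-between: \<open>k * k\<close> is at most
  \<open>2 * 2 ^ k\<close>, yet exceeds every linear function eventually.\<close>

lemma exp_not_linearly_bounded: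
  fixes \<alpha> \<beta> :: real
  assumes "\<And>k::nat. 2 ^ k \<le> \<alpha> + \<beta> * real k"
  shows False
proof -
  have lin: "2 * real k + 1 \<le> 2 * 2 ^ k" for k
  proof (induction k)
    case (Suc k)
    have "(1::real) \<le> 2 ^ k" by simp
    then show ?case using Suc unfolding power_Suc of_nat_Suc by argo
  qed simp
  have sq: "real k * real k \<le> 2 * 2 ^ k" for k
  proof (induction k)
    case (Suc k)
    then show ?case using lin[of k] by (simp add: algebra_simps)
  qed simp
  obtain k :: nat where k: "real k > 2 * \<bar>\<alpha>\<bar> + 2 * \<bar>\<beta>\<bar> + 1" using reals_Archimedean2 by blast
  then have k1: "real k \<ge> 1" by linarith
  have "2 * (\<alpha> + \<beta> * real k) \<le> (2 * \<bar>\<alpha>\<bar> + 2 * \<bar>\<beta>\<bar>) * real k"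
  proof -
    have "\<alpha> \<le> \<bar>\<alpha>\<bar> * real k" using k1 by (metis abs_ge_self abs_ge_zero mult_left_mono mult.right_neutral order_trans)
    moreover have "\<beta> * real k \<le> \<bar>\<beta>\<bar> * real k" by (intro mult_right_mono) auto
    ultimately show ?thesis by (simp add: algebra_simps)
  qed
  also have "\<dots> < real k * real k" using k k1 by (intro mult_strict_right_mono) linarith+
  finally show False using sq[of k] assms[of k] by argo
qed

text \<open>In the coset of the powers of \<open>a\<close> that contains a given power of
  \<open>b\<close>, take a shortest element \<open>c\<close>. If it were long, the flat strip
  spanned by \<open>c\<close> and a suitable power of \<open>a\<close> would violate the four-point
  inequality, so all these elements lie in one ball and two of them coincide. As \<phi> vanishes on
  \<open>b\<close> but not on \<open>a\<close>, both contain the same power of \<open>a\<close>, and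
  two powers of \<open>b\<close> are equal.\<close>

theorem hyperbolic_commuting_finite_order:
  assumes hyp: "hyperbolic_group G" and \<phi>: "\<phi> \<in> hom G integer_group"
    and a: "a \<in> carrier G" and b: "b \<in> carrier G" and ab: "a \<otimes>\<^bsub>G\<^esub> b = b \<otimes>\<^bsub>G\<^esub> a"
    and \<phi>a: "\<phi> a \<noteq> 0" and \<phi>b: "\<phi> b = 0"
  shows "\<exists>n::nat. n > 0 \<and> b [^]\<^bsub>G\<^esub> n = \<one>\<^bsub>G\<^esub>"
proof -
  obtain A where gG: "group G" and A: "finite A" "A \<subseteq> carrier G" "generate G A = carrier G"
    and gr: "gromov_hyperbolic (carrier G) (word_metric G A)"
    using hyp by (auto simp: hyperbolic_group_def)
  interpret finitely_generated G A
    using gG A by (simp add: finitely_generated_def finitely_generated_axioms_def)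
  interpret \<phi>: group_hom G integer_group \<phi> using \<phi> gG by (simp add: group_hom_def group_hom_axioms_def)
  let ?d = "word_metric G A"
  obtain \<delta> where \<delta>: "\<forall>w\<in>carrier G. \<forall>x\<in>carrier G. \<forall>y\<in>carrier G. \<forall>z\<in>carrier G.
        min (gromov_product ?d w x y) (gromov_product ?d w y z) - \<delta> \<le> gromov_product ?d w x z"
    using gr unfolding gromov_hyperbolic_def by blast
  have d: "?d x y = real (len (inv\<^bsub>G\<^esub> x \<otimes>\<^bsub>G\<^esub> y))" for x y by (simp add: word_metric_def)
  have dsym: "?d x y = ?d y x" if "x \<in> carrier G" "y \<in> carrier G" for x y
    using word_length_inv[of "inv\<^bsub>G\<^esub> x \<otimes>\<^bsub>G\<^esub> y"] that by (simp add: d inv_mult_group)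
  note four = gromov_four_point[OF \<delta>]
  define P where "P n = a [^]\<^bsub>G\<^esub> (n::int)" for n
  have P: "P n \<in> carrier G" for n using a by (simp add: P_def)
  have Padd: "P m \<otimes>\<^bsub>G\<^esub> P n = P (m + n)" for m n using a by (simp add: P_def int_pow_mult)
  have Pinv: "inv\<^bsub>G\<^esub> (P n) = P (- n)" for n using a by (simp add: P_def int_pow_neg)
  have P0: "P 0 = \<one>\<^bsub>G\<^esub>" by (simp add: P_def)
  define f where "f n = real (len (P (int n)))" for n
  have fneg: "real (len (P (- int n))) = f n" for n
    using word_length_inv[OF P, of "int n"] by (simp add: Pinv f_def)
  obtain C where C: "C \<ge> 0" "\<And>g. g \<in> carrier G \<Longrightarrow> \<bar>real_of_int (\<phi> g)\<bar> \<le> C * real (len g)"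
    using hom_integer_word_length[OF \<phi>] by blast
  have \<phi>P: "\<phi> (P n) = n * \<phi> a" for n
    using hom_int_pow[OF \<phi> a gG group_integer_group, of n] by (simp add: P_def)
  \<comment> \<open>If doubling the exponent never gained more than 4\<delta>, the length of
    \<open>a\<close> to the power \<open>2 ^ k\<close> would grow at most linearly in
    \<open>k\<close>, whereas \<phi> makes it grow at least like a constant times
    \<open>2 ^ k\<close>.\<close>
  obtain n where n: "f (2 * n) > f n + 4 * \<delta>"
  proof (rule ccontr)
    assume "\<not> thesis"
    then have le: "f (2 * n) \<le> f n + 4 * \<delta>" for n using that by (meson not_less)
    have fk: "f (2 ^ k) \<le> f 1 + 4 * \<delta> * real k" for k
    proof (induction k)
      case (Suc k)
      then show ?case using le[of "2 ^ k"] by (simp add: algebra_simps)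
    qed simp
    have "2 ^ k \<le> C * f 1 + (C * (4 * \<delta>)) * real k" for k :: nat
    proof -
      have "\<bar>real_of_int (\<phi> (P (int (2 ^ k))))\<bar> = 2 ^ k * \<bar>real_of_int (\<phi> a)\<bar>"
        unfolding \<phi>P by (simp add: abs_mult)
      moreover have "\<bar>real_of_int (\<phi> a)\<bar> \<ge> 1" using \<phi>a by linarith
      ultimately have "2 ^ k \<le> \<bar>real_of_int (\<phi> (P (int (2 ^ k))))\<bar>"
        using mult_left_mono[of 1 "\<bar>real_of_int (\<phi> a)\<bar>" "2 ^ k"] by simp
      also have "\<dots> \<le> C * f (2 ^ k)" unfolding f_def using C(2)[OF P] by blast
      also have "\<dots> \<le> C * (f 1 + 4 * \<delta> * real k)" using fk C(1) by (intro mult_left_mono)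
      finally show ?thesis by (simp add: algebra_simps)
    qed
    then show False by (rule exp_not_linearly_bounded)
  qed
  define B where "B k = b [^]\<^bsub>G\<^esub> (k::nat)" for k
  have B: "B k \<in> carrier G" for k using b by (simp add: B_def)
  have aB: "P i \<otimes>\<^bsub>G\<^esub> B k = B k \<otimes>\<^bsub>G\<^esub> P i" for i k
  proof -
    have bk: "b [^]\<^bsub>G\<^esub> k \<otimes>\<^bsub>G\<^esub> a = a \<otimes>\<^bsub>G\<^esub> b [^]\<^bsub>G\<^esub> k"
      using a b ab by (intro group_commutes_pow) auto
    have nat: "a [^]\<^bsub>G\<^esub> m \<otimes>\<^bsub>G\<^esub> B k = B k \<otimes>\<^bsub>G\<^esub> a [^]\<^bsub>G\<^esub> m" for m :: nat
      using a b bk by (intro group_commutes_pow) (auto simp: B_def)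
    have inv: "inv\<^bsub>G\<^esub> x \<otimes>\<^bsub>G\<^esub> y = y \<otimes>\<^bsub>G\<^esub> inv\<^bsub>G\<^esub> x"
      if "x \<in> carrier G" "y \<in> carrier G" "x \<otimes>\<^bsub>G\<^esub> y = y \<otimes>\<^bsub>G\<^esub> x" for x y
      using that by (metis inv_closed inv_solve_left inv_solve_right m_assoc m_closed)
    show ?thesis
      unfolding P_def int_pow_def2
      by (cases "i < 0") (simp_all only: if_True if_False nat inv[OF nat_pow_closed[OF a] B[of k] nat])
  qed
  have "\<exists>c. \<exists>i. c = P i \<otimes>\<^bsub>G\<^esub> B k \<and> (\<forall>j. len c \<le> len (P j \<otimes>\<^bsub>G\<^esub> B k))" for k
    using ex_has_least_nat[of "\<lambda>_. True" 0 "\<lambda>i. len (P i \<otimes>\<^bsub>G\<^esub> B k)"] by auto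
  then obtain c i where c: "\<And>k. c k = P (i k) \<otimes>\<^bsub>G\<^esub> B k" "\<And>k j. len (c k) \<le> len (P j \<otimes>\<^bsub>G\<^esub> B k)"
    by metis
  have cC: "c k \<in> carrier G" for k using c(1) P B by simp
  have min: "len (c k) \<le> len (P j \<otimes>\<^bsub>G\<^esub> c k)" for k j
    using c(2)[of k "j + i k"] by (simp add: c(1) m_assoc[symmetric] P B Padd)
  have comm: "P j \<otimes>\<^bsub>G\<^esub> c k = c k \<otimes>\<^bsub>G\<^esub> P j" for j k
    unfolding c(1) using P B aB by (metis Padd add.commute m_assoc)
  \<comment> \<open>Two quadrilaterals are used. The first, 1, a^n, a^n c, c, gives |a^n c| + |a^-n
    c| \<le> 2|c| + 2\<delta> as soon as |c| exceeds |a^n|. The second, c, a^-n, 1, a^n, bounds |c|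
    + |a^2n| by the larger of these two lengths plus |a^n| + 2\<delta>. Minimality of c makes both
    lengths at least |c|, so |a^2n| \<le> |a^n| + 4\<delta>, against the choice of
    \<open>n\<close>.\<close>
  have small: "real (len (c k)) \<le> f n" for k
  proof (rule ccontr)
    assume big: "\<not> real (len (c k)) \<le> f n"
    let ?c = "c k" and ?N = "int n"
    note cc = cC[of k]
    let ?p = "real (len (P ?N \<otimes>\<^bsub>G\<^esub> ?c))" and ?m = "real (len (P (- ?N) \<otimes>\<^bsub>G\<^esub> ?c))"
    have "?d \<one>\<^bsub>G\<^esub> (P ?N \<otimes>\<^bsub>G\<^esub> ?c) + ?d (P ?N) ?c
        \<le> max (?d \<one>\<^bsub>G\<^esub> (P ?N) + ?d (P ?N \<otimes>\<^bsub>G\<^esub> ?c) ?c) (?d (P ?N) (P ?N \<otimes>\<^bsub>G\<^esub> ?c) + ?d \<one>\<^bsub>G\<^esub> ?c) + 2 * \<delta>"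
      using P cc by (intro four) auto
    moreover have "?d \<one>\<^bsub>G\<^esub> (P ?N \<otimes>\<^bsub>G\<^esub> ?c) = ?p" "?d (P ?N) ?c = ?m" "?d \<one>\<^bsub>G\<^esub> (P ?N) = f n" "?d \<one>\<^bsub>G\<^esub> ?c = real (len ?c)"
      using P cc by (simp_all add: d Pinv f_def)
    moreover have "?d (P ?N) (P ?N \<otimes>\<^bsub>G\<^esub> ?c) = real (len ?c)"
      using P cc by (simp add: d m_assoc[symmetric])
    moreover have "?d (P ?N \<otimes>\<^bsub>G\<^esub> ?c) ?c = f n"
    proof -
      have "inv\<^bsub>G\<^esub> (P ?N \<otimes>\<^bsub>G\<^esub> ?c) \<otimes>\<^bsub>G\<^esub> ?c = inv\<^bsub>G\<^esub> (P ?N)"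
        unfolding comm using P cc by (simp add: inv_mult_group m_assoc)
      then show ?thesis by (simp add: d Pinv fneg)
    qed
    ultimately have 1: "?p + ?m \<le> 2 * real (len ?c) + 2 * \<delta>" using big by (simp add: max_def split: if_splits)
    have "?d ?c \<one>\<^bsub>G\<^esub> + ?d (P (- ?N)) (P ?N) \<le> max (?d ?c (P (- ?N)) + ?d \<one>\<^bsub>G\<^esub> (P ?N)) (?d (P (- ?N)) \<one>\<^bsub>G\<^esub> + ?d ?c (P ?N)) + 2 * \<delta>"
      using P cc by (intro four) auto
    moreover have "?d ?c \<one>\<^bsub>G\<^esub> = real (len ?c)" "?d (P (- ?N)) \<one>\<^bsub>G\<^esub> = f n" "?d \<one>\<^bsub>G\<^esub> (P ?N) = f n"
      using P cc by (simp_all add: d Pinv f_def word_length_inv)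
    moreover have "?d (P (- ?N)) (P ?N) = f (2 * n)" using P by (simp add: d Pinv Padd f_def)
    moreover have "?d ?c (P (- ?N)) = ?p"
      using dsym[OF cc P] by (simp add: d Pinv)
    moreover have "?d ?c (P ?N) = ?m"
      using dsym[OF cc P] by (simp add: d Pinv)
    ultimately have 2: "real (len ?c) + f (2 * n) \<le> max ?p ?m + f n + 2 * \<delta>"
      by (simp add: max_def split: if_splits)
    have 3: "real (len ?c) \<le> ?p" "real (len ?c) \<le> ?m" using min by auto
    show False using 1 2 3 n by (auto simp: max_def split: if_splits)
  qed
  have "finite (range c)"
  proof (rule finite_subset[OF _ finite_word_ball[of "nat \<lfloor>f n\<rfloor>"]])
    show "range c \<subseteq> {g \<in> carrier G. len g \<le> nat \<lfloor>f n\<rfloor>}"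
      using cC small by (auto simp: le_nat_floor)
  qed
  then have "\<not> inj c" using finite_imageD[of c UNIV] by auto
  then obtain k l where kl: "k < l" "c k = c l" unfolding inj_def by (metis linorder_neqE_nat)
  have \<phi>B: "\<phi> (B k) = 0" for k
    using \<phi>.hom_nat_pow[OF b, of k] \<phi>b by (simp add: B_def)
  have \<phi>c: "\<phi> (c k) = i k * \<phi> a" for k
    unfolding c(1) using P B by (simp add: \<phi>P \<phi>B)
  have ikl: "i k = i l" using \<phi>c[of k] \<phi>c[of l] kl \<phi>a by simp
  then have "B k = B l" using kl(2) unfolding c(1) using P B by simp
  moreover have "B l = B k \<otimes>\<^bsub>G\<^esub> B (l - k)" unfolding B_def using kl b by (simp add: nat_pow_mult)
  ultimately have "B (l - k) = \<one>\<^bsub>G\<^esub>" using B by (metis l_cancel_one')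
  then show ?thesis using kl by (auto simp: B_def intro!: exI[of _ "l - k"])
qed

section \<open>The configuration space of three points as an open and closed quotient\<close>

section \<open>Unordered configurations of three points\<close>

lemma lessThan_3: "{..<3::nat} = {0, 1, 2}"
  by auto

lemma permutation_orbit_comp:
  assumes "\<sigma> permutes {..<n}"
  shows "permutation_orbit n (f \<circ> \<sigma>) = permutation_orbit n f"
proof -
  have sub: "permutation_orbit n (g \<circ> \<tau>) \<subseteq> permutation_orbit n g" if "\<tau> permutes {..<n}" for g :: "nat \<Rightarrow> 'a" and \<tau>
    unfolding permutation_orbit_def using permutes_compose[OF _ that] by (auto simp: comp_assoc)
  have "(f \<circ> \<sigma>) \<circ> inv_into UNIV \<sigma> = f"
    using permutes_inv_o(1)[OF assms] by (simp add: comp_assoc)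
  then show ?thesis using sub[OF assms, of f] sub[OF permutes_inv[OF assms], of "f \<circ> \<sigma>"] by auto
qed

lemma permutation_orbit_eq_iff:
  "permutation_orbit n f = permutation_orbit n g \<longleftrightarrow> (\<exists>\<sigma>. \<sigma> permutes {..<n} \<and> g = f \<circ> \<sigma>)"
proof
  assume "permutation_orbit n f = permutation_orbit n g"
  moreover have "g \<in> permutation_orbit n g"
    unfolding permutation_orbit_def by (auto intro!: exI[of _ id] permutes_id)
  ultimately show "\<exists>\<sigma>. \<sigma> permutes {..<n} \<and> g = f \<circ> \<sigma>" by (auto simp: permutation_orbit_def)
qed (auto simp: permutation_orbit_comp)

lemma continuous_map_comp_permutation:
  assumes "\<sigma> permutes {..<n}"
  shows "continuous_map (configuration_space n X) (configuration_space n X) (\<lambda>x. x \<circ> \<sigma>)"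
proof -
  have m: "\<sigma> i \<in> {..<n} \<longleftrightarrow> i \<in> {..<n}" for i using permutes_in_image[OF assms] .
  have o: "\<sigma> i = i" if "i \<notin> {..<n}" for i using assms that by (rule permutes_not_in)
  have "continuous_map (configuration_space n X) (product_topology (\<lambda>_. X) {..<n}) (\<lambda>x. x \<circ> \<sigma>)"
  proof -
    have "(\<lambda>x. x \<circ> \<sigma>) \<in> topspace (configuration_space n X) \<rightarrow> extensional {..<n}"
      using o by (auto simp: configuration_space_def extensional_def PiE_iff)
    moreover have "continuous_map (configuration_space n X) X (\<lambda>x. (x \<circ> \<sigma>) k)" if "k \<in> {..<n}" for k
    proof -
      have "\<sigma> k \<in> {..<n}" using m that by blast
      then show ?thesis unfolding configuration_space_def comp_def
        by (intro continuous_map_from_subtopology continuous_map_product_projection)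
    qed
    ultimately show ?thesis unfolding continuous_map_componentwise by blast
  qed
  moreover have "inj_on (x \<circ> \<sigma>) {..<n}" if "inj_on x {..<n}" for x :: "nat \<Rightarrow> 'a"
    using that permutes_inj_on[OF assms] permutes_image[OF assms] by (simp add: comp_inj_on)
  ultimately show ?thesis
    by (auto simp: configuration_space_def continuous_map_in_subtopology)
qed

text \<open>Saturating a set of ordered configurations adds its translates under the permutations,
  of which there are finitely many. So the orbit map is open and closed; openness serves the charts,
  closedness the wall.\<close>

lemma orbit_preimage:
  assumes "S \<subseteq> topspace (configuration_space n X)"
  shows "{x \<in> topspace (configuration_space n X). permutation_orbit n x \<in> permutation_orbit n ` S}
    = (\<Union>\<sigma>\<in>{\<sigma>. \<sigma> permutes {..<n}}. {x \<in> topspace (configuration_space n X). x \<circ> \<sigma> \<in> S})"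
  by (auto simp: permutation_orbit_eq_iff permutation_orbit_comp[symmetric] image_iff)

lemma open_map_orbit:
  "open_map (configuration_space n X) (unordered_configuration_space n X) (permutation_orbit n)"
  unfolding open_map_def unordered_configuration_space_def openin_quotient_topology
proof (intro allI impI conjI)
  fix S assume S: "openin (configuration_space n X) S"
  then have sub: "S \<subseteq> topspace (configuration_space n X)" by (rule openin_subset)
  then show "permutation_orbit n ` S \<subseteq> permutation_orbit n ` topspace (configuration_space n X)" by blast
  show "openin (configuration_space n X)
      {x \<in> topspace (configuration_space n X). permutation_orbit n x \<in> permutation_orbit n ` S}"
    unfolding orbit_preimage[OF sub] 
    by (intro openin_Union) (auto intro!: openin_continuous_map_preimage[OF continuous_map_comp_permutation S])
qed

lemma closed_map_orbit:
  "closed_map (configuration_space n X) (unordered_configuration_space n X) (permutation_orbit n)"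
  unfolding closed_map_def
proof (intro allI impI)
  fix S assume S: "closedin (configuration_space n X) S"
  then have sub: "S \<subseteq> topspace (configuration_space n X)" by (rule closedin_subset)
  have q: "quotient_map (configuration_space n X) (unordered_configuration_space n X) (permutation_orbit n)"
    unfolding unordered_configuration_space_def by (rule quotient_map_quotient_topology)
  have "closedin (configuration_space n X)
      {x \<in> topspace (configuration_space n X). permutation_orbit n x \<in> permutation_orbit n ` S}"
    unfolding orbit_preimage[OF sub] 
    by (intro closedin_Union) (auto intro!: closedin_continuous_map_preimage[OF continuous_map_comp_permutation S] simp: finite_permutations)
  moreover have "permutation_orbit n ` S \<subseteq> topspace (unordered_configuration_space n X)"
    using sub by (auto simp: unordered_configuration_space_def)
  ultimately show "closedin (unordered_configuration_space n X) (permutation_orbit n ` S)"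
    using q unfolding quotient_map_closedin by blast
qed

text \<open>Restricted because points of the product topology are extensional functions on
  \<open>{..<3}\<close>.\<close>

definition triple :: "'a \<Rightarrow> 'a \<Rightarrow> 'a \<Rightarrow> nat \<Rightarrow> 'a" where
  "triple x y z = restrict (\<lambda>i. if i = 0 then x else if i = 1 then y else z) {..<3}"

definition cfg :: "'a \<Rightarrow> 'a \<Rightarrow> 'a \<Rightarrow> (nat \<Rightarrow> 'a) set" where
  "cfg x y z = permutation_orbit 3 (triple x y z)"

definition pts :: "(nat \<Rightarrow> 'a) set \<Rightarrow> 'a set" where
  "pts c = (\<Union>f\<in>c. f ` {..<3})"

text \<open>A copy of \<open>configuration_space 3 X\<close> made of nested pairs, in which
  projections, boxes and continuity are handled one coordinate at a time.\<close>

definition ordered_triples :: "'a topology \<Rightarrow> ('a \<times> 'a \<times> 'a) topology" where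
  "ordered_triples X = subtopology (prod_topology X (prod_topology X X)) {(x, y, z). x \<noteq> y \<and> x \<noteq> z \<and> y \<noteq> z}"

lemma topspace_ordered_triples:
  "topspace (ordered_triples X) =
     {(x, y, z). x \<in> topspace X \<and> y \<in> topspace X \<and> z \<in> topspace X \<and> x \<noteq> y \<and> x \<noteq> z \<and> y \<noteq> z}"
  by (auto simp: ordered_triples_def)

lemma triple_simps [simp]: "triple x y z 0 = x" "triple x y z (Suc 0) = y" "triple x y z 2 = z"
  by (simp_all add: triple_def)

lemma triple_eta: "f \<in> extensional {..<3} \<Longrightarrow> triple (f 0) (f 1) (f 2) = f"
  by (rule ext) (auto simp: triple_def extensional_def lessThan_3 less_Suc_eq numeral_3_eq_3 numeral_2_eq_2)

lemma inj_on_three: "inj_on f {0, Suc 0, 2::nat} \<longleftrightarrow> f 0 \<noteq> f 1 \<and> f 0 \<noteq> f 2 \<and> f 1 \<noteq> f 2"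
  by auto

lemma homeomorphic_map_triple:
  "homeomorphic_map (ordered_triples X) (configuration_space 3 X) (\<lambda>(x, y, z). triple x y z)"
proof -
  have top: "topspace (configuration_space 3 X)
      = {f \<in> extensional {..<3}. f 0 \<in> topspace X \<and> f 1 \<in> topspace X \<and> f 2 \<in> topspace X \<and>
           f 0 \<noteq> f 1 \<and> f 0 \<noteq> f 2 \<and> f 1 \<noteq> f 2}"
    by (rule Set.set_eqI) (simp add: configuration_space_def PiE_iff lessThan_3 inj_on_three, blast?)
  have 1: "continuous_map (ordered_triples X) (product_topology (\<lambda>_. X) {..<3}) (\<lambda>(x, y, z). triple x y z)"
  proof -
    have pr3: "continuous_map (ordered_triples X) X fst" "continuous_map (ordered_triples X) X (fst \<circ> snd)"
      "continuous_map (ordered_triples X) X (snd \<circ> snd)"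
      unfolding ordered_triples_def
      by (intro continuous_map_from_subtopology continuous_map_compose[OF continuous_map_snd]
          continuous_map_fst continuous_map_snd)+
    have "continuous_map (ordered_triples X) X (\<lambda>w. (case w of (x, y, z) \<Rightarrow> triple x y z) k)" if "k \<in> {..<3}" for k
    proof -
      have "(\<lambda>w. (case w of (x, y, z) \<Rightarrow> triple x y z) k) \<in> {fst, fst \<circ> snd, snd \<circ> snd}"
        using that unfolding lessThan_3 by (auto simp: fun_eq_iff)
      then show ?thesis using pr3 by (elim insertE emptyE) (erule ssubst, assumption)+
    qed
    moreover have "(\<lambda>(x, y, z). triple x y z) \<in> topspace (ordered_triples X) \<rightarrow> extensional {..<3}"
      by (auto simp: triple_def)
    ultimately show ?thesis unfolding continuous_map_componentwise by blast
  qed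
  have cont1: "continuous_map (ordered_triples X) (configuration_space 3 X) (\<lambda>(x, y, z). triple x y z)"
    using 1 unfolding configuration_space_def continuous_map_in_subtopology
    by (auto simp: topspace_ordered_triples inj_on_three lessThan_3)
  have prj: "continuous_map (configuration_space 3 X) X (\<lambda>f. f k)" if "k \<in> {..<3}" for k
    unfolding configuration_space_def
    by (intro continuous_map_from_subtopology continuous_map_product_projection that)
  have 2: "continuous_map (configuration_space 3 X) (ordered_triples X) (\<lambda>f. (f 0, f 1, f 2))"
    unfolding ordered_triples_def continuous_map_in_subtopology
    using prj by (auto intro!: continuous_map_pairedI simp: top)
  have "homeomorphic_maps (ordered_triples X) (configuration_space 3 X)
      (\<lambda>(x, y, z). triple x y z) (\<lambda>f. (f 0, f 1, f 2))"
    unfolding homeomorphic_maps_def using cont1 2 by (auto simp: top triple_eta[simplified])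
  then show ?thesis by (rule homeomorphic_maps_map[THEN iffD1, THEN conjunct1])
qed

abbreviation UC3 :: "'a topology \<Rightarrow> (nat \<Rightarrow> 'a) set topology" where
  "UC3 X \<equiv> unordered_configuration_space 3 X"

lemma cfg_comp: "(\<lambda>(x, y, z). cfg x y z) = permutation_orbit 3 \<circ> (\<lambda>(x, y, z). triple x y z)"
  by (auto simp: cfg_def)

lemma open_map_cfg: "open_map (ordered_triples X) (UC3 X) (\<lambda>(x, y, z). cfg x y z)"
  unfolding cfg_comp
  by (rule open_map_compose[OF homeomorphic_imp_open_map[OF homeomorphic_map_triple] open_map_orbit])

lemma closed_map_cfg: "closed_map (ordered_triples X) (UC3 X) (\<lambda>(x, y, z). cfg x y z)"
  unfolding cfg_comp
  by (rule closed_map_compose[OF homeomorphic_imp_closed_map[OF homeomorphic_map_triple] closed_map_orbit])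

lemma continuous_map_cfg3: "continuous_map (ordered_triples X) (UC3 X) (\<lambda>(x, y, z). cfg x y z)"
proof -
  have "quotient_map (configuration_space 3 X) (UC3 X) (permutation_orbit 3)"
    unfolding unordered_configuration_space_def by (rule quotient_map_quotient_topology)
  then show ?thesis unfolding cfg_comp
    by (rule continuous_map_compose[OF homeomorphic_imp_continuous_map[OF homeomorphic_map_triple]
          quotient_imp_continuous_map])
qed

lemma topspace_UC3: "topspace (UC3 X) = (\<lambda>(x, y, z). cfg x y z) ` topspace (ordered_triples X)"
  using homeomorphic_imp_surjective_map[OF homeomorphic_map_triple[of X]]
  unfolding cfg_comp image_comp[symmetric] unordered_configuration_space_def by simp

lemma UC3_cases:
  assumes "c \<in> topspace (UC3 X)"
  obtains x y z where "c = cfg x y z" "x \<in> topspace X" "y \<in> topspace X" "z \<in> topspace X"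
    "x \<noteq> y" "x \<noteq> z" "y \<noteq> z"
  using assms unfolding topspace_UC3 topspace_ordered_triples by auto

lemma continuous_map_cfg:
  assumes "continuous_map Z X p" "continuous_map Z X q" "continuous_map Z X r"
    "\<And>t. t \<in> topspace Z \<Longrightarrow> p t \<noteq> q t \<and> p t \<noteq> r t \<and> q t \<noteq> r t"
  shows "continuous_map Z (UC3 X) (\<lambda>t. cfg (p t) (q t) (r t))"
proof -
  have "continuous_map Z (ordered_triples X) (\<lambda>t. (p t, q t, r t))"
    unfolding ordered_triples_def continuous_map_in_subtopology
    using assms by (auto intro!: continuous_map_pairedI)
  from continuous_map_compose[OF this continuous_map_cfg3] show ?thesis by (simp add: comp_def)
qed

lemma pts_cfg: "pts (cfg x y z) = {x, y, z}"
proof -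
  have "pts (permutation_orbit 3 f) = f ` {..<3}" for f :: "nat \<Rightarrow> 'a"
  proof -
    have "(f \<circ> \<sigma>) ` {..<3} = f ` {..<3}" if "\<sigma> permutes {..<3}" for \<sigma> :: "nat \<Rightarrow> nat"
      using permutes_image[OF that] by (simp only: image_comp[symmetric])
    moreover have "f \<in> permutation_orbit 3 f"
      unfolding permutation_orbit_def by (auto intro!: exI[of _ id] permutes_id)
    ultimately show ?thesis unfolding pts_def permutation_orbit_def by blast
  qed
  then show ?thesis by (auto simp: cfg_def lessThan_3)
qed

lemma cfg_swap: "cfg x y z = cfg y x z" and cfg_swap': "cfg x y z = cfg x z y"
proof -
  have p: "Transposition.transpose 0 1 permutes {..<3::nat}" "Transposition.transpose 1 2 permutes {..<3::nat}"
    by (auto intro!: permutes_swap_id)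
  have "triple y x z = triple x y z \<circ> Transposition.transpose 0 1"
    "triple x z y = triple x y z \<circ> Transposition.transpose 1 2"
    by (auto simp: fun_eq_iff triple_def Transposition.transpose_def)
  then show "cfg x y z = cfg y x z" "cfg x y z = cfg x z y"
    unfolding cfg_def permutation_orbit_eq_iff using p by blast+
qed

lemma cfg_eqI:
  assumes "{x, y, z} = {x', y', z'}" "x \<noteq> y" "x \<noteq> z" "y \<noteq> z"
  shows "cfg x y z = cfg x' y' z'"
proof -
  have "card {x', y', z'} = 3" unfolding assms(1)[symmetric] using assms(2-4) by simp
  then have d: "x' \<noteq> y'" "x' \<noteq> z'" "y' \<noteq> z'" by (auto simp: card_insert_if split: if_splits)
  have "x' \<in> {x, y, z}" "y' \<in> {x, y, z}" "z' \<in> {x, y, z}" unfolding assms(1) by auto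
  moreover have "cfg x y z = cfg x z y" "cfg x y z = cfg y x z" by (rule cfg_swap', rule cfg_swap)
  moreover have "cfg x z y = cfg z x y" "cfg z x y = cfg z y x" "cfg y x z = cfg y z x"
    by (rule cfg_swap, rule cfg_swap', rule cfg_swap')
  ultimately show ?thesis using d by auto
qed

lemma cfg_eq_iff:
  "x \<noteq> y \<Longrightarrow> x \<noteq> z \<Longrightarrow> y \<noteq> z \<Longrightarrow> cfg x y z = cfg x' y' z' \<longleftrightarrow> {x, y, z} = {x', y', z'}"
  by (metis cfg_eqI pts_cfg)

lemma path_component_cfg:
  assumes "pathin X p" "pathin X q" "pathin X r"
    "\<And>t. t \<in> {0..1} \<Longrightarrow> p t \<noteq> q t \<and> p t \<noteq> r t \<and> q t \<noteq> r t"
    "\<And>t. t \<in> {0..1} \<Longrightarrow> cfg (p t) (q t) (r t) \<in> U"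
  shows "path_component_of (subtopology (UC3 X) U) (cfg (p 0) (q 0) (r 0)) (cfg (p 1) (q 1) (r 1))"
proof -
  have "pathin (UC3 X) (\<lambda>t. cfg (p t) (q t) (r t))"
    unfolding pathin_def using assms by (intro continuous_map_cfg) (auto simp: pathin_def[symmetric])
  then have "pathin (subtopology (UC3 X) U) (\<lambda>t. cfg (p t) (q t) (r t))"
    using assms(5) by (simp add: pathin_subtopology)
  then show ?thesis
    unfolding path_component_of_def by (intro exI[of _ "\<lambda>t. cfg (p t) (q t) (r t)"]) simp
qed

section \<open>Cell structures on finite graphs and their topology\<close>

section \<open>Finite graphs\<close>

lemma closedin_path_image:
  assumes "Hausdorff_space X" "pathin X p" "compact K" "K \<subseteq> {0..1}"
  shows "closedin X (p ` K)"
proof -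
  have "compactin (top_of_set {0..1}) K" using assms by (simp add: compactin_subtopology)
  then have "compactin X (p ` K)" using assms(2) unfolding pathin_def by (rule image_compactin)
  with assms(1) show ?thesis by (rule compactin_imp_closedin)
qed

lemma compact_path_preimage:
  assumes "pathin X p" "closedin X F"
  shows "compact {t \<in> {0..1}. p t \<in> F}"
proof -
  have "closedin (top_of_set {0..1}) {t \<in> {0..1}. p t \<in> F}"
    using closedin_continuous_map_preimage[OF assms(1)[unfolded pathin_def] assms(2)] by simp
  then show ?thesis by (rule closedin_compact[OF compact_Icc])
qed

text \<open>A path in a Hausdorff space is a closed map because its domain is compact. The last
  hypothesis makes \<open>J\<close> saturated, and a closed map stays closed when restricted to a
  saturated set.\<close>

lemma homeomorphic_map_path_restrict:
  assumes "Hausdorff_space X" "pathin X p" "J \<subseteq> {0..1}" "inj_on p J" "p ` J \<inter> p ` ({0..1} - J) = {}"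
  shows "homeomorphic_map (top_of_set J) (subtopology X (p ` J)) p"
proof -
  have "closed_map (top_of_set {0..1}) X p"
    using assms(1,2) unfolding pathin_def
    by (intro continuous_imp_closed_map) (auto simp: compact_space_subtopology)
  moreover have "{t \<in> topspace (top_of_set {0..1}). p t \<in> p ` J} = J"
  proof -
    have "t \<in> J" if "t \<in> {0..1}" "p t \<in> p ` J" for t
    proof (rule ccontr)
      assume "t \<notin> J"
      then have "p t \<in> p ` J \<inter> p ` ({0..1} - J)" using that by blast
      then show False using assms(5) by simp
    qed
    then show ?thesis using assms(3) by auto
  qed
  ultimately have "closed_map (subtopology (top_of_set {0..1}) J) (subtopology X (p ` J)) p"
    by (rule closed_map_restriction)
  moreover have J: "subtopology (top_of_set {0..1}) J = top_of_set J"
    using assms(3) by (simp add: subtopology_subtopology Int_absorb1)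
  moreover have "continuous_map (top_of_set J) (subtopology X (p ` J)) p"
    using continuous_map_from_subtopology[OF assms(2)[unfolded pathin_def], of J] unfolding J
    by (auto simp: continuous_map_in_subtopology)
  moreover have "p ` J \<subseteq> topspace X" using assms(2,3) pathin_topspace by blast
  ultimately show ?thesis using assms(4)
    by (intro bijective_closed_imp_homeomorphic_map) auto
qed

lemma path_rev_interior: "path_rev f ` {0<..<1} = f ` {0<..<1}"
proof -
  have "path_rev f ` {0<..<1} \<subseteq> f ` {0<..<1}" for f :: "real \<Rightarrow> 'a"
    unfolding path_rev_def by force
  from this[of f] this[of "path_rev f"] show ?thesis by auto
qed

lemma closed_interval_image: "e ` {0..1} = insert (e 0) (insert (e 1) (e ` {0<..<1::real}))"
proof -
  have "{0..1::real} = insert 0 (insert 1 {0<..<1})" by auto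
  then show ?thesis by simp
qed

locale graph_structure =
  fixes \<Gamma> :: "'a topology" and V :: "'a set" and E :: "(real \<Rightarrow> 'a) set"
  assumes Hausdorff: "Hausdorff_space \<Gamma>" and finite_V: "finite V" and V_sub: "V \<subseteq> topspace \<Gamma>"
    and finite_E: "finite E"
    and edge: "e \<in> E \<Longrightarrow> pathin \<Gamma> e \<and> e 0 \<in> V \<and> e 1 \<in> V \<and> inj_on e {0<..<1} \<and> disjnt (e ` {0<..<1}) V"
    and edges_disjoint: "pairwise (\<lambda>e e'. disjnt (e ` {0<..<1}) (e' ` {0<..<1})) E"
    and topspace_eq: "topspace \<Gamma> = V \<union> (\<Union>e\<in>E. e ` {0<..<1})"
begin

text \<open>Oriented edges. One that starts at \<open>v\<close> stands for one end of an edge at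
  \<open>v\<close>, so valence is counted correctly in the presence of loops: a loop contributes
  two.\<close>

definition OE :: "(real \<Rightarrow> 'a) set" where "OE = E \<union> path_rev ` E"

lemma OE_props:
  assumes "f \<in> OE"
  shows "pathin \<Gamma> f" "f 0 \<in> V" "f 1 \<in> V" "inj_on f {0<..<1}" "f ` {0<..<1} \<inter> V = {}"
proof -
  have "pathin \<Gamma> f \<and> f 0 \<in> V \<and> f 1 \<in> V \<and> inj_on f {0<..<1} \<and> f ` {0<..<1} \<inter> V = {}"
  proof (cases "f \<in> E")
    case True
    then show ?thesis using edge[of f] by (auto simp: disjnt_def)
  next
    case False
    then obtain e where e: "e \<in> E" "f = path_rev e" using assms by (auto simp: OE_def)
    have "inj_on (path_rev e) {0<..<1}"
    proof (rule inj_onI)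
      fix x y :: real assume "x \<in> {0<..<1}" "y \<in> {0<..<1}" "path_rev e x = path_rev e y"
      then have "1 - x = 1 - y"
        using inj_onD[of e "{0<..<1}" "1 - x" "1 - y"] edge[OF e(1)] by (simp add: path_rev_def)
      then show "x = y" by simp
    qed
    then show ?thesis using edge[OF e(1)] e(2) path_rev_interior[of e] by (auto simp: disjnt_def)
  qed
  then show "pathin \<Gamma> f" "f 0 \<in> V" "f 1 \<in> V" "inj_on f {0<..<1}" "f ` {0<..<1} \<inter> V = {}" by auto
qed

lemma OE_rev: "f \<in> OE \<Longrightarrow> path_rev f \<in> OE"
  by (auto simp: OE_def)

lemma E_OE: "e \<in> E \<Longrightarrow> e \<in> OE"
  by (simp add: OE_def)

lemma OE_E: "f \<in> OE \<Longrightarrow> \<exists>e\<in>E. e ` {0<..<1} = f ` {0<..<1}"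
  unfolding OE_def by (force simp: path_rev_interior)

lemma OE_V_iff:
  assumes "f \<in> OE" "t \<in> {0..1}"
  shows "f t \<in> V \<longleftrightarrow> t = 0 \<or> t = 1"
proof -
  have "f t \<notin> V" if "t \<noteq> 0" "t \<noteq> 1"
  proof -
    have "t \<in> {0<..<1}" using assms(2) that by auto
    then show ?thesis using OE_props(5)[OF assms(1)] by blast
  qed
  then show ?thesis using OE_props(2,3)[OF assms(1)] by auto
qed

lemma OE_disjoint:
  assumes "f \<in> OE" "g \<in> OE" "f \<noteq> g" "g \<noteq> path_rev f"
  shows "f ` {0<..<1} \<inter> g ` {0<..<1} = {}"
proof -
  obtain e where e: "e \<in> E" "f = e \<or> f = path_rev e" using assms(1) by (auto simp: OE_def)
  obtain e' where e': "e' \<in> E" "g = e' \<or> g = path_rev e'" using assms(2) by (auto simp: OE_def)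
  have "e \<noteq> e'" using assms(3,4) e e' by auto
  then have "e ` {0<..<1} \<inter> e' ` {0<..<1} = {}"
    using edges_disjoint e e' by (auto simp: pairwise_def disjnt_def)
  then show ?thesis using e e' path_rev_interior by metis
qed

text \<open>The case to keep in mind is a loop: its two ends at the vertex are different oriented
  edges on the same set of points, and only the parameters tell them apart.\<close>

lemma OE_meet:
  assumes "f \<in> OE" "g \<in> OE" "f \<noteq> g" "s \<in> {0<..<1}" "t \<in> {0<..<1}" "f s = g t"
  shows "g = path_rev f \<and> s + t = 1"
proof -
  have "f s \<in> f ` {0<..<1} \<inter> g ` {0<..<1}" using assms(4-6) by (metis IntI imageI)
  then have g: "g = path_rev f" using OE_disjoint[OF assms(1-3)] by auto
  then have "f s = f (1 - t)" using assms(6) by (simp add: path_rev_def)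
  then have "s = 1 - t" using OE_props(4)[OF assms(1)] assms(4,5) unfolding inj_on_def by auto
  then show ?thesis using g by simp
qed

lemma closedin_edge: "e \<in> E \<Longrightarrow> closedin \<Gamma> (e ` {0..1})"
  using closedin_path_image[OF Hausdorff] edge by auto

text \<open>The complement consists of the vertices and finitely many closed edges, hence is
  closed.\<close>

lemma openin_edge:
  assumes "f \<in> OE"
  shows "openin \<Gamma> (f ` {0<..<1})"
proof -
  obtain e where e: "e \<in> E" "e ` {0<..<1} = f ` {0<..<1}" using OE_E[OF assms] by blast
  have "closedin \<Gamma> (\<Union>e'\<in>E - {e}. e' ` {0..1})"
    using finite_E closedin_edge by (intro closedin_Union) auto
  then have cl: "closedin \<Gamma> (V \<union> (\<Union>e'\<in>E - {e}. e' ` {0..1}))"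
    by (intro closedin_Un closedin_Hausdorff_finite[OF Hausdorff V_sub finite_V])
  have dis: "e ` {0<..<1} \<inter> e' ` {0..1} = {}" if "e' \<in> E - {e}" for e'
  proof -
    have "e ` {0<..<1} \<inter> e' ` {0<..<1} = {}"
      using edges_disjoint e(1) that unfolding pairwise_def disjnt_def by blast
    then show ?thesis using edge[of e'] edge[of e] e that
      unfolding closed_interval_image by (auto simp: disjnt_def)
  qed
  have "topspace \<Gamma> - (V \<union> (\<Union>e'\<in>E - {e}. e' ` {0..1})) = e ` {0<..<1}"
  proof
    show "topspace \<Gamma> - (V \<union> (\<Union>e'\<in>E - {e}. e' ` {0..1})) \<subseteq> e ` {0<..<1}"
    proof
      fix x assume x: "x \<in> topspace \<Gamma> - (V \<union> (\<Union>e'\<in>E - {e}. e' ` {0..1}))"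
      then obtain e' where e': "e' \<in> E" "x \<in> e' ` {0<..<1}" unfolding topspace_eq by blast
      have "e' ` {0<..<1} \<subseteq> e' ` {0..1}" by (rule image_mono) auto
      then show "x \<in> e ` {0<..<1}" using x e' by blast
    qed
    show "e ` {0<..<1} \<subseteq> topspace \<Gamma> - (V \<union> (\<Union>e'\<in>E - {e}. e' ` {0..1}))"
      using dis edge[of e] e unfolding topspace_eq disjnt_def by blast
  qed
  then show ?thesis using cl e by (metis openin_diff openin_topspace)
qed

lemma OE_homeomorphic:
  assumes "f \<in> OE"
  shows "homeomorphic_map (top_of_set {0<..<1}) (subtopology \<Gamma> (f ` {0<..<1})) f"
proof (rule homeomorphic_map_path_restrict[OF Hausdorff])
  have "{0..1} - {0<..<1} = {0, 1::real}" by auto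
  then show "f ` {0<..<1} \<inter> f ` ({0..1} - {0<..<1}) = {}"
    using OE_props[OF assms] by auto
qed (use OE_props[OF assms] in auto)

text \<open>A finite graph carries the weak topology: the preimage of a closed set is a finite union
  of compact pieces, one in each closed edge, together with finitely many vertices.\<close>

lemma continuous_map_from_graph:
  assumes "\<And>x. x \<in> topspace \<Gamma> \<Longrightarrow> f x \<in> topspace Y"
    and "\<And>e. e \<in> E \<Longrightarrow> continuous_map (top_of_set {0..1}) Y (\<lambda>t. f (e t))"
  shows "continuous_map \<Gamma> Y f"
  unfolding continuous_map_closedin
proof (intro conjI ballI allI impI)
  show "f \<in> topspace \<Gamma> \<rightarrow> topspace Y" using assms(1) by auto
  fix C assume C: "closedin Y C"
  have eq: "{x \<in> topspace \<Gamma>. f x \<in> C} = {x \<in> V. f x \<in> C} \<union> (\<Union>e\<in>E. e ` {t \<in> {0..1}. f (e t) \<in> C})"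
  proof -
    have "e t \<in> topspace \<Gamma>" if "e \<in> E" "t \<in> {0..1}" for e t
      using edge[OF that(1)] that(2) pathin_topspace by metis
    then have "{x \<in> V. f x \<in> C} \<union> (\<Union>e\<in>E. e ` {t \<in> {0..1}. f (e t) \<in> C}) \<subseteq> {x \<in> topspace \<Gamma>. f x \<in> C}"
      using V_sub by blast
    moreover have "x \<in> {x \<in> V. f x \<in> C} \<union> (\<Union>e\<in>E. e ` {t \<in> {0..1}. f (e t) \<in> C})"
      if x: "x \<in> topspace \<Gamma>" "f x \<in> C" for x
    proof (cases "x \<in> V")
      case False
      then obtain e t where e: "e \<in> E" "t \<in> {0<..<1}" "x = e t" using x(1) unfolding topspace_eq by blast
      then have "t \<in> {0..1}" by simp
      then show ?thesis using e x by blast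
    qed (use x in auto)
    ultimately show ?thesis by blast
  qed
  have "closedin \<Gamma> (e ` {t \<in> {0..1}. f (e t) \<in> C})" if "e \<in> E" for e
    using edge[OF that] closedin_compact[OF compact_Icc, of 0 1 "{t \<in> {0..1}. f (e t) \<in> C}"]
      closedin_continuous_map_preimage[OF assms(2)[OF that] C]
    by (intro closedin_path_image[OF Hausdorff]) auto
  then have "closedin \<Gamma> (\<Union>e\<in>E. e ` {t \<in> {0..1}. f (e t) \<in> C})"
    using finite_E by (intro closedin_Union) auto
  moreover have "closedin \<Gamma> {x \<in> V. f x \<in> C}"
    using finite_V V_sub by (intro closedin_Hausdorff_finite[OF Hausdorff]) auto
  ultimately show "closedin \<Gamma> {x \<in> topspace \<Gamma>. f x \<in> C}"
    unfolding eq by (intro closedin_Un)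
qed

text \<open>Vertices and closed edges form a finite closed cover by path connected pieces. The
  pieces inside one path component and the remaining ones have closed unions that partition the
  space, so connectedness leaves a single class.\<close>

lemma path_connected:
  assumes "connected_space \<Gamma>"
  shows "path_connected_space \<Gamma>"
proof -
  define SS where "SS = (\<lambda>v. {v}) ` V \<union> (\<lambda>e. e ` {0..1}) ` E"
  have fin: "finite SS" using finite_V finite_E by (simp add: SS_def)
  have cl: "closedin \<Gamma> S" if "S \<in> SS" for S
    using that closedin_edge closedin_Hausdorff_finite[OF Hausdorff] V_sub by (auto simp: SS_def)
  have un: "\<Union>SS = topspace \<Gamma>"
  proof -
    have a: "\<Union>SS = V \<union> (\<Union>e\<in>E. e ` {0..1})" by (auto simp: SS_def)
    have b: "(\<Union>e\<in>E. e ` {0<..<1}) \<subseteq> (\<Union>e\<in>E. e ` {0..1})"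
      by (intro UN_mono image_mono) auto
    have c: "(\<Union>e\<in>E. e ` {0..1}) \<subseteq> topspace \<Gamma>"
    proof (rule UN_least)
      fix e assume "e \<in> E"
      then show "e ` {0..1} \<subseteq> topspace \<Gamma>" using edge[of e] pathin_topspace[of \<Gamma> e] by blast
    qed
    show ?thesis
      unfolding a by (rule subset_antisym, rule Un_least[OF V_sub c], subst topspace_eq, rule Un_mono[OF subset_refl b])
  qed
  have pc: "path_component_of \<Gamma> x y" if S: "S \<in> SS" "x \<in> S" "y \<in> S" for S x y
  proof -
    consider v where "v \<in> V" "S = {v}" | e where "e \<in> E" "S = e ` {0..1}" using S(1) by (auto simp: SS_def)
    then show ?thesis
    proof cases
      case 1
      then show ?thesis using S V_sub by (auto simp: path_component_of_refl)
    next
      case 2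
      then obtain s t where st: "s \<in> {0..1}" "t \<in> {0..1}" "x = e s" "y = e t" using S by blast
      have "pathin \<Gamma> (e \<circ> linepath s t)"
        using pathin_linepath[of "{0..1}" \<Gamma> e s t UNIV] edge[OF 2(1)] st by (auto simp: pathin_def)
      then show ?thesis unfolding path_component_of_def st(3,4)
        by (intro exI[of _ "e \<circ> linepath s t"]) (simp add: linepath_0' linepath_1')
    qed
  qed
  have "path_component_of \<Gamma> x y" if x: "x \<in> topspace \<Gamma>" and y: "y \<in> topspace \<Gamma>" for x y
  proof -
    define P where "P = {y. path_component_of \<Gamma> x y}"
    define A where "A = \<Union>{S \<in> SS. S \<subseteq> P}"
    define B where "B = \<Union>{S \<in> SS. \<not> S \<subseteq> P}"
    have P: "S \<subseteq> P \<or> S \<inter> P = {}" if "S \<in> SS" for S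
    proof (cases "S \<inter> P = {}")
      case False
      then obtain y where y: "y \<in> S" "path_component_of \<Gamma> x y" by (auto simp: P_def)
      then show ?thesis
        unfolding P_def using pc[OF that y(1)] path_component_of_trans[OF y(2)] by blast
    qed simp
    have cA: "closedin \<Gamma> A" and cB: "closedin \<Gamma> B"
      unfolding A_def B_def by (rule closedin_Union; use fin cl in auto)+
    have AB: "A \<union> B = topspace \<Gamma>" "A \<inter> B = {}" unfolding A_def B_def un[symmetric] using P by blast+
    then have "A = topspace \<Gamma> - B" by blast
    then have oA: "openin \<Gamma> A" using cB by auto
    have "x \<in> \<Union>SS" using x un by simp
    then obtain S where S: "S \<in> SS" "x \<in> S" by (rule UnionE)
    have "x \<in> P" using x by (simp add: P_def path_component_of_refl)
    then have "S \<subseteq> P" using P[OF S(1)] S(2) by blast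
    then have "x \<in> A" unfolding A_def using S by (intro UnionI[of S]) auto
    moreover have "A = {} \<or> A = topspace \<Gamma>"
      using assms oA cA unfolding connected_space_clopen_in by simp
    ultimately have "A = topspace \<Gamma>" by blast
    then have "y \<in> A" using y by simp
    then show ?thesis unfolding A_def P_def by blast
  qed
  then show ?thesis unfolding path_connected_space_iff_path_component by blast
qed

end

section \<open>Path connectedness of the space of three unordered points on a graph\<close>

lemma three_set_relabel:
  assumes "x \<noteq> y" "x \<noteq> z" "y \<noteq> z" "x' \<in> {x, y, z}"
  obtains y' z' where "{x', y', z'} = {x, y, z}" "x' \<noteq> y'" "x' \<noteq> z'" "y' \<noteq> z'"
proof -
  consider "x' = x" | "x' = y" | "x' = z" using assms(4) by auto
  then show ?thesis
  proof cases
    case 1 then show ?thesis using that[of y z] assms by auto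
  next
    case 2 then show ?thesis using that[of x z] assms by auto
  next
    case 3 then show ?thesis using that[of x y] assms by auto
  qed
qed

context graph_structure
begin

text \<open>A path from an outside particle to the middle of \<open>e0\<close> may run into other
  particles. The last outside particle on it is therefore the one that travels: its way to the edge
  is free, and a small step past the end vertex brings it inside. The drop in the number of outside
  particles drives an induction.\<close>

lemma cfg_move_into_edge:
  assumes conn: "connected_space \<Gamma>" and e0: "e0 \<in> E"
    and xyz: "x \<in> topspace \<Gamma>" "y \<in> topspace \<Gamma>" "z \<in> topspace \<Gamma>" "x \<noteq> y" "x \<noteq> z" "y \<noteq> z"
    and out: "\<not> {x, y, z} \<subseteq> e0 ` {0<..<1}"
  obtains x' y' z' where "x' \<in> topspace \<Gamma>" "y' \<in> topspace \<Gamma>" "z' \<in> topspace \<Gamma>" "x' \<noteq> y'" "x' \<noteq> z'" "y' \<noteq> z'"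
    "path_component_of (UC3 \<Gamma>) (cfg x y z) (cfg x' y' z')"
    "card ({x', y', z'} - e0 ` {0<..<1}) < card ({x, y, z} - e0 ` {0<..<1})"
proof -
  define O' where "O' = e0 ` {0<..<1}"
  define S where "S = {x, y, z}"
  have S: "S \<subseteq> topspace \<Gamma>" "finite S" using xyz by (auto simp: S_def)
  note e0p = OE_props[OF E_OE[OF e0]]
  obtain w where w: "w \<in> S - O'" using out by (auto simp: S_def O'_def)
  have half: "(1/2::real) \<in> {0<..<1}" by simp
  then have mid: "e0 (1/2) \<in> O'" unfolding O'_def by (rule imageI)
  have midt: "e0 (1/2) \<in> topspace \<Gamma>" using mid e0 unfolding O'_def topspace_eq by blast
  have "path_connected_space \<Gamma>" by (rule path_connected[OF conn])
  moreover have "w \<in> topspace \<Gamma>" using w S by blast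
  ultimately obtain \<gamma> where \<gamma>: "pathin \<Gamma> \<gamma>" "\<gamma> 0 = w" "\<gamma> 1 = e0 (1/2)"
    using midt unfolding path_connected_space_def by blast
  \<comment> \<open>Times at which the path sits at a particle outside the open edge; the largest
    one picks the particle that moves.\<close>
  define R where "R = {t \<in> {0..1}. \<gamma> t \<in> S - O'}"
  have "closedin \<Gamma> (S - O')" using S by (intro closedin_Hausdorff_finite[OF Hausdorff]) auto
  then have "compact R" unfolding R_def by (rule compact_path_preimage[OF \<gamma>(1)])
  moreover have "0 \<in> R" using w \<gamma> by (simp add: R_def)
  ultimately obtain t1 where t1: "t1 \<in> R" "\<And>t. t \<in> R \<Longrightarrow> t \<le> t1"
    using compact_attains_sup[of R] by auto
  define x1 where "x1 = \<gamma> t1"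
  have x1: "x1 \<in> S" "x1 \<notin> O'" "0 \<le> t1" "t1 \<le> 1" using t1(1) by (auto simp: R_def x1_def)
  obtain y1 z1 where yz: "{x1, y1, z1} = S" "x1 \<noteq> y1" "x1 \<noteq> z1" "y1 \<noteq> z1"
    using three_set_relabel[OF xyz(4-6), of x1] x1(1) unfolding S_def by blast
  have top1: "x1 \<in> topspace \<Gamma>" "y1 \<in> topspace \<Gamma>" "z1 \<in> topspace \<Gamma>" using S(1) unfolding yz(1)[symmetric] by auto
  have sub: "O' \<subseteq> e0 ` {0..1}" unfolding O'_def by (rule image_mono) auto
  \<comment> \<open>Times from \<open>t1\<close> on at which the path lies in the closed edge. At
    the first of them it is at an end of the edge: the interior is open, so it would have been
    entered earlier.\<close>
  define R2 where "R2 = {t \<in> {0..1}. \<gamma> t \<in> e0 ` {0..1}} \<inter> {t1..1}"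
  have "compact R2"
    unfolding R2_def using compact_path_preimage[OF \<gamma>(1) closedin_edge[OF e0]] by (intro compact_Int) auto
  moreover have "1 \<in> R2" using \<gamma> mid sub x1 by (auto simp: R2_def)
  ultimately obtain t2 where t2: "t2 \<in> R2" "\<And>t. t \<in> R2 \<Longrightarrow> t2 \<le> t"
    using compact_attains_inf[of R2] by auto
  have t12: "t1 \<le> t2" "t2 \<le> 1" using t2(1) by (auto simp: R2_def)
  define u where "u = \<gamma> t2"
  have uO: "u \<notin> O'"
  proof
    assume uO: "u \<in> O'"
    then have "t1 \<noteq> t2" using x1(2) by (auto simp: u_def x1_def)
    then have lt: "t1 < t2" using t12 by simp
    have "openin (top_of_set {0..1}) {t \<in> {0..1}. \<gamma> t \<in> O'}"
      using openin_continuous_map_preimage[OF \<gamma>(1)[unfolded pathin_def] openin_edge[OF E_OE[OF e0]]]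
      by (simp add: O'_def)
    moreover have "t2 \<in> {t \<in> {0..1}. \<gamma> t \<in> O'}" using uO t12 x1 by (simp add: u_def)
    ultimately obtain \<epsilon> where \<epsilon>: "\<epsilon> > 0" "ball t2 \<epsilon> \<inter> {0..1} \<subseteq> {t \<in> {0..1}. \<gamma> t \<in> O'}"
      unfolding openin_contains_ball by blast
    define t where "t = max t1 (t2 - \<epsilon> / 2)"
    have t: "t1 \<le> t" "t < t2" "0 \<le> t" "t \<le> 1" "t2 - \<epsilon> / 2 \<le> t" using lt \<epsilon>(1) t12 x1 by (auto simp: t_def)
    have "dist t2 t < \<epsilon>" using t(2,5) \<epsilon>(1) by (simp add: dist_real_def)
    then have "\<gamma> t \<in> O'" using \<epsilon>(2) t by auto
    then have "t \<in> R2" using sub t by (auto simp: R2_def)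
    then show False using t2(2)[of t] t(2) by simp
  qed
  have avoid: "\<gamma> \<tau> \<noteq> y1 \<and> \<gamma> \<tau> \<noteq> z1" if \<tau>: "t1 \<le> \<tau>" "\<tau> \<le> t2" for \<tau>
  proof -
    have "\<gamma> \<tau> \<notin> S - {x1}"
    proof
      assume a: "\<gamma> \<tau> \<in> S - {x1}"
      show False
      proof (cases "\<gamma> \<tau> \<in> O'")
        case True
        then have "\<tau> \<in> R2" using sub \<tau> t12 x1 by (auto simp: R2_def)
        then have "\<tau> = t2" using t2(2)[of \<tau>] \<tau> by simp
        then show False using True uO by (simp add: u_def)
      next
        case False
        then have "\<tau> \<in> R" using a \<tau> t12 x1 by (auto simp: R_def)
        then have "\<tau> = t1" using t1(2)[of \<tau>] \<tau> by simp
        then show False using a by (simp add: x1_def)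
      qed
    qed
    then show ?thesis using yz by auto
  qed
  have "u \<in> e0 ` {0..1}" using t2(1) by (simp add: R2_def u_def)
  then have "u = e0 0 \<or> u = e0 1" using uO unfolding closed_interval_image O'_def by blast
  then obtain f where f: "f \<in> OE" "f 0 = u" "f ` {0<..<1} = O'"
  proof
    assume "u = e0 0" then show ?thesis using that[of e0] E_OE[OF e0] by (simp add: O'_def)
  next
    assume "u = e0 1"
    then show ?thesis using that[of "path_rev e0"] OE_rev[OF E_OE[OF e0]] path_rev_interior[of e0] by (simp add: O'_def)
  qed
  note fp = OE_props[OF f(1)]
  define P where "P = {s \<in> {0<..<1}. f s \<in> S}"
  have "finite (f ` P)" using S(2) by (rule finite_subset[rotated]) (auto simp: P_def)
  moreover have "inj_on f P" using fp(4) by (rule inj_on_subset) (auto simp: P_def)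
  ultimately have "finite P" by (rule finite_imageD)
  \<comment> \<open>Half the parameter of the first particle already on the edge, or 1/2 if there is
    none, so that the newcomer stops in front of it.\<close>
  define \<epsilon> where "\<epsilon> = Min (insert 1 P) / 2"
  have Min: "Min (insert 1 P) > 0" "Min (insert 1 P) \<le> 1" "\<And>s. s \<in> P \<Longrightarrow> Min (insert 1 P) \<le> s"
    using \<open>finite P\<close> by (auto simp: P_def)
  have \<epsilon>: "0 < \<epsilon>" "\<epsilon> < 1" using Min(1,2) by (auto simp: \<epsilon>_def)
  have \<epsilon>P: "\<epsilon> < s" if "s \<in> P" for s using Min(3)[OF that] Min(1) by (simp add: \<epsilon>_def)
  have 1: "path_component_of (UC3 \<Gamma>) (cfg x1 y1 z1) (cfg u y1 z1)"
  proof -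
    have "path_component_of (subtopology (UC3 \<Gamma>) UNIV)
       (cfg (\<gamma> (t1 + 0 * (t2 - t1))) y1 z1) (cfg (\<gamma> (t1 + 1 * (t2 - t1))) y1 z1)"
    proof (rule path_component_cfg)
      have b: "t1 \<le> t1 + t * (t2 - t1)" "t1 + t * (t2 - t1) \<le> t2" if "t \<in> {0..1}" for t
        using that t12(1) mult_right_mono[of t 1 "t2 - t1"] by auto
      show "pathin \<Gamma> (\<lambda>t. \<gamma> (t1 + t * (t2 - t1)))"
      proof (rule pathin_compose_real[OF \<gamma>(1)])
        show "t1 + t * (t2 - t1) \<in> {0..1}" if "t \<in> {0..1}" for t
          using b[OF that] t12 x1(3) by auto
      qed (intro continuous_intros)
      show "\<gamma> (t1 + t * (t2 - t1)) \<noteq> y1 \<and> \<gamma> (t1 + t * (t2 - t1)) \<noteq> z1 \<and> y1 \<noteq> z1" if "t \<in> {0..1}" for t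
        using avoid[OF b[OF that]] yz(4) by auto
    qed (use top1 in auto)
    then show ?thesis by (simp add: x1_def u_def)
  qed
  have 2: "path_component_of (UC3 \<Gamma>) (cfg u y1 z1) (cfg (f \<epsilon>) y1 z1)"
  proof -
    have "path_component_of (subtopology (UC3 \<Gamma>) UNIV) (cfg (f (\<epsilon> * 0)) y1 z1) (cfg (f (\<epsilon> * 1)) y1 z1)"
    proof (rule path_component_cfg)
      have b: "0 \<le> \<epsilon> * t" "\<epsilon> * t \<le> \<epsilon>" if "t \<in> {0..1}" for t using that \<epsilon> mult_left_mono[of t 1 \<epsilon>] by auto
      show "pathin \<Gamma> (\<lambda>t. f (\<epsilon> * t))"
      proof (rule pathin_compose_real[OF fp(1)])
        show "\<epsilon> * t \<in> {0..1}" if "t \<in> {0..1}" for t 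
          using b(1)[OF that] order_trans[OF b(2)[OF that] less_imp_le[OF \<epsilon>(2)]]
          by (simp only: atLeastAtMost_iff)
      qed (intro continuous_intros)
      show "f (\<epsilon> * t) \<noteq> y1 \<and> f (\<epsilon> * t) \<noteq> z1 \<and> y1 \<noteq> z1" if t: "t \<in> {0..1}" for t
      proof (cases "t = 0")
        case True
        then show ?thesis using avoid[of t2] t12 yz(4) f(2) by (auto simp: u_def)
      next
        case False
        then have "\<epsilon> * t > 0" using \<epsilon>(1) t by simp
        then have "\<epsilon> * t \<in> {0<..<1}" using le_less_trans[OF b(2)[OF t] \<epsilon>(2)] by (simp only: greaterThanLessThan_iff)
        then have "f (\<epsilon> * t) \<notin> S" using \<epsilon>P[of "\<epsilon> * t"] b(2)[OF t] unfolding P_def by (metis (no_types, lifting) leD mem_Collect_eq)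
        then show ?thesis using yz by auto
      qed
    qed (use top1 in auto)
    then show ?thesis using f(2) by simp
  qed
  have \<epsilon>O: "f \<epsilon> \<in> O'" unfolding f(3)[symmetric] using \<epsilon> by auto
  have "f \<epsilon> \<notin> S" using \<epsilon>P[of \<epsilon>] \<epsilon> by (auto simp: P_def)
  then have d: "f \<epsilon> \<noteq> y1" "f \<epsilon> \<noteq> z1" using yz by auto
  have "{x, y, z} = {x1, y1, z1}" using yz(1) by (simp only: S_def)
  then have c: "cfg x y z = cfg x1 y1 z1" by (rule cfg_eqI[OF _ xyz(4-6)])
  have "{f \<epsilon>, y1, z1} - O' = S - O' - {x1}"
    unfolding yz(1)[symmetric] using \<epsilon>O yz(2,3) by auto
  moreover have "card (S - O' - {x1}) < card (S - O')"
    using S(2) x1 by (intro card_Diff1_less) auto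
  ultimately have card: "card ({f \<epsilon>, y1, z1} - O') < card (S - O')" by simp
  have \<epsilon>t: "f \<epsilon> \<in> topspace \<Gamma>" using \<epsilon>O e0 unfolding O'_def topspace_eq by blast
  have pc: "path_component_of (UC3 \<Gamma>) (cfg x y z) (cfg (f \<epsilon>) y1 z1)"
    unfolding c by (rule path_component_of_trans[OF 1 2])
  show ?thesis by (rule that[OF \<epsilon>t top1(2,3) d yz(4) pc card[unfolded O'_def S_def]])
qed

text \<open>Linear interpolation between increasing parameters keeps them increasing, so particles
  never collide. Since configurations are unordered, the parameters may be sorted first.\<close>

lemma cfg_in_edge_standard:
  assumes e0: "e0 \<in> E" and in_e: "{x, y, z} \<subseteq> e0 ` {0<..<1}" "x \<noteq> y" "x \<noteq> z" "y \<noteq> z"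
  shows "path_component_of (UC3 \<Gamma>) (cfg x y z) (cfg (e0 (1/4)) (e0 (1/2)) (e0 (3/4)))"
proof -
  note e0p = OE_props[OF E_OE[OF e0]]
  have ord: "path_component_of (UC3 \<Gamma>) (cfg (e0 a) (e0 b) (e0 c)) (cfg (e0 (1/4)) (e0 (1/2)) (e0 (3/4)))"
    if abc: "0 < a" "a < b" "b < c" "c < 1" for a b c
  proof -
    let ?l = "\<lambda>s m t. (1 - t) * s + t * (m::real)"
    have b: "0 < ?l s m t" "?l s m t < 1" if "0 < s" "s < 1" "0 < m" "m < 1" "t \<in> {0..1}" for s m t :: real
    proof -
      have "?l s m t \<in> {0<..<1}"
        using convexD_alt[of "{0<..<1::real}" s m t] that by simp
      then show "0 < ?l s m t" "?l s m t < 1" by auto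
    qed
    have mono: "?l s m t < ?l s' m' t" if "s < s'" "m < m'" "t \<in> {0..1}" for s m s' m' t :: real
    proof (cases "t = 0")
      case False
      then have "t * m < t * m'" "(1 - t) * s \<le> (1 - t) * s'" using that by (auto intro!: mult_left_mono)
      then show ?thesis by (rule add_le_less_mono[rotated])
    qed (use that in simp)
    have p: "pathin \<Gamma> (\<lambda>t. e0 (?l s m t))" if "0 < s" "s < 1" "0 < m" "m < 1" for s m
    proof (rule pathin_compose_real[OF e0p(1)])
      show "?l s m t \<in> {0..1}" if "t \<in> {0..1}" for t
        using b[OF \<open>0 < s\<close> \<open>s < 1\<close> \<open>0 < m\<close> \<open>m < 1\<close> that] by auto
    qed (intro continuous_intros)
    have ne: "e0 (?l s m t) \<noteq> e0 (?l s' m' t)"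
      if "0 < s" "s < s'" "s' < 1" "0 < m" "m < m'" "m' < 1" "t \<in> {0..1}" for s m s' m' t
    proof
      assume "e0 (?l s m t) = e0 (?l s' m' t)"
      moreover have "?l s m t \<in> {0<..<1}" "?l s' m' t \<in> {0<..<1}"
        using b[of s m t] b[of s' m' t] that by auto
      ultimately have "?l s m t = ?l s' m' t" using e0p(4) by (simp add: inj_on_eq_iff)
      then show False using mono[of s s' m m' t] that by simp
    qed
    have "path_component_of (subtopology (UC3 \<Gamma>) UNIV) (cfg (e0 (?l a (1/4) 0)) (e0 (?l b (1/2) 0)) (e0 (?l c (3/4) 0)))
       (cfg (e0 (?l a (1/4) 1)) (e0 (?l b (1/2) 1)) (e0 (?l c (3/4) 1)))"
      using abc by (intro path_component_cfg p conjI ne) simp_all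
    then show ?thesis by simp
  qed
  obtain r s t where rst: "r \<in> {0<..<1}" "s \<in> {0<..<1}" "t \<in> {0<..<1}" "x = e0 r" "y = e0 s" "z = e0 t"
    using in_e(1) by auto
  have ne: "r \<noteq> s" "r \<noteq> t" "s \<noteq> t" using rst in_e by auto
  have "\<exists>a b c. {a, b, c} = {r, s, t} \<and> a < b \<and> b < c"
  proof -
    consider "r < s" "s < t" | "r < t" "t < s" | "s < r" "r < t" | "s < t" "t < r" | "t < r" "r < s" | "t < s" "s < r"
      using ne by fastforce
    then show ?thesis
      by cases (rule exI[of _ r], rule exI[of _ s], rule exI[of _ t], simp,
        rule exI[of _ r], rule exI[of _ t], rule exI[of _ s], simp add: insert_commute,
        rule exI[of _ s], rule exI[of _ r], rule exI[of _ t], simp add: insert_commute,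
        rule exI[of _ s], rule exI[of _ t], rule exI[of _ r], simp add: insert_commute,
        rule exI[of _ t], rule exI[of _ r], rule exI[of _ s], simp add: insert_commute,
        rule exI[of _ t], rule exI[of _ s], rule exI[of _ r], simp add: insert_commute)
  qed
  then obtain a b c where abc: "{a, b, c} = {r, s, t}" "a < b" "b < c" by blast
  have "a \<in> {r, s, t}" "b \<in> {r, s, t}" "c \<in> {r, s, t}" using abc(1) by auto
  then have "a \<in> {0<..<1}" "c \<in> {0<..<1}" using rst by auto
  then have "path_component_of (UC3 \<Gamma>) (cfg (e0 a) (e0 b) (e0 c)) (cfg (e0 (1/4)) (e0 (1/2)) (e0 (3/4)))"
    using ord abc by auto
  moreover have "{e0 a, e0 b, e0 c} = {x, y, z}"
    using arg_cong[OF abc(1), of "image e0"] rst by simp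
  then have "cfg x y z = cfg (e0 a) (e0 b) (e0 c)" using in_e by (intro cfg_eqI) auto
  ultimately show ?thesis by simp
qed

theorem path_connected_UC3:
  assumes conn: "connected_space \<Gamma>" and e0: "e0 \<in> E"
  shows "path_connected_space (UC3 \<Gamma>)"
proof -
  let ?b = "cfg (e0 (1/4)) (e0 (1/2)) (e0 (3/4))"
  have reach: "path_component_of (UC3 \<Gamma>) (cfg x y z) ?b"
    if "x \<in> topspace \<Gamma>" "y \<in> topspace \<Gamma>" "z \<in> topspace \<Gamma>" "x \<noteq> y" "x \<noteq> z" "y \<noteq> z" for x y z
    using that
  proof (induction "card ({x, y, z} - e0 ` {0<..<1})" arbitrary: x y z rule: less_induct)
    case less
    show ?case
    proof (cases "{x, y, z} \<subseteq> e0 ` {0<..<1}")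
      case True
      then show ?thesis using cfg_in_edge_standard[OF e0] less.prems by blast
    next
      case False
      obtain x' y' z' where x': "x' \<in> topspace \<Gamma>" "y' \<in> topspace \<Gamma>" "z' \<in> topspace \<Gamma>" "x' \<noteq> y'" "x' \<noteq> z'" "y' \<noteq> z'"
        "path_component_of (UC3 \<Gamma>) (cfg x y z) (cfg x' y' z')"
        "card ({x', y', z'} - e0 ` {0<..<1}) < card ({x, y, z} - e0 ` {0<..<1})"
        using cfg_move_into_edge[OF conn e0 less.prems False] by blast
      have "path_component_of (UC3 \<Gamma>) (cfg x' y' z') ?b" using less.hyps[OF x'(8) x'(1-6)] .
      with x'(7) show ?thesis by (rule path_component_of_trans)
    qed
  qed
  have rb: "path_component_of (UC3 \<Gamma>) c ?b" if "c \<in> topspace (UC3 \<Gamma>)" for c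
    by (rule UC3_cases[OF that]) (simp add: reach)
  show ?thesis
    unfolding path_connected_space_iff_path_component
  proof (intro ballI)
    fix c d assume "c \<in> topspace (UC3 \<Gamma>)" "d \<in> topspace (UC3 \<Gamma>)"
    then have "path_component_of (UC3 \<Gamma>) c ?b" "path_component_of (UC3 \<Gamma>) ?b d"
      using rb path_component_of_sym[OF rb] by auto
    then show "path_component_of (UC3 \<Gamma>) c d" by (rule path_component_of_trans)
  qed
qed

end

section \<open>The wall of configurations at a leaf edge or a loop\<close>

section \<open>A simply connected wall at a leaf edge or a loop\<close>

text \<open>A path in \<open>X\<close> can change its component of \<open>U\<close> only while
  crossing \<open>W\<close>, and the part of \<open>W\<close> inside \<open>U\<close> belongs to the
  single component \<open>P\<close>. So membership in \<open>P \<union> W\<close> is constant along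
  paths; this is expressed by an integer potential whose coboundary vanishes over both members of
  the cover.\<close>

lemma path_connected_complement:
  assumes pc: "path_connected_space X" and U: "openin X U" and W: "openin X W"
    and cov: "topspace X \<subseteq> U \<union> W" and UW: "U \<inter> W = A \<union> B"
    and pcA: "path_connected_space (subtopology X A)" and pcB: "path_connected_space (subtopology X B)"
    and x0: "x0 \<in> A" and x1: "x1 \<in> B" and x01: "path_component_of (subtopology X U) x0 x1"
  shows "path_connected_space (subtopology X U)"
proof -
  define P where "P = {x. path_component_of (subtopology X U) x0 x}"
  have sub: "A \<subseteq> U" "B \<subseteq> U" using UW by auto
  have top: "U \<subseteq> topspace X" using U by (rule openin_subset)
  have up: "path_component_of (subtopology X U) x y"
    if "path_connected_space (subtopology X C)" "C \<subseteq> U" "x \<in> C" "y \<in> C" for C x y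
  proof -
    have "x \<in> topspace X \<inter> C" "y \<in> topspace X \<inter> C" using that top by auto
    from path_connected_spaceD[OF that(1) this] obtain p where
      "pathin (subtopology X C) p" "p 0 = x" "p 1 = y" by blast
    then show ?thesis
      unfolding path_component_of_def using pathin_subtopology_mono[OF _ that(2)] by (intro exI[of _ p]) simp
  qed
  have AP: "A \<subseteq> P" unfolding P_def using up[OF pcA sub(1) x0] by auto
  have BP: "B \<subseteq> P"
    unfolding P_def using up[OF pcB sub(2) x1] path_component_of_trans[OF x01] by auto
  define \<tau> where "\<tau> x = (if x \<in> P \<union> W then 0 else 1 :: int)" for x
  have tT: "transport X integer_group (\<lambda>p. inv\<^bsub>integer_group\<^esub> (\<tau> (p 0)) \<otimes>\<^bsub>integer_group\<^esub> \<tau> (p 1))"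
    by (rule transport_coboundary) auto
  have t0: "transport X integer_group (\<lambda>p. 0)"
    unfolding transport_def by simp
  have inP: "p 0 \<in> P \<union> W \<longleftrightarrow> p 1 \<in> P \<union> W" if p: "pathin (subtopology X U) p" for p
  proof -
    have U01: "p 0 \<in> U" "p 1 \<in> U" using p by (auto simp: pathin_subtopology)
    have c1: "path_component_of (subtopology X U) (p 0) (p 1)"
      unfolding path_component_of_def using p by (intro exI[of _ p]) simp
    note c = c1 path_component_of_sym[OF c1]
    have UP: "x \<in> P \<union> W \<longleftrightarrow> x \<in> P" if "x \<in> U" for x using that UW AP BP by blast
    have "p 0 \<in> P \<longleftrightarrow> p 1 \<in> P"
      unfolding P_def using path_component_of_trans[OF _ c(1), of x0] path_component_of_trans[OF _ c(2), of x0] by auto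
    then show ?thesis using UP[OF U01(1)] UP[OF U01(2)] by simp
  qed
  have key: "inv\<^bsub>integer_group\<^esub> (\<tau> (p 0)) \<otimes>\<^bsub>integer_group\<^esub> \<tau> (p 1) = 0" if "pathin X p" for p
  proof (rule transport_eqI[OF group_integer_group, of UNIV X "\<lambda>i. if i then U else W", OF _ _ tT t0 _ that])
    show "topspace X \<subseteq> (\<Union>i\<in>UNIV. if i then U else W)" using cov by (auto split: if_splits)
    show "inv\<^bsub>integer_group\<^esub> (\<tau> (p 0)) \<otimes>\<^bsub>integer_group\<^esub> \<tau> (p 1) = 0"
      if "pathin (subtopology X (if i then U else W)) p" for i p
    proof (cases i)
      case True
      then show ?thesis using inP[of p] that by (simp add: \<tau>_def)
    next
      case False
      then have "p 0 \<in> W" "p 1 \<in> W" using that by (auto simp: pathin_subtopology)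
      then show ?thesis by (simp add: \<tau>_def)
    qed
  qed (use U W in auto)
  have "path_component_of (subtopology X U) x0 y" if y: "y \<in> U" for y
  proof -
    have "x0 \<in> topspace X" "y \<in> topspace X" using y x0 sub top by auto
    then obtain p where p: "pathin X p" "p 0 = x0" "p 1 = y"
      using pc unfolding path_connected_space_def by blast
    have "x0 \<in> P \<union> W" using x0 AP by blast
    then have "y \<in> P \<union> W" using key[OF p(1)] p by (simp add: \<tau>_def split: if_splits)
    then show ?thesis using y UW AP BP unfolding P_def by blast
  qed
  note all = this
  show ?thesis
    unfolding path_connected_space_iff_path_component
  proof (intro ballI)
    fix x y assume "x \<in> topspace (subtopology X U)" "y \<in> topspace (subtopology X U)"
    then have "path_component_of (subtopology X U) x x0" "path_component_of (subtopology X U) x0 y"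
      using all path_component_of_sym[OF all] by auto
    then show "path_component_of (subtopology X U) x y" by (rule path_component_of_trans)
  qed
qed

text \<open>\<open>h\<close> is a homeomorphism onto an open image, so segments and straight-line
  homotopies in \<open>K\<close> are carried over.\<close>

lemma convex_chart:
  fixes K :: "'k::real_normed_vector set"
  assumes K: "convex K" and h: "continuous_map (top_of_set K) X h" and inj: "inj_on h K"
    and op: "\<And>N. open N \<Longrightarrow> openin X (h ` (K \<inter> N))"
  shows "path_unique (subtopology X (h ` K))" "path_connected_space (subtopology X (h ` K))"
    "openin X (h ` K)"
proof -
  let ?Y = "subtopology X (h ` K)"
  show oK: "openin X (h ` K)" using op[of UNIV] by simp
  have hY: "continuous_map (top_of_set K) ?Y h" using h by (auto simp: continuous_map_in_subtopology)
  have om: "open_map (top_of_set K) ?Y h"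
    unfolding open_map_def
  proof (intro allI impI)
    fix S assume "openin (top_of_set K) S"
    then obtain N where N: "open N" "S = K \<inter> N" by (auto simp: openin_open)
    then show "openin ?Y (h ` S)"
      using op[OF N(1)] oK by (simp add: openin_open_subtopology) blast
  qed
  have img: "h ` topspace (top_of_set K) = topspace ?Y" using openin_subset[OF oK] by auto
  have "homeomorphic_map (top_of_set K) ?Y h"
    by (rule bijective_open_imp_homeomorphic_map[OF hY om img]) (use inj in simp)
  then obtain k where k: "homeomorphic_maps (top_of_set K) ?Y h k" by (auto simp: homeomorphic_map_maps)
  have kc: "continuous_map ?Y (top_of_set K) k" and hk: "\<And>y. y \<in> topspace ?Y \<Longrightarrow> h (k y) = y"
    using k by (auto simp: homeomorphic_maps_def)
  have lift: "path (k \<circ> p)" "path_image (k \<circ> p) \<subseteq> K" "path_homotopic ?Y p (h \<circ> (k \<circ> p))"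
    if p: "pathin ?Y p" for p
  proof -
    have "continuous_map (top_of_set {0..1}) (top_of_set K) (k \<circ> p)"
      using continuous_map_compose[OF p[unfolded pathin_def] kc] .
    then show "path (k \<circ> p)" "path_image (k \<circ> p) \<subseteq> K" by (auto simp: path_def path_image_def)
    show "path_homotopic ?Y p (h \<circ> (k \<circ> p))"
    proof (rule path_homotopic_cong[OF p])
      fix t :: real assume "t \<in> {0..1}"
      then show "p t = (h \<circ> (k \<circ> p)) t" using hk pathin_topspace[OF p] by (simp only: comp_def)
    qed
  qed
  show "path_unique ?Y"
    unfolding path_unique_def
  proof (intro allI impI)
    fix p q assume p: "pathin ?Y p" and q: "pathin ?Y q" and pq: "p 0 = q 0" "p 1 = q 1"
    have "path_homotopic ?Y (h \<circ> (k \<circ> p)) (h \<circ> (k \<circ> q))"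
      using lift(1,2)[OF p] lift(1,2)[OF q] pq by (intro path_homotopic_convex[OF K hY]) auto
    from path_homotopic_trans[OF lift(3)[OF p] this] path_homotopic_sym[OF lift(3)[OF q]]
    show "path_homotopic ?Y p q" by (rule path_homotopic_trans)
  qed
  show "path_connected_space ?Y"
    unfolding path_connected_space_def
  proof (intro ballI)
    fix x y assume "x \<in> topspace ?Y" "y \<in> topspace ?Y"
    then obtain a b where ab: "a \<in> K" "b \<in> K" "x = h a" "y = h b" by auto
    have "h ` closed_segment a b \<subseteq> h ` K" using K ab by (intro image_mono closed_segment_subset)
    from pathin_linepath[OF K h ab(1,2) this]
    show "\<exists>p. pathin ?Y p \<and> p 0 = x \<and> p 1 = y"
      by (intro exI[of _ "h \<circ> linepath a b"]) (simp add: ab linepath_0' linepath_1')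
  qed
qed

text \<open>\<open>e\<close> is a loop at \<open>v\<close> or leads from \<open>v\<close> to a leaf:
  if its end differs from \<open>v\<close>, no other edge starts there. The lanes \<open>f\<close>
  and \<open>g\<close> may be the two ends of one further loop, as \<open>g = path_rev f\<close> is
  allowed; this is why later comparisons exclude parameters adding up to 1.\<close>

locale lane_wall = graph_structure +
  fixes e f g :: "real \<Rightarrow> 'a" and v :: 'a
  assumes conn: "connected_space \<Gamma>"
    and efg: "e \<in> OE" "f \<in> OE" "g \<in> OE" "e 0 = v" "f 0 = v" "g 0 = v"
    and ne: "f \<noteq> g" "f \<noteq> e" "f \<noteq> path_rev e" "g \<noteq> e" "g \<noteq> path_rev e"
    and leaf: "e 1 \<noteq> v \<Longrightarrow> l \<in> OE \<Longrightarrow> l 0 = e 1 \<Longrightarrow> l = path_rev e"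
begin

text \<open>\<open>d\<close> measures the distance to \<open>v\<close> along \<open>e\<close>, from
  the nearer end if \<open>e\<close> is a loop, and \<open>J\<close> is \<open>e\<close> without
  \<open>v\<close>. The third particle has position \<open>s\<close> relative to \<open>m\<close>,
  the distance of the nearer particle on \<open>e\<close>; so \<open>s < 1\<close> says that it is
  closest to \<open>v\<close>, and the wall is \<open>s = 1/2\<close>. Scaling by \<open>m\<close>
  makes the wall closed: when a particle on \<open>e\<close> tends to \<open>v\<close>, so does the
  third one, and the limit is a collision.\<close>

definition d :: "real \<Rightarrow> real" where "d t = (if e 1 = v then min t (1 - t) else t)"
definition J :: "real set" where "J = {t \<in> {0..1}. 0 < d t}"
definition m :: "real \<Rightarrow> real \<Rightarrow> real" where "m s t = min (d s) (d t)"
definition h :: "real \<times> real \<times> real \<Rightarrow> (nat \<Rightarrow> 'a) set" where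
  "h = (\<lambda>(a, b, s). cfg (e a) (e b) (f (s * m a b)))"
definition K :: "real \<Rightarrow> real \<Rightarrow> (real \<times> real \<times> real) set" where
  "K p q = {(a, b, s). a \<in> J \<and> b \<in> J \<and> a < b \<and> p < s \<and> s < q}"
definition wall :: "(nat \<Rightarrow> 'a) set set" where
  "wall = (\<lambda>(a, b). cfg (e a) (e b) (f (m a b / 2))) ` {(a, b). a \<in> J \<and> b \<in> J \<and> a < b}"

lemma J_eq: "J = (if e 1 = v then {0<..<1} else {0<..1})"
  by (auto simp: J_def d_def)

lemma d_bounds: "t \<in> {0..1} \<Longrightarrow> 0 \<le> d t \<and> d t \<le> 1"
  by (auto simp: d_def)

lemma d_J: "t \<in> J \<Longrightarrow> 0 < d t \<and> d t \<le> 1" "t \<in> J \<Longrightarrow> t \<in> {0..1}"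
  by (auto simp: J_def d_def)

lemma d_notJ: "t \<in> {0..1} \<Longrightarrow> t \<notin> J \<Longrightarrow> d t = 0 \<and> e t = v"
  using efg(4) by (auto simp: J_def d_def min_def split: if_splits)

lemma d_small: "t \<le> 1/2 \<Longrightarrow> d t = t"
  by (auto simp: d_def)

lemma small_J: "0 < t \<Longrightarrow> t \<le> 1/2 \<Longrightarrow> t \<in> J"
  by (auto simp: J_eq)

lemma m_bounds: "a \<in> J \<Longrightarrow> b \<in> J \<Longrightarrow> 0 < m a b \<and> m a b \<le> 1"
  using d_J[of a] d_J[of b] by (auto simp: m_def)

lemma continuous_on_d: "continuous_on S d"
  unfolding d_def by (cases "e 1 = v") (auto intro!: continuous_intros)

lemma v_V: "v \<in> V"
  using OE_props(2)[OF efg(1)] efg(4) by simp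

lemma eJ_sub: "e ` J \<subseteq> topspace \<Gamma>"
  using OE_props(1)[OF efg(1)] pathin_topspace d_J(2) by blast

lemma OE_top: "l \<in> OE \<Longrightarrow> t \<in> {0..1} \<Longrightarrow> l t \<in> topspace \<Gamma>"
  using OE_props(1) pathin_topspace by metis

lemma interval_insert: "{0<..1::real} = insert 1 {0<..<1}"
  by auto

lemma inj_eJ: "inj_on e J"
proof (cases "e 1 = v")
  case True
  then show ?thesis using OE_props(4)[OF efg(1)] by (simp add: J_eq)
next
  case False
  have "e 1 \<notin> e ` {0<..<1}" using OE_props(3,5)[OF efg(1)] by blast
  then show ?thesis using OE_props(4)[OF efg(1)] False by (simp add: J_eq interval_insert)
qed

lemma v_notin_eJ: "v \<notin> e ` J"
  using OE_props(5)[OF efg(1)] v_V by (auto simp: J_eq interval_insert split: if_splits)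

lemma lane_notin_eJ:
  assumes "l \<in> OE" "l \<noteq> e" "l \<noteq> path_rev e" "t \<in> {0<..<1}"
  shows "l t \<notin> e ` J"
proof -
  have "e ` {0<..<1} \<inter> l ` {0<..<1} = {}" using OE_disjoint[OF efg(1) assms(1)] assms(2,3) by metis
  then have 1: "l t \<notin> e ` {0<..<1}" using assms(4) by blast
  have "l t \<notin> V" using OE_props(5)[OF assms(1)] assms(4) by blast
  then have "l t \<noteq> e 1" using OE_props(3)[OF efg(1)] by metis
  with 1 show ?thesis by (auto simp: J_eq interval_insert split: if_splits)
qed

lemma f_notin_eJ: "t \<in> {0..<1} \<Longrightarrow> f t \<notin> e ` J"
  using lane_notin_eJ[OF efg(2) ne(2,3), of t] v_notin_eJ efg(5) by (cases "t = 0") auto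

lemma g_notin_eJ: "t \<in> {0..<1} \<Longrightarrow> g t \<notin> e ` J"
  using lane_notin_eJ[OF efg(3) ne(4,5), of t] v_notin_eJ efg(6) by (cases "t = 0") auto

text \<open>For a loop this is an open edge. In the leaf case the end point \<open>e 1\<close> is
  included, and openness holds because no other edge ends there.\<close>

lemma openin_eJ: "openin \<Gamma> (e ` J)"
proof (cases "e 1 = v")
  case True
  then show ?thesis using openin_edge[OF efg(1)] by (simp add: J_eq)
next
  case False
  obtain e' where e': "e' \<in> E" "e' = e \<or> e' = path_rev e" using efg(1) by (auto simp: OE_def)
  have img: "e' ` {0<..<1} = e ` {0<..<1}" using e'(2) path_rev_interior by metis
  have "closedin \<Gamma> (\<Union>c\<in>E - {e'}. c ` {0..1})"
    using finite_E closedin_edge by (intro closedin_Union) auto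
  moreover have "closedin \<Gamma> (V - {e 1})"
    using finite_V V_sub by (intro closedin_Hausdorff_finite[OF Hausdorff]) auto
  ultimately have cl: "closedin \<Gamma> ((V - {e 1}) \<union> (\<Union>c\<in>E - {e'}. c ` {0..1}))"
    by (intro closedin_Un)
  have notend: "c t \<notin> e ` J" if c: "c \<in> E - {e'}" and t: "t \<in> {0..1}" for c t
  proof -
    have cO: "c \<in> OE" "path_rev c \<in> OE" using c E_OE OE_rev by auto
    have cne: "c \<noteq> e" "c \<noteq> path_rev e"
    proof -
      have "c ` {0<..<1} \<inter> e' ` {0<..<1} = {}"
        using edges_disjoint c e'(1) by (auto simp: pairwise_def disjnt_def)
      moreover have "(1/2::real) \<in> {0<..<1}" by simp
      ultimately have "c ` {0<..<1} \<noteq> e ` {0<..<1}" unfolding img by (metis Int_absorb imageI empty_iff)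
      then show "c \<noteq> e" "c \<noteq> path_rev e" using path_rev_interior[of e] by auto
    qed
    have cne': "path_rev c \<noteq> e" "path_rev c \<noteq> path_rev e" using cne by (metis path_rev_rev)+
    have ends: "c 0 \<noteq> e 1" "c 1 \<noteq> e 1"
      using leaf[OF False cO(1)] leaf[OF False cO(2)] cne cne' by auto
    have V01: "c 0 \<in> V" "c 1 \<in> V" using OE_props(2,3)[OF cO(1)] by auto
    have "x \<notin> e ` J" if "x \<in> V" "x \<noteq> e 1" for x
      using OE_props(5)[OF efg(1)] that False by (auto simp: J_eq interval_insert)
    then have "c 0 \<notin> e ` J" "c 1 \<notin> e ` J" using V01 ends by auto
    moreover have "c t \<notin> e ` J" if "t \<in> {0<..<1}" using lane_notin_eJ[OF cO(1) cne that] .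
    ultimately show ?thesis using t by (cases "t = 0"; cases "t = 1") auto
  qed
  have "topspace \<Gamma> - ((V - {e 1}) \<union> (\<Union>c\<in>E - {e'}. c ` {0..1})) = e ` J"
  proof (rule subset_antisym)
    show "topspace \<Gamma> - ((V - {e 1}) \<union> (\<Union>c\<in>E - {e'}. c ` {0..1})) \<subseteq> e ` J"
    proof
      fix x assume x: "x \<in> topspace \<Gamma> - ((V - {e 1}) \<union> (\<Union>c\<in>E - {e'}. c ` {0..1}))"
      show "x \<in> e ` J"
      proof (cases "x \<in> V")
        case True
        then show ?thesis using x False by (auto simp: J_eq interval_insert)
      next
        case False
        then obtain c where c: "c \<in> E" "x \<in> c ` {0<..<1}" using x unfolding topspace_eq by blast
        have "c ` {0<..<1} \<subseteq> c ` {0..1}" by (rule image_mono) auto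
        then have "c = e'" using x c by blast
        then show ?thesis using c(2) img \<open>e 1 \<noteq> v\<close> by (simp add: J_eq interval_insert)
      qed
    qed
    show "e ` J \<subseteq> topspace \<Gamma> - ((V - {e 1}) \<union> (\<Union>c\<in>E - {e'}. c ` {0..1}))"
    proof
      fix x assume x: "x \<in> e ` J"
      then have "x \<notin> V - {e 1}"
        using OE_props(5)[OF efg(1)] False by (auto simp: J_eq interval_insert)
      moreover have "x \<notin> (\<Union>c\<in>E - {e'}. c ` {0..1})" using notend x by blast
      ultimately show "x \<in> topspace \<Gamma> - ((V - {e 1}) \<union> (\<Union>c\<in>E - {e'}. c ` {0..1}))"
        using x eJ_sub by blast
    qed
  qed
  then show ?thesis using cl by (metis openin_diff openin_topspace)
qed

lemma homeomorphic_eJ: "homeomorphic_map (top_of_set J) (subtopology \<Gamma> (e ` J)) e"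
proof (rule homeomorphic_map_path_restrict[OF Hausdorff OE_props(1)[OF efg(1)] _ inj_eJ])
  have "e t = v" if "t \<in> {0..1} - J" for t using d_notJ that by blast
  then have "e ` ({0..1} - J) \<subseteq> {v}" by blast
  then show "e ` J \<inter> e ` ({0..1} - J) = {}" using v_notin_eJ by blast
qed (use d_J(2) in auto)

lemma convex_J: "convex J"
  by (auto simp: J_eq)

lemma convex_K: "convex (K p q)"
proof -
  have "K p q = (J \<times> J \<times> {p<..<q}) \<inter> {z. fst z < fst (snd z)}"
    by (auto simp: K_def)
  moreover have "convex {z :: real \<times> real \<times> real. fst z < fst (snd z)}"
  proof -
    have "{z :: real \<times> real \<times> real. fst z < fst (snd z)} = {z. inner (1, -1, 0) z < 0}"
      by (auto simp: inner_prod_def)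
    then show ?thesis by (simp add: convex_halfspace_lt)
  qed
  ultimately show ?thesis using convex_J by (auto intro!: convex_Int convex_Times)
qed

end

lemma prod_topology_euclidean: "prod_topology euclidean euclidean = euclidean"
  using prod_topology_subtopology_eu[of UNIV UNIV] by simp

lemma openin_ordered_triples_Times:
  assumes "openin X A" "openin X B" "openin X C"
  shows "openin (ordered_triples X) ((A \<times> B \<times> C) \<inter> {(x, y, z). x \<noteq> y \<and> x \<noteq> z \<and> y \<noteq> z})"
  unfolding ordered_triples_def
  using assms by (intro openin_subtopology_Int) (simp add: openin_prod_Times_iff)

context lane_wall
begin

lemma wall_points:
  assumes "a \<in> J" "b \<in> J" "a < b" "r \<in> {0..<1}"
  shows "e a \<noteq> e b" "e a \<noteq> f r" "e b \<noteq> f r"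
proof -
  show "e a \<noteq> e b" using inj_onD[OF inj_eJ _ assms(1,2)] assms(3) by auto
  show "e a \<noteq> f r" "e b \<noteq> f r" using f_notin_eJ[OF assms(4)] assms(1,2) by (metis imageI)+
qed

text \<open>The third particle is the only one outside the image of \<open>J\<close> under
  \<open>e\<close>, and the order of the parameters separates the other two. Hence \<open>h\<close>
  is injective although configurations are unordered.\<close>

lemma wall_set_eq:
  assumes "a \<in> J" "b \<in> J" "a < b" "a' \<in> J" "b' \<in> J" "a' < b'" "x \<notin> e ` J" "x' \<notin> e ` J"
    and eq: "{e a, e b, x} = {e a', e b', x'}"
  shows "a = a'" "b = b'" "x = x'"
proof -
  have "{e a, e b, x} - e ` J = {x}" "{e a', e b', x'} - e ` J = {x'}" using assms(1-8) by auto
  then show "x = x'" using eq by auto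
  have "{e a, e b, x} \<inter> e ` J = e ` {a, b}" "{e a', e b', x'} \<inter> e ` J = e ` {a', b'}" using assms(1-8) by auto
  then have "e ` {a, b} = e ` {a', b'}" using eq by auto
  then have "{a, b} = {a', b'}"
    using inj_on_image_eq_iff[OF inj_eJ, of "{a, b}" "{a', b'}"] assms(1-6) by auto
  then show "a = a'" "b = b'" using assms(3,6) by (auto simp: doubleton_eq_iff)
qed

lemma sm_interval:
  assumes "a \<in> J" "b \<in> J" "0 < s" "s < 1"
  shows "s * m a b \<in> {0<..<1}"
proof -
  have mm: "0 < m a b" "m a b \<le> 1" using m_bounds[OF assms(1,2)] by auto
  have "s * m a b \<le> s * 1" using mm assms(3) by (intro mult_left_mono) auto
  then have "s * m a b < 1" using assms(4) by simp
  then show ?thesis using mm assms(3) by simp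
qed

lemma h_eq: "h (a, b, s) = cfg (e a) (e b) (f (s * m a b))"
  by (simp add: h_def)

lemma K_mem: "(a, b, s) \<in> K p q \<longleftrightarrow> a \<in> J \<and> b \<in> J \<and> a < b \<and> p < s \<and> s < q"
  by (simp add: K_def)

lemma inj_h: "inj_on h (K 0 1)"
proof (rule inj_onI)
  fix w w' assume "w \<in> K 0 1" "w' \<in> K 0 1" and eq: "h w = h w'"
  then obtain a b s a' b' s' where w: "w = (a, b, s)" "w' = (a', b', s')"
    and m: "a \<in> J" "b \<in> J" "a < b" "0 < s" "s < 1" "a' \<in> J" "b' \<in> J" "a' < b'" "0 < s'" "s' < 1"
    by (cases w; cases w') (auto simp: K_mem)
  note r = sm_interval[OF m(1,2,4,5)] sm_interval[OF m(6,7,9,10)]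
  have r': "s * m a b \<in> {0..<1}" "s' * m a' b' \<in> {0..<1}" using r by auto
  have "{e a, e b, f (s * m a b)} = {e a', e b', f (s' * m a' b')}"
    using eq wall_points[OF m(1-3) r'(1)] unfolding w h_eq by (simp add: cfg_eq_iff)
  note E = wall_set_eq[OF m(1-3,6-8) f_notin_eJ[OF r'(1)] f_notin_eJ[OF r'(2)] this]
  have "s * m a b = s' * m a b"
    using E r by (intro inj_onD[OF OE_props(4)[OF efg(2)]]) auto
  then have "s = s'" using m_bounds[OF m(1,2)] by auto
  then show "w = w'" using E w by simp
qed

lemma K_mono: "p' \<le> p \<Longrightarrow> q \<le> q' \<Longrightarrow> K p q \<subseteq> K p' q'"
  by (auto simp: K_def)

lemma continuous_on_m: "continuous_on S (\<lambda>w. m (fst w) (fst (snd w)))"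
  unfolding m_def
  by (intro continuous_on_min continuous_on_compose2[OF continuous_on_d[of UNIV]] continuous_intros) auto

lemma continuous_map_edge_comp:
  assumes "l \<in> OE" "continuous_on S u" "\<And>w. w \<in> S \<Longrightarrow> u w \<in> {0..1}"
  shows "continuous_map (top_of_set S) \<Gamma> (\<lambda>w. l (u w))"
proof -
  have "continuous_map (top_of_set S) (top_of_set {0..1}) u" using assms(2,3) by auto
  from continuous_map_compose[OF this OE_props(1)[OF assms(1), unfolded pathin_def]]
  show ?thesis by (simp add: comp_def)
qed

lemma continuous_h: "continuous_map (top_of_set (K 0 1)) (UC3 \<Gamma>) h"
proof -
  have h: "h = (\<lambda>w. cfg (e (fst w)) (e (fst (snd w))) (f (snd (snd w) * m (fst w) (fst (snd w)))))"
    by (auto simp: h_def)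
  have K: "fst w \<in> J" "fst (snd w) \<in> J" "fst w < fst (snd w)" "0 < snd (snd w)" "snd (snd w) < 1"
    if "w \<in> K 0 1" for w
    using that by (auto simp: K_def)
  have sm: "snd (snd w) * m (fst w) (fst (snd w)) \<in> {0<..<1}" if "w \<in> K 0 1" for w
    using sm_interval K[OF that] by blast
  show ?thesis
    unfolding h
  proof (rule continuous_map_cfg)
    show "continuous_map (top_of_set (K 0 1)) \<Gamma> (\<lambda>w. e (fst w))"
      using K d_J(2) by (intro continuous_map_edge_comp efg(1) continuous_intros) blast
    show "continuous_map (top_of_set (K 0 1)) \<Gamma> (\<lambda>w. e (fst (snd w)))"
      using K d_J(2) by (intro continuous_map_edge_comp efg(1) continuous_intros) blast
    show "continuous_map (top_of_set (K 0 1)) \<Gamma> (\<lambda>w. f (snd (snd w) * m (fst w) (fst (snd w))))"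
    proof (rule continuous_map_edge_comp[OF efg(2)])
      show "continuous_on (K 0 1) (\<lambda>w. snd (snd w) * m (fst w) (fst (snd w)))"
        by (intro continuous_on_mult continuous_on_m continuous_intros)
      show "snd (snd w) * m (fst w) (fst (snd w)) \<in> {0..1}" if "w \<in> K 0 1" for w
        using sm[OF that] by auto
    qed
    fix w assume "w \<in> topspace (top_of_set (K 0 1))"
    then have w: "w \<in> K 0 1" by simp
    have "snd (snd w) * m (fst w) (fst (snd w)) \<in> {0..<1}" using sm[OF w] by auto
    from wall_points[OF K(1-3)[OF w] this]
    show "e (fst w) \<noteq> e (fst (snd w)) \<and> e (fst w) \<noteq> f (snd (snd w) * m (fst w) (fst (snd w))) \<and>
        e (fst (snd w)) \<noteq> f (snd (snd w) * m (fst w) (fst (snd w)))" by simp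
  qed
qed

text \<open>The coordinates are recovered continuously on an open box of ordered triples, and the
  passage to unordered configurations is an open map.\<close>

lemma open_h:
  assumes N: "open N" and pq: "0 \<le> p" "q \<le> 1"
  shows "openin (UC3 \<Gamma>) (h ` (K p q \<inter> N))"
proof -
  let ?T = "ordered_triples \<Gamma>" and ?F = "f ` {0<..<1}"
  obtain ei where ei: "homeomorphic_maps (top_of_set J) (subtopology \<Gamma> (e ` J)) e ei"
    using homeomorphic_eJ by (auto simp: homeomorphic_map_maps)
  obtain fi where fi: "homeomorphic_maps (top_of_set {0<..<1}) (subtopology \<Gamma> ?F) f fi"
    using OE_homeomorphic[OF efg(2)] by (auto simp: homeomorphic_map_maps)
  have eiJ: "ei (e a) = a" if "a \<in> J" for a using ei that by (simp add: homeomorphic_maps_def)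
  have fiJ: "fi (f r) = r" if "r \<in> {0<..<1}" for r
    using fi that unfolding homeomorphic_maps_def by simp
  define M0 where "M0 = (e ` J \<times> e ` J \<times> ?F) \<inter> {(x, y, z). x \<noteq> y \<and> x \<noteq> z \<and> y \<noteq> z}"
  have oM: "openin ?T M0"
    unfolding M0_def by (intro openin_ordered_triples_Times openin_eJ openin_edge[OF efg(2)])
  let ?Y = "subtopology ?T M0"
  have topY: "topspace ?Y = M0" using openin_subset[OF oM] by auto
  have p1: "continuous_map ?Y \<Gamma> fst" "continuous_map ?Y \<Gamma> (fst \<circ> snd)" "continuous_map ?Y \<Gamma> (snd \<circ> snd)"
    unfolding ordered_triples_def
    by (intro continuous_map_from_subtopology continuous_map_compose[OF continuous_map_snd]
        continuous_map_fst continuous_map_snd)+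
  have p2: "continuous_map ?Y (subtopology \<Gamma> (e ` J)) fst" "continuous_map ?Y (subtopology \<Gamma> (e ` J)) (fst \<circ> snd)"
    "continuous_map ?Y (subtopology \<Gamma> ?F) (snd \<circ> snd)"
    using p1 topY by (auto simp: continuous_map_in_subtopology M0_def)
  have eic: "continuous_map (subtopology \<Gamma> (e ` J)) euclideanreal ei"
    using ei by (auto simp: homeomorphic_maps_def continuous_map_in_subtopology)
  have fic: "continuous_map (subtopology \<Gamma> ?F) euclideanreal fi"
    using fi by (auto simp: homeomorphic_maps_def continuous_map_in_subtopology)
  have c1: "continuous_map ?Y euclideanreal (\<lambda>w. ei (fst w))"
    using continuous_map_compose[OF p2(1) eic] by (simp add: comp_def)
  have c2: "continuous_map ?Y euclideanreal (\<lambda>w. ei (fst (snd w)))"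
    using continuous_map_compose[OF p2(2) eic] by (simp add: comp_def)
  have c3: "continuous_map ?Y euclideanreal (\<lambda>w. fi (snd (snd w)))"
    using continuous_map_compose[OF p2(3) fic] by (simp add: comp_def)
  have dc: "continuous_map euclideanreal euclideanreal d" using continuous_on_d[of UNIV] by simp
  have cm: "continuous_map ?Y euclideanreal (\<lambda>w. m (ei (fst w)) (ei (fst (snd w))))"
    unfolding m_def
    using continuous_map_real_min[OF continuous_map_compose[OF c1 dc] continuous_map_compose[OF c2 dc]]
    by (simp add: comp_def)
  have mem: "\<exists>a b r. w = (e a, e b, f r) \<and> a \<in> J \<and> b \<in> J \<and> r \<in> {0<..<1}" if "w \<in> M0" for w
    using that unfolding M0_def by blast
  have mpos: "m (ei (fst w)) (ei (fst (snd w))) \<noteq> 0" if w: "w \<in> topspace ?Y" for w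
  proof -
    obtain a b r where "w = (e a, e b, f r)" "a \<in> J" "b \<in> J" "r \<in> {0<..<1}" using mem[of w] w topY by blast
    then show ?thesis using m_bounds[of a b] by (simp add: eiJ)
  qed
  \<comment> \<open>The inverse of the chart: the edge parameters of the three particles, the third
    divided by \<open>m\<close>, which is positive on the box.\<close>
  define \<phi> where "\<phi> = (\<lambda>w. (ei (fst w), ei (fst (snd w)), fi (snd (snd w)) / m (ei (fst w)) (ei (fst (snd w)))))"
  have \<phi>c: "continuous_map ?Y euclidean \<phi>"
  proof -
    have "continuous_map ?Y (prod_topology euclideanreal (prod_topology euclideanreal euclideanreal)) \<phi>"
      unfolding \<phi>_def
      by (intro continuous_map_pairedI c1 c2 continuous_map_real_divide[OF c3 cm mpos])
    then show ?thesis by (simp add: prod_topology_euclidean)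
  qed
  define N' where "N' = N \<inter> {w. fst w < fst (snd w)} \<inter> {w. p < snd (snd w)} \<inter> {w. snd (snd w) < q}"
  have "open N'"
    unfolding N'_def using N
    by (intro open_Int open_Collect_less continuous_intros) auto
  then have "openin ?Y {w \<in> topspace ?Y. \<phi> w \<in> N'}"
    using openin_continuous_map_preimage[OF \<phi>c] by simp
  then have oS: "openin ?T {w \<in> topspace ?Y. \<phi> w \<in> N'}" by (rule openin_trans_full[OF _ oM])
  have eq: "h ` (K p q \<inter> N) = (\<lambda>(x, y, z). cfg x y z) ` {w \<in> topspace ?Y. \<phi> w \<in> N'}"
  proof (rule subset_antisym; rule subsetI)
    fix c assume "c \<in> h ` (K p q \<inter> N)"
    then obtain a b s where abs: "c = h (a, b, s)" "(a, b, s) \<in> K p q" "(a, b, s) \<in> N" by auto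
    then have m: "a \<in> J" "b \<in> J" "a < b" "0 < s" "s < 1" "p < s" "s < q" using pq by (auto simp: K_mem)
    note r = sm_interval[OF m(1,2,4,5)]
    have r': "s * m a b \<in> {0..<1}" using r by auto
    let ?w = "(e a, e b, f (s * m a b))"
    have "?w \<in> M0" unfolding M0_def using m(1,2) r wall_points[OF m(1-3) r'] by auto
    moreover have "\<phi> ?w = (a, b, s)"
      using m_bounds[OF m(1,2)] by (simp add: \<phi>_def eiJ[OF m(1)] eiJ[OF m(2)] fiJ[OF r])
    then have "\<phi> ?w \<in> N'" using abs(3) m by (simp add: N'_def)
    ultimately show "c \<in> (\<lambda>(x, y, z). cfg x y z) ` {w \<in> topspace ?Y. \<phi> w \<in> N'}"
      unfolding abs(1) h_eq topY by (intro image_eqI[of _ _ ?w]) auto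
  next
    fix c assume "c \<in> (\<lambda>(x, y, z). cfg x y z) ` {w \<in> topspace ?Y. \<phi> w \<in> N'}"
    then obtain w where w: "w \<in> M0" "\<phi> w \<in> N'" "c = (\<lambda>(x, y, z). cfg x y z) w" unfolding topY by blast
    obtain a b r where abr: "w = (e a, e b, f r)" "a \<in> J" "b \<in> J" "r \<in> {0<..<1}" using mem[OF w(1)] by blast
    have \<phi>w: "\<phi> w = (a, b, r / m a b)" using abr by (simp add: \<phi>_def eiJ fiJ del: greaterThanLessThan_iff)
    have "(a, b, r / m a b) \<in> K p q \<inter> N" using w(2) abr(2,3) unfolding \<phi>w N'_def by (simp add: K_mem)
    moreover have "h (a, b, r / m a b) = c"
      using m_bounds[OF abr(2,3)] by (simp add: h_eq w(3) abr(1))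
    ultimately show "c \<in> h ` (K p q \<inter> N)" by (metis imageI)
  qed
  show ?thesis unfolding eq by (rule open_map_cfg[unfolded open_map_def, rule_format, OF oS])
qed

text \<open>The formula for the wall makes sense on the compact triangle of all parameters
  \<open>a \<le> b\<close>, including those where a particle reaches \<open>v\<close> or the two on
  \<open>e\<close> coincide. There two points collide, so discarding collisions from the compact
  image leaves exactly the wall.\<close>

lemma closed_wall: "closedin (UC3 \<Gamma>) wall"
proof -
  let ?P = "prod_topology \<Gamma> (prod_topology \<Gamma> \<Gamma>)"
  define T where "T = {w :: real \<times> real. 0 \<le> fst w \<and> fst w \<le> snd w \<and> snd w \<le> 1}"
  define \<Psi> where "\<Psi> = (\<lambda>w. (e (fst w), e (snd w), f (m (fst w) (snd w) / 2)))"
  have Tsub: "T \<subseteq> {0..1} \<times> {0..1}" by (auto simp: T_def)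
  moreover have "closed T"
    unfolding T_def by (intro closed_Collect_conj closed_Collect_le continuous_intros)
  ultimately have "compact T" by (metis bounded_subset compact_Icc compact_Times compact_eq_bounded_closed)
  have T01: "fst w \<in> {0..1}" "snd w \<in> {0..1}" if "w \<in> T" for w using that by (auto simp: T_def)
  have m01: "0 \<le> m a b" "m a b \<le> 1" if "a \<in> {0..1}" "b \<in> {0..1}" for a b
    using d_bounds[OF that(1)] d_bounds[OF that(2)] by (auto simp: m_def)
  have "continuous_map (top_of_set T) ?P \<Psi>"
    unfolding \<Psi>_def
  proof (intro continuous_map_pairedI continuous_map_edge_comp efg)
    show "continuous_on T (\<lambda>w. m (fst w) (snd w) / 2)"
      unfolding m_def
      by (intro continuous_on_min continuous_on_compose2[OF continuous_on_d[of UNIV]] continuous_intros) auto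
    show "m (fst w) (snd w) / 2 \<in> {0..1}" if "w \<in> T" for w
      using m01[OF T01[OF that]] by auto
  qed (use T01 in \<open>auto intro!: continuous_intros\<close>)
  moreover have "compactin (top_of_set T) T" using \<open>compact T\<close> by (simp add: compactin_subtopology)
  ultimately have "compactin ?P (\<Psi> ` T)" by (metis image_compactin)
  moreover have "Hausdorff_space ?P" using Hausdorff by (simp add: Hausdorff_space_prod_topology)
  ultimately have cl: "closedin ?P (\<Psi> ` T)" by (metis compactin_imp_closedin)
  let ?D = "{(x, y, z). x \<noteq> y \<and> x \<noteq> z \<and> y \<noteq> (z::'a)}"
  have cZ: "closedin (ordered_triples \<Gamma>) (\<Psi> ` T \<inter> ?D)"
    unfolding ordered_triples_def closedin_subtopology using cl by blast
  have eq: "wall = (\<lambda>(x, y, z). cfg x y z) ` (\<Psi> ` T \<inter> ?D)"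
  proof (rule subset_antisym; rule subsetI)
    fix c assume "c \<in> wall"
    then obtain a b where ab: "a \<in> J" "b \<in> J" "a < b" "c = cfg (e a) (e b) (f (m a b / 2))"
      by (auto simp: wall_def)
    have r: "m a b / 2 \<in> {0..<1}" using m_bounds[OF ab(1,2)] by auto
    have "\<Psi> (a, b) \<in> ?D" using wall_points[OF ab(1-3) r] by (simp add: \<Psi>_def)
    moreover have "(a, b) \<in> T" using ab(3) d_J(2)[OF ab(1)] d_J(2)[OF ab(2)] by (simp add: T_def)
    ultimately have "\<Psi> (a, b) \<in> \<Psi> ` T \<inter> ?D" by blast
    moreover have "c = (\<lambda>(x, y, z). cfg x y z) (\<Psi> (a, b))" using ab(4) by (simp add: \<Psi>_def)
    ultimately show "c \<in> (\<lambda>(x, y, z). cfg x y z) ` (\<Psi> ` T \<inter> ?D)" by (rule rev_image_eqI)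
  next
    fix c assume "c \<in> (\<lambda>(x, y, z). cfg x y z) ` (\<Psi> ` T \<inter> ?D)"
    then obtain u where u: "c = (\<lambda>(x, y, z). cfg x y z) u" "u \<in> \<Psi> ` T \<inter> ?D" by (rule imageE)
    then obtain w where w': "w \<in> T" "u = \<Psi> w" by blast
    have w: "w \<in> T" "\<Psi> w \<in> ?D" "c = (\<lambda>(x, y, z). cfg x y z) (\<Psi> w)" using u w' by simp_all
    define a b where "a = fst w" and "b = snd w"
    have ab: "a \<in> {0..1}" "b \<in> {0..1}" "a \<le> b" using w(1) by (auto simp: T_def a_def b_def)
    have D: "e a \<noteq> e b" "e a \<noteq> f (m a b / 2)" "e b \<noteq> f (m a b / 2)"
      using w(2) by (auto simp: \<Psi>_def a_def b_def)
    have "a \<in> J"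
    proof (rule ccontr)
      assume "a \<notin> J"
      then have "d a = 0" "e a = v" using d_notJ[OF ab(1)] by auto
      then have "m a b = 0" using d_bounds[OF ab(2)] by (simp add: m_def)
      then show False using D(2) \<open>e a = v\<close> efg(5) by simp
    qed
    moreover have "b \<in> J"
    proof (rule ccontr)
      assume "b \<notin> J"
      then have "d b = 0" "e b = v" using d_notJ[OF ab(2)] by auto
      then have "m a b = 0" using d_bounds[OF ab(1)] by (simp add: m_def)
      then show False using D(3) \<open>e b = v\<close> efg(5) by simp
    qed
    moreover have "a < b" using ab(3) D(1) by (cases "a = b") auto
    moreover have "c = cfg (e a) (e b) (f (m a b / 2))" using w(3) by (simp add: \<Psi>_def a_def b_def)
    ultimately show "c \<in> wall" unfolding wall_def by auto
  qed
  show ?thesis unfolding eq by (rule closed_map_cfg[unfolded closed_map_def, rule_format, OF cZ])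
qed

text \<open>Wall configurations have two particles in the image of \<open>J\<close>; with at most
  one there, the particles can be moved without regard to the wall.\<close>

lemma not_wall_one:
  assumes "x \<notin> e ` J" "y \<notin> e ` J" "x \<noteq> y" "x \<noteq> z" "y \<noteq> z"
  shows "cfg x y z \<notin> wall"
proof
  assume "cfg x y z \<in> wall"
  then obtain a b where ab: "a \<in> J" "b \<in> J" "a < b" "cfg x y z = cfg (e a) (e b) (f (m a b / 2))"
    by (auto simp: wall_def)
  then have "{x, y, z} = {e a, e b, f (m a b / 2)}" using assms by (simp add: cfg_eq_iff)
  then have "e a \<in> {x, y, z}" "e b \<in> {x, y, z}" by auto
  moreover have "e a \<in> e ` J" "e b \<in> e ` J" using ab by auto
  ultimately have "e a = z" "e b = z" using assms(1,2) by auto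
  then show False using inj_onD[OF inj_eJ _ ab(1,2)] ab(3) by auto
qed

lemma not_wall_two:
  assumes "a \<in> J" "b \<in> J" "a < b" "x \<notin> e ` J" "x \<noteq> f (m a b / 2)"
  shows "cfg (e a) (e b) x \<notin> wall"
proof
  assume "cfg (e a) (e b) x \<in> wall"
  then obtain a' b' where ab: "a' \<in> J" "b' \<in> J" "a' < b'" "cfg (e a) (e b) x = cfg (e a') (e b') (f (m a' b' / 2))"
    by (auto simp: wall_def)
  have "e a \<noteq> e b" using inj_onD[OF inj_eJ _ assms(1,2)] assms(3) by auto
  moreover have "e a \<noteq> x" "e b \<noteq> x" using assms(1,2,4) by auto
  ultimately have eq: "{e a, e b, x} = {e a', e b', f (m a' b' / 2)}" using ab(4) by (simp add: cfg_eq_iff)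
  have "m a' b' / 2 \<in> {0..<1}" using m_bounds[OF ab(1,2)] by auto
  from wall_set_eq[OF assms(1-3) ab(1-3) assms(4) f_notin_eJ[OF this] eq] show False using assms(5) by simp
qed

abbreviation "U \<equiv> topspace (UC3 \<Gamma>) - wall"

lemma outward_move:
  assumes l: "l \<in> OE" and a: "0 < a" "a < 1" and yz: "y \<in> topspace \<Gamma>" "z \<in> topspace \<Gamma>" "y \<noteq> z"
    and av: "\<And>r. r \<in> {0..a} \<Longrightarrow> l r \<noteq> y \<and> l r \<noteq> z \<and> cfg (l r) y z \<notin> wall"
  shows "path_component_of (subtopology (UC3 \<Gamma>) U) (cfg (l 0) y z) (cfg (l a) y z)"
proof -
  have b: "a * t \<in> {0..a}" if "t \<in> {0..1}" for t using that a mult_left_mono[of t 1 a] by auto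
  have b1: "a * t \<in> {0..1}" if "t \<in> {0..1}" for t
    using b[OF that] less_imp_le[OF a(2)] unfolding atLeastAtMost_iff by (meson order_trans)
  have p: "pathin \<Gamma> (\<lambda>t. l (a * t))"
    by (rule pathin_compose_real[OF OE_props(1)[OF l] _ b1]) (auto intro!: continuous_intros)
  have "path_component_of (subtopology (UC3 \<Gamma>) U) (cfg (l (a * 0)) y z) (cfg (l (a * 1)) y z)"
  proof (rule path_component_cfg[OF p])
    fix t :: real assume t: "t \<in> {0..1}"
    have A: "l (a * t) \<noteq> y" "l (a * t) \<noteq> z" "cfg (l (a * t)) y z \<notin> wall" using av[OF b[OF t]] by auto
    then show "l (a * t) \<noteq> y \<and> l (a * t) \<noteq> z \<and> y \<noteq> z" using yz(3) by simp
    have "(l (a * t), y, z) \<in> topspace (ordered_triples \<Gamma>)"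
      using A yz OE_top[OF l b1[OF t]] by (simp add: topspace_ordered_triples)
    then have "cfg (l (a * t)) y z \<in> topspace (UC3 \<Gamma>)" unfolding topspace_UC3 by (rule rev_image_eqI) simp
    then show "cfg (l (a * t)) y z \<in> U" using A by simp
  qed (use yz in auto)
  then show ?thesis by simp
qed

text \<open>The excluded case \<open>s + t = 1\<close> does occur: \<open>l'\<close> may be the
  reverse of \<open>l\<close>, when both are ends of one loop.\<close>

lemma lane_ne:
  assumes "l \<in> OE" "l' \<in> OE" "l 0 = v" "l' 0 = v" "l \<noteq> l'" "0 \<le> s" "s < 1" "0 < t" "t < 1" "s + t \<noteq> 1"
  shows "l s \<noteq> l' t"
proof (cases "s = 0")
  case True
  have "l' t \<notin> V" using OE_V_iff[OF assms(2), of t] assms(8,9) by auto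
  then show ?thesis using True assms(3) v_V by metis
next
  case False
  then have "s \<in> {0<..<1}" "t \<in> {0<..<1}" using assms by auto
  then show ?thesis using OE_meet[OF assms(1,2,5)] assms(10) by metis
qed

text \<open>The third particle withdraws to \<open>g\<close>, the nearer particle on
  \<open>e\<close> leaves for the far position \<open>F'\<close> on \<open>f\<close>, and the one on
  \<open>g\<close> takes its place on \<open>e\<close>. As configurations are unordered, the result
  is the initial one with the third particle beyond the wall.\<close>

lemma sides_connected:
  "path_component_of (subtopology (UC3 \<Gamma>) U) (h (1/4, 1/2, 1/4)) (h (1/4, 1/2, 3/4))"
proof -
  let ?R = "path_component_of (subtopology (UC3 \<Gamma>) U)"
  \<comment> \<open>With \<open>A\<close> at 1/4 and \<open>B\<close> at 1/2 the nearer distance is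
    1/4 and the wall sits at 1/8 on \<open>f\<close>; \<open>F\<close> at 1/16 and \<open>F'\<close>
    at 3/16 lie on its two sides. All parameters on \<open>f\<close> and \<open>g\<close> are small,
    so no two add up to 1.\<close>
  define A B F G F' where "A = e (1/4)" and "B = e (1/2)" and "F = f (1/16)" and "G = g (1/16)" and "F' = f (3/16)"
  have J: "1/4 \<in> J" "1/2 \<in> J" by (auto intro: small_J)
  have dd: "d (1/4) = 1/4" "d (1/2) = 1/2" using d_small by auto
  have m1: "m a (1/2) = a" if "a \<le> 1/2" for a using d_small[OF that] dd that by (simp add: m_def)
  have top: "A \<in> topspace \<Gamma>" "B \<in> topspace \<Gamma>" "F \<in> topspace \<Gamma>" "G \<in> topspace \<Gamma>" "F' \<in> topspace \<Gamma>"
    unfolding A_def B_def F_def G_def F'_def using OE_top efg(1-3) by auto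
  have ABJ: "A \<in> e ` J" "B \<in> e ` J" unfolding A_def B_def using J by auto
  have AB: "A \<noteq> B" unfolding A_def B_def using wall_points(1)[OF J, of 0] by simp
  have nJ: "F \<notin> e ` J" "G \<notin> e ` J" "F' \<notin> e ` J"
    unfolding F_def G_def F'_def using f_notin_eJ g_notin_eJ by auto
  have ne': "A \<noteq> F" "A \<noteq> G" "A \<noteq> F'" "B \<noteq> F" "B \<noteq> G" "B \<noteq> F'" using nJ ABJ by auto
  have GF: "G \<noteq> F'" unfolding G_def F'_def using lane_ne[OF efg(3,2,6,5), of "1/16" "3/16"] ne(1) by auto
  have fJ: "f r \<notin> e ` J" "g r \<notin> e ` J" if "0 \<le> r" "r < 1" for r
    using f_notin_eJ g_notin_eJ that by auto
  have finj: "f r \<noteq> f s" if "0 \<le> r" "r < 1" "0 < s" "s < 1" "r \<noteq> s" for r s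
  proof (cases "r = 0")
    case True
    have "f s \<notin> V" using OE_V_iff[OF efg(2), of s] that by auto
    then show ?thesis using True efg(5) v_V by metis
  next
    case False
    then show ?thesis using inj_onD[OF OE_props(4)[OF efg(2)], of r s] that by auto
  qed
  have gf: "g r \<noteq> f s" if "0 \<le> r" "r < 1" "0 < s" "s < 1" "r + s \<noteq> 1" for r s
    using lane_ne[OF efg(3,2,6,5)] ne(1) that by auto
  have fg: "f r \<noteq> g s" if "0 \<le> r" "r < 1" "0 < s" "s < 1" "r + s \<noteq> 1" for r s
    using lane_ne[OF efg(2,3,5,6)] ne(1) that by auto
  have swap: "cfg x A B = cfg A B x" for x
    using cfg_swap[of x A B] cfg_swap'[of A x B] by simp
  have "?R (cfg (f 0) A B) (cfg (f (1/16)) A B)"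
  proof (rule outward_move[OF efg(2)])
    fix r :: real assume "r \<in> {0..1/16}"
    then have r: "0 \<le> r" "r < 1" "r \<noteq> 1/8" by auto
    have "f r \<noteq> f (m (1/4) (1/2) / 2)" using finj[OF r(1,2), of "1/8"] r(3) by (simp add: m1)
    from not_wall_two[OF J _ fJ(1)[OF r(1,2)] this] have "cfg (f r) A B \<notin> wall"
      unfolding swap by (simp add: A_def B_def)
    then show "f r \<noteq> A \<and> f r \<noteq> B \<and> cfg (f r) A B \<notin> wall" using fJ(1)[OF r(1,2)] ABJ by auto
  qed (use top AB in auto)
  then have 1: "?R (cfg v A B) (cfg F A B)" unfolding efg(5) F_def[symmetric] .
  have "?R (cfg (g 0) A B) (cfg (g (1/16)) A B)"
  proof (rule outward_move[OF efg(3)])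
    fix r :: real assume "r \<in> {0..1/16}"
    then have r: "0 \<le> r" "r < 1" "r + 1/8 \<noteq> 1" by auto
    have "g r \<noteq> f (m (1/4) (1/2) / 2)" using gf[OF r(1,2), of "1/8"] r(3) by (simp add: m1)
    from not_wall_two[OF J _ fJ(2)[OF r(1,2)] this] have "cfg (g r) A B \<notin> wall"
      unfolding swap by (simp add: A_def B_def)
    then show "g r \<noteq> A \<and> g r \<noteq> B \<and> cfg (g r) A B \<notin> wall" using fJ(2)[OF r(1,2)] ABJ by auto
  qed (use top AB in auto)
  then have 2: "?R (cfg v A B) (cfg G A B)" unfolding efg(6) G_def[symmetric] .
  \<comment> \<open>While the particle moves from \<open>v\<close> to 1/4 on \<open>e\<close>, it is
    nearer than \<open>B\<close>, so the wall position runs over \<open>f (a / 2)\<close> for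
    \<open>a\<close> up to 1/4. A third particle \<open>Z\<close> away from these points keeps the
    motion off the wall.\<close>
  have inward: "?R (cfg v B Z) (cfg A B Z)"
    if Z: "Z \<in> topspace \<Gamma>" "Z \<notin> e ` J" "Z \<noteq> v" "\<And>a. 0 < a \<Longrightarrow> a \<le> 1/4 \<Longrightarrow> Z \<noteq> f (a / 2)" for Z
  proof -
    have "?R (cfg (e 0) B Z) (cfg (e (1/4)) B Z)"
    proof (rule outward_move[OF efg(1)])
      have BZ: "B \<noteq> Z" using Z(2) ABJ by auto
      then show "B \<noteq> Z" .
      fix r :: real assume r: "r \<in> {0..1/4}"
      show "e r \<noteq> B \<and> e r \<noteq> Z \<and> cfg (e r) B Z \<notin> wall"
      proof (cases "r = 0")
        case True
        have "v \<noteq> B" using v_notin_eJ ABJ by auto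
        moreover have "cfg v Z B \<notin> wall"
          using Z BZ v_notin_eJ ABJ by (intro not_wall_one) auto
        then have "cfg v B Z \<notin> wall" by (simp add: cfg_swap'[of v B Z])
        ultimately show ?thesis using True efg(4) Z(3) by auto
      next
        case False
        then have r': "0 < r" "r \<le> 1/4" "r < 1/2" "r \<le> 1/2" using r by auto
        have rJ: "r \<in> J" using small_J r' by auto
        have "Z \<noteq> f (m r (1/2) / 2)" using Z(4)[OF r'(1,2)] by (simp add: m1[OF r'(4)])
        from not_wall_two[OF rJ J(2) r'(3) Z(2) this] have "cfg (e r) B Z \<notin> wall" by (simp add: B_def)
        moreover have "e r \<noteq> B" unfolding B_def using wall_points(1)[OF rJ J(2) r'(3), of 0] by simp
        moreover have "e r \<noteq> Z" using Z(2) rJ by auto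
        ultimately show ?thesis by simp
      qed
    qed (use top Z in auto)
    then show ?thesis unfolding efg(4) A_def[symmetric] .
  qed
  have Gv: "G \<noteq> v" "F' \<noteq> v"
    unfolding G_def F'_def using OE_V_iff[OF efg(3), of "1/16"] OE_V_iff[OF efg(2), of "3/16"] v_V by auto
  have 3: "?R (cfg v B G) (cfg A B G)"
  proof (rule inward[OF top(4) nJ(2) Gv(1)])
    fix a :: real assume "0 < a" "a \<le> 1/4"
    then show "G \<noteq> f (a / 2)" unfolding G_def by (intro gf) auto
  qed
  have 5: "?R (cfg v B F') (cfg A B F')"
  proof (rule inward[OF top(5) nJ(3) Gv(2)])
    fix a :: real assume "0 < a" "a \<le> 1/4"
    then show "F' \<noteq> f (a / 2)" unfolding F'_def by (intro finj) auto
  qed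
  have "?R (cfg (f 0) B G) (cfg (f (3/16)) B G)"
  proof (rule outward_move[OF efg(2)])
    fix r :: real assume "r \<in> {0..3/16}"
    then have r: "0 \<le> r" "r < 1" "r + 1/16 \<noteq> 1" by auto
    have G: "f r \<noteq> G" unfolding G_def using fg[OF r(1,2), of "1/16"] r(3) by simp
    have "f r \<noteq> B" using fJ(1)[OF r(1,2)] ABJ by auto
    moreover have "cfg (f r) G B \<notin> wall"
      using fJ(1)[OF r(1,2)] nJ(2) G \<open>f r \<noteq> B\<close> ne'(5) by (intro not_wall_one) auto
    ultimately show "f r \<noteq> B \<and> f r \<noteq> G \<and> cfg (f r) B G \<notin> wall" using G by (simp add: cfg_swap'[of _ B G])
  qed (use top ne' in auto)
  then have 4: "?R (cfg v B G) (cfg F' B G)" unfolding efg(5) F'_def[symmetric] .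
  have "?R (cfg (g 0) B F') (cfg (g (1/16)) B F')"
  proof (rule outward_move[OF efg(3)])
    fix r :: real assume "r \<in> {0..1/16}"
    then have r: "0 \<le> r" "r < 1" "r + 3/16 \<noteq> 1" by auto
    have G: "g r \<noteq> F'" unfolding F'_def using gf[OF r(1,2), of "3/16"] r(3) by simp
    have "g r \<noteq> B" using fJ(2)[OF r(1,2)] ABJ by auto
    moreover have "cfg (g r) F' B \<notin> wall"
      using fJ(2)[OF r(1,2)] nJ(3) G \<open>g r \<noteq> B\<close> ne'(6) by (intro not_wall_one) auto
    ultimately show "g r \<noteq> B \<and> g r \<noteq> F' \<and> cfg (g r) B F' \<notin> wall" using G by (simp add: cfg_swap'[of _ B F'])
  qed (use top ne' in auto)
  then have 6: "?R (cfg v B F') (cfg G B F')" unfolding efg(6) G_def[symmetric] .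
  have eq46: "cfg F' B G = cfg G B F'"
    using cfg_swap[of F' B G] cfg_swap'[of B F' G] cfg_swap[of B G F'] by simp
  note t = path_component_of_trans and y = path_component_of_sym
  have "?R (cfg A B F) (cfg A B G)" using t[OF y[OF 1] 2] unfolding swap .
  then have "?R (cfg A B F) (cfg F' B G)" by (rule t[OF t[OF _ y[OF 3]] 4])
  then have "?R (cfg A B F) (cfg G B F')" unfolding eq46 .
  then have "?R (cfg A B F) (cfg v B F')" by (rule t[OF _ y[OF 6]])
  then have "?R (cfg A B F) (cfg A B F')" by (rule t[OF _ 5])
  moreover have "h (1/4, 1/2, 1/4) = cfg A B F" "h (1/4, 1/2, 3/4) = cfg A B F'"
    by (simp_all add: h_eq m1 A_def B_def F_def F'_def)
  ultimately show ?thesis by simp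
qed

text \<open>The collar and its sides are the images of the convex sets \<open>K 0 1\<close>,
  \<open>K 0 (1/2)\<close> and \<open>K (1/2) 1\<close>, which makes all three simply connected at
  once; the wall is the slice between the sides.\<close>

theorem UC3_free_factor:
  assumes S: "S \<in> topspace (UC3 \<Gamma>)"
  shows "\<exists>H :: (real \<Rightarrow> (nat \<Rightarrow> 'a) set) set monoid.
    group H \<and> fundamental_group (UC3 \<Gamma>) S \<cong> free_product H integer_group"
proof -
  let ?X = "UC3 \<Gamma>" and ?A = "h ` K 0 (1/2)" and ?B = "h ` K (1/2) 1" and ?W = "h ` K 0 1"
  let ?x0 = "h (1/4, 1/2, 1/4)" and ?x1 = "h (1/4, 1/2, 3/4)"
  have chart: "path_unique (subtopology ?X (h ` K p q))" "path_connected_space (subtopology ?X (h ` K p q))"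
    "openin ?X (h ` K p q)" if "0 \<le> p" "q \<le> 1" for p q
  proof -
    have sub: "K p q \<subseteq> K 0 1" using that by (rule K_mono)
    have "continuous_map (top_of_set (K p q)) ?X h"
      using continuous_map_from_subtopology[OF continuous_h, of "K p q"] sub
      by (simp add: subtopology_subtopology Int_absorb1)
    note C = convex_chart[OF convex_K this inj_on_subset[OF inj_h sub] open_h[OF _ that]]
    show "path_unique (subtopology ?X (h ` K p q))" "path_connected_space (subtopology ?X (h ` K p q))"
      "openin ?X (h ` K p q)" using C by auto
  qed
  have wall_eq: "wall = h ` {(a, b, s). a \<in> J \<and> b \<in> J \<and> a < b \<and> s = 1/2}"
  proof -
    have eq: "{(a, b, s). a \<in> J \<and> b \<in> J \<and> a < b \<and> s = c} = (\<lambda>(a, b). (a, b, c)) ` {(a, b). a \<in> J \<and> b \<in> J \<and> a < b}"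
      for c :: real by auto
    show ?thesis unfolding wall_def eq image_image by (rule image_cong) (auto simp: h_eq)
  qed
  have W_sub: "wall \<subseteq> ?W" unfolding wall_eq by (rule image_mono) (auto simp: K_mem)
  have W_eq: "?W = ?A \<union> ?B \<union> wall"
  proof -
    have "K 0 1 = K 0 (1/2) \<union> K (1/2) 1 \<union> {(a, b, s). a \<in> J \<and> b \<in> J \<and> a < b \<and> s = 1/2}"
      by (auto simp: K_def)
    then show ?thesis unfolding wall_eq by (simp only: image_Un)
  qed
  have disj: "h ` P \<inter> h ` Q = {}" if "P \<subseteq> K 0 1" "Q \<subseteq> K 0 1" "P \<inter> Q = {}" for P Q
    using inj_on_image_Int[OF inj_h that(1,2)] that(3) by simp
  have sub: "K 0 (1/2) \<subseteq> K 0 1" "K (1/2) 1 \<subseteq> K 0 1"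
    "{(a, b, s). a \<in> J \<and> b \<in> J \<and> a < b \<and> s = 1/2} \<subseteq> K 0 1" by (auto simp: K_def)
  have AB: "?A \<inter> ?B = {}" by (rule disj[OF sub(1,2)]) (auto simp: K_def)
  have Aw: "?A \<inter> wall = {}" unfolding wall_eq by (rule disj[OF sub(1,3)]) (auto simp: K_def)
  have Bw: "?B \<inter> wall = {}" unfolding wall_eq by (rule disj[OF sub(2,3)]) (auto simp: K_def)
  have oW: "openin ?X ?W" and oA: "openin ?X ?A" and oB: "openin ?X ?B" by (rule chart(3); simp)+
  have oU: "openin ?X U" using closed_wall by (simp add: openin_diff)
  have aux: "(T - w) \<inter> W = A \<union> B" if "W \<subseteq> T" "W = A \<union> B \<union> w" "A \<inter> w = {}" "B \<inter> w = {}"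
    for T w W A B :: "(nat \<Rightarrow> 'a) set set" using that by blast
  have UW: "U \<inter> ?W = ?A \<union> ?B" by (rule aux[OF openin_subset[OF oW] W_eq Aw Bw])
  have aux2: "T \<subseteq> (T - w) \<union> W" if "w \<subseteq> W" for T w W :: "(nat \<Rightarrow> 'a) set set" using that by blast
  have cov: "topspace ?X \<subseteq> U \<union> ?W" by (rule aux2[OF W_sub])
  have J: "1/4 \<in> J" "1/2 \<in> J" by (auto intro: small_J)
  have x0: "?x0 \<in> ?A" and x1: "?x1 \<in> ?B" using J by (auto intro!: imageI simp: K_mem)
  obtain e0 where e0: "e0 \<in> E" using OE_E[OF efg(1)] by blast
  have pcX: "path_connected_space ?X" by (rule path_connected_UC3[OF conn e0])
  have pcU: "path_connected_space (subtopology ?X U)"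
    by (rule path_connected_complement[OF pcX oU oW cov UW _ _ x0 x1 sides_connected]; rule chart(2); simp)
  have split: "fundamental_group ?X ?x0 \<cong> free_product (fundamental_group (subtopology ?X U) ?x0) integer_group"
    by (rule fundamental_group_split[OF oU oW oA oB cov UW AB x0 x1 pcU]; rule chart; simp)
  have x0U: "?x0 \<in> U" using UnI1[OF x0, of ?B] unfolding UW[symmetric] by (rule IntD1)
  then have "fundamental_group ?X S \<cong> fundamental_group ?X ?x0"
    using S by (intro fundamental_group_base_change[OF pcX]) auto
  from iso_trans[OF this split] have "fundamental_group ?X S \<cong> free_product (fundamental_group (subtopology ?X U) ?x0) integer_group" .
  moreover have "group (fundamental_group (subtopology ?X U) ?x0)"
    using x0U by (intro group_fundamental_group) auto
  ultimately show ?thesis by blast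
qed

end

section \<open>Crossing homomorphisms: reading labels when a particle passes a point\<close>

section \<open>Counting crossings\<close>

text \<open>\<open>D\<close> plays the distance to its zero, of which there is at most one. The last
  clause makes \<open>lab\<close> constant on path components of the punctured neighbourhood
  \<open>0 < D < 1\<close>, that is, a labelling of the lanes at that point.\<close>

definition crossing_label :: "'a topology \<Rightarrow> ('q, 'm) monoid_scheme \<Rightarrow> ('a \<Rightarrow> real) \<Rightarrow> ('a \<Rightarrow> 'q) \<Rightarrow> bool" where
  "crossing_label \<Gamma> Q D lab \<longleftrightarrow> group Q \<and> continuous_map \<Gamma> euclideanreal D \<and>
     (\<forall>x\<in>topspace \<Gamma>. 0 \<le> D x) \<and> (\<forall>x\<in>topspace \<Gamma>. \<forall>y\<in>topspace \<Gamma>. D x = 0 \<longrightarrow> D y = 0 \<longrightarrow> x = y) \<and>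
     (\<forall>x. lab x \<in> carrier Q) \<and>
     (\<forall>p. pathin \<Gamma> p \<longrightarrow> (\<forall>t\<in>{0..1}. 0 < D (p t) \<and> D (p t) < 1) \<longrightarrow> lab (p 0) = lab (p 1))"

text \<open>
  The lane label of the particle closest to the zero of \<open>D\<close> is locally constant as long as no
  particle sits at that zero; it jumps exactly when a particle crosses.
\<close>

lemma crossing_transport:
  assumes cl: "crossing_label \<Gamma> Q D lab"
  obtains T where "transport (UC3 \<Gamma>) Q T"
    "\<And>p q r. pathin \<Gamma> p \<Longrightarrow> pathin \<Gamma> q \<Longrightarrow> pathin \<Gamma> r \<Longrightarrow>
       (\<And>t. t \<in> {0..1} \<Longrightarrow> p t \<noteq> q t \<and> p t \<noteq> r t \<and> q t \<noteq> r t \<and> D (p t) \<noteq> 0 \<and> D (q t) \<noteq> 0 \<and> D (r t) \<noteq> 0) \<Longrightarrow>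
       T (\<lambda>t. cfg (p t) (q t) (r t)) = \<one>\<^bsub>Q\<^esub>"
    "\<And>p y z. pathin \<Gamma> p \<Longrightarrow> y \<in> topspace \<Gamma> \<Longrightarrow> z \<in> topspace \<Gamma> \<Longrightarrow> y \<noteq> z \<Longrightarrow>
       (\<And>t. t \<in> {0..1} \<Longrightarrow> D (p t) < D y \<and> D (p t) < D z \<and> D (p t) < 1) \<Longrightarrow>
       T (\<lambda>t. cfg (p t) y z) = inv\<^bsub>Q\<^esub> (lab (p 0)) \<otimes>\<^bsub>Q\<^esub> lab (p 1)"
proof -
  have gQ: "group Q" and Dc: "continuous_map \<Gamma> euclideanreal D" and D0: "\<And>x. x \<in> topspace \<Gamma> \<Longrightarrow> 0 \<le> D x"
    and Du: "\<And>x y. x \<in> topspace \<Gamma> \<Longrightarrow> y \<in> topspace \<Gamma> \<Longrightarrow> D x = 0 \<Longrightarrow> D y = 0 \<Longrightarrow> x = y"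
    and lc: "\<And>x. lab x \<in> carrier Q"
    and ll: "\<And>p. pathin \<Gamma> p \<Longrightarrow> (\<And>t. t \<in> {0..1} \<Longrightarrow> 0 < D (p t) \<and> D (p t) < 1) \<Longrightarrow> lab (p 0) = lab (p 1)"
    using cl by (auto simp: crossing_label_def)
  interpret Q: group Q by (rule gQ)
  let ?T3 = "ordered_triples \<Gamma>" and ?X = "UC3 \<Gamma>" and ?c = "\<lambda>(x, y, z). cfg x y z"
  \<comment> \<open>In \<open>S0\<close> the first particle is strictly nearest and at distance less
    than 1, in \<open>S1\<close> no particle sits at the zero. A configuration with a particle at
    the zero comes from \<open>S0\<close> after reordering, since no second particle can be
    there.\<close>
  define S0 where "S0 = {w \<in> topspace ?T3. D (fst w) < D (fst (snd w)) \<and> D (fst w) < D (snd (snd w)) \<and> D (fst w) < 1}"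
  define S1 where "S1 = {w \<in> topspace ?T3. D (fst w) \<noteq> 0 \<and> D (fst (snd w)) \<noteq> 0 \<and> D (snd (snd w)) \<noteq> 0}"
  have pj: "continuous_map ?T3 \<Gamma> fst" "continuous_map ?T3 \<Gamma> (fst \<circ> snd)" "continuous_map ?T3 \<Gamma> (snd \<circ> snd)"
    unfolding ordered_triples_def
    by (intro continuous_map_from_subtopology continuous_map_compose[OF continuous_map_snd]
        continuous_map_fst continuous_map_snd)+
  have c1: "continuous_map ?T3 euclideanreal (\<lambda>w. D (fst w))"
    using continuous_map_compose[OF pj(1) Dc] by (simp add: comp_def)
  have c2: "continuous_map ?T3 euclideanreal (\<lambda>w. D (fst (snd w)))"
    using continuous_map_compose[OF pj(2) Dc] by (simp add: comp_def)
  have c3: "continuous_map ?T3 euclideanreal (\<lambda>w. D (snd (snd w)))"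
    using continuous_map_compose[OF pj(3) Dc] by (simp add: comp_def)
  have pre: "openin ?T3 {w \<in> topspace ?T3. f w \<in> A}" if "continuous_map ?T3 euclideanreal f" "open A" for f A
    using openin_continuous_map_preimage[OF that(1)] that(2) by simp
  have oS0: "openin ?T3 S0"
  proof -
    have "S0 = {w \<in> topspace ?T3. D (fst (snd w)) - D (fst w) \<in> {0<..}} \<inter>
        {w \<in> topspace ?T3. D (snd (snd w)) - D (fst w) \<in> {0<..}} \<inter> {w \<in> topspace ?T3. D (fst w) \<in> {..<1}}"
      by (auto simp: S0_def)
    then show ?thesis
      using pre[OF continuous_map_diff[OF c2 c1], of "{0<..}"] pre[OF continuous_map_diff[OF c3 c1], of "{0<..}"]
        pre[OF c1, of "{..<1}"] by (simp add: openin_Int)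
  qed
  have oS1: "openin ?T3 S1"
  proof -
    have eq: "S1 = {w \<in> topspace ?T3. D (fst w) \<in> - {0}} \<inter> {w \<in> topspace ?T3. D (fst (snd w)) \<in> - {0}} \<inter>
        {w \<in> topspace ?T3. D (snd (snd w)) \<in> - {0}}"
      by (auto simp: S1_def)
    have op: "open (- {0::real})" by auto
    show ?thesis unfolding eq by (intro openin_Int pre[OF c1 op] pre[OF c2 op] pre[OF c3 op])
  qed
  have om: "openin ?X (?c ` S)" if "openin ?T3 S" for S
    by (rule open_map_cfg[unfolded open_map_def, rule_format, OF that])
  let ?V0 = "?c ` S0" and ?V1 = "?c ` S1"
  have cov: "topspace ?X \<subseteq> ?V0 \<union> ?V1"
  proof
    fix c assume "c \<in> topspace ?X"
    then obtain x y z where c: "c = cfg x y z" and t: "x \<in> topspace \<Gamma>" "y \<in> topspace \<Gamma>" "z \<in> topspace \<Gamma>"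
      and d: "x \<noteq> y" "x \<noteq> z" "y \<noteq> z" by (rule UC3_cases)
    have hit: "cfg a b b' \<in> ?V0" if "a \<in> topspace \<Gamma>" "b \<in> topspace \<Gamma>" "b' \<in> topspace \<Gamma>" "a \<noteq> b" "a \<noteq> b'" "b \<noteq> b'" "D a = 0" for a b b'
    proof -
      have "D b > 0" "D b' > 0" using D0 Du that by (metis less_eq_real_def)+
      then have "(a, b, b') \<in> S0" using that by (simp add: S0_def topspace_ordered_triples)
      then show ?thesis by (rule rev_image_eqI) simp
    qed
    consider "D x = 0" | "D y = 0" | "D z = 0" | "D x \<noteq> 0" "D y \<noteq> 0" "D z \<noteq> 0" by blast
    then show "c \<in> ?V0 \<union> ?V1"
    proof cases
      case 1 then show ?thesis using hit[OF t d] c by simp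
    next
      case 2 then show ?thesis using hit[of y x z] t d c cfg_swap[of x y z] by auto
    next
      case 3
      have "cfg x y z = cfg z x y" using cfg_swap'[of x y z] cfg_swap[of x z y] by simp
      then show ?thesis using 3 hit[of z x y] t d c by auto
    next
      case 4
      then have "(x, y, z) \<in> S1" using t d by (simp add: S1_def topspace_ordered_triples)
      then have "c \<in> ?V1" unfolding c by (rule rev_image_eqI) simp
      then show ?thesis by simp
    qed
  qed
  define nearest where "nearest c = (SOME x. x \<in> pts c \<and> (\<forall>y\<in>pts c. y \<noteq> x \<longrightarrow> D x < D y))" for c
  have near: "nearest (?c w) = fst w" if w: "w \<in> S0" for w
  proof -
    obtain x y z where w': "w = (x, y, z)" by (cases w)
    have *: "D x < D y" "D x < D z" using w by (auto simp: S0_def w')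
    show ?thesis unfolding nearest_def w' prod.case pts_cfg fst_conv
    proof (rule some_equality)
      show "x \<in> {x, y, z} \<and> (\<forall>y\<in>{x, y, z}. y \<noteq> x \<longrightarrow> D x < D y)" using * by auto
      fix u assume u: "u \<in> {x, y, z} \<and> (\<forall>y\<in>{x, y, z}. y \<noteq> u \<longrightarrow> D u < D y)"
      show "u = x"
      proof (rule ccontr)
        assume "u \<noteq> x"
        then have "D u < D x" "D x < D u" using u * by auto
        then show False by simp
      qed
    qed
  qed
  \<comment> \<open>On ordered triples in \<open>S0\<close> the nearest particle is the first
    coordinate, and the open map to unordered configurations restricts to a quotient map; so
    continuity descends.\<close>
  have nc: "continuous_map (subtopology ?X ?V0) \<Gamma> nearest"
  proof -
    let ?S = "subtopology ?T3 S0" and ?Y = "subtopology ?X ?V0"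
    have topS: "topspace ?S = S0" using openin_subset[OF oS0] by auto
    have cc: "continuous_map ?S ?Y ?c"
      using continuous_map_from_subtopology[OF continuous_map_cfg3, of \<Gamma> S0] topS
      by (auto simp: continuous_map_in_subtopology)
    have "open_map ?S ?Y ?c"
      unfolding open_map_def
    proof (intro allI impI)
      fix N assume N: "openin ?S N"
      then have "openin ?T3 N" by (rule openin_trans_full[OF _ oS0])
      moreover have "N \<subseteq> S0" using openin_subset[OF N] topS by simp
      ultimately show "openin ?Y (?c ` N)"
        using om[of N] by (simp add: openin_open_subtopology[OF om[OF oS0]] image_mono)
    qed
    moreover have "?c ` topspace ?S = topspace ?Y" using openin_subset[OF om[OF oS0]] unfolding topS by auto
    ultimately have q: "quotient_map ?S ?Y ?c" by (rule continuous_open_imp_quotient_map[OF cc])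
    have "continuous_map ?S \<Gamma> (nearest \<circ> ?c)"
    proof (rule continuous_map_eq[of _ _ fst])
      show "continuous_map ?S \<Gamma> fst" by (rule continuous_map_from_subtopology[OF pj(1)])
      show "fst w = (nearest \<circ> ?c) w" if "w \<in> topspace ?S" for w
        using near[of w] that unfolding topS by (simp only: comp_def)
    qed
    then show ?thesis by (rule continuous_compose_quotient_map[OF q])
  qed
  define V where "V i = (if i then ?V0 else ?V1)" for i :: bool
  \<comment> \<open>Over \<open>?V0\<close> the coboundary of the label of the nearest particle,
    over \<open>?V1\<close> the trivial functor. On the overlap the nearest particle stays in the
    punctured neighbourhood, so its label does not change and the two agree.\<close>
  define T0 where "T0 i = (if i then (\<lambda>p :: real \<Rightarrow> (nat \<Rightarrow> 'a) set. inv\<^bsub>Q\<^esub> (lab (nearest (p 0))) \<otimes>\<^bsub>Q\<^esub> lab (nearest (p 1))) else (\<lambda>p. \<one>\<^bsub>Q\<^esub>))" for i :: bool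
  have agree: "T0 True p = T0 False p" if p: "pathin (subtopology ?X (?V0 \<inter> ?V1)) p" for p
  proof -
    have p0: "pathin (subtopology ?X ?V0) p" using p by (simp add: pathin_subtopology)
    have np: "pathin \<Gamma> (nearest \<circ> p)" by (rule pathin_compose[OF p0 nc])
    have "0 < D ((nearest \<circ> p) t) \<and> D ((nearest \<circ> p) t) < 1" if t: "t \<in> {0..1}" for t
    proof -
      have "p t \<in> ?V0" "p t \<in> ?V1" using p t by (auto simp: pathin_subtopology)
      then have t0: "p t \<in> ?V0" and t1: "p t \<in> ?V1" by simp_all
      obtain w where w: "p t = ?c w" "w \<in> S0" using t0 by (rule imageE)
      obtain w' where w': "p t = ?c w'" "w' \<in> S1" using t1 by (rule imageE)
      obtain x y z where x: "w = (x, y, z)" by (cases w)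
      obtain x' y' z' where x': "w' = (x', y', z')" by (cases w')
      have n: "nearest (p t) = x" using near[OF w(2)] w(1) x by simp
      have "pts (p t) = {x, y, z}" unfolding w(1) x by (simp add: pts_cfg)
      moreover have "pts (p t) = {x', y', z'}" unfolding w'(1) x' by (simp add: pts_cfg)
      ultimately have "x \<in> {x', y', z'}" by auto
      then have "D x \<noteq> 0" using w'(2) by (auto simp: S1_def x')
      moreover have "D x < 1" "x \<in> topspace \<Gamma>" using w(2) by (auto simp: S0_def x topspace_ordered_triples)
      ultimately show ?thesis using D0[of x] n by (simp add: less_le)
    qed
    from ll[OF np this] have "lab (nearest (p 0)) = lab (nearest (p 1))" by simp
    then show ?thesis using lc by (simp add: T0_def)
  qed
  interpret G: glue_data Q ?X UNIV V T0
  proof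
    show "openin ?X (V i)" for i using om[OF oS0] om[OF oS1] by (simp add: V_def)
    show "topspace ?X \<subseteq> (\<Union>i\<in>UNIV. V i)" using cov by (auto simp: V_def split: if_splits)
    show "transport (subtopology ?X (V i)) Q (T0 i)" for i
    proof (cases i)
      case True
      then show ?thesis unfolding V_def T0_def using transport_coboundary[OF gQ, of _ "\<lambda>c. lab (nearest c)"] lc by simp
    next
      case False
      then show ?thesis unfolding V_def T0_def by (simp add: transport_def)
    qed
    show "T0 i p = T0 j p" if "pathin (subtopology ?X (V i \<inter> V j)) p" for i j p
      using agree[of p] that by (cases i; cases j) (auto simp: V_def Int_commute)
  qed
  show ?thesis
  proof (rule that[OF G.transport_glued])
    fix p q r assume pqr: "pathin \<Gamma> p" "pathin \<Gamma> q" "pathin \<Gamma> r"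
      and d: "\<And>t. t \<in> {0..1} \<Longrightarrow> p t \<noteq> q t \<and> p t \<noteq> r t \<and> q t \<noteq> r t \<and> D (p t) \<noteq> 0 \<and> D (q t) \<noteq> 0 \<and> D (r t) \<noteq> 0"
    have "pathin ?X (\<lambda>t. cfg (p t) (q t) (r t))"
      unfolding pathin_def using pqr d by (intro continuous_map_cfg) (auto simp: pathin_def)
    moreover have "cfg (p t) (q t) (r t) \<in> ?V1" if t: "t \<in> {0..1}" for t
    proof -
      have "p t \<in> topspace \<Gamma>" "q t \<in> topspace \<Gamma>" "r t \<in> topspace \<Gamma>" using pathin_topspace[OF _ t] pqr by auto
      then have "(p t, q t, r t) \<in> S1" using d[OF t] by (simp add: S1_def topspace_ordered_triples)
      then show ?thesis by (rule rev_image_eqI) simp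
    qed
    ultimately have "pathin (subtopology ?X (V False)) (\<lambda>t. cfg (p t) (q t) (r t))"
      by (simp add: pathin_subtopology V_def)
    from G.glued_restrict[OF _ this] show "G.glued (\<lambda>t. cfg (p t) (q t) (r t)) = \<one>\<^bsub>Q\<^esub>" by (simp add: T0_def)
  next
    fix p y z assume p: "pathin \<Gamma> p" and yz: "y \<in> topspace \<Gamma>" "z \<in> topspace \<Gamma>" "y \<noteq> z"
      and d: "\<And>t. t \<in> {0..1} \<Longrightarrow> D (p t) < D y \<and> D (p t) < D z \<and> D (p t) < 1"
    have ne: "p t \<noteq> y \<and> p t \<noteq> z" if "t \<in> {0..1}" for t using d[OF that] by auto
    have in0: "(p t, y, z) \<in> S0" if t: "t \<in> {0..1}" for t
      using d[OF t] ne[OF t] yz pathin_topspace[OF p t] by (simp add: S0_def topspace_ordered_triples)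
    have "pathin ?X (\<lambda>t. cfg (p t) y z)"
      unfolding pathin_def using p yz ne by (intro continuous_map_cfg) (auto simp: pathin_def)
    moreover have "cfg (p t) y z \<in> ?V0" if t: "t \<in> {0..1}" for t
      using in0[OF t] by (rule rev_image_eqI) simp
    ultimately have P: "pathin (subtopology ?X (V True)) (\<lambda>t. cfg (p t) y z)"
      by (simp add: pathin_subtopology V_def)
    have "nearest (cfg (p 0) y z) = p 0" "nearest (cfg (p 1) y z) = p 1"
      using near[OF in0[of 0]] near[OF in0[of 1]] by simp_all
    then show "G.glued (\<lambda>t. cfg (p t) y z) = inv\<^bsub>Q\<^esub> (lab (p 0)) \<otimes>\<^bsub>Q\<^esub> lab (p 1)"
      using G.glued_restrict[OF _ P] by (simp add: T0_def)
  qed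
qed

text \<open>
  Cutting at parameter \<open>1/2\<close> isolates the part near \<open>\<rho> 0\<close>, where the moving particle is the closest one.
\<close>

definition cross_step :: "(real \<Rightarrow> 'a) \<Rightarrow> (real \<Rightarrow> 'a) \<Rightarrow> real \<Rightarrow> 'a" where
  "cross_step \<rho> \<rho>' = ((\<lambda>t. \<rho> (1 - t / 2)) \<diamondop> ((\<lambda>t. \<rho> ((1 - t) / 2)) \<diamondop> (\<lambda>t. \<rho>' (t / 2)))) \<diamondop> (\<lambda>t. \<rho>' ((1 + t) / 2))"

lemma cross_step_ends [simp]: "cross_step \<rho> \<rho>' 0 = \<rho> 1" "cross_step \<rho> \<rho>' 1 = \<rho>' 1"
  by (simp_all add: cross_step_def)

lemma loop_join_image:
  "t \<in> {0..1} \<Longrightarrow> (p \<diamondop> q) t \<in> p ` {0..1} \<union> q ` {0..1}"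
  by (auto simp: loop_join_def intro!: imageI)

lemma pathin_cross_parts:
  assumes "pathin X \<rho>"
  shows "pathin X (\<lambda>t. \<rho> (1 - t / 2))" "pathin X (\<lambda>t. \<rho> ((1 - t) / 2))" "pathin X (\<lambda>t. \<rho> (t / 2))"
    "pathin X (\<lambda>t. \<rho> ((1 + t) / 2))"
  by (rule pathin_compose_real[OF assms]; auto intro!: continuous_intros)+

lemma pathin_cross_step:
  assumes "pathin X \<rho>" "pathin X \<rho>'" "\<rho> 0 = \<rho>' 0"
  shows "pathin X (cross_step \<rho> \<rho>')"
  unfolding cross_step_def
  using assms pathin_cross_parts[OF assms(1)] pathin_cross_parts[OF assms(2)]
  by (intro pathin_join) auto

lemma cross_step_image:
  assumes "t \<in> {0..1}"
  shows "cross_step \<rho> \<rho>' t \<in> \<rho> ` {0..1} \<union> \<rho>' ` {0..1}"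
proof -
  have s: "(\<lambda>t. \<rho> (1 - t / 2)) ` {0..1} \<subseteq> \<rho> ` {0..1}" "(\<lambda>t. \<rho> ((1 - t) / 2)) ` {0..1} \<subseteq> \<rho> ` {0..1}"
    "(\<lambda>t. \<rho>' (t / 2)) ` {0..1} \<subseteq> \<rho>' ` {0..1}" "(\<lambda>t. \<rho>' ((1 + t) / 2)) ` {0..1} \<subseteq> \<rho>' ` {0..1}"
    by (auto intro!: imageI)
  have j: "(p \<diamondop> q) ` {0..1} \<subseteq> S" if "p ` {0..1} \<subseteq> S" "q ` {0..1} \<subseteq> S" for p q :: "real \<Rightarrow> 'a" and S
    by (rule order_trans[OF image_subsetI[OF loop_join_image] Un_least[OF that]])
  have "cross_step \<rho> \<rho>' ` {0..1} \<subseteq> \<rho> ` {0..1} \<union> \<rho>' ` {0..1}"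
    unfolding cross_step_def
    by (intro j le_supI1[OF s(1)] le_supI1[OF s(2)] le_supI2[OF s(3)] le_supI2[OF s(4)])
  then show ?thesis using assms by blast
qed

lemma cfg_join: "(\<lambda>t. cfg ((p \<diamondop> q) t) y z) = (\<lambda>t. cfg (p t) y z) \<diamondop> (\<lambda>t. cfg (q t) y z)"
  by (rule ext) (simp add: loop_join_def)

text \<open>On the outer pieces no particle meets the zero of \<open>D\<close>, so \<open>T1\<close>
  gives the neutral element. On the middle piece the moving particle is the nearest one, and
  \<open>T2\<close> returns the labels at the ends of that piece, the points at parameter
  1/2.\<close>

lemma cross_step_transport:
  fixes D :: "'a \<Rightarrow> real"
  assumes T: "transport (UC3 \<Gamma>) Q T" and gQ: "group Q"
    and T1: "\<And>p q r. pathin \<Gamma> p \<Longrightarrow> pathin \<Gamma> q \<Longrightarrow> pathin \<Gamma> r \<Longrightarrow>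
       (\<And>t. t \<in> {0..1} \<Longrightarrow> p t \<noteq> q t \<and> p t \<noteq> r t \<and> q t \<noteq> r t \<and> D (p t) \<noteq> 0 \<and> D (q t) \<noteq> 0 \<and> D (r t) \<noteq> 0) \<Longrightarrow>
       T (\<lambda>t. cfg (p t) (q t) (r t)) = \<one>\<^bsub>Q\<^esub>"
    and T2: "\<And>p y z. pathin \<Gamma> p \<Longrightarrow> y \<in> topspace \<Gamma> \<Longrightarrow> z \<in> topspace \<Gamma> \<Longrightarrow> y \<noteq> z \<Longrightarrow>
       (\<And>t. t \<in> {0..1} \<Longrightarrow> D (p t) < D y \<and> D (p t) < D z \<and> D (p t) < 1) \<Longrightarrow>
       T (\<lambda>t. cfg (p t) y z) = inv\<^bsub>Q\<^esub> (lab (p 0)) \<otimes>\<^bsub>Q\<^esub> lab (p 1)"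
    and lc: "\<And>x. lab x \<in> carrier Q"
    and \<rho>: "pathin \<Gamma> \<rho>" "pathin \<Gamma> \<rho>'" "\<rho> 0 = \<rho>' 0"
    and yz: "y \<in> topspace \<Gamma>" "z \<in> topspace \<Gamma>" "y \<noteq> z" "D y \<noteq> 0" "D z \<noteq> 0"
    and av: "\<And>s. s \<in> {0..1} \<Longrightarrow> \<rho> s \<noteq> y \<and> \<rho> s \<noteq> z \<and> \<rho>' s \<noteq> y \<and> \<rho>' s \<noteq> z"
    and nz: "\<And>s. s \<in> {0<..1} \<Longrightarrow> D (\<rho> s) \<noteq> 0 \<and> D (\<rho>' s) \<noteq> 0"
    and nr: "\<And>s. s \<in> {0..1/2} \<Longrightarrow> D (\<rho> s) < D y \<and> D (\<rho> s) < D z \<and> D (\<rho> s) < 1 \<and>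
                D (\<rho>' s) < D y \<and> D (\<rho>' s) < D z \<and> D (\<rho>' s) < 1"
  shows "T (\<lambda>t. cfg (cross_step \<rho> \<rho>' t) y z) = inv\<^bsub>Q\<^esub> (lab (\<rho> (1/2))) \<otimes>\<^bsub>Q\<^esub> lab (\<rho>' (1/2))"
proof -
  interpret Q: group Q by (rule gQ)
  note P = pathin_cross_parts[OF \<rho>(1)] and P' = pathin_cross_parts[OF \<rho>(2)]
  let ?A = "\<lambda>t. \<rho> (1 - t / 2)" and ?B = "(\<lambda>t. \<rho> ((1 - t) / 2)) \<diamondop> (\<lambda>t. \<rho>' (t / 2))" and ?C = "\<lambda>t. \<rho>' ((1 + t) / 2)"
  have pB: "pathin \<Gamma> ?B" using P(2) P'(3) \<rho>(3) by (intro pathin_join) auto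
  have pX: "pathin (UC3 \<Gamma>) (\<lambda>t. cfg (p t) y z)" if "pathin \<Gamma> p" "\<And>t. t \<in> {0..1} \<Longrightarrow> p t \<noteq> y \<and> p t \<noteq> z" for p
    unfolding pathin_def using that yz by (intro continuous_map_cfg) (auto simp: pathin_def)
  have avA: "?A t \<noteq> y \<and> ?A t \<noteq> z" if "t \<in> {0..1}" for t using av[of "1 - t / 2"] that by auto
  have avC: "?C t \<noteq> y \<and> ?C t \<noteq> z" if "t \<in> {0..1}" for t using av[of "(1 + t) / 2"] that by auto
  have nB: "D (?B t) < D y \<and> D (?B t) < D z \<and> D (?B t) < 1" if t: "t \<in> {0..1}" for t
  proof -
    have "?B t \<in> \<rho> ` {0..1/2} \<union> \<rho>' ` {0..1/2}" using t by (auto simp: loop_join_def intro!: imageI)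
    then show ?thesis using nr by auto
  qed
  have avB: "?B t \<noteq> y \<and> ?B t \<noteq> z" if "t \<in> {0..1}" for t
  proof -
    have "u \<noteq> y \<and> u \<noteq> z" if "D u < D y \<and> D u < D z \<and> D u < 1" for u using that by auto
    from this[OF nB[OF that]] show ?thesis .
  qed
  have TA: "T (\<lambda>t. cfg (?A t) y z) = \<one>\<^bsub>Q\<^esub>"
  proof (rule T1[OF P(1)])
    fix t :: real assume t: "t \<in> {0..1}"
    have "D (?A t) \<noteq> 0" using nz[of "1 - t / 2"] t by auto
    then show "?A t \<noteq> y \<and> ?A t \<noteq> z \<and> y \<noteq> z \<and> D (?A t) \<noteq> 0 \<and> D y \<noteq> 0 \<and> D z \<noteq> 0" using avA[OF t] yz by simp
  qed (use yz in auto)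
  have TC: "T (\<lambda>t. cfg (?C t) y z) = \<one>\<^bsub>Q\<^esub>"
  proof (rule T1[OF P'(4)])
    fix t :: real assume t: "t \<in> {0..1}"
    have "D (?C t) \<noteq> 0" using nz[of "(1 + t) / 2"] t by auto
    then show "?C t \<noteq> y \<and> ?C t \<noteq> z \<and> y \<noteq> z \<and> D (?C t) \<noteq> 0 \<and> D y \<noteq> 0 \<and> D z \<noteq> 0" using avC[OF t] yz by simp
  qed (use yz in auto)
  have TB: "T (\<lambda>t. cfg (?B t) y z) = inv\<^bsub>Q\<^esub> (lab (\<rho> (1/2))) \<otimes>\<^bsub>Q\<^esub> lab (\<rho>' (1/2))"
    using T2[OF pB yz(1-3) nB] by simp
  have pA: "pathin (UC3 \<Gamma>) (\<lambda>t. cfg (?A t) y z)" by (rule pX[OF P(1) avA])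
  have pBX: "pathin (UC3 \<Gamma>) (\<lambda>t. cfg (?B t) y z)" by (rule pX[OF pB avB])
  have pC: "pathin (UC3 \<Gamma>) (\<lambda>t. cfg (?C t) y z)" by (rule pX[OF P'(4) avC])
  have eq: "(\<lambda>t. cfg (cross_step \<rho> \<rho>' t) y z) = ((\<lambda>t. cfg (?A t) y z) \<diamondop> (\<lambda>t. cfg (?B t) y z)) \<diamondop> (\<lambda>t. cfg (?C t) y z)"
    unfolding cross_step_def cfg_join ..
  have j1: "T ((\<lambda>t. cfg (?A t) y z) \<diamondop> (\<lambda>t. cfg (?B t) y z)) = T (\<lambda>t. cfg (?A t) y z) \<otimes>\<^bsub>Q\<^esub> T (\<lambda>t. cfg (?B t) y z)"
    by (rule transport_join[OF T pA pBX]) simp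
  have pAB: "pathin (UC3 \<Gamma>) ((\<lambda>t. cfg (?A t) y z) \<diamondop> (\<lambda>t. cfg (?B t) y z))"
    by (rule pathin_join[OF pA pBX]) simp
  have "T (((\<lambda>t. cfg (?A t) y z) \<diamondop> (\<lambda>t. cfg (?B t) y z)) \<diamondop> (\<lambda>t. cfg (?C t) y z))
      = T ((\<lambda>t. cfg (?A t) y z) \<diamondop> (\<lambda>t. cfg (?B t) y z)) \<otimes>\<^bsub>Q\<^esub> T (\<lambda>t. cfg (?C t) y z)"
    by (rule transport_join[OF T pAB pC]) simp
  then show ?thesis unfolding eq j1 TA TB TC using lc by simp
qed

section \<open>A cycle, a branch vertex off the cycle, and two commuting braids\<close>

section \<open>Commuting braids from a cycle and a disjoint branch vertex\<close>

context graph_structure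
begin

text \<open>An interior point of an edge determines the edge and the parameter, so the prescriptions
  have to be compatible at end points only.\<close>

lemma graph_function:
  fixes F :: "(real \<Rightarrow> 'a) \<Rightarrow> real \<Rightarrow> 'b"
  assumes "\<And>e. e \<in> E \<Longrightarrow> F e 0 = G (e 0)" "\<And>e. e \<in> E \<Longrightarrow> F e 1 = G (e 1)"
  obtains f where "\<And>v. v \<in> V \<Longrightarrow> f v = G v" "\<And>e t. e \<in> E \<Longrightarrow> t \<in> {0..1} \<Longrightarrow> f (e t) = F e t"
proof -
  define P where "P x w \<longleftrightarrow> fst w \<in> E \<and> snd w \<in> {0<..<1} \<and> x = fst w (snd w)" for x :: 'a and w
  define f where "f x = (if x \<in> V then G x else (let w = SOME w. P x w in F (fst w) (snd w)))" for x
  have "f (e t) = F e t" if e: "e \<in> E" and t: "t \<in> {0..1}" for e t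
  proof (cases "t = 0 \<or> t = 1")
    case True
    then show ?thesis using assms[OF e] edge[OF e] by (auto simp: f_def)
  next
    case False
    then have t': "t \<in> {0<..<1}" using t by auto
    have nV: "e t \<notin> V" using OE_V_iff[OF E_OE[OF e] t] False by blast
    have "(SOME w. P (e t) w) = (e, t)"
    proof (rule some_equality)
      show "P (e t) (e, t)" using e t' by (simp add: P_def)
      fix w assume "P (e t) w"
      then have w: "fst w \<in> E" "snd w \<in> {0<..<1}" "e t = fst w (snd w)" by (auto simp: P_def)
      have "e = fst w"
      proof (rule ccontr)
        assume ne: "e \<noteq> fst w"
        then have "e ` {0<..<1} \<inter> fst w ` {0<..<1} = {}"
          using edges_disjoint e w(1) unfolding pairwise_def disjnt_def by blast
        moreover have "e t \<in> e ` {0<..<1}" using t' by (rule imageI)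
        moreover have "e t \<in> fst w ` {0<..<1}" unfolding w(3) using w(2) by (rule imageI)
        ultimately show False by blast
      qed
      moreover from this have "t = snd w"
        using w t' OE_props(4)[OF E_OE[OF e]] by (auto dest: inj_onD)
      ultimately show "w = (e, t)" by (cases w) simp
    qed
    then show ?thesis using nV by (simp add: f_def)
  qed
  then show ?thesis using that[of f] by (simp add: f_def)
qed

lemma openin_subedge:
  assumes "f \<in> OE" "0 \<le> a" "b \<le> 1"
  shows "openin \<Gamma> (f ` {a<..<b})"
proof -
  have "openin (top_of_set {0<..<1}) {a<..<b}" using assms(2,3) by (auto simp: openin_open intro!: exI[of _ "{a<..<b}"])
  moreover have "open_map (top_of_set {0<..<1}) (subtopology \<Gamma> (f ` {0<..<1})) f"
    using OE_homeomorphic[OF assms(1)] by (rule homeomorphic_imp_open_map)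
  ultimately have "openin (subtopology \<Gamma> (f ` {0<..<1})) (f ` {a<..<b})" by (simp add: open_map_def)
  then show ?thesis by (rule openin_trans_full[OF _ openin_edge[OF assms(1)]])
qed

text \<open>Within \<open>0 < D < 1\<close> the arc is open, and also closed because its end points,
  where \<open>D\<close> is 0 or 1, are missing. A path cannot leave such a set.\<close>

lemma label_locally_constant:
  assumes f: "f \<in> OE" and ab: "0 \<le> a" "a < b" "b \<le> 1"
    and D: "continuous_map \<Gamma> euclideanreal D" and Da: "D (f a) = 0 \<or> D (f a) = 1" and Db: "D (f b) = 0 \<or> D (f b) = 1"
    and p: "pathin \<Gamma> p" "\<And>t. t \<in> {0..1} \<Longrightarrow> 0 < D (p t) \<and> D (p t) < 1"
  shows "p 0 \<in> f ` {a<..<b} \<longleftrightarrow> p 1 \<in> f ` {a<..<b}"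
proof -
  let ?L = "f ` {a<..<b}" and ?C = "f ` {a..b}"
  define M where "M = {x \<in> topspace \<Gamma>. D x \<in> {0<..<1}}"
  have oM: "openin \<Gamma> M" unfolding M_def using openin_continuous_map_preimage[OF D, of "{0<..<1}"] by simp
  have cC: "closedin \<Gamma> ?C"
    using ab by (intro closedin_path_image[OF Hausdorff OE_props(1)[OF f]]) auto
  have oL: "openin \<Gamma> ?L" by (rule openin_subedge[OF f ab(1,3)])
  have "{a..b} = insert a (insert b {a<..<b})" using ab(2) by auto
  then have C: "?C = insert (f a) (insert (f b) ?L)" by simp
  have pM: "p t \<in> M" if "t \<in> {0..1}" for t using p(2)[OF that] pathin_topspace[OF p(1) that] by (simp add: M_def)
  have Mab: "f a \<notin> M" "f b \<notin> M" using Da Db by (auto simp: M_def)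
  have cov: "p t \<in> ?L \<union> (M - ?C)" if "t \<in> {0..1}" for t using pM[OF that] Mab unfolding C by auto
  have "pathin (subtopology \<Gamma> (?L \<union> (M - ?C))) p" using p(1) cov by (simp add: pathin_subtopology)
  moreover have "?L \<inter> (M - ?C) = {}" unfolding C by blast
  ultimately have "pathin (subtopology \<Gamma> ?L) p \<or> pathin (subtopology \<Gamma> (M - ?C)) p"
    by (rule path_in_open_union[OF _ oL openin_diff[OF oM cC]])
  then show ?thesis
  proof
    assume "pathin (subtopology \<Gamma> ?L) p"
    then show ?thesis by (simp add: pathin_subtopology)
  next
    assume "pathin (subtopology \<Gamma> (M - ?C)) p"
    then have "p 0 \<notin> ?C" "p 1 \<notin> ?C" by (auto simp: pathin_subtopology)
    then show ?thesis unfolding C by simp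
  qed
qed

lemma midpoint_distance:
  assumes e0: "e0 \<in> E"
  obtains D where "continuous_map \<Gamma> euclideanreal D" "\<And>t. t \<in> {0..1} \<Longrightarrow> D (e0 t) = \<bar>2 * t - 1\<bar>"
    "\<And>x. x \<in> topspace \<Gamma> \<Longrightarrow> x \<notin> e0 ` {0<..<1} \<Longrightarrow> D x = 1"
proof -
  define F where "F e t = (if e = e0 then \<bar>2 * t - 1\<bar> else 1 :: real)" for e and t :: real
  have F0: "F e 0 = 1" "F e 1 = 1" for e by (simp_all add: F_def)
  obtain D where D: "\<And>v. v \<in> V \<Longrightarrow> D v = 1" "\<And>e t. e \<in> E \<Longrightarrow> t \<in> {0..1} \<Longrightarrow> D (e t) = F e t"
  proof (rule graph_function[where F = F and G = "\<lambda>_. 1", OF F0])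
    fix D assume "\<And>v. v \<in> V \<Longrightarrow> D v = 1" "\<And>e t. e \<in> E \<Longrightarrow> t \<in> {0..1} \<Longrightarrow> D (e t) = F e t"
    then show thesis by (rule that)
  qed
  have "continuous_map \<Gamma> euclideanreal D"
  proof (rule continuous_map_from_graph)
    fix e assume e: "e \<in> E"
    have "continuous_on {0..1} (F e)" unfolding F_def by (cases "e = e0") (auto intro!: continuous_intros)
    then have "continuous_on {0..1} (\<lambda>t. D (e t))"
      by (rule continuous_on_eq) (rule D(2)[OF e, symmetric])
    then show "continuous_map (top_of_set {0..1}) euclideanreal (\<lambda>t. D (e t))" by simp
  qed auto
  moreover have "D x = 1" if x: "x \<in> topspace \<Gamma>" "x \<notin> e0 ` {0<..<1}" for x
  proof (cases "x \<in> V")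
    case False
    then obtain e t where e: "e \<in> E" "t \<in> {0<..<1}" "x = e t" using x(1) unfolding topspace_eq by blast
    then have "e \<noteq> e0" using x(2) by blast
    moreover have "t \<in> {0..1}" using e(2) by auto
    ultimately show ?thesis using D(2)[OF e(1)] e(3) by (simp add: F_def)
  qed (use D in auto)
  moreover have "D (e0 t) = \<bar>2 * t - 1\<bar>" if "t \<in> {0..1}" for t using D(2)[OF e0 that] by (simp add: F_def)
  ultimately show ?thesis using that[of D] by blast
qed

lemma vertex_distance:
  assumes w: "w \<in> V"
  obtains D where "continuous_map \<Gamma> euclideanreal D" "\<And>x. x \<in> topspace \<Gamma> \<Longrightarrow> 0 \<le> D x"
    "\<And>x. x \<in> topspace \<Gamma> \<Longrightarrow> D x = 0 \<longleftrightarrow> x = w"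
    "\<And>r t. r \<in> OE \<Longrightarrow> r 0 = w \<Longrightarrow> t \<in> {0..1/2} \<Longrightarrow> D (r t) = 2 * t"
proof -
  \<comment> \<open>One factor for each end of the edge, so that a loop at \<open>w\<close> gets the
    value 0 at both ends. Each factor is 1 on the half away from its end, so near an end only the
    factor of that end counts.\<close>
  define F where "F e t = (if e 0 = w then min 1 (2 * t) else 1) * (if e 1 = w then min 1 (2 - 2 * t) else 1 :: real)"
    for e :: "real \<Rightarrow> 'a" and t :: real
  have F0: "F e 0 = (if e 0 = w then 0 else 1)" "F e 1 = (if e 1 = w then 0 else 1)" for e
    by (simp_all add: F_def)
  obtain D where D: "\<And>v. v \<in> V \<Longrightarrow> D v = (if v = w then 0 else 1)" "\<And>e t. e \<in> E \<Longrightarrow> t \<in> {0..1} \<Longrightarrow> D (e t) = F e t"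
  proof (rule graph_function[where F = F and G = "\<lambda>v. if v = w then 0 else 1", OF F0])
    fix D assume "\<And>v. v \<in> V \<Longrightarrow> D v = (if v = w then 0 else 1)" "\<And>e t. e \<in> E \<Longrightarrow> t \<in> {0..1} \<Longrightarrow> D (e t) = F e t"
    then show thesis by (rule that)
  qed
  have "continuous_map \<Gamma> euclideanreal D"
  proof (rule continuous_map_from_graph)
    fix e assume e: "e \<in> E"
    have "continuous_on {0..1} (F e)"
      unfolding F_def by (cases "e 0 = w"; cases "e 1 = w") (auto intro!: continuous_intros)
    then have "continuous_on {0..1} (\<lambda>t. D (e t))"
      by (rule continuous_on_eq) (rule D(2)[OF e, symmetric])
    then show "continuous_map (top_of_set {0..1}) euclideanreal (\<lambda>t. D (e t))" by simp
  qed auto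
  moreover have pos: "0 \<le> D x \<and> (D x = 0 \<longleftrightarrow> x = w)" if x: "x \<in> topspace \<Gamma>" for x
  proof (cases "x \<in> V")
    case False
    then obtain e t where e: "e \<in> E" "t \<in> {0<..<1}" "x = e t" using x unfolding topspace_eq by blast
    then have t: "t \<in> {0..1}" "0 < t" "t < 1" by auto
    have "0 < min 1 (2 * t)" "0 < min 1 (2 - 2 * t)" using t by auto
    then have "0 < F e t" unfolding F_def by (auto intro!: mult_pos_pos)
    moreover have "x \<noteq> w" using False w by blast
    ultimately show ?thesis using D(2)[OF e(1) t(1)] e(3) by simp
  qed (use D in auto)
  moreover have "D (r t) = 2 * t" if r: "r \<in> OE" "r 0 = w" and t: "t \<in> {0..1/2}" for r t
  proof (cases "r \<in> E")
    case True
    have "D (r t) = F r t" using D(2)[OF True] t by auto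
    also have "\<dots> = 2 * t" using r(2) t by (simp add: F_def min_def)
    finally show ?thesis .
  next
    case False
    then obtain e where e: "e \<in> E" "r = path_rev e" using r(1) by (auto simp: OE_def)
    have e1: "e 1 = w" using r(2) e(2) by simp
    have "D (r t) = F e (1 - t)" using D(2)[OF e(1), of "1 - t"] t e(2) by (auto simp: path_rev_def)
    also have "\<dots> = 2 * t" using e1 t by (simp add: F_def min_def)
    finally show ?thesis .
  qed
  ultimately show ?thesis using that[of D] by blast
qed

end

text \<open>The target for labels at the vertex. It contains the infinite dihedral group generated
  by two reflections of the integers, in which a product of involutions has infinite order.\<close>

definition bij_group :: "(int \<Rightarrow> int) monoid" where
  "bij_group = \<lparr>carrier = {f. bij f}, monoid.mult = (\<circ>), one = id\<rparr>"

lemma group_bij_group: "group bij_group"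
proof (rule groupI)
  fix f assume "f \<in> carrier bij_group"
  then have f: "bij f" by (simp add: bij_group_def)
  then have "inv_into UNIV f \<circ> f = id" by (simp add: bij_is_inj)
  then show "\<exists>g\<in>carrier bij_group. g \<otimes>\<^bsub>bij_group\<^esub> f = \<one>\<^bsub>bij_group\<^esub>"
    using bij_imp_bij_inv[OF f] by (intro bexI[of _ "inv_into UNIV f"]) (simp_all add: bij_group_def)
qed (auto simp: bij_group_def bij_comp comp_assoc)

lemma bij_group_translation_order:
  fixes k :: nat
  assumes "g = (\<lambda>n. n + 2)"
  shows "g [^]\<^bsub>bij_group\<^esub> k = (\<lambda>n. n + 2 * int k)"
  by (induction k) (auto simp: bij_group_def assms nat_pow_def fun_eq_iff)

lemma pathin_Times:
  assumes "pathin X p"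
  shows "continuous_map (top_of_set ({0..1} \<times> {0..1})) X (\<lambda>z. p (fst z))"
    "continuous_map (top_of_set ({0..1} \<times> {0..1})) X (\<lambda>z. p (snd z))"
proof -
  have f: "continuous_map (top_of_set ({0..1} \<times> {0..1})) (top_of_set {0..1::real}) fst"
    "continuous_map (top_of_set ({0..1} \<times> {0..1})) (top_of_set {0..1::real}) snd"
    by (auto intro!: continuous_intros)
  show "continuous_map (top_of_set ({0..1} \<times> {0..1})) X (\<lambda>z. p (fst z))"
    "continuous_map (top_of_set ({0..1} \<times> {0..1})) X (\<lambda>z. p (snd z))"
    using continuous_map_compose[OF f(1) assms[unfolded pathin_def]]
      continuous_map_compose[OF f(2) assms[unfolded pathin_def]] by (simp_all add: comp_def)
qed

text \<open>Both ways around the square are homotopic to its diagonal. Motions of different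
  particles in disjoint regions give such a square.\<close>

lemma square_commutes:
  assumes H: "continuous_map (top_of_set ({0..1} \<times> {0..1})) X H"
    and a: "(\<lambda>s. H (s, 0)) = a" "(\<lambda>s. H (s, 1)) = a" and b: "(\<lambda>t. H (0, t)) = b" "(\<lambda>t. H (1, t)) = b"
  shows "path_homotopic X (a \<diamondop> b) (b \<diamondop> a)"
proof -
  let ?K = "{0..1::real} \<times> {0..1::real}"
  have K: "convex ?K" by (simp add: convex_Times)
  have 1: "path_homotopic X ((H \<circ> linepath (0, 0) (1, 0)) \<diamondop> (H \<circ> linepath (1, 0) (1, 1))) (H \<circ> linepath (0, 0) (1, 1))"
    by (rule path_homotopic_linepath_join[OF K H]) auto
  have 2: "path_homotopic X ((H \<circ> linepath (0, 0) (0, 1)) \<diamondop> (H \<circ> linepath (0, 1) (1, 1))) (H \<circ> linepath (0, 0) (1, 1))"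
    by (rule path_homotopic_linepath_join[OF K H]) auto
  have "H \<circ> linepath (0, 0) (1, 0) = a" "H \<circ> linepath (0, 1) (1, 1) = a"
    "H \<circ> linepath (0, 0) (0, 1) = b" "H \<circ> linepath (1, 0) (1, 1) = b"
    unfolding a(1)[symmetric] b(1)[symmetric]
    using fun_cong[OF a(2)] fun_cong[OF b(2)] fun_cong[OF a(1)] fun_cong[OF b(1)]
    by (auto simp: linepath_def fun_eq_iff)
  then show ?thesis using path_homotopic_trans[OF 1 path_homotopic_sym[OF 2]] by simp
qed

lemma loop_join_subset:
  assumes "p ` {0..1} \<subseteq> S" "q ` {0..1} \<subseteq> S"
  shows "(p \<diamondop> q) ` {0..1} \<subseteq> S"
  by (rule order_trans[OF image_subsetI[OF loop_join_image] Un_least[OF assms]])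

lemma cross_step_subset: "cross_step \<rho> \<rho>' ` {0..1} \<subseteq> \<rho> ` {0..1} \<union> \<rho>' ` {0..1}"
  by (rule image_subsetI) (rule cross_step_image)

lemma loop_join_ne:
  assumes "\<And>t. t \<in> {0..1} \<Longrightarrow> p t \<noteq> p' t" "\<And>t. t \<in> {0..1} \<Longrightarrow> q t \<noteq> q' t" "t \<in> {0..1}"
  shows "(p \<diamondop> q) t \<noteq> (p' \<diamondop> q') t"
  using assms(1)[of "2 * t"] assms(2)[of "2 * t - 1"] assms(3) by (auto simp: loop_join_def)

text \<open>Estimates for a star of radius \<open>d\<close> at a vertex, with \<open>m\<close> a
  lower bound for the distance to a cycle: parameters stay in the first half of the lanes, the star
  misses the cycle, different lanes do not meet, and the inner half of the star is closer to the
  vertex than everything else.\<close>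

lemma radius_arith:
  fixes u d m :: real
  shows "u \<le> d \<Longrightarrow> d \<le> 1/4 \<Longrightarrow> u \<le> 1/2"
    "m \<le> 2 * u \<Longrightarrow> u \<le> d \<Longrightarrow> d \<le> m / 4 \<Longrightarrow> 0 < m \<Longrightarrow> False"
    "u + u = 1 \<Longrightarrow> u \<le> d \<Longrightarrow> d \<le> 1/4 \<Longrightarrow> False"
    "u \<le> d / 2 \<Longrightarrow> 0 < d \<Longrightarrow> d \<le> 1/4 \<Longrightarrow> d \<le> m / 4 \<Longrightarrow> 0 < m \<Longrightarrow>
       2 * u < 2 * d \<and> 2 * u < 1 \<and> 2 * u < m"
  by argo+

context graph_structure
begin

text \<open>\<zeta> closes \<open>e0\<close> up to a loop that avoids \<open>w\<close>; it may be
  constant when \<open>e0\<close> is a loop itself. The braid \<open>a\<close> runs one particle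
  round it, and \<open>b\<close> exchanges the other two on a star at \<open>w\<close> so small that
  it misses the loop.\<close>

theorem UC3_not_hyperbolic:
  assumes conn: "connected_space \<Gamma>" and e0: "e0 \<in> E" and w: "w \<in> V" "w \<noteq> e0 0" "w \<noteq> e0 1"
    and r: "r1 \<in> OE" "r2 \<in> OE" "r3 \<in> OE" "r1 0 = w" "r2 0 = w" "r3 0 = w"
    and rne: "r1 \<noteq> r2" "r1 \<noteq> r3" "r2 \<noteq> r3"
    and \<zeta>: "pathin \<Gamma> \<zeta>" "\<zeta> 0 = e0 1" "\<zeta> 1 = e0 0" "\<And>t. t \<in> {0..1} \<Longrightarrow> \<zeta> t \<noteq> w \<and> \<zeta> t \<notin> e0 ` {0<..<1}"
    and S: "S \<in> topspace (UC3 \<Gamma>)"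
  shows "\<not> hyperbolic_group (fundamental_group (UC3 \<Gamma>) S)"
proof
  assume hyp: "hyperbolic_group (fundamental_group (UC3 \<Gamma>) S)"
  let ?X = "UC3 \<Gamma>"
  define M where "M = e0 ` {0..1} \<union> \<zeta> ` {0..1}"
  obtain Dw where DwC: "continuous_map \<Gamma> euclideanreal Dw" and Dw0: "\<And>x. x \<in> topspace \<Gamma> \<Longrightarrow> 0 \<le> Dw x"
    and Dwz: "\<And>x. x \<in> topspace \<Gamma> \<Longrightarrow> Dw x = 0 \<longleftrightarrow> x = w"
    and Dwr: "\<And>r t. r \<in> OE \<Longrightarrow> r 0 = w \<Longrightarrow> t \<in> {0..1/2} \<Longrightarrow> Dw (r t) = 2 * t"
  proof (rule vertex_distance[OF w(1)])
    fix Dw assume "continuous_map \<Gamma> euclideanreal Dw" "\<And>x. x \<in> topspace \<Gamma> \<Longrightarrow> 0 \<le> Dw x" "\<And>x. x \<in> topspace \<Gamma> \<Longrightarrow> Dw x = 0 \<longleftrightarrow> x = w" "\<And>r t. r \<in> OE \<Longrightarrow> r 0 = w \<Longrightarrow> t \<in> {0..1/2} \<Longrightarrow> Dw (r t) = 2 * t"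
    then show thesis by (rule that)
  qed
  obtain Dm where DmC: "continuous_map \<Gamma> euclideanreal Dm"
    and Dme: "\<And>t. t \<in> {0..1} \<Longrightarrow> Dm (e0 t) = \<bar>2 * t - 1\<bar>"
    and Dm1: "\<And>x. x \<in> topspace \<Gamma> \<Longrightarrow> x \<notin> e0 ` {0<..<1} \<Longrightarrow> Dm x = 1"
  proof (rule midpoint_distance[OF e0])
    fix Dm assume "continuous_map \<Gamma> euclideanreal Dm" "\<And>t. t \<in> {0..1} \<Longrightarrow> Dm (e0 t) = \<bar>2 * t - 1\<bar>" "\<And>x. x \<in> topspace \<Gamma> \<Longrightarrow> x \<notin> e0 ` {0<..<1} \<Longrightarrow> Dm x = 1"
    then show thesis by (rule that)
  qed
  note e0p = OE_props[OF E_OE[OF e0]]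
  have OM: "e0 ` {0<..<1} \<subseteq> M" unfolding M_def by (rule le_supI1) (rule image_mono, auto)
  have wpath: "\<exists>\<mu>>0. \<forall>t\<in>{0..1}. \<mu> \<le> Dw (p t)" if p: "pathin \<Gamma> p" "\<And>t. t \<in> {0..1} \<Longrightarrow> p t \<noteq> w" for p
  proof -
    have "continuous_map (top_of_set {0..1}) euclideanreal (Dw \<circ> p)"
      by (rule continuous_map_compose[OF p(1)[unfolded pathin_def] DwC])
    then have "continuous_on {0..1} (Dw \<circ> p)" by simp
    then obtain s where s: "s \<in> {0..1}" "\<And>t. t \<in> {0..1} \<Longrightarrow> (Dw \<circ> p) s \<le> (Dw \<circ> p) t"
      using continuous_attains_inf[of "{0..1::real}" "Dw \<circ> p"] by auto
    have ps: "p s \<in> topspace \<Gamma>" by (rule pathin_topspace[OF p(1) s(1)])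
    have "Dw (p s) > 0" using Dw0[OF ps] Dwz[OF ps] p(2)[OF s(1)] by simp
    then show ?thesis using s(2) by (intro exI[of _ "Dw (p s)"]) simp
  qed
  have e0w: "e0 t \<noteq> w" if "t \<in> {0..1}" for t
    using OE_V_iff[OF E_OE[OF e0] that] w by auto
  obtain \<mu>1 where \<mu>1: "\<mu>1 > 0" "\<And>t. t \<in> {0..1} \<Longrightarrow> \<mu>1 \<le> Dw (e0 t)" using wpath[OF e0p(1) e0w] by blast
  obtain \<mu>2 where \<mu>2: "\<mu>2 > 0" "\<And>t. t \<in> {0..1} \<Longrightarrow> \<mu>2 \<le> Dw (\<zeta> t)" using wpath[OF \<zeta>(1)] \<zeta>(4) by blast
  define \<mu> where "\<mu> = min \<mu>1 \<mu>2"
  have \<mu>: "\<mu> > 0" using \<mu>1(1) \<mu>2(1) by (simp add: \<mu>_def)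
  have M\<mu>: "\<mu> \<le> Dw x" if "x \<in> M" for x
    using that \<mu>1(2) \<mu>2(2) unfolding M_def \<mu>_def by (auto simp: min.coboundedI1 min.coboundedI2)
  \<comment> \<open>\<open>Dw\<close> is at most 2\<delta> on the star, hence at most half of its
    lower bound \<mu> on the cycle. The bound 1/4 keeps parameters where \<open>Dw\<close> is linear
    and stops the two ends of a loop at \<open>w\<close> from meeting.\<close>
  define \<delta> where "\<delta> = min (1/4) (\<mu> / 4)"
  have \<delta>: "0 < \<delta>" "\<delta> \<le> 1/4" "\<delta> \<le> \<mu> / 4" using \<mu> by (auto simp: \<delta>_def)
  define \<rho> where "\<rho> r t = r (\<delta> * t)" for r :: "real \<Rightarrow> 'a" and t
  define L where "L = {r1, r2, r3}"
  have L: "q \<in> OE" "q 0 = w" if "q \<in> L" for q using that r by (auto simp: L_def)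
  have \<delta>t: "0 \<le> \<delta> * t" "\<delta> * t \<le> \<delta>" if "t \<in> {0..1}" for t
    using that \<delta>(1) mult_left_mono[of t 1 \<delta>] by auto
  have \<delta>t2: "\<delta> * t \<in> {0..1/2}" if "t \<in> {0..1}" for t
  proof -
    have "\<delta> * t \<le> 1/2" by (rule radius_arith(1)[OF \<delta>t(2)[OF that] \<delta>(2)])
    then show ?thesis using \<delta>t(1)[OF that] by simp
  qed
  have \<rho>p: "pathin \<Gamma> (\<rho> q)" if "q \<in> L" for q
    unfolding \<rho>_def
  proof (rule pathin_compose_real[OF OE_props(1)[OF L(1)[OF that]]])
    show "\<delta> * t \<in> {0..1}" if "t \<in> {0..1}" for t using \<delta>t2[OF that] by auto
  qed (intro continuous_intros)
  have \<rho>0: "\<rho> q 0 = w" if "q \<in> L" for q using L(2)[OF that] by (simp add: \<rho>_def)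
  have \<rho>D: "Dw (\<rho> q t) = 2 * (\<delta> * t)" if "q \<in> L" "t \<in> {0..1}" for q t
    unfolding \<rho>_def using Dwr[OF L[OF that(1)] \<delta>t2[OF that(2)]] .
  have \<rho>top: "\<rho> q t \<in> topspace \<Gamma>" if "q \<in> L" "t \<in> {0..1}" for q t by (rule pathin_topspace[OF \<rho>p[OF that(1)] that(2)])
  have \<rho>M: "\<rho> q t \<notin> M" if "q \<in> L" "t \<in> {0..1}" for q t
  proof
    assume "\<rho> q t \<in> M"
    then have "\<mu> \<le> 2 * (\<delta> * t)" using M\<mu>[of "\<rho> q t"] \<rho>D[OF that] by simp
    then show False by (rule radius_arith(2)[OF _ \<delta>t(2)[OF that(2)] \<delta>(3) \<mu>])
  qed
  have \<rho>ne: "\<rho> q s \<noteq> \<rho> q' t" if q: "q \<in> L" "q' \<in> L" "q \<noteq> q'" and st: "s \<in> {0..1}" "t \<in> {0<..1}" for q q' s t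
  proof
    assume eq: "\<rho> q s = \<rho> q' t"
    have t: "t \<in> {0..1}" "0 < t" using st by auto
    have "2 * (\<delta> * s) = 2 * (\<delta> * t)"
      unfolding \<rho>D[OF q(1) st(1), symmetric] \<rho>D[OF q(2) t(1), symmetric] eq ..
    then have s: "s = t" using \<delta>(1) by simp
    have "\<delta> * t > 0" using \<delta>(1) t(2) by simp
    moreover have "\<delta> * t \<le> 1/2" using \<delta>t2[OF t(1)] by simp
    ultimately have i: "\<delta> * t \<in> {0<..<1}" by simp
    have "\<delta> * t + \<delta> * t = 1" using OE_meet[OF L(1)[OF q(1)] L(1)[OF q(2)] q(3) i i] eq s by (simp add: \<rho>_def)
    then show False by (rule radius_arith(3)[OF _ \<delta>t(2)[OF t(1)] \<delta>(2)])
  qed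
  have rL: "r1 \<in> L" "r2 \<in> L" "r3 \<in> L" by (auto simp: L_def)
  define x1 x2 x3 where "x1 = \<rho> r1 1" and "x2 = \<rho> r2 1" and "x3 = \<rho> r3 1"
  define z0 where "z0 = e0 0"
  have z0M: "z0 \<in> M" unfolding z0_def M_def by (intro UnI1 imageI) simp
  have z0V: "z0 \<in> V" using e0p(2) by (simp add: z0_def)
  then have z0t: "z0 \<in> topspace \<Gamma>" using V_sub by blast
  have xt: "x1 \<in> topspace \<Gamma>" "x2 \<in> topspace \<Gamma>" "x3 \<in> topspace \<Gamma>"
    unfolding x1_def x2_def x3_def using \<rho>top rL by auto
  have xM: "x1 \<notin> M" "x2 \<notin> M" "x3 \<notin> M" unfolding x1_def x2_def x3_def using \<rho>M rL by auto
  have x12: "x1 \<noteq> x2" unfolding x1_def x2_def using \<rho>ne[OF rL(1,2) rne(1)] by auto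
  \<comment> \<open>The two halves of \<open>e0\<close>, both run from the midpoint outwards as
    \<open>cross_step\<close> requires; \<open>Dm\<close> at parameter \<open>s\<close> is then
    \<open>s\<close>.\<close>
  define \<rho>m \<rho>m' where "\<rho>m = (\<lambda>t. e0 ((1 - t) / 2))" and "\<rho>m' = (\<lambda>t. e0 ((1 + t) / 2))"
  have \<rho>mp: "pathin \<Gamma> \<rho>m" "pathin \<Gamma> \<rho>m'" unfolding \<rho>m_def \<rho>m'_def using pathin_cross_parts[OF e0p(1)] by auto
  define za where "za = cross_step \<rho>m \<rho>m' \<diamondop> \<zeta>"
  have csp: "pathin \<Gamma> (cross_step \<rho>m \<rho>m')" by (rule pathin_cross_step[OF \<rho>mp]) (simp add: \<rho>m_def \<rho>m'_def)
  have za: "pathin \<Gamma> za" "za 0 = z0" "za 1 = z0"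
    unfolding za_def using csp \<zeta>(1-3) by (auto simp: \<rho>m_def \<rho>m'_def z0_def intro!: pathin_join)
  have \<rho>m_sub: "\<rho>m ` {0..1} \<subseteq> e0 ` {0..1}" "\<rho>m' ` {0..1} \<subseteq> e0 ` {0..1}"
    unfolding \<rho>m_def \<rho>m'_def by (auto intro!: imageI)
  have csM: "cross_step \<rho>m \<rho>m' ` {0..1} \<subseteq> M"
    unfolding M_def by (rule le_supI1, rule order_trans[OF cross_step_subset Un_least[OF \<rho>m_sub]])
  have "za ` {0..1} \<subseteq> M"
    unfolding za_def by (rule loop_join_subset[OF csM]) (simp add: M_def)
  then have zaM: "za t \<in> M" if "t \<in> {0..1}" for t using that by blast
  \<comment> \<open>The exchange in three moves, one particle at a time: the first goes from lane 1
    to lane 3, the second from lane 2 to lane 1, the first from lane 3 to lane 2. Constant pieces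
    keep the two schedules in step. At the end the particles have swapped places, which closes the
    loop in the unordered space.\<close>
  define xp where "xp = cross_step (\<rho> r1) (\<rho> r3) \<diamondop> ((\<lambda>_. x3) \<diamondop> cross_step (\<rho> r3) (\<rho> r2))"
  define yp where "yp = (\<lambda>_. x2) \<diamondop> (cross_step (\<rho> r2) (\<rho> r1) \<diamondop> (\<lambda>_. x1))"
  have cs: "pathin \<Gamma> (cross_step (\<rho> q) (\<rho> q'))" if "q \<in> L" "q' \<in> L" for q q'
    by (rule pathin_cross_step[OF \<rho>p[OF that(1)] \<rho>p[OF that(2)]]) (simp add: \<rho>0 that)
  have xp: "pathin \<Gamma> xp" "xp 0 = x1" "xp 1 = x2" and yp: "pathin \<Gamma> yp" "yp 0 = x2" "yp 1 = x1"
    unfolding xp_def yp_def using cs rL xt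
    by (auto simp: x1_def x2_def x3_def intro!: pathin_join)
  define St where "St = \<rho> r1 ` {0..1} \<union> \<rho> r2 ` {0..1} \<union> \<rho> r3 ` {0..1}"
  have StM: "x \<notin> M" if "x \<in> St" for x using that \<rho>M rL unfolding St_def by auto
  have Stt: "x \<in> topspace \<Gamma>" if "x \<in> St" for x using that \<rho>top rL unfolding St_def by auto
  have csS: "cross_step (\<rho> q) (\<rho> q') ` {0..1} \<subseteq> St" if "q \<in> L" "q' \<in> L" for q q'
    by (rule order_trans[OF cross_step_subset]) (use that in \<open>auto simp: L_def St_def\<close>)
  have xS: "x1 \<in> St" "x2 \<in> St" "x3 \<in> St" by (auto simp: x1_def x2_def x3_def St_def)
  have xpS: "xp ` {0..1} \<subseteq> St" unfolding xp_def using csS rL xS by (intro loop_join_subset) auto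
  have ypS: "yp ` {0..1} \<subseteq> St" unfolding yp_def using csS rL xS by (intro loop_join_subset) auto
  have xpS': "xp t \<in> St" and ypS': "yp t \<in> St" if "t \<in> {0..1}" for t
    using subsetD[OF xpS imageI[OF that]] subsetD[OF ypS imageI[OF that]] by simp_all
  have csne: "cross_step (\<rho> q) (\<rho> q') t \<noteq> \<rho> k 1" if "q \<in> L" "q' \<in> L" "k \<in> L" "q \<noteq> k" "q' \<noteq> k" "t \<in> {0..1}" for q q' k t
  proof -
    have "cross_step (\<rho> q) (\<rho> q') t \<in> \<rho> q ` {0..1} \<union> \<rho> q' ` {0..1}" by (rule cross_step_image[OF that(6)])
    then show ?thesis using \<rho>ne[OF that(1,3,4), of _ 1] \<rho>ne[OF that(2,3,5), of _ 1] by auto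
  qed
  have xyne: "xp t \<noteq> yp t" if "t \<in> {0..1}" for t
    unfolding xp_def yp_def
  proof (rule loop_join_ne[OF _ loop_join_ne that])
    show "cross_step (\<rho> r1) (\<rho> r3) t \<noteq> x2" if "t \<in> {0..1}" for t
      unfolding x2_def using csne[OF rL(1,3,2) _ _ that] rne by auto
    show "x3 \<noteq> cross_step (\<rho> r2) (\<rho> r1) t" if "t \<in> {0..1}" for t
      unfolding x3_def using csne[OF rL(2,1,3) _ _ that] rne by metis
    show "cross_step (\<rho> r3) (\<rho> r2) t \<noteq> x1" if "t \<in> {0..1}" for t
      unfolding x1_def using csne[OF rL(3,2,1) _ _ that] rne by metis
  qed
  define a where "a = (\<lambda>s. cfg x1 x2 (za s))"
  define b where "b = (\<lambda>t. cfg (xp t) (yp t) z0)"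
  define c0 where "c0 = cfg x1 x2 z0"
  have Mne: "u \<noteq> y" if "u \<in> St" "y \<in> M" for u y using StM that by blast
  have pa: "pathin ?X a"
    unfolding a_def pathin_def
    using za(1) xt x12 Mne[OF xS(1) zaM] Mne[OF xS(2) zaM]
    by (intro continuous_map_cfg) (auto simp: pathin_def)
  have pb: "pathin ?X b"
    unfolding b_def pathin_def
    using xp(1) yp(1) z0t xyne Mne[OF xpS' z0M] Mne[OF ypS' z0M]
    by (intro continuous_map_cfg) (auto simp: pathin_def)
  have la: "a \<in> loops ?X c0" using pa za by (simp add: loops_def a_def c0_def)
  have lb: "b \<in> loops ?X c0"
    using pb xp yp cfg_swap[of x2 x1 z0] by (simp add: loops_def b_def c0_def)
  have comm: "path_homotopic ?X (a \<diamondop> b) (b \<diamondop> a)"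
  proof (rule square_commutes[where H = "\<lambda>z. cfg (xp (snd z)) (yp (snd z)) (za (fst z))"])
    show "continuous_map (top_of_set ({0..1} \<times> {0..1})) ?X (\<lambda>z. cfg (xp (snd z)) (yp (snd z)) (za (fst z)))"
    proof (rule continuous_map_cfg)
      fix z :: "real \<times> real" assume "z \<in> topspace (top_of_set ({0..1} \<times> {0..1}))"
      then have z: "fst z \<in> {0..1}" "snd z \<in> {0..1}" by auto
      show "xp (snd z) \<noteq> yp (snd z) \<and> xp (snd z) \<noteq> za (fst z) \<and> yp (snd z) \<noteq> za (fst z)"
        using xyne[OF z(2)] Mne[OF xpS'[OF z(2)] zaM[OF z(1)]] Mne[OF ypS'[OF z(2)] zaM[OF z(1)]] by simp
    qed (use pathin_Times xp yp za in blast)+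
    show "(\<lambda>s. cfg (xp (snd (s, 0))) (yp (snd (s, 0))) (za (fst (s, 0)))) = a" by (simp add: a_def xp yp)
    show "(\<lambda>s. cfg (xp (snd (s, 1))) (yp (snd (s, 1))) (za (fst (s, 1)))) = a"
      by (simp add: a_def xp yp cfg_swap[of x2 x1])
    show "(\<lambda>t. cfg (xp (snd (0, t))) (yp (snd (0, t))) (za (fst (0, t)))) = b" by (simp add: b_def za)
    show "(\<lambda>t. cfg (xp (snd (1, t))) (yp (snd (1, t))) (za (fst (1, t)))) = b" by (simp add: b_def za)
  qed
  \<comment> \<open>Reflections about 0 and about 1/2, the labels of lanes 2 and 3; every other
    point is labelled by the identity. Both are their own inverses, and \<open>l3 \<circ> l2\<close>
    is the translation by 1.\<close>
  define l2 l3 :: "int \<Rightarrow> int" where "l2 = (\<lambda>n. - n)" and "l3 = (\<lambda>n. 1 - n)"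
  have l22: "l2 \<circ> l2 = id" and l33: "l3 \<circ> l3 = id" by (auto simp: l2_def l3_def)
  have bl: "bij l2" "bij l3" using l22 l33 by (metis o_bij)+
  interpret B: group bij_group by (rule group_bij_group)
  have blc: "l2 \<in> carrier bij_group" "l3 \<in> carrier bij_group" using bl by (auto simp: bij_group_def)
  have il: "inv\<^bsub>bij_group\<^esub> l2 = l2" "inv\<^bsub>bij_group\<^esub> l3 = l3"
    by (rule B.inv_equality[OF _ blc(1) blc(1)], simp add: bij_group_def l22)
      (rule B.inv_equality[OF _ blc(2) blc(2)], simp add: bij_group_def l33)
  define lab where "lab x = (if x \<in> r2 ` {0<..<1/2} then l2 else if x \<in> r3 ` {0<..<1/2} then l3 else id)" for x
  have labc: "lab x \<in> carrier bij_group" for x using bl by (auto simp: lab_def bij_group_def)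
  have cw: "crossing_label \<Gamma> bij_group Dw lab"
    unfolding crossing_label_def
  proof (intro conjI ballI allI impI)
    fix p assume p: "pathin \<Gamma> p" "\<forall>t\<in>{0..1}. 0 < Dw (p t) \<and> Dw (p t) < 1"
    have e: "p 0 \<in> q ` {0<..<1/2} \<longleftrightarrow> p 1 \<in> q ` {0<..<1/2}" if "q \<in> L" for q
    proof (rule label_locally_constant[OF L(1)[OF that] _ _ _ DwC _ _ p(1)])
      show "Dw (q 0) = 0 \<or> Dw (q 0) = 1" using Dwr[OF L[OF that], of 0] by simp
      show "Dw (q (1/2)) = 0 \<or> Dw (q (1/2)) = 1" using Dwr[OF L[OF that], of "1/2"] by simp
    qed (use p(2) in auto)
    show "lab (p 0) = lab (p 1)" unfolding lab_def using e[OF rL(2)] e[OF rL(3)] by simp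
  qed (use DwC Dw0 Dwz labc group_bij_group in auto)
  obtain T where T: "transport ?X bij_group T"
    and T1: "\<And>p q r. pathin \<Gamma> p \<Longrightarrow> pathin \<Gamma> q \<Longrightarrow> pathin \<Gamma> r \<Longrightarrow>
       (\<And>t. t \<in> {0..1} \<Longrightarrow> p t \<noteq> q t \<and> p t \<noteq> r t \<and> q t \<noteq> r t \<and> Dw (p t) \<noteq> 0 \<and> Dw (q t) \<noteq> 0 \<and> Dw (r t) \<noteq> 0) \<Longrightarrow>
       T (\<lambda>t. cfg (p t) (q t) (r t)) = \<one>\<^bsub>bij_group\<^esub>"
    and T2: "\<And>p y z. pathin \<Gamma> p \<Longrightarrow> y \<in> topspace \<Gamma> \<Longrightarrow> z \<in> topspace \<Gamma> \<Longrightarrow> y \<noteq> z \<Longrightarrow>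
       (\<And>t. t \<in> {0..1} \<Longrightarrow> Dw (p t) < Dw y \<and> Dw (p t) < Dw z \<and> Dw (p t) < 1) \<Longrightarrow>
       T (\<lambda>t. cfg (p t) y z) = inv\<^bsub>bij_group\<^esub> (lab (p 0)) \<otimes>\<^bsub>bij_group\<^esub> lab (p 1)"
  proof (rule crossing_transport[OF cw])
    fix T assume "transport ?X bij_group T" "\<And>p q r. pathin \<Gamma> p \<Longrightarrow> pathin \<Gamma> q \<Longrightarrow> pathin \<Gamma> r \<Longrightarrow>
       (\<And>t. t \<in> {0..1} \<Longrightarrow> p t \<noteq> q t \<and> p t \<noteq> r t \<and> q t \<noteq> r t \<and> Dw (p t) \<noteq> 0 \<and> Dw (q t) \<noteq> 0 \<and> Dw (r t) \<noteq> 0) \<Longrightarrow>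
       T (\<lambda>t. cfg (p t) (q t) (r t)) = \<one>\<^bsub>bij_group\<^esub>" "\<And>p y z. pathin \<Gamma> p \<Longrightarrow> y \<in> topspace \<Gamma> \<Longrightarrow> z \<in> topspace \<Gamma> \<Longrightarrow> y \<noteq> z \<Longrightarrow>
       (\<And>t. t \<in> {0..1} \<Longrightarrow> Dw (p t) < Dw y \<and> Dw (p t) < Dw z \<and> Dw (p t) < 1) \<Longrightarrow>
       T (\<lambda>t. cfg (p t) y z) = inv\<^bsub>bij_group\<^esub> (lab (p 0)) \<otimes>\<^bsub>bij_group\<^esub> lab (p 1)"
    then show thesis by (rule that)
  qed
  have step: "T (\<lambda>t. cfg (cross_step (\<rho> q) (\<rho> q') t) (\<rho> k 1) z0)
      = inv\<^bsub>bij_group\<^esub> (lab (\<rho> q (1/2))) \<otimes>\<^bsub>bij_group\<^esub> lab (\<rho> q' (1/2))"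
    if q: "q \<in> L" "q' \<in> L" "k \<in> L" "q \<noteq> k" "q' \<noteq> k" for q q' k
  proof (rule cross_step_transport[OF T group_bij_group T1 T2 labc \<rho>p[OF q(1)] \<rho>p[OF q(2)]])
    have one: "(1::real) \<in> {0..1}" "(1::real) \<in> {0<..1}" by auto
    show "\<rho> q 0 = \<rho> q' 0" using \<rho>0 q by simp
    show "\<rho> k 1 \<in> topspace \<Gamma>" by (rule \<rho>top[OF q(3) one(1)])
    show "z0 \<in> topspace \<Gamma>" by (rule z0t)
    show kz: "\<rho> k 1 \<noteq> z0" using \<rho>M[OF q(3) one(1)] z0M by metis
    have Dk: "Dw (\<rho> k 1) = 2 * \<delta>" using \<rho>D[OF q(3) one(1)] by simp
    show "Dw (\<rho> k 1) \<noteq> 0" using Dk \<delta>(1) by simp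
    have Dz: "\<mu> \<le> Dw z0" by (rule M\<mu>[OF z0M])
    show "Dw z0 \<noteq> 0" using Dz \<mu> by simp
    fix s :: real
    show "\<rho> q s \<noteq> \<rho> k 1 \<and> \<rho> q s \<noteq> z0 \<and> \<rho> q' s \<noteq> \<rho> k 1 \<and> \<rho> q' s \<noteq> z0" if s: "s \<in> {0..1}"
      using \<rho>ne[OF q(1,3,4) s one(2)] \<rho>ne[OF q(2,3,5) s one(2)] \<rho>M[OF q(1) s] \<rho>M[OF q(2) s] z0M by metis
    show "Dw (\<rho> q s) \<noteq> 0 \<and> Dw (\<rho> q' s) \<noteq> 0" if s: "s \<in> {0<..1}"
    proof -
      have "s \<in> {0..1}" "s \<noteq> 0" using s by auto
      then show ?thesis using \<rho>D[OF q(1), of s] \<rho>D[OF q(2), of s] \<delta>(1) by simp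
    qed
    show "Dw (\<rho> q s) < Dw (\<rho> k 1) \<and> Dw (\<rho> q s) < Dw z0 \<and> Dw (\<rho> q s) < 1 \<and>
        Dw (\<rho> q' s) < Dw (\<rho> k 1) \<and> Dw (\<rho> q' s) < Dw z0 \<and> Dw (\<rho> q' s) < 1" if s: "s \<in> {0..1/2}"
    proof -
      have s1: "s \<in> {0..1}" using s by auto
      have "\<delta> * s \<le> \<delta> / 2" using mult_left_mono[of s "1/2" \<delta>] s \<delta>(1) by auto
      then have "2 * (\<delta> * s) < 2 * \<delta>" "2 * (\<delta> * s) < 1" "2 * (\<delta> * s) < \<mu>" using radius_arith(4)[OF _ \<delta> \<mu>] by blast+
      then have "2 * (\<delta> * s) < Dw z0" using Dz by simp
      then show ?thesis using \<rho>D[OF q(1) s1] \<rho>D[OF q(2) s1] Dk \<open>2 * (\<delta> * s) < 2 * \<delta>\<close> \<open>2 * (\<delta> * s) < 1\<close> by simp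
    qed
  qed
  have half: "\<rho> q (1/2) = q (\<delta> / 2)" for q by (simp add: \<rho>_def)
  have \<delta>2: "\<delta> / 2 \<in> {0<..<1/2}" "\<delta> / 2 \<in> {0<..<1}" using \<delta>(1,2) by auto
  have notin: "q (\<delta> / 2) \<notin> q' ` {0<..<1/2}" if "q \<in> L" "q' \<in> L" "q \<noteq> q'" for q q'
  proof
    assume "q (\<delta> / 2) \<in> q' ` {0<..<1/2}"
    then obtain s where s: "q (\<delta> / 2) = q' s" "s \<in> {0<..<1/2}" by (rule imageE)
    then have "\<delta> / 2 + s = 1" using OE_meet[OF L(1)[OF that(1)] L(1)[OF that(2)] that(3) \<delta>2(2), of s] by auto
    then show False using s(2) \<delta>(2) by auto
  qed
  have lab1: "lab (\<rho> r1 (1/2)) = id"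
    unfolding half lab_def using notin[OF rL(1,2) rne(1)] notin[OF rL(1,3) rne(2)] by simp
  have lab2: "lab (\<rho> r2 (1/2)) = l2" unfolding half lab_def using \<delta>2(1) by simp
  have lab3: "lab (\<rho> r3 (1/2)) = l3"
    unfolding half lab_def using \<delta>2(1) notin[OF rL(3,2)] rne(3) by simp
  have pX: "pathin ?X (\<lambda>t. cfg (p t) y z)"
    if "pathin \<Gamma> p" "\<And>t. t \<in> {0..1} \<Longrightarrow> p t \<noteq> y \<and> p t \<noteq> z" "y \<in> topspace \<Gamma>" "z \<in> topspace \<Gamma>" "y \<noteq> z" for p y z
    unfolding pathin_def using that by (intro continuous_map_cfg) (auto simp: pathin_def)
  have pS: "pathin ?X (\<lambda>t. cfg (cross_step (\<rho> q) (\<rho> q') t) (\<rho> k 1) z0)"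
    if q: "q \<in> L" "q' \<in> L" "k \<in> L" "q \<noteq> k" "q' \<noteq> k" for q q' k
  proof (rule pX[OF cs[OF q(1,2)]])
    have one: "(1::real) \<in> {0..1}" by auto
    show "cross_step (\<rho> q) (\<rho> q') t \<noteq> \<rho> k 1 \<and> cross_step (\<rho> q) (\<rho> q') t \<noteq> z0" if t: "t \<in> {0..1}" for t
      using csne[OF q t] Mne[OF subsetD[OF csS[OF q(1,2)] imageI[OF t]] z0M] by simp
    show "\<rho> k 1 \<in> topspace \<Gamma>" by (rule \<rho>top[OF q(3) one])
    show "\<rho> k 1 \<noteq> z0" using \<rho>M[OF q(3) one] z0M by metis
  qed (rule z0t)
  let ?b1 = "\<lambda>t. cfg (cross_step (\<rho> r1) (\<rho> r3) t) (\<rho> r2 1) z0"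
  let ?b2 = "\<lambda>t. cfg (cross_step (\<rho> r2) (\<rho> r1) t) (\<rho> r3 1) z0"
  let ?b3 = "\<lambda>t. cfg (cross_step (\<rho> r3) (\<rho> r2) t) (\<rho> r1 1) z0"
  have rne': "r3 \<noteq> r2" "r2 \<noteq> r1" "r3 \<noteq> r1" using rne by auto
  have bj: "b = ?b1 \<diamondop> (?b2 \<diamondop> ?b3)"
    unfolding b_def xp_def yp_def x1_def x2_def x3_def
    by (rule ext) (simp add: loop_join_def cfg_swap[of "\<rho> r3 1"])
  note pb1 = pS[OF rL(1,3,2) rne(1) rne'(1)] and pb2 = pS[OF rL(2,1,3) rne(3,2)] and pb3 = pS[OF rL(3,2,1) rne'(3,2)]
  have e23: "?b2 1 = ?b3 0" by (simp add: cfg_swap)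
  have e12: "?b1 1 = (?b2 \<diamondop> ?b3) 0" by (simp add: cfg_swap)
  \<comment> \<open>The three moves contribute the label quotients from lane 1 to 3, from 2 to 1 and
    from 3 to 2. With the identity on lane 1, their product is \<open>l3 \<circ> l2\<close> applied
    twice, hence the translation by 2.\<close>
  have Tb: "T b = (\<lambda>n. n + 2)"
  proof -
    have "T b = T ?b1 \<otimes>\<^bsub>bij_group\<^esub> (T ?b2 \<otimes>\<^bsub>bij_group\<^esub> T ?b3)"
      unfolding bj using transport_join[OF T pb1 pathin_join[OF pb2 pb3 e23] e12] transport_join[OF T pb2 pb3 e23] by simp
    also have "\<dots> = (id \<circ> l3) \<circ> ((l2 \<circ> id) \<circ> (l3 \<circ> l2))"
      unfolding step[OF rL(1,3,2) rne(1) rne'(1)] step[OF rL(2,1,3) rne(3,2)] step[OF rL(3,2,1) rne'(3,2)] lab1 lab2 lab3 il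
      using B.inv_one by (simp add: bij_group_def)
    also have "\<dots> = (\<lambda>n. n + 2)" by (auto simp: l2_def l3_def)
    finally show ?thesis .
  qed
  \<comment> \<open>Only the far half of \<open>e0\<close> is labelled 1, so passing the midpoint
    forwards raises the label from 0 to 1. The jump back at \<open>e0 1\<close> is not counted
    because \<open>Dm\<close> is 1 there.\<close>
  define lm :: "'a \<Rightarrow> int" where "lm x = (if x \<in> e0 ` {1/2<..<1} then 1 else 0)" for x
  have Dm0: "0 \<le> Dm x \<and> (Dm x = 0 \<longrightarrow> x = e0 (1/2))" if x: "x \<in> topspace \<Gamma>" for x
  proof (cases "x \<in> e0 ` {0<..<1}")
    case True
    then obtain t where t: "x = e0 t" "t \<in> {0<..<1}" by (rule imageE)
    have "Dm x = \<bar>2 * t - 1\<bar>" unfolding t(1) using t(2) by (intro Dme) auto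
    moreover have "t = 1/2" if "\<bar>2 * t - 1\<bar> = 0" using that by simp
    ultimately show ?thesis using t(1) by (metis abs_ge_zero)
  next
    case False
    then show ?thesis using Dm1[OF x] by simp
  qed
  have cm: "crossing_label \<Gamma> integer_group Dm lm"
    unfolding crossing_label_def
  proof (intro conjI ballI allI impI)
    fix p assume p: "pathin \<Gamma> p" "\<forall>t\<in>{0..1}. 0 < Dm (p t) \<and> Dm (p t) < 1"
    have "p 0 \<in> e0 ` {1/2<..<1} \<longleftrightarrow> p 1 \<in> e0 ` {1/2<..<1}"
    proof (rule label_locally_constant[OF E_OE[OF e0] _ _ _ DmC _ _ p(1)])
      show "Dm (e0 (1/2)) = 0 \<or> Dm (e0 (1/2)) = 1" using Dme[of "1/2"] by simp
      show "Dm (e0 1) = 0 \<or> Dm (e0 1) = 1" using Dme[of 1] by simp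
    qed (use p(2) in auto)
    then show "lm (p 0) = lm (p 1)" by (simp add: lm_def)
  next
    fix x y assume "x \<in> topspace \<Gamma>" "y \<in> topspace \<Gamma>" "Dm x = 0" "Dm y = 0"
    then show "x = y" using Dm0[of x] Dm0[of y] by simp
  qed (use DmC Dm0 in auto)
  obtain T' where T': "transport ?X integer_group T'"
    and T1': "\<And>p q r. pathin \<Gamma> p \<Longrightarrow> pathin \<Gamma> q \<Longrightarrow> pathin \<Gamma> r \<Longrightarrow>
       (\<And>t. t \<in> {0..1} \<Longrightarrow> p t \<noteq> q t \<and> p t \<noteq> r t \<and> q t \<noteq> r t \<and> Dm (p t) \<noteq> 0 \<and> Dm (q t) \<noteq> 0 \<and> Dm (r t) \<noteq> 0) \<Longrightarrow>
       T' (\<lambda>t. cfg (p t) (q t) (r t)) = \<one>\<^bsub>integer_group\<^esub>"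
    and T2': "\<And>p y z. pathin \<Gamma> p \<Longrightarrow> y \<in> topspace \<Gamma> \<Longrightarrow> z \<in> topspace \<Gamma> \<Longrightarrow> y \<noteq> z \<Longrightarrow>
       (\<And>t. t \<in> {0..1} \<Longrightarrow> Dm (p t) < Dm y \<and> Dm (p t) < Dm z \<and> Dm (p t) < 1) \<Longrightarrow>
       T' (\<lambda>t. cfg (p t) y z) = inv\<^bsub>integer_group\<^esub> (lm (p 0)) \<otimes>\<^bsub>integer_group\<^esub> lm (p 1)"
  proof (rule crossing_transport[OF cm])
    fix T' assume "transport ?X integer_group T'" "\<And>p q r. pathin \<Gamma> p \<Longrightarrow> pathin \<Gamma> q \<Longrightarrow> pathin \<Gamma> r \<Longrightarrow>
       (\<And>t. t \<in> {0..1} \<Longrightarrow> p t \<noteq> q t \<and> p t \<noteq> r t \<and> q t \<noteq> r t \<and> Dm (p t) \<noteq> 0 \<and> Dm (q t) \<noteq> 0 \<and> Dm (r t) \<noteq> 0) \<Longrightarrow>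
       T' (\<lambda>t. cfg (p t) (q t) (r t)) = \<one>\<^bsub>integer_group\<^esub>" "\<And>p y z. pathin \<Gamma> p \<Longrightarrow> y \<in> topspace \<Gamma> \<Longrightarrow> z \<in> topspace \<Gamma> \<Longrightarrow> y \<noteq> z \<Longrightarrow>
       (\<And>t. t \<in> {0..1} \<Longrightarrow> Dm (p t) < Dm y \<and> Dm (p t) < Dm z \<and> Dm (p t) < 1) \<Longrightarrow>
       T' (\<lambda>t. cfg (p t) y z) = inv\<^bsub>integer_group\<^esub> (lm (p 0)) \<otimes>\<^bsub>integer_group\<^esub> lm (p 1)"
    then show thesis by (rule that)
  qed
  have StD: "Dm x = 1" if "x \<in> St" for x using Dm1[OF Stt[OF that]] StM[OF that] OM by blast
  have z0D: "Dm z0 = 1" using Dm1[OF z0t] e0p(5) z0V by blast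
  have T'b: "T' b = 0"
    unfolding b_def
    using T1'[OF xp(1) yp(1), of "\<lambda>_. z0"] z0t xyne Mne[OF xpS' z0M] Mne[OF ypS' z0M] StD[OF xpS'] StD[OF ypS'] z0D
    by simp
  have rot: "cfg x1 x2 u = cfg u x1 x2" for u using cfg_swap'[of x1 x2 u] cfg_swap[of x1 u x2] by simp
  \<comment> \<open>One forward crossing of the midpoint; the return along \<zeta> stays where
    \<open>Dm\<close> is 1 and adds nothing.\<close>
  have T'a: "T' a = 1"
  proof -
    let ?a1 = "\<lambda>t. cfg (cross_step \<rho>m \<rho>m' t) x1 x2" and ?a2 = "\<lambda>t. cfg (\<zeta> t) x1 x2"
    have aj: "a = ?a1 \<diamondop> ?a2"
      unfolding a_def za_def rot by (rule ext) (simp add: loop_join_def)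
    have MM: "u \<noteq> x1 \<and> u \<noteq> x2" if "u \<in> M" for u using Mne[OF xS(1) that] Mne[OF xS(2) that] by auto
    have \<zeta>M: "\<zeta> t \<in> M" if "t \<in> {0..1}" for t unfolding M_def using that by blast
    have csM': "cross_step \<rho>m \<rho>m' t \<in> M" if "t \<in> {0..1}" for t using subsetD[OF csM imageI[OF that]] .
    have p1: "pathin ?X ?a1" by (rule pX[OF csp]) (use MM[OF csM'] xt x12 in simp_all)
    have p2: "pathin ?X ?a2" by (rule pX[OF \<zeta>(1)]) (use MM[OF \<zeta>M] xt x12 in simp_all)
    have \<zeta>t: "\<zeta> t \<in> topspace \<Gamma>" if "t \<in> {0..1}" for t by (rule pathin_topspace[OF \<zeta>(1) that])
    have "T' ?a2 = 0"
      using T1'[OF \<zeta>(1), of "\<lambda>_. x1" "\<lambda>_. x2"] xt x12 MM[OF \<zeta>M] Dm1[OF \<zeta>t] \<zeta>(4) StD[OF xS(1)] StD[OF xS(2)] by simp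
    moreover have "T' ?a1 = inv\<^bsub>integer_group\<^esub> (lm (\<rho>m (1/2))) \<otimes>\<^bsub>integer_group\<^esub> lm (\<rho>m' (1/2))"
    proof (rule cross_step_transport[OF T' group_integer_group T1' T2' _ \<rho>mp])
      show "\<rho>m 0 = \<rho>m' 0" by (simp add: \<rho>m_def \<rho>m'_def)
      show "Dm x1 \<noteq> 0" "Dm x2 \<noteq> 0" using StD xS by auto
      fix s :: real
      show "\<rho>m s \<noteq> x1 \<and> \<rho>m s \<noteq> x2 \<and> \<rho>m' s \<noteq> x1 \<and> \<rho>m' s \<noteq> x2" if s: "s \<in> {0..1}"
      proof -
        have "\<rho>m s \<in> M" "\<rho>m' s \<in> M"
          using subsetD[OF \<rho>m_sub(1) imageI[OF s]] subsetD[OF \<rho>m_sub(2) imageI[OF s]]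
          by (simp_all add: M_def)
        then show ?thesis using MM by blast
      qed
      have D: "Dm (\<rho>m s) = s" "Dm (\<rho>m' s) = s" if "s \<in> {0..1}"
        using Dme[of "(1 - s) / 2"] Dme[of "(1 + s) / 2"] that by (auto simp: \<rho>m_def \<rho>m'_def field_simps)
      show "Dm (\<rho>m s) \<noteq> 0 \<and> Dm (\<rho>m' s) \<noteq> 0" if "s \<in> {0<..1}" using D that by auto
      show "Dm (\<rho>m s) < Dm x1 \<and> Dm (\<rho>m s) < Dm x2 \<and> Dm (\<rho>m s) < 1 \<and>
         Dm (\<rho>m' s) < Dm x1 \<and> Dm (\<rho>m' s) < Dm x2 \<and> Dm (\<rho>m' s) < 1" if "s \<in> {0..1/2}"
        using D StD[OF xS(1)] StD[OF xS(2)] that by auto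
    qed (use xt x12 in auto)
    moreover have "lm (\<rho>m (1/2)) = 0"
    proof -
      have "e0 (1/4) \<notin> e0 ` {1/2<..<1}"
      proof
        assume "e0 (1/4) \<in> e0 ` {1/2<..<1}"
        then obtain s where "e0 (1/4) = e0 s" "s \<in> {1/2<..<1}" by (rule imageE)
        then show False using inj_onD[OF e0p(4), of "1/4" s] by auto
      qed
      then show ?thesis by (simp add: lm_def \<rho>m_def)
    qed
    moreover have "lm (\<rho>m' (1/2)) = 1"
    proof -
      have "e0 (3/4) \<in> e0 ` {1/2<..<1}" by (rule imageI) simp
      then show ?thesis by (simp add: lm_def \<rho>m'_def)
    qed
    moreover have "T' a = T' ?a1 \<otimes>\<^bsub>integer_group\<^esub> T' ?a2"
      unfolding aj by (rule transport_join[OF T' p1 p2]) (simp add: \<rho>m'_def \<zeta>(2))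
    ultimately show ?thesis by simp
  qed
  have c0t: "c0 \<in> topspace ?X" using pathin_topspace[OF pa, of 0] la by (simp add: loops_def)
  let ?G = "fundamental_group ?X c0" and ?GS = "fundamental_group ?X S"
  have gG: "group ?G" and gS: "group ?GS" using c0t S by (auto intro: group_fundamental_group)
  obtain \<Phi> where \<Phi>: "\<Phi> \<in> hom ?G integer_group" "\<And>p. p \<in> loops ?X c0 \<Longrightarrow> \<Phi> (loop_class ?X c0 p) = T' p"
  proof (rule transport_hom_fundamental_group[OF T', of c0])
    fix \<Phi> assume "\<Phi> \<in> hom ?G integer_group" "\<And>p. p \<in> loops ?X c0 \<Longrightarrow> \<Phi> (loop_class ?X c0 p) = T' p"
    then show thesis by (rule that)
  qed
  obtain \<Psi> where \<Psi>: "\<Psi> \<in> hom ?G bij_group" "\<And>p. p \<in> loops ?X c0 \<Longrightarrow> \<Psi> (loop_class ?X c0 p) = T p"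
  proof (rule transport_hom_fundamental_group[OF T, of c0])
    fix \<Psi> assume "\<Psi> \<in> hom ?G bij_group" "\<And>p. p \<in> loops ?X c0 \<Longrightarrow> \<Psi> (loop_class ?X c0 p) = T p"
    then show thesis by (rule that)
  qed
  \<comment> \<open>Hyperbolicity is given at the base point \<open>S\<close>, so the commuting pair
    is pulled back along an isomorphism of fundamental groups, and the word metric stays where it
    is.\<close>
  have "?GS \<cong> ?G" by (rule fundamental_group_base_change[OF path_connected_UC3[OF conn e0] c0t S])
  then obtain i where i: "i \<in> iso ?GS ?G" unfolding is_iso_def by blast
  have ih: "i \<in> hom ?GS ?G" and ib: "bij_betw i (carrier ?GS) (carrier ?G)" using i by (auto simp: iso_def)
  define A B where "A = loop_class ?X c0 a" and "B = loop_class ?X c0 b"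
  have AB: "A \<in> carrier ?G" "B \<in> carrier ?G" unfolding A_def B_def using la lb by (auto intro: loop_class_in_carrier)
  have AB': "A \<in> i ` carrier ?GS" "B \<in> i ` carrier ?GS" using AB bij_betw_imp_surj_on[OF ib] by simp_all
  obtain A' where A'': "A = i A'" "A' \<in> carrier ?GS" using AB'(1) by (rule imageE)
  obtain B' where B'': "B = i B'" "B' \<in> carrier ?GS" using AB'(2) by (rule imageE)
  have A': "A' \<in> carrier ?GS" "i A' = A" and B': "B' \<in> carrier ?GS" "i B' = B" using A'' B'' by simp_all
  interpret GS: group ?GS by (rule gS)
  have ab01: "(a \<diamondop> b) 0 = c0" "(a \<diamondop> b) 1 = c0" using la lb by (simp_all add: loops_def)
  have ABc: "A \<otimes>\<^bsub>?G\<^esub> B = B \<otimes>\<^bsub>?G\<^esub> A"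
    unfolding A_def B_def fundamental_group_mult[OF la lb] fundamental_group_mult[OF lb la]
    by (rule loop_class_eqI[OF comm ab01])
  have eqi: "i (A' \<otimes>\<^bsub>?GS\<^esub> B') = i (B' \<otimes>\<^bsub>?GS\<^esub> A')"
    using hom_mult[OF ih A'(1) B'(1)] hom_mult[OF ih B'(1) A'(1)] ABc A'(2) B'(2) by simp
  have c': "A' \<otimes>\<^bsub>?GS\<^esub> B' = B' \<otimes>\<^bsub>?GS\<^esub> A'"
    by (rule inj_onD[OF bij_betw_imp_inj_on[OF ib] eqi GS.m_closed[OF A'(1) B'(1)] GS.m_closed[OF B'(1) A'(1)]])
  have h\<Phi>: "(\<lambda>g. \<Phi> (i g)) \<in> hom ?GS integer_group" using hom_compose[OF ih \<Phi>(1)] by (simp add: comp_def)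
  have "\<Phi> A = 1" "\<Phi> B = 0" unfolding A_def B_def using \<Phi>(2)[OF la] \<Phi>(2)[OF lb] T'a T'b by simp_all
  then have "\<exists>n::nat. n > 0 \<and> B' [^]\<^bsub>?GS\<^esub> n = \<one>\<^bsub>?GS\<^esub>"
    using hyperbolic_commuting_finite_order[OF hyp h\<Phi> A'(1) B'(1) c'] A'(2) B'(2) by simp
  then obtain n :: nat where n: "n > 0" "B' [^]\<^bsub>?GS\<^esub> n = \<one>\<^bsub>?GS\<^esub>" by blast
  have h\<Psi>: "(\<lambda>g. \<Psi> (i g)) \<in> hom ?GS bij_group" using hom_compose[OF ih \<Psi>(1)] by (simp add: comp_def)
  interpret h: group_hom ?GS bij_group "\<lambda>g. \<Psi> (i g)"
    using h\<Psi> gS group_bij_group by (simp add: group_hom_def group_hom_axioms_def)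
  have "\<Psi> (i B') [^]\<^bsub>bij_group\<^esub> n = \<one>\<^bsub>bij_group\<^esub>"
    using h.hom_nat_pow[OF B'(1), of n] h.hom_one n(2) by simp
  moreover have "\<Psi> (i B') = (\<lambda>n. n + 2)" unfolding B'(2) B_def using \<Psi>(2)[OF lb] Tb by simp
  ultimately have "(\<lambda>m. m + 2 * int n) = \<one>\<^bsub>bij_group\<^esub>" using bij_group_translation_order[of "\<lambda>n. n + 2" n] by simp
  then have "(\<lambda>m. m + 2 * int n) = id" by (simp add: bij_group_def)
  then have "0 + 2 * int n = id 0" by (rule fun_cong)
  then show False using n(1) by simp
qed

end

section \<open>Two vertices and no loops: an explicit homeomorphism with a theta graph\<close>

section \<open>Recognising generalized theta graphs\<close>

lemma continuous_map_from_sum_topology: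
  assumes "\<And>i. i \<in> I \<Longrightarrow> continuous_map (X i) Y (\<lambda>x. f (i, x))"
  shows "continuous_map (sum_topology X I) Y f"
  unfolding continuous_map_def
proof (intro conjI allI impI)
  have t: "f (i, x) \<in> topspace Y" if "i \<in> I" "x \<in> topspace (X i)" for i x
    using assms[OF that(1)] that(2) by (auto simp: continuous_map_def)
  then show "f \<in> topspace (sum_topology X I) \<rightarrow> topspace Y" by auto
  fix U assume U: "openin Y U"
  show "openin (sum_topology X I) {x \<in> topspace (sum_topology X I). f x \<in> U}"
    unfolding openin_sum_topology
  proof (intro conjI ballI)
    fix i assume i: "i \<in> I"
    have "{x. (i, x) \<in> {x \<in> topspace (sum_topology X I). f x \<in> U}} = {x \<in> topspace (X i). f (i, x) \<in> U}"
      using i by auto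
    then show "openin (X i) {x. (i, x) \<in> {x \<in> topspace (sum_topology X I). f x \<in> U}}"
      using openin_continuous_map_preimage[OF assms[OF i] U] by simp
  qed auto
qed

lemma sphere_Re: "z \<in> sphere 0 1 \<Longrightarrow> (Re z)\<^sup>2 + (Im z)\<^sup>2 = 1"
  by (simp add: cmod_power2[symmetric])

lemma sphere_Re_bounds:
  assumes "z \<in> sphere 0 1"
  shows "(1 - Re z) / 2 \<in> {0..1}"
proof -
  have "\<bar>Re z\<bar> \<le> 1" using abs_Re_le_cmod[of z] assms by simp
  then show ?thesis by auto
qed

lemma sphere_Re_interior:
  assumes "z \<in> sphere 0 1" "Im z \<noteq> 0"
  shows "(1 - Re z) / 2 \<in> {0<..<1}"
proof -
  have "(Re z)\<^sup>2 < 1" using sphere_Re[OF assms(1)] assms(2) by (metis less_add_same_cancel1 zero_less_power2)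
  then have "\<bar>Re z\<bar> < 1" by (simp add: abs_square_less_1)
  then show ?thesis by auto
qed

lemma sphere_Im_0:
  assumes "z \<in> sphere 0 1" "Im z = 0"
  shows "(1 - Re z) / 2 = 0 \<or> (1 - Re z) / 2 = 1"
proof -
  have "(Re z)\<^sup>2 = 1" using sphere_Re[OF assms(1)] assms(2) by simp
  then have "Re z = 1 \<or> Re z = -1" by (simp add: power2_eq_1_iff)
  then show ?thesis by auto
qed

lemma sphere_eqI:
  assumes "z \<in> sphere 0 1" "z' \<in> sphere 0 1" "Re z = Re z'" "(0 \<le> Im z \<and> 0 \<le> Im z') \<or> (Im z \<le> 0 \<and> Im z' \<le> 0)"
  shows "z = z'"
proof -
  have "(Im z)\<^sup>2 = (Im z')\<^sup>2" using sphere_Re[OF assms(1)] sphere_Re[OF assms(2)] assms(3) by simp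
  then have "Im z = Im z' \<or> Im z = - Im z'" by (simp add: power2_eq_iff)
  then have "Im z = Im z'" using assms(4) by auto
  then show ?thesis using assms(3) by (simp add: complex_eq_iff)
qed

lemma sphere_point_exists:
  assumes "u \<in> {0..1}"
  shows "\<exists>z. z \<in> sphere 0 1 \<and> 0 \<le> Im z \<and> (1 - Re z) / 2 = u"
    "u \<in> {0<..<1} \<Longrightarrow> \<exists>z. z \<in> sphere 0 1 \<and> Im z < 0 \<and> (1 - Re z) / 2 = u"
proof -
  define s where "s = sqrt (1 - (1 - 2 * u)\<^sup>2)"
  have "\<bar>1 - 2 * u\<bar> \<le> 1" using assms by auto
  then have sq: "(1 - 2 * u)\<^sup>2 \<le> 1" by (simp add: abs_square_le_1)
  then have s: "s\<^sup>2 = 1 - (1 - 2 * u)\<^sup>2" "0 \<le> s" by (simp_all add: s_def)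
  have sp: "Complex (1 - 2 * u) t \<in> sphere 0 1" if "t\<^sup>2 = s\<^sup>2" for t
    using that s(1) by (simp add: cmod_def)
  show "\<exists>z. z \<in> sphere 0 1 \<and> 0 \<le> Im z \<and> (1 - Re z) / 2 = u"
    using sp[of s] s(2) by (intro exI[of _ "Complex (1 - 2 * u) s"]) simp
  assume "u \<in> {0<..<1}"
  then have "\<bar>1 - 2 * u\<bar> < 1" by auto
  then have "(1 - 2 * u)\<^sup>2 < 1" by (simp add: abs_square_less_1)
  then have "0 < s" by (simp add: s_def)
  then show "\<exists>z. z \<in> sphere 0 1 \<and> Im z < 0 \<and> (1 - Re z) / 2 = u"
    using sp[of "- s"] by (intro exI[of _ "Complex (1 - 2 * u) (- s)"]) simp
qed

context graph_structure
begin

text \<open>The coordinate \<open>c z\<close> runs from 0 to 1 along either half circle. The common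
  upper half goes to one edge and the lower half of each circle to another, so \<open>m + 1\<close>
  edges give \<open>theta_graph m\<close>. The induced map is a continuous bijection from a compact
  space to a Hausdorff space.\<close>

lemma theta_homeomorphic:
  assumes V: "V = {p, q}" "p \<noteq> q" and E: "E \<noteq> {}" "\<And>e. e \<in> E \<Longrightarrow> e 0 \<noteq> e 1"
  shows "\<exists>m. \<Gamma> homeomorphic_space theta_graph m"
proof -
  define m where "m = card E - 1"
  have cE: "card E = Suc m" using E(1) finite_E by (simp add: m_def card_gt_0_iff)
  obtain \<beta> where \<beta>: "bij_betw \<beta> {0..<card E} E" using ex_bij_betw_nat_finite[OF finite_E] by blast
  have I: "{0..<card E} = {..m}" unfolding cE by auto
  have \<beta>E: "\<beta> i \<in> E" if "i \<in> {..m}" for i using bij_betwE[OF \<beta>] that unfolding I by blast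
  have \<beta>i: "inj_on \<beta> {..m}" using \<beta> unfolding I by (rule bij_betw_imp_inj_on)
  have \<beta>s: "\<beta> ` {..m} = E" using \<beta> unfolding I by (rule bij_betw_imp_surj_on)
  \<comment> \<open>All edges are oriented from \<open>p\<close> to \<open>q\<close>, so that they
    fit together at the two points where the half circles meet.\<close>
  define \<epsilon> where "\<epsilon> i = (if \<beta> i 0 = p then \<beta> i else path_rev (\<beta> i))" for i
  have \<epsilon>: "\<epsilon> i \<in> OE" "\<epsilon> i 0 = p" "\<epsilon> i 1 = q" "\<epsilon> i ` {0<..<1} = \<beta> i ` {0<..<1}" if "i \<in> {..m}" for i
  proof -
    have e: "\<beta> i 0 \<in> {p, q}" "\<beta> i 1 \<in> {p, q}" "\<beta> i 0 \<noteq> \<beta> i 1"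
      using edge[OF \<beta>E[OF that]] E(2)[OF \<beta>E[OF that]] V(1) by auto
    show "\<epsilon> i \<in> OE" using E_OE[OF \<beta>E[OF that]] OE_rev by (simp add: \<epsilon>_def)
    show "\<epsilon> i 0 = p" "\<epsilon> i 1 = q" using e V(2) by (auto simp: \<epsilon>_def)
    show "\<epsilon> i ` {0<..<1} = \<beta> i ` {0<..<1}" by (simp add: \<epsilon>_def path_rev_interior)
  qed
  have \<epsilon>dis: "i = j \<and> s = t" if "i \<in> {..m}" "j \<in> {..m}" "s \<in> {0<..<1}" "t \<in> {0<..<1}" "\<epsilon> i s = \<epsilon> j t" for i j s t
  proof -
    have "i = j"
    proof (rule ccontr)
      assume "i \<noteq> j"
      then have "\<beta> i \<noteq> \<beta> j" using inj_onD[OF \<beta>i _ that(1,2)] by blast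
      then have "\<beta> i ` {0<..<1} \<inter> \<beta> j ` {0<..<1} = {}"
        using edges_disjoint \<beta>E[OF that(1)] \<beta>E[OF that(2)] unfolding pairwise_def disjnt_def by blast
      moreover have "\<epsilon> i s \<in> \<beta> i ` {0<..<1}" using imageI[OF that(3), of "\<epsilon> i"] \<epsilon>(4)[OF that(1)] by simp
      moreover have "\<epsilon> i s \<in> \<beta> j ` {0<..<1}" unfolding that(5) using imageI[OF that(4), of "\<epsilon> j"] \<epsilon>(4)[OF that(2)] by simp
      ultimately show False by blast
    qed
    then show ?thesis using inj_onD[OF OE_props(4)[OF \<epsilon>(1)[OF that(1)]] _ that(3,4)] that(5) by simp
  qed
  have zero: "0 \<in> {..m}" by simp
  define c where "c z = (1 - Re z) / 2" for z
  define X where "X i = (if i = 0 then top_of_set {z \<in> sphere 0 1. 0 \<le> Im z} else top_of_set (sphere 0 (1::real)))" for i :: nat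
  define f where "f = (\<lambda>(i :: nat, z). if 0 \<le> Im z then (0, z) else (i, z))"
  let ?Y = "sum_topology X {..m}"
  have th: "theta_graph m = quotient_topology ?Y f"
    unfolding theta_graph_def X_def f_def ..
  define F where "F = (\<lambda>(i, z). (if 0 \<le> Im z then \<epsilon> 0 else \<epsilon> i) (c z))"
  have Xs: "z \<in> sphere 0 1" if "z \<in> topspace (X i)" for i z using that by (auto simp: X_def split: if_splits)
  have cc: "continuous_on A c" for A unfolding c_def by (intro continuous_intros) auto
  have edgec: "continuous_map (top_of_set A) \<Gamma> (\<lambda>z. \<epsilon> i (c z))" if "i \<in> {..m}" "A \<subseteq> sphere 0 1" for i A
  proof -
    have "c z \<in> {0..1}" if "z \<in> A" for z
      unfolding c_def using sphere_Re_bounds[OF subsetD[OF \<open>A \<subseteq> sphere 0 1\<close> that]] .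
    then have "continuous_map (top_of_set A) (top_of_set {0..1}) c" using cc by auto
    from continuous_map_compose[OF this OE_props(1)[OF \<epsilon>(1)[OF that(1)], unfolded pathin_def]]
    show ?thesis by (simp add: comp_def)
  qed
  have F1: "continuous_map (X i) \<Gamma> (\<lambda>z. F (i, z))" if i: "i \<in> {..m}" for i
  proof (cases "i = 0")
    case True
    have "continuous_map (X i) \<Gamma> (\<lambda>z. \<epsilon> 0 (c z))" unfolding X_def using True edgec[OF zero, of "{z \<in> sphere 0 1. 0 \<le> Im z}"] by fastforce
    then show ?thesis using True by (simp add: F_def)
  next
    case False
    have eq: "(\<lambda>z. F (i, z)) = (\<lambda>z. if 0 \<le> Im z then \<epsilon> 0 (c z) else \<epsilon> i (c z))"
      by (auto simp: F_def)
    have Xi: "X i = top_of_set (sphere 0 1)" using False by (simp add: X_def)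
    show ?thesis
      unfolding eq Xi
    proof (rule continuous_map_cases_le)
      show "continuous_map (top_of_set (sphere 0 1)) euclideanreal (\<lambda>z. 0)" by simp
      show "continuous_map (top_of_set (sphere 0 1)) euclideanreal Im" by (auto intro!: continuous_intros)
      show "continuous_map (subtopology (top_of_set (sphere 0 1)) {z \<in> topspace (top_of_set (sphere 0 1)). 0 \<le> Im z}) \<Gamma> (\<lambda>z. \<epsilon> 0 (c z))"
        by (rule continuous_map_from_subtopology[OF edgec[OF zero order_refl]])
      show "continuous_map (subtopology (top_of_set (sphere 0 1)) {z \<in> topspace (top_of_set (sphere 0 1)). Im z \<le> 0}) \<Gamma> (\<lambda>z. \<epsilon> i (c z))"
        by (rule continuous_map_from_subtopology[OF edgec[OF i order_refl]])
      fix z assume "z \<in> topspace (top_of_set (sphere 0 1))" "0 = Im z"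
      then have "c z = 0 \<or> c z = 1" using sphere_Im_0[of z] by (auto simp: c_def)
      then show "\<epsilon> 0 (c z) = \<epsilon> i (c z)" using \<epsilon>(2,3)[OF zero] \<epsilon>(2,3)[OF i] by auto
    qed
  qed
  have Fc: "continuous_map ?Y \<Gamma> F" by (rule continuous_map_from_sum_topology[OF F1])
  have Ff: "F (f w) = F w" for w by (cases w) (auto simp: F_def f_def)
  have q: "quotient_map ?Y (theta_graph m) f" unfolding th by (rule quotient_map_quotient_topology)
  have "F \<circ> f = F" using Ff by auto
  then have Fth: "continuous_map (theta_graph m) \<Gamma> F"
    using continuous_compose_quotient_map[OF q, of \<Gamma> F] Fc by simp
  have topth: "topspace (theta_graph m) = f ` topspace ?Y" unfolding th by simp
  have comp: "compact_space (theta_graph m)"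
  proof -
    have "compactin (theta_graph m) ((\<lambda>z. f (i, z)) ` topspace (X i))" if i: "i \<in> {..m}" for i
    proof (rule image_compactin[of "X i"])
      have "compact {z \<in> sphere 0 (1::real). 0 \<le> Im z}"
        using compact_Int_closed[OF compact_sphere[of "0::complex" 1] closed_halfspace_Im_ge[of 0]] by (simp add: Int_def)
      then have "compact_space (X i)" by (simp add: X_def compact_space_subtopology)
      then show "compactin (X i) (topspace (X i))" by (simp add: compact_space_def)
      have "continuous_map (X i) ?Y (\<lambda>z. (i, z))" by (rule continuous_map_component_injection[OF i])
      from continuous_map_compose[OF this quotient_imp_continuous_map[OF q]]
      show "continuous_map (X i) (theta_graph m) (\<lambda>z. f (i, z))" by (simp add: comp_def)
    qed
    then have "compactin (theta_graph m) (\<Union>i\<in>{..m}. (\<lambda>z. f (i, z)) ` topspace (X i))"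
      by (intro compactin_Union) auto
    moreover have "(\<Union>i\<in>{..m}. (\<lambda>z. f (i, z)) ` topspace (X i)) = topspace (theta_graph m)"
      unfolding topth by auto
    ultimately show ?thesis by (simp add: compact_space_def)
  qed
  \<comment> \<open>Normal forms for points of the quotient: the closed upper half occurs in summand
    0 only, the open lower half in the others only. On them \<open>F\<close> has a single formula,
    and injectivity becomes a comparison of edges and parameters.\<close>
  have form: "\<exists>i z. w = (i, z) \<and> i \<in> {..m} \<and> z \<in> sphere 0 1 \<and> ((i = 0 \<and> 0 \<le> Im z) \<or> (i \<noteq> 0 \<and> Im z < 0))" if "w \<in> topspace (theta_graph m)" for w
  proof -
    obtain u where u: "w = f u" "u \<in> topspace ?Y" using \<open>w \<in> topspace (theta_graph m)\<close> unfolding topth by (rule imageE)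
    define i z where "i = fst u" and "z = snd u"
    have iz: "i \<in> {..m}" "z \<in> topspace (X i)" "w = f (i, z)" using u unfolding i_def z_def by auto
    show ?thesis
    proof (cases "0 \<le> Im z")
      case True
      then show ?thesis using iz Xs[OF iz(2)] by (intro exI[of _ 0] exI[of _ z]) (simp add: f_def)
    next
      case False
      then have "i \<noteq> 0" using iz(2) by (auto simp: X_def split: if_splits)
      then show ?thesis using iz False Xs[OF iz(2)] by (intro exI[of _ i] exI[of _ z]) (auto simp: f_def)
    qed
  qed
  have Feq: "F (i, z) = \<epsilon> i (c z)" if "(i = 0 \<and> 0 \<le> Im z) \<or> (i \<noteq> 0 \<and> Im z < 0)" for i z
    using that by (auto simp: F_def)
  have inj: "inj_on F (topspace (theta_graph m))"
  proof (rule inj_onI)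
    fix w w' assume w: "w \<in> topspace (theta_graph m)" and w': "w' \<in> topspace (theta_graph m)" and eq: "F w = F w'"
    obtain i z where iz: "w = (i, z)" "i \<in> {..m}" "z \<in> sphere 0 1" "(i = 0 \<and> 0 \<le> Im z) \<or> (i \<noteq> 0 \<and> Im z < 0)" using form[OF w] by blast
    obtain j y where jy: "w' = (j, y)" "j \<in> {..m}" "y \<in> sphere 0 1" "(j = 0 \<and> 0 \<le> Im y) \<or> (j \<noteq> 0 \<and> Im y < 0)" using form[OF w'] by blast
    have e: "\<epsilon> i (c z) = \<epsilon> j (c y)" using eq Feq[OF iz(4)] Feq[OF jy(4)] unfolding iz(1) jy(1) by simp
    have c01: "c z \<in> {0..1}" "c y \<in> {0..1}" unfolding c_def by (rule sphere_Re_bounds[OF iz(3)] sphere_Re_bounds[OF jy(3)])+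
    have Viff: "\<epsilon> i (c z) \<in> V \<longleftrightarrow> c z = 0 \<or> c z = 1" "\<epsilon> j (c y) \<in> V \<longleftrightarrow> c y = 0 \<or> c y = 1"
      using OE_V_iff[OF \<epsilon>(1)[OF iz(2)] c01(1)] OE_V_iff[OF \<epsilon>(1)[OF jy(2)] c01(2)] by auto
    have same: "c z = c y \<and> i = j \<and> (Im z < 0 \<longleftrightarrow> Im y < 0)"
    proof (cases "c z = 0 \<or> c z = 1")
      case True
      then have T': "c y = 0 \<or> c y = 1" using Viff e by simp
      have i0: "i = 0" "0 \<le> Im z" using iz(4) sphere_Re_interior[OF iz(3)] True by (auto simp: c_def)
      have j0: "j = 0" "0 \<le> Im y" using jy(4) sphere_Re_interior[OF jy(3)] T' by (auto simp: c_def)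
      have "c z = c y" using True T' e \<epsilon>(2,3)[OF iz(2)] \<epsilon>(2,3)[OF jy(2)] V(2) by auto
      then show ?thesis using i0 j0 by simp
    next
      case False
      then have F': "\<not> (c y = 0 \<or> c y = 1)" using Viff e by simp
      have "c z \<in> {0<..<1}" "c y \<in> {0<..<1}" using c01 False F' by auto
      then have ij: "i = j" "c z = c y" using \<epsilon>dis[OF iz(2) jy(2) _ _ e] by auto
      moreover have "Im z < 0 \<longleftrightarrow> Im y < 0" using iz(4) jy(4) ij(1) by auto
      ultimately show ?thesis by blast
    qed
    have "Re z = Re y" using same by (simp add: c_def)
    moreover have "(0 \<le> Im z \<and> 0 \<le> Im y) \<or> (Im z \<le> 0 \<and> Im y \<le> 0)" using same by auto
    ultimately have "z = y" by (rule sphere_eqI[OF iz(3) jy(3)])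
    then show "w = w'" using same by (simp add: iz(1) jy(1))
  qed
  have upper: "(0, z) \<in> topspace (theta_graph m)" if "z \<in> sphere 0 1" "0 \<le> Im z" for z
  proof -
    have "(0, z) \<in> topspace ?Y" using that by (simp add: X_def)
    then have "f (0, z) \<in> topspace (theta_graph m)" unfolding topth by (rule imageI)
    then show ?thesis using that(2) by (simp add: f_def)
  qed
  have lower: "(i, z) \<in> topspace (theta_graph m)" if "z \<in> sphere 0 1" "Im z < 0" "i \<in> {..m}" "i \<noteq> 0" for i z
  proof -
    have "(i, z) \<in> topspace ?Y" using that by (simp add: X_def)
    then have "f (i, z) \<in> topspace (theta_graph m)" unfolding topth by (rule imageI)
    then show ?thesis using that(2) by (simp add: f_def)
  qed
  have up: "\<epsilon> 0 u \<in> F ` topspace (theta_graph m)" if u: "u \<in> {0..1}" for u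
  proof -
    obtain z where z: "z \<in> sphere 0 1" "0 \<le> Im z" "c z = u" using sphere_point_exists(1)[OF u] by (auto simp: c_def)
    have "F (0, z) = \<epsilon> 0 u" using z by (simp add: F_def)
    then show ?thesis using imageI[OF upper[OF z(1,2)], of F] by simp
  qed
  have low: "\<epsilon> i u \<in> F ` topspace (theta_graph m)" if u: "u \<in> {0<..<1}" and i: "i \<in> {..m}" "i \<noteq> 0" for i u
  proof -
    have "u \<in> {0..1}" using u by simp
    then obtain z where z: "z \<in> sphere 0 1" "Im z < 0" "c z = u" using sphere_point_exists(2)[OF _ u] by (auto simp: c_def)
    have "F (i, z) = \<epsilon> i u" using z by (simp add: F_def)
    then show ?thesis using imageI[OF lower[OF z(1,2) i], of F] by simp
  qed
  have surj: "F ` topspace (theta_graph m) = topspace \<Gamma>"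
  proof
    show "F ` topspace (theta_graph m) \<subseteq> topspace \<Gamma>" by (rule continuous_map_image_subset_topspace[OF Fth])
    show "topspace \<Gamma> \<subseteq> F ` topspace (theta_graph m)"
    proof
      fix x assume "x \<in> topspace \<Gamma>"
      then consider "x \<in> V" | e where "e \<in> E" "x \<in> e ` {0<..<1}" unfolding topspace_eq by blast
      then show "x \<in> F ` topspace (theta_graph m)"
      proof cases
        case 1
        then have "x = \<epsilon> 0 0 \<or> x = \<epsilon> 0 1" using V(1) \<epsilon>(2,3)[OF zero] by auto
        then show ?thesis using up[of 0] up[of 1] by auto
      next
        case (2 e)
        obtain i where i: "i \<in> {..m}" "e = \<beta> i" using 2(1) \<beta>s by auto
        obtain u where u: "x = \<epsilon> i u" "u \<in> {0<..<1}" using 2(2) unfolding i(2) \<epsilon>(4)[OF i(1), symmetric] by (rule imageE)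
        show ?thesis
        proof (cases "i = 0")
          case True
          then show ?thesis using up[of u] u by simp
        next
          case False
          then show ?thesis using low[OF u(2) i(1)] u by simp
        qed
      qed
    qed
  qed
  have "closed_map (theta_graph m) \<Gamma> F" by (rule continuous_imp_closed_map[OF Fth comp Hausdorff])
  then have "homeomorphic_map (theta_graph m) \<Gamma> F"
    by (rule bijective_closed_imp_homeomorphic_map[OF Fth _ surj inj])
  then have "theta_graph m homeomorphic_space \<Gamma>" by (rule homeomorphic_map_imp_homeomorphic_space)
  then show ?thesis using homeomorphic_space_sym by blast
qed

end

section \<open>Smoothing, combinatorial connectedness, and the circle\<close>

section \<open>Removing bivalent vertices\<close>

context graph_structure
begin

lemma OE_rev_neq:
  assumes "f \<in> OE"
  shows "path_rev f \<noteq> f"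
proof
  assume "path_rev f = f"
  then have "path_rev f (1/4) = f (1/4)" by (rule fun_cong)
  moreover have "path_rev f (1/4) = f (3/4)" by (simp add: path_rev_def)
  ultimately have "f (3/4) = f (1/4)" by (rule back_subst[of "\<lambda>u. u = f (1/4)"])
  then have "(3/4::real) = 1/4" by (rule inj_onD[OF OE_props(4)[OF assms]]) auto
  then show False by simp
qed

lemma OE_underlying:
  assumes "r \<in> OE"
  obtains e where "e \<in> E" "e = r \<or> e = path_rev r"
  using assms unfolding OE_def by auto

text \<open>The two edges at \<open>v\<close> are merged into one edge \<open>k\<close>, which runs
  backwards along \<open>f\<close> and then along \<open>g\<close>. The condition
  \<open>g \<noteq> path_rev f\<close> excludes a loop at \<open>v\<close>, which has nothing to be
  merged with.\<close>

lemma smooth_vertex: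
  assumes f: "f \<in> OE" "f 0 = v" and g: "g \<in> OE" "g 0 = v" and fg: "f \<noteq> g" "g \<noteq> path_rev f"
    and only: "\<And>l. l \<in> OE \<Longrightarrow> l 0 = v \<Longrightarrow> l = f \<or> l = g"
  shows "\<exists>E'. graph_structure \<Gamma> (V - {v}) E'"
proof -
  note fp = OE_props[OF f(1)] and gp = OE_props[OF g(1)]
  have vV: "v \<in> V" using fp(2) f(2) by simp
  have f1: "f 1 \<noteq> v"
    using only[OF OE_rev[OF f(1)]] OE_rev_neq[OF f(1)] fg(2) by auto
  have g1: "g 1 \<noteq> v"
    using only[OF OE_rev[OF g(1)]] OE_rev_neq[OF g(1)] fg(2) by (metis path_rev_0 path_rev_rev)
  \<comment> \<open>\<open>E\<close> contains each edge in one orientation, not known here, so both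
    orientations of \<open>f\<close> and \<open>g\<close> are removed.\<close>
  define E0 where "E0 = {e \<in> E. e \<noteq> f \<and> e \<noteq> path_rev f \<and> e \<noteq> g \<and> e \<noteq> path_rev g}"
  define k where "k = loop_join (path_rev f) g"
  have kt: "k t = (if t \<le> 1/2 then f (1 - 2 * t) else g (2 * t - 1))" for t
    by (simp add: k_def loop_join_def path_rev_def)
  have kl: "k t = f (1 - 2 * t) \<and> 1 - 2 * t \<in> {0<..<1}" if "0 < t" "t < 1/2" for t
    using that by (simp add: kt)
  have kg: "k t = g (2 * t - 1) \<and> 2 * t - 1 \<in> {0<..<1}" if "1/2 < t" "t < 1" for t
    using that by (simp add: kt)
  have km: "k (1/2) = v" by (simp add: kt f(2))
  have dfg: "f ` {0<..<1} \<inter> g ` {0<..<1} = {}" by (rule OE_disjoint[OF f(1) g(1) fg])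
  have vf: "v \<notin> f ` {0<..<1}" and vg: "v \<notin> g ` {0<..<1}" using fp(5) gp(5) vV by auto
  have kim: "k ` {0<..<1} = f ` {0<..<1} \<union> {v} \<union> g ` {0<..<1}"
  proof
    show "k ` {0<..<1} \<subseteq> f ` {0<..<1} \<union> {v} \<union> g ` {0<..<1}"
    proof
      fix x assume "x \<in> k ` {0<..<1}"
      then obtain t where t: "x = k t" "0 < t" "t < 1" by auto
      consider "t < 1/2" | "t = 1/2" | "1/2 < t" by argo
      then show "x \<in> f ` {0<..<1} \<union> {v} \<union> g ` {0<..<1}"
      proof cases
        case 1
        then show ?thesis unfolding t(1) using kl[OF t(2) 1] by auto
      next
        case 2
        show ?thesis unfolding t(1) 2 using km by simp
      next
        case 3
        then show ?thesis unfolding t(1) using kg[OF 3 t(3)] by auto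
      qed
    qed
    have "f s \<in> k ` {0<..<1}" if "s \<in> {0<..<1}" for s
    proof -
      have "k ((1 - s) / 2) = f s" "(1 - s) / 2 \<in> {0<..<1}" using that by (auto simp: kt field_simps)
      then show ?thesis by (metis imageI)
    qed
    moreover have "g s \<in> k ` {0<..<1}" if "s \<in> {0<..<1}" for s
    proof -
      have "k ((1 + s) / 2) = g s" "(1 + s) / 2 \<in> {0<..<1}" using that by (auto simp: kt field_simps)
      then show ?thesis by (metis imageI)
    qed
    moreover have "v \<in> k ` {0<..<1}" using imageI[of "1/2" "{0<..<1}" k] km by simp
    ultimately show "f ` {0<..<1} \<union> {v} \<union> g ` {0<..<1} \<subseteq> k ` {0<..<1}" by auto
  qed
  have kinj: "inj_on k {0<..<1}"
  proof (rule linorder_inj_onI')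
    fix s t :: real assume s: "s \<in> {0<..<1}" and t: "t \<in> {0<..<1}" and st: "s < t"
    have s': "0 < s" "s < 1" and t': "0 < t" "t < 1" using s t by auto
    consider "s < 1/2" "t < 1/2" | "s < 1/2" "t = 1/2" | "s < 1/2" "1/2 < t" | "s = 1/2" "1/2 < t" | "1/2 < s" "1/2 < t"
      using st by argo
    then show "k s \<noteq> k t"
    proof cases
      case 1
      have "f (1 - 2 * s) \<noteq> f (1 - 2 * t)"
        using inj_on_contraD[OF fp(4), of "1 - 2 * s" "1 - 2 * t"] kl[OF s'(1) 1(1)] kl[OF t'(1) 1(2)] st by simp
      then show ?thesis using kl[OF s'(1) 1(1)] kl[OF t'(1) 1(2)] by simp
    next
      case 2
      have "k s \<in> f ` {0<..<1}" using kl[OF s'(1) 2(1)] by (metis imageI)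
      then show ?thesis unfolding 2(2) km using vf by metis
    next
      case 3
      have "k s \<in> f ` {0<..<1}" "k t \<in> g ` {0<..<1}" using kl[OF s'(1) 3(1)] kg[OF 3(2) t'(2)] by (metis imageI)+
      then show ?thesis using dfg by (metis IntI empty_iff)
    next
      case 4
      have "k t \<in> g ` {0<..<1}" using kg[OF 4(2) t'(2)] by (metis imageI)
      then show ?thesis unfolding 4(1) km using vg by metis
    next
      case 5
      have "g (2 * s - 1) \<noteq> g (2 * t - 1)"
        using inj_on_contraD[OF gp(4), of "2 * s - 1" "2 * t - 1"] kg[OF 5(1) s'(2)] kg[OF 5(2) t'(2)] st by simp
      then show ?thesis using kg[OF 5(1) s'(2)] kg[OF 5(2) t'(2)] by simp
    qed
  qed
  have kp: "pathin \<Gamma> k" unfolding k_def by (rule pathin_join) (use fp(1) gp(1) f(2) g(2) in simp_all)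
  have k01: "k 0 = f 1" "k 1 = g 1" by (simp_all add: kt)
  have E0: "e \<in> E" "e 0 \<noteq> v" "e 1 \<noteq> v" "e ` {0<..<1} \<inter> f ` {0<..<1} = {}" "e ` {0<..<1} \<inter> g ` {0<..<1} = {}" if "e \<in> E0" for e
  proof -
    show e: "e \<in> E" using that by (simp add: E0_def)
    have e': "e \<noteq> f" "e \<noteq> path_rev f" "e \<noteq> g" "e \<noteq> path_rev g" using that by (simp_all add: E0_def)
    show "e 0 \<noteq> v" using only[OF E_OE[OF e]] e' by auto
    show "e 1 \<noteq> v" using only[OF OE_rev[OF E_OE[OF e]]] e' by (metis path_rev_0 path_rev_rev)
    show "e ` {0<..<1} \<inter> f ` {0<..<1} = {}"
      by (rule OE_disjoint[OF E_OE[OF e] f(1)]) (use e' in \<open>metis path_rev_rev\<close>)+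
    show "e ` {0<..<1} \<inter> g ` {0<..<1} = {}"
      by (rule OE_disjoint[OF E_OE[OF e] g(1)]) (use e' in \<open>metis path_rev_rev\<close>)+
  qed
  have "graph_structure \<Gamma> (V - {v}) (insert k E0)"
  proof
    show "Hausdorff_space \<Gamma>" by (rule Hausdorff)
    show "finite (V - {v})" using finite_V by simp
    show "V - {v} \<subseteq> topspace \<Gamma>" using V_sub by blast
    show "finite (insert k E0)" using finite_E by (simp add: E0_def)
    show "pathin \<Gamma> e \<and> e 0 \<in> V - {v} \<and> e 1 \<in> V - {v} \<and> inj_on e {0<..<1} \<and> disjnt (e ` {0<..<1}) (V - {v})"
      if "e \<in> insert k E0" for e
    proof (cases "e = k")
      case True
      have "disjnt (k ` {0<..<1}) (V - {v})" unfolding disjnt_def kim using fp(5) gp(5) by blast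
      then show ?thesis unfolding True using kp k01 fp(3) gp(3) f1 g1 kinj by simp
    next
      case False
      then have e: "e \<in> E0" using that by simp
      have "disjnt (e ` {0<..<1}) (V - {v})" using edge[OF E0(1)[OF e]] by (auto simp: disjnt_def)
      then show ?thesis using edge[OF E0(1)[OF e]] E0(2,3)[OF e] by simp
    qed
    have kd: "disjnt (k ` {0<..<1}) (e ` {0<..<1})" if "e \<in> E0" for e
    proof -
      have "v \<notin> e ` {0<..<1}" using edge[OF E0(1)[OF that]] vV by (auto simp: disjnt_def)
      then show ?thesis unfolding disjnt_def kim using E0(4,5)[OF that] by blast
    qed
    have "pairwise (\<lambda>e e'. disjnt (e ` {0<..<1}) (e' ` {0<..<1})) E0"
      by (rule pairwise_subset[OF edges_disjoint]) (auto simp: E0_def)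
    then show "pairwise (\<lambda>e e'. disjnt (e ` {0<..<1}) (e' ` {0<..<1})) (insert k E0)"
      unfolding pairwise_insert using kd disjnt_sym by blast
    have "(\<Union>e\<in>E. e ` {0<..<1}) = (\<Union>e\<in>E0. e ` {0<..<1}) \<union> f ` {0<..<1} \<union> g ` {0<..<1}" (is "?L = ?R")
    proof
      show "?L \<subseteq> ?R"
      proof (rule UN_least)
        fix e assume e: "e \<in> E"
        show "e ` {0<..<1} \<subseteq> ?R"
        proof (cases "e \<in> E0")
          case True
          then show ?thesis by blast
        next
          case False
          then have "e = f \<or> e = path_rev f \<or> e = g \<or> e = path_rev g" using e by (simp add: E0_def)
          then have "e ` {0<..<1} = f ` {0<..<1} \<or> e ` {0<..<1} = g ` {0<..<1}" using path_rev_interior by metis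
          then show ?thesis by blast
        qed
      qed
      obtain a where a: "a \<in> E" "a ` {0<..<1} = f ` {0<..<1}" using OE_E[OF f(1)] by blast
      obtain b where b: "b \<in> E" "b ` {0<..<1} = g ` {0<..<1}" using OE_E[OF g(1)] by blast
      have "f ` {0<..<1} \<subseteq> ?L" using UN_upper[OF a(1), of "\<lambda>e. e ` {0<..<1}"] unfolding a(2) .
      moreover have "g ` {0<..<1} \<subseteq> ?L" using UN_upper[OF b(1), of "\<lambda>e. e ` {0<..<1}"] unfolding b(2) .
      moreover have "(\<Union>e\<in>E0. e ` {0<..<1}) \<subseteq> ?L" by (rule UN_mono) (auto simp: E0_def)
      ultimately show "?R \<subseteq> ?L" by (intro Un_least)
    qed
    then have "topspace \<Gamma> = V \<union> ((\<Union>e\<in>E0. e ` {0<..<1}) \<union> f ` {0<..<1} \<union> g ` {0<..<1})" using topspace_eq by simp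
    moreover have "(\<Union>e\<in>insert k E0. e ` {0<..<1}) = k ` {0<..<1} \<union> (\<Union>e\<in>E0. e ` {0<..<1})" by simp
    moreover have "V \<union> (A \<union> B \<union> C) = (V - {v}) \<union> ((B \<union> {v} \<union> C) \<union> A)" for A B C using vV by blast
    ultimately show "topspace \<Gamma> = (V - {v}) \<union> (\<Union>e\<in>insert k E0. e ` {0<..<1})"
      unfolding kim by simp
  qed
  then show ?thesis ..
qed

text \<open>Topological connectedness made combinatorial: \<open>P\<close> with all edges starting
  in it, and the same for the remaining vertices, are two disjoint closed sets that cover the
  graph.\<close>

lemma connected_vertices:
  assumes conn: "connected_space \<Gamma>" and P: "P \<subseteq> V" "P \<noteq> {}" "\<And>l. l \<in> OE \<Longrightarrow> l 0 \<in> P \<Longrightarrow> l 1 \<in> P"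
  shows "P = V"
proof -
  define C where "C Q = Q \<union> (\<Union>e\<in>{e \<in> E. e 0 \<in> Q}. e ` {0..1})" for Q
  have cl: "closedin \<Gamma> (C Q)" if "Q \<subseteq> V" for Q
    unfolding C_def
  proof (rule closedin_Un)
    show "closedin \<Gamma> Q"
      using closedin_Hausdorff_finite[OF Hausdorff _ finite_subset[OF that finite_V]] that V_sub by blast
    show "closedin \<Gamma> (\<Union>e\<in>{e \<in> E. e 0 \<in> Q}. e ` {0..1})"
      using finite_E closedin_edge by (intro closedin_Union) auto
  qed
  have rev_in: "e 0 \<in> P" if "e \<in> E" "e 1 \<in> P" for e
    using P(3)[OF OE_rev[OF E_OE[OF that(1)]]] that(2) by simp
  have ends: "e t \<in> V \<Longrightarrow> t = 0 \<or> t = 1" if "e \<in> E" "t \<in> {0..1}" for e t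
    using OE_V_iff[OF E_OE[OF that(1)] that(2)] by simp
  have inC: "x \<in> C Q \<longleftrightarrow> x \<in> Q \<or> (\<exists>e\<in>E. \<exists>t\<in>{0..1}. e 0 \<in> Q \<and> x = e t)" for x Q
    unfolding C_def by auto
  have inter: "e 0 = e' 0" if "e \<in> E" "e' \<in> E" "t \<in> {0..1}" "t' \<in> {0..1}" "e t = e' t'" "e t \<notin> V" for e e' t t'
  proof -
    have "t \<in> {0<..<1}"
      using that(3,6) edge[OF that(1)] by (cases "t = 0 \<or> t = 1") auto
    moreover have "t' \<in> {0<..<1}"
      using that(4,5,6) edge[OF that(2)] by (cases "t' = 0 \<or> t' = 1") auto
    ultimately have "e t \<in> e ` {0<..<1}" "e t \<in> e' ` {0<..<1}" using that(5) by (metis imageI)+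
    then have "e = e'" using edges_disjoint that(1,2) unfolding pairwise_def disjnt_def by blast
    then show ?thesis by simp
  qed
  have side: "x \<in> P" if "x \<in> C P" "x \<in> V" for x
  proof -
    have "x \<in> P" if "e \<in> E" "t \<in> {0..1}" "e 0 \<in> P" "x = e t" for e t
      using ends[OF that(1,2)] that P(3)[OF E_OE[OF that(1)]] \<open>x \<in> V\<close> by auto
    then show ?thesis using that(1) unfolding inC by blast
  qed
  have side': "x \<notin> P" if "x \<in> C (V - P)" "x \<in> V" for x
  proof -
    have "x \<notin> P" if "e \<in> E" "t \<in> {0..1}" "e 0 \<in> V - P" "x = e t" for e t
      using ends[OF that(1,2)] that rev_in[OF that(1)] \<open>x \<in> V\<close> by auto
    then show ?thesis using that(1) unfolding inC by blast
  qed
  have disj: "C P \<inter> C (V - P) = {}"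
  proof (rule ccontr)
    assume "C P \<inter> C (V - P) \<noteq> {}"
    then obtain x where x: "x \<in> C P" "x \<in> C (V - P)" by blast
    show False
    proof (cases "x \<in> V")
      case True
      then show False using side[OF x(1)] side'[OF x(2)] by blast
    next
      case False
      then obtain e t where e: "e \<in> E" "t \<in> {0..1}" "e 0 \<in> P" "x = e t" using x(1) P(1) unfolding inC by blast
      obtain e' t' where e': "e' \<in> E" "t' \<in> {0..1}" "e' 0 \<in> V - P" "x = e' t'" using x(2) False unfolding inC by blast
      have "e 0 = e' 0" by (rule inter[OF e(1) e'(1) e(2) e'(2)]) (use e(4) e'(4) False in simp_all)
      then show False using e(3) e'(3) by simp
    qed
  qed
  have un: "C P \<union> C (V - P) = topspace \<Gamma>"
  proof
    show "C P \<union> C (V - P) \<subseteq> topspace \<Gamma>" using closedin_subset[OF cl[OF P(1)]] closedin_subset[OF cl[of "V - P"]] by blast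
    show "topspace \<Gamma> \<subseteq> C P \<union> C (V - P)"
    proof
      fix x assume "x \<in> topspace \<Gamma>"
      then consider "x \<in> V" | e where "e \<in> E" "x \<in> e ` {0<..<1}" unfolding topspace_eq by blast
      then show "x \<in> C P \<union> C (V - P)"
      proof cases
        case 1
        then show ?thesis by (auto simp: C_def)
      next
        case (2 e)
        then obtain t where t: "x = e t" "t \<in> {0<..<1}" by blast
        have t1: "t \<in> {0..1}" using t(2) by simp
        have "e 0 \<in> P \<or> e 0 \<in> V - P" using edge[OF 2(1)] by blast
        then show ?thesis using 2(1) t(1) t1 unfolding Un_iff inC by blast
      qed
    qed
  qed
  have "openin \<Gamma> (C P)"
  proof -
    have "C P = topspace \<Gamma> - C (V - P)" using un disj by blast
    then show ?thesis using cl[of "V - P"] by (simp add: closedin_def)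
  qed
  then have "C P = {} \<or> C P = topspace \<Gamma>" using conn cl[OF P(1)] unfolding connected_space_clopen_in by blast
  moreover have "C P \<noteq> {}" using P(2) by (simp add: C_def)
  ultimately have "C P = topspace \<Gamma>" by blast
  then have "V \<subseteq> P" using side V_sub by blast
  then show ?thesis using P(1) by blast
qed

text \<open>The circle is subdivided at the midpoint of its only edge. This gives two vertices
  joined by two edges, the form in which theta graphs are recognised.\<close>

lemma single_loop_theta:
  assumes V: "V = {v}" and e: "e \<in> OE" and only: "\<And>l. l \<in> OE \<Longrightarrow> l = e \<or> l = path_rev e"
  shows "\<exists>m. \<Gamma> homeomorphic_space theta_graph m"
proof -
  note ep = OE_props[OF e]
  have e01: "e 0 = v" "e 1 = v" using ep(2,3) V by auto
  let ?m = "e (1/2)"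
  define a where "a t = e (t / 2)" for t
  define b where "b t = e (1 - t / 2)" for t
  have mv: "?m \<noteq> v" using ep(5) V by auto
  have half: "t / 2 \<in> {0<..<1}" "1 - t / 2 \<in> {0<..<1}" if "t \<in> {0<..<1}" for t :: real using that by auto
  have mid: "(1/2::real) \<in> {0<..<1}" by simp
  have inj: "e s = e t \<Longrightarrow> s = t" if "s \<in> {0<..<1}" "t \<in> {0<..<1}" for s t using inj_onD[OF ep(4) _ that] .
  have ia: "inj_on a {0<..<1}" unfolding a_def by (rule inj_onI) (use inj[OF half(1) half(1)] in simp)
  have ib: "inj_on b {0<..<1}" unfolding b_def by (rule inj_onI) (use inj[OF half(2) half(2)] in simp)
  have av: "a t \<noteq> v" "b t \<noteq> v" if "t \<in> {0<..<1}" for t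
    unfolding a_def b_def using ep(5) V half[OF that] by auto
  have am: "a t \<noteq> ?m" "b t \<noteq> ?m" if "t \<in> {0<..<1}" for t
    using inj[OF half(1)[OF that] mid] inj[OF half(2)[OF that] mid] that by (auto simp: a_def b_def)
  have ab: "a s \<noteq> b t" if "s \<in> {0<..<1}" "t \<in> {0<..<1}" for s t
  proof
    assume "a s = b t"
    then have "s / 2 = 1 - t / 2" unfolding a_def b_def by (rule inj[OF half(1)[OF that(1)] half(2)[OF that(2)]])
    then show False using that by auto
  qed
  have abne: "a \<noteq> b" using ab[of "1/2" "1/2"] by auto
  have dab: "disjnt (a ` {0<..<1}) (b ` {0<..<1})" using ab unfolding disjnt_def by blast
  have pa: "pathin \<Gamma> a" unfolding a_def by (rule pathin_compose_real[OF ep(1)]) (auto intro!: continuous_intros)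
  have pb: "pathin \<Gamma> b" unfolding b_def by (rule pathin_compose_real[OF ep(1)]) (auto intro!: continuous_intros)
  have ends: "a 0 = v" "a 1 = ?m" "b 0 = v" "b 1 = ?m" by (simp_all add: a_def b_def e01)
  have split: "e ` {0<..<1} = insert ?m (a ` {0<..<1} \<union> b ` {0<..<1})"
  proof
    show "e ` {0<..<1} \<subseteq> insert ?m (a ` {0<..<1} \<union> b ` {0<..<1})"
    proof
      fix x assume "x \<in> e ` {0<..<1}"
      then obtain t where t: "x = e t" "0 < t" "t < 1" by auto
      consider "t < 1/2" | "t = 1/2" | "1/2 < t" by argo
      then show "x \<in> insert ?m (a ` {0<..<1} \<union> b ` {0<..<1})"
      proof cases
        case 1
        have "x = a (2 * t)" "2 * t \<in> {0<..<1}" using t 1 by (auto simp: a_def)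
        then show ?thesis by blast
      next
        case 2
        show ?thesis unfolding t(1) 2 by simp
      next
        case 3
        have "1 - (2 - 2 * t) / 2 = t" by (simp add: field_simps)
        then have "x = b (2 - 2 * t)" "2 - 2 * t \<in> {0<..<1}" using t 3 by (auto simp: b_def)
        then show ?thesis by blast
      qed
    qed
    have "a t \<in> e ` {0<..<1}" "b t \<in> e ` {0<..<1}" if "t \<in> {0<..<1}" for t
      unfolding a_def b_def using half[OF that] by (auto intro: imageI)
    then show "insert ?m (a ` {0<..<1} \<union> b ` {0<..<1}) \<subseteq> e ` {0<..<1}" using imageI[OF mid, of e] by blast
  qed
  obtain e0 where e0: "e0 \<in> E" "e0 ` {0<..<1} = e ` {0<..<1}" using OE_E[OF e] by blast
  have all: "e' ` {0<..<1} = e ` {0<..<1}" if "e' \<in> E" for e'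
    using only[OF E_OE[OF that]] path_rev_interior[of e] by metis
  have top: "topspace \<Gamma> = insert v (e ` {0<..<1})"
    unfolding topspace_eq V using all e0 by auto
  interpret C: graph_structure \<Gamma> "{v, ?m}" "{a, b}"
  proof
    show "{v, ?m} \<subseteq> topspace \<Gamma>" unfolding top using imageI[OF mid, of e] by blast
    show "pathin \<Gamma> l \<and> l 0 \<in> {v, ?m} \<and> l 1 \<in> {v, ?m} \<and> inj_on l {0<..<1} \<and> disjnt (l ` {0<..<1}) {v, ?m}"
      if "l \<in> {a, b}" for l
    proof -
      have "disjnt (a ` {0<..<1}) {v, ?m}" "disjnt (b ` {0<..<1}) {v, ?m}"
        unfolding disjnt_def using av am by blast+
      then show ?thesis using that pa pb ia ib ends by auto
    qed
    show "pairwise (\<lambda>l l'. disjnt (l ` {0<..<1}) (l' ` {0<..<1})) {a, b}"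
      unfolding pairwise_insert using dab disjnt_sym by auto
    show "topspace \<Gamma> = {v, ?m} \<union> (\<Union>l\<in>{a, b}. l ` {0<..<1})" unfolding top split by auto
  qed (simp_all add: Hausdorff)
  show ?thesis by (rule C.theta_homeomorphic[of v ?m]) (use mv ends in auto)
qed

end

section \<open>Case analysis on a cell structure with the fewest vertices\<close>

section \<open>Graphs with the fewest vertices\<close>

locale minimal_graph = graph_structure +
  fixes S :: "(nat \<Rightarrow> 'a) set"
  assumes conn: "connected_space \<Gamma>"
    and minimal: "graph_structure \<Gamma> V' E' \<Longrightarrow> card V \<le> card V'"
    and not_theta: "\<not> \<Gamma> homeomorphic_space theta_graph m"
    and S: "S \<in> topspace (UC3 \<Gamma>)"
    and hyp: "hyperbolic_group (fundamental_group (UC3 \<Gamma>) S)"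
begin

abbreviation has_free_factor :: bool where
  "has_free_factor \<equiv> \<exists>H :: (real \<Rightarrow> (nat \<Rightarrow> 'a) set) set monoid.
     group H \<and> fundamental_group (UC3 \<Gamma>) S \<cong> free_product H integer_group"

text \<open>Otherwise \<open>v\<close> could be smoothed, against minimality. The two ends of a
  single loop are excluded, since the vertex of an isolated circle cannot be smoothed away.\<close>

lemma not_bivalent:
  assumes "f \<in> OE" "f 0 = v" "g \<in> OE" "g 0 = v" "f \<noteq> g" "g \<noteq> path_rev f"
  obtains l where "l \<in> OE" "l 0 = v" "l \<noteq> f" "l \<noteq> g"
proof (rule ccontr)
  assume "\<not> thesis"
  then have "l = f \<or> l = g" if "l \<in> OE" "l 0 = v" for l using \<open>\<And>l. l \<in> OE \<Longrightarrow> l 0 = v \<Longrightarrow> l \<noteq> f \<Longrightarrow> l \<noteq> g \<Longrightarrow> thesis\<close> that by blast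
  then obtain E' where "graph_structure \<Gamma> (V - {v}) E'" using smooth_vertex[OF assms] by blast
  then have "card V \<le> card (V - {v})" by (rule minimal)
  moreover have "v \<in> V" using OE_props(2)[OF assms(1)] assms(2) by simp
  ultimately show False using card_Diff1_less[OF finite_V, of v] by simp
qed

text \<open>The obstruction to hyperbolicity, freed from the orientation stored in \<open>E\<close>:
  if \<open>r\<close> itself is in \<open>E\<close>, the detour has to be reversed so that it
  returns from \<open>r 1\<close> to \<open>r 0\<close>.\<close>

lemma not_bypassed:
  assumes r: "r \<in> OE" and w: "w \<in> V" "w \<noteq> r 0" "w \<noteq> r 1"
    and "r1 \<in> OE" "r2 \<in> OE" "r3 \<in> OE" "r1 0 = w" "r2 0 = w" "r3 0 = w" "r1 \<noteq> r2" "r1 \<noteq> r3" "r2 \<noteq> r3"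
    and \<zeta>: "pathin \<Gamma> \<zeta>" "\<zeta> 0 = r 0" "\<zeta> 1 = r 1" "\<And>t. t \<in> {0..1} \<Longrightarrow> \<zeta> t \<noteq> w \<and> \<zeta> t \<notin> r ` {0<..<1}"
  shows False
proof -
  obtain e0 where e0: "e0 \<in> E" "e0 = r \<or> e0 = path_rev r" by (rule OE_underlying[OF r])
  note nh = UC3_not_hyperbolic[OF conn e0(1) w(1) _ _ assms(5-13) _ _ _ _ S]
  from e0(2) show False
  proof
    assume e: "e0 = path_rev r"
    have "\<not> hyperbolic_group (fundamental_group (UC3 \<Gamma>) S)"
      by (rule nh[of \<zeta>]) (use w \<zeta> in \<open>simp_all add: e path_rev_interior\<close>)
    then show False using hyp by contradiction
  next
    assume e: "e0 = r"
    have "path_rev \<zeta> t \<noteq> w \<and> path_rev \<zeta> t \<notin> r ` {0<..<1}" if "t \<in> {0..1}" for t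
      unfolding path_rev_def by (rule \<zeta>(4)) (use that in auto)
    then have "\<not> hyperbolic_group (fundamental_group (UC3 \<Gamma>) S)"
      by (intro nh[of "path_rev \<zeta>"]) (use w \<zeta> in \<open>simp_all add: e\<close>)
    then show False using hyp by contradiction
  qed
qed

text \<open>Without edges a connected graph has one point, but the base configuration
  \<open>S\<close> provides distinct points.\<close>

lemma edges_nonempty: "E \<noteq> {}"
proof
  assume E: "E = {}"
  obtain x y z where xyz: "x \<in> topspace \<Gamma>" "y \<in> topspace \<Gamma>" "x \<noteq> y" by (rule UC3_cases[OF S])
  have OE_empty: "OE = {}" unfolding OE_def using E by simp
  have "topspace \<Gamma> = V" using topspace_eq E by simp
  then have xV: "x \<in> V" "y \<in> V" using xyz by simp_all
  have "{x} = V" by (rule connected_vertices[OF conn]) (use xV OE_empty in auto)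
  then show False using xV xyz(3) by auto
qed

text \<open>A vertex without edges would be closed under adjacency, hence the only vertex, and the
  existing edges would have nowhere to start.\<close>

lemma lane_exists:
  assumes "v \<in> V"
  obtains l where "l \<in> OE" "l 0 = v"
proof (rule ccontr)
  assume "\<not> thesis"
  then have no: "l 0 \<noteq> v" if "l \<in> OE" for l using \<open>\<And>l. l \<in> OE \<Longrightarrow> l 0 = v \<Longrightarrow> thesis\<close> that by blast
  have "{v} = V" by (rule connected_vertices[OF conn]) (use assms no in auto)
  moreover obtain e where "e \<in> E" using edges_nonempty by blast
  ultimately show False using edge[of e] no[OF E_OE] by auto
qed

text \<open>The leaf is \<open>l 0\<close>; the wall is built at the other end \<open>l 1\<close>,
  with \<open>path_rev l\<close> as the edge carrying two particles. If no other edge starts there,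
  the graph is a segment, the theta graph with m = 0; otherwise minimality supplies two further
  lanes.\<close>

lemma leaf_free_factor:
  assumes l: "l \<in> OE" and only: "\<And>l'. l' \<in> OE \<Longrightarrow> l' 0 = l 0 \<Longrightarrow> l' = l"
  shows has_free_factor
proof -
  note lp = OE_props[OF l] and rp = OE_rev[OF l]
  have ne: "l 1 \<noteq> l 0" using only[OF rp] OE_rev_neq[OF l] by auto
  have "\<exists>f. f \<in> OE \<and> f 0 = l 1 \<and> f \<noteq> path_rev l"
  proof (rule ccontr)
    assume "\<nexists>f. f \<in> OE \<and> f 0 = l 1 \<and> f \<noteq> path_rev l"
    then have only1: "f = path_rev l" if "f \<in> OE" "f 0 = l 1" for f using that by blast
    have V: "{l 0, l 1} = V"
    proof (rule connected_vertices[OF conn])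
      fix f assume f: "f \<in> OE" "f 0 \<in> {l 0, l 1}"
      then have "f = l \<or> f = path_rev l" using only only1 by blast
      then show "f 1 \<in> {l 0, l 1}" by auto
    qed (use lp in auto)
    have "e 0 \<noteq> e 1" if "e \<in> E" for e
    proof -
      have "e 0 \<in> {l 0, l 1}" using edge[OF that] V by blast
      then have "e = l \<or> e = path_rev l" using only only1 E_OE[OF that] by blast
      then show ?thesis using ne by auto
    qed
    then show False using theta_homeomorphic[OF V[symmetric] ne[symmetric] edges_nonempty] not_theta by blast
  qed
  then obtain f where f: "f \<in> OE" "f 0 = l 1" "f \<noteq> path_rev l" by blast
  have fl: "f \<noteq> l" using f(2) ne by auto
  obtain g where g: "g \<in> OE" "g 0 = l 1" "g \<noteq> path_rev l" "g \<noteq> f"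
    by (rule not_bivalent[OF rp path_rev_0 f(1,2) f(3)[symmetric]]) (use fl in simp)
  interpret lane_wall \<Gamma> V E "path_rev l" f g "l 1"
  proof
    fix l' assume "l' \<in> OE" "l' 0 = path_rev l 1"
    then show "l' = path_rev (path_rev l)" using only by simp
  qed (use conn rp f g fl ne in auto)
  show ?thesis by (rule UC3_free_factor[OF S])
qed

text \<open>The cases follow the number of further lanes at the base of the loop. None: the graph is
  a circle. At least two: the wall applies. Exactly one: its other end is either a branch vertex,
  which the loop avoids, contrary to hyperbolicity, or a leaf, which yields the free factor
  instead.\<close>

lemma loop_free_factor:
  assumes e: "e \<in> OE" "e 0 = e 1"
  shows has_free_factor
proof -
  let ?v = "e 0"
  note ep = OE_props[OF e(1)]
  have "\<exists>g. g \<in> OE \<and> g 0 = ?v \<and> g \<noteq> e \<and> g \<noteq> path_rev e"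
  proof (rule ccontr)
    assume "\<nexists>g. g \<in> OE \<and> g 0 = ?v \<and> g \<noteq> e \<and> g \<noteq> path_rev e"
    then have only: "g = e \<or> g = path_rev e" if "g \<in> OE" "g 0 = ?v" for g using that by blast
    have V: "{?v} = V"
    proof (rule connected_vertices[OF conn])
      fix f assume "f \<in> OE" "f 0 \<in> {?v}"
      then have "f = e \<or> f = path_rev e" using only by simp
      then show "f 1 \<in> {?v}" using e(2) by auto
    qed (use ep in auto)
    have "g = e \<or> g = path_rev e" if "g \<in> OE" for g
      by (rule only[OF that]) (use OE_props(2)[OF that] V in auto)
    then show False using single_loop_theta[OF V[symmetric] e(1)] not_theta by blast
  qed
  then obtain g where g: "g \<in> OE" "g 0 = ?v" "g \<noteq> e" "g \<noteq> path_rev e" by blast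
  show ?thesis
  proof (cases "\<exists>f. f \<in> OE \<and> f 0 = ?v \<and> f \<noteq> e \<and> f \<noteq> path_rev e \<and> f \<noteq> g")
    case True
    then obtain f where f: "f \<in> OE" "f 0 = ?v" "f \<noteq> e" "f \<noteq> path_rev e" "f \<noteq> g" by blast
    interpret lane_wall \<Gamma> V E e f g ?v
      by unfold_locales (use conn e f g in auto)
    show ?thesis by (rule UC3_free_factor[OF S])
  next
    case False
    then have only: "f = e \<or> f = path_rev e \<or> f = g" if "f \<in> OE" "f 0 = ?v" for f using that by blast
    let ?r = "path_rev g"
    have r: "?r \<in> OE" by (rule OE_rev[OF g(1)])
    have gv: "g 1 \<noteq> ?v"
    proof
      assume "g 1 = ?v"
      then have "?r = e \<or> ?r = path_rev e \<or> ?r = g" using only[OF r] by simp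
      then show False using g OE_rev_neq[OF g(1)] by (metis path_rev_rev)
    qed
    show ?thesis
    proof (cases "\<exists>h. h \<in> OE \<and> h 0 = g 1 \<and> h \<noteq> ?r")
      case True
      then obtain h where h: "h \<in> OE" "h 0 = g 1" "h \<noteq> ?r" by blast
      have hg: "h \<noteq> path_rev ?r" using h(2) g(2) gv by auto
      obtain k where k: "k \<in> OE" "k 0 = g 1" "k \<noteq> ?r" "k \<noteq> h"
        by (rule not_bivalent[OF r path_rev_0 h(1,2) h(3)[symmetric] hg])
      have gV: "g 1 \<in> V" by (rule OE_props(3)[OF g(1)])
      \<comment> \<open>A loop is already closed, so the constant path at its base serves as the
        detour.\<close>
      have "?v \<in> topspace \<Gamma>" using ep(2) V_sub by blast
      then have "pathin \<Gamma> (\<lambda>_. ?v)" by (simp add: pathin_def)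
      moreover have "?v \<notin> e ` {0<..<1}" using ep(2,5) by blast
      ultimately have False
        using not_bypassed[OF e(1) gV gv _ r h(1) k(1) path_rev_0 h(2) k(2), of "\<lambda>_. ?v"] e(2) gv h(3) k(3,4) by auto
      then show ?thesis by (rule FalseE)
    next
      case False
      then have "h = ?r" if "h \<in> OE" "h 0 = ?r 0" for h using that by auto
      then show ?thesis by (rule leaf_free_factor[OF r])
    qed
  qed
qed

text \<open>Without leaves and loops every vertex has at least three lanes, and parallel edges would
  form a cycle missing a third vertex, which exists outside theta graphs. On a longest path all
  neighbours of the first vertex lie on the path, and at least two have index 2 or more. The edge to
  the nearer of these closes a cycle that misses the farther one.\<close>

lemma leaf_or_loop:
  "(\<exists>l\<in>OE. \<forall>l'\<in>OE. l' 0 = l 0 \<longrightarrow> l' = l) \<or> (\<exists>e\<in>OE. e 0 = e 1)"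
proof (rule ccontr)
  assume "\<not> ?thesis"
  then have noleaf: "\<exists>l'\<in>OE. l' 0 = l 0 \<and> l' \<noteq> l" and noloop: "l 0 \<noteq> l 1" if "l \<in> OE" for l
    using that by blast+
  have three: "\<exists>r1 r2 r3. r1 \<in> OE \<and> r2 \<in> OE \<and> r3 \<in> OE \<and> r1 0 = v \<and> r2 0 = v \<and> r3 0 = v \<and> r1 \<noteq> r2 \<and> r1 \<noteq> r3 \<and> r2 \<noteq> r3"
    if v: "v \<in> V" for v
  proof -
    obtain r1 where r1: "r1 \<in> OE" "r1 0 = v" by (rule lane_exists[OF v])
    obtain r2 where r2: "r2 \<in> OE" "r2 0 = v" "r2 \<noteq> r1" using noleaf[OF r1(1)] r1(2) by blast
    have "r2 \<noteq> path_rev r1" using r1(2) r2(2) noloop[OF r1(1)] by auto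
    then obtain r3 where "r3 \<in> OE" "r3 0 = v" "r3 \<noteq> r1" "r3 \<noteq> r2"
      by (rule not_bivalent[OF r1 r2(1,2) r2(3)[symmetric]])
    then show ?thesis using r1 r2 by blast
  qed
  have third: "\<exists>w\<in>V. w \<noteq> x \<and> w \<noteq> y" if "x \<in> V" "y \<in> V" "x \<noteq> y" for x y
  proof (rule ccontr)
    assume "\<not> (\<exists>w\<in>V. w \<noteq> x \<and> w \<noteq> y)"
    then have "V = {x, y}" using that by blast
    then show False using theta_homeomorphic[OF _ that(3) edges_nonempty] noloop[OF E_OE] not_theta by blast
  qed
  have noparallel: "r = r'" if r: "r \<in> OE" "r' \<in> OE" "r 0 = r' 0" "r 1 = r' 1" for r r'
  proof (rule ccontr)
    assume ne: "r \<noteq> r'"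
    obtain w where w: "w \<in> V" "w \<noteq> r 0" "w \<noteq> r 1"
      using third[OF OE_props(2)[OF r(1)] OE_props(3)[OF r(1)] noloop[OF r(1)]] by blast
    obtain r1 r2 r3 where rr: "r1 \<in> OE" "r2 \<in> OE" "r3 \<in> OE" "r1 0 = w" "r2 0 = w" "r3 0 = w" "r1 \<noteq> r2" "r1 \<noteq> r3" "r2 \<noteq> r3"
      using three[OF w(1)] by blast
    have "r' \<noteq> path_rev r" using noloop[OF r(1)] r(3) by auto
    then have dis: "r ` {0<..<1} \<inter> r' ` {0<..<1} = {}" by (rule OE_disjoint[OF r(1,2) ne])
    show False
    proof (rule not_bypassed[OF r(1) w rr OE_props(1)[OF r(2)] r(3)[symmetric] r(4)[symmetric]])
      fix t :: real assume t: "t \<in> {0..1}"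
      consider "t = 0 \<or> t = 1" | "t \<in> {0<..<1}" using t by force
      then show "r' t \<noteq> w \<and> r' t \<notin> r ` {0<..<1}"
      proof cases
        case 1
        then show ?thesis using w r(3,4) OE_props(2,3,5)[OF r(1)] by auto
      next
        case 2
        then have "r' t \<in> r' ` {0<..<1}" by (rule imageI)
        then show ?thesis using dis OE_props(5)[OF r(2)] w(1) by (metis IntI empty_iff)
      qed
    qed
  qed
  define adj where "adj x y \<longleftrightarrow> (\<exists>l\<in>OE. l 0 = x \<and> l 1 = y)" for x y
  define D where "D xs \<longleftrightarrow> xs \<noteq> [] \<and> distinct xs \<and> set xs \<subseteq> V \<and> successively adj xs" for xs
  obtain v where v: "v \<in> V" using edges_nonempty edge by blast
  have Dv: "D [v]" using v by (simp add: D_def)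
  have bound: "\<forall>xs. D xs \<longrightarrow> length xs < Suc (card V)"
    unfolding D_def using card_mono[OF finite_V] distinct_card by (metis le_imp_less_Suc)
  obtain xs where xs: "D xs" and longest: "\<And>ys. D ys \<Longrightarrow> length ys \<le> length xs"
    using ex_has_greatest_nat[of D "[v]" length "Suc (card V)", OF Dv] bound by (metis less_imp_le)
  let ?x = "xs ! 0"
  have xs': "xs \<noteq> []" "distinct xs" "set xs \<subseteq> V" "successively adj xs" using xs by (simp_all add: D_def)
  have len: "0 < length xs" using xs'(1) by simp
  have xV: "xs ! i \<in> V" if "i < length xs" for i using xs'(3) nth_mem[OF that] by blast
  have idx: "i = j" if "xs ! i = xs ! j" "i < length xs" "j < length xs" for i j
    using nth_eq_iff_index_eq[OF xs'(2) that(2,3)] that(1) by simp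
  have end_in: "\<exists>i<length xs. l 1 = xs ! i \<and> i \<noteq> 0" if l: "l \<in> OE" "l 0 = ?x" for l
  proof -
    have "l 1 \<in> set xs"
    proof (rule ccontr)
      assume n: "l 1 \<notin> set xs"
      have "adj (l 1) (hd xs)"
        unfolding adj_def using OE_rev[OF l(1)] l(2) xs'(1) by (intro bexI[of _ "path_rev l"]) (simp_all add: hd_conv_nth)
      then have "D (l 1 # xs)"
        unfolding D_def using n xs' OE_props(3)[OF l(1)] by (simp add: successively_Cons)
      then show False using longest by fastforce
    qed
    then obtain i where "i < length xs" "l 1 = xs ! i" by (auto simp: in_set_conv_nth)
    moreover have "i \<noteq> 0" using noloop[OF l(1)] l(2) calculation(2) by metis
    ultimately show ?thesis by blast
  qed
  define I where "I = {i. i < length xs \<and> i \<noteq> 0 \<and> (\<exists>l\<in>OE. l 0 = ?x \<and> l 1 = xs ! i)}"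
  obtain r1 r2 r3 where rr: "r1 \<in> OE" "r2 \<in> OE" "r3 \<in> OE" "r1 0 = ?x" "r2 0 = ?x" "r3 0 = ?x" "r1 \<noteq> r2" "r1 \<noteq> r3" "r2 \<noteq> r3"
    using three[OF xV[OF len]] by blast
  obtain a where a: "a < length xs" "r1 1 = xs ! a" "a \<noteq> 0" using end_in[OF rr(1,4)] by blast
  obtain b where b: "b < length xs" "r2 1 = xs ! b" "b \<noteq> 0" using end_in[OF rr(2,5)] by blast
  obtain c where c: "c < length xs" "r3 1 = xs ! c" "c \<noteq> 0" using end_in[OF rr(3,6)] by blast
  have abc: "a \<in> I" "b \<in> I" "c \<in> I" unfolding I_def using a b c rr by blast+
  have neq: "a \<noteq> b" "a \<noteq> c" "b \<noteq> c"
    using noparallel[OF rr(1,2)] noparallel[OF rr(1,3)] noparallel[OF rr(2,3)] rr a(2) b(2) c(2) by auto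
  have ordered: "\<exists>p q. p \<in> I \<and> q \<in> I \<and> 2 \<le> p \<and> p < q" if "p \<in> I" "q \<in> I" "2 \<le> p" "2 \<le> q" "p \<noteq> q" for p q
    using that by (metis linorder_neqE_nat)
  \<comment> \<open>Three distinct nonzero indices: at most one of them equals 1.\<close>
  have "(2 \<le> a \<and> 2 \<le> b) \<or> (2 \<le> a \<and> 2 \<le> c) \<or> (2 \<le> b \<and> 2 \<le> c)" using neq a(3) b(3) c(3) by arith
  then have "\<exists>p q. p \<in> I \<and> q \<in> I \<and> 2 \<le> p \<and> p < q"
    using ordered[OF abc(1,2)] ordered[OF abc(1,3)] ordered[OF abc(2,3)] neq by blast
  then obtain j k where jk: "j \<in> I" "k \<in> I" "2 \<le> j" "j < k" by blast
  obtain r where r: "r \<in> OE" "r 0 = ?x" "r 1 = xs ! j" using jk(1) unfolding I_def by blast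
  have kl: "k < length xs" and jl: "j < length xs" using jk(1,2) by (simp_all add: I_def)
  let ?w = "xs ! k"
  have w: "?w \<in> V" "?w \<noteq> r 0" "?w \<noteq> r 1"
    using xV[OF kl] idx[OF _ kl len] idx[OF _ kl jl] jk(3,4) r(2,3) by auto
  define A where "A = topspace \<Gamma> - {?w} - r ` {0<..<1}"
  have Vr: "u \<notin> r ` {0<..<1}" if "u \<in> V" for u using OE_props(5)[OF r(1)] that by blast
  \<comment> \<open>The stretch of the longest path up to index \<open>j\<close> is the detour
    around \<open>r\<close>. It avoids \<open>?w\<close> because \<open>k\<close> exceeds
    \<open>j\<close>, and it avoids the interior of \<open>r\<close> because \<open>j\<close> is at
    least 2, so \<open>r\<close> is not one of its edges.\<close>
  have walk: "path_component_of (subtopology \<Gamma> A) ?x (xs ! i)" if "i \<le> j" for i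
    using that
  proof (induction i)
    case 0
    have "?x \<in> A" unfolding A_def using xV[OF len] V_sub w(2) r(2) Vr[OF xV[OF len]] by auto
    then show ?case using xV[OF len] V_sub by (auto simp: path_component_of_refl)
  next
    case (Suc i)
    have il: "i < length xs" "Suc i < length xs" using Suc.prems jl by auto
    have "adj (xs ! i) (xs ! Suc i)" using xs'(4) il(2) unfolding successively_conv_nth by blast
    then obtain l where l: "l \<in> OE" "l 0 = xs ! i" "l 1 = xs ! Suc i" unfolding adj_def by blast
    have "r \<noteq> l"
    proof
      assume "r = l"
      then have "i = 0" "Suc i = j" using idx[OF _ il(1) len] idx[OF _ il(2) jl] l r by auto
      then show False using jk(3) by simp
    qed
    moreover have "l \<noteq> path_rev r"
    proof
      assume "l = path_rev r"
      then have "xs ! Suc i = ?x" using l(3) r(2) by simp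
      then show False using idx[OF _ il(2) len] by blast
    qed
    ultimately have dis: "r ` {0<..<1} \<inter> l ` {0<..<1} = {}" by (rule OE_disjoint[OF r(1) l(1)])
    have "l t \<in> A" if t: "t \<in> {0..1}" for t
    proof -
      have lt: "l t \<in> topspace \<Gamma>" by (rule pathin_topspace[OF OE_props(1)[OF l(1)] t])
      consider "t = 0" | "t = 1" | "t \<in> {0<..<1}" using t by force
      then have "l t \<noteq> ?w \<and> l t \<notin> r ` {0<..<1}"
      proof cases
        case 1
        then show ?thesis using l(2) Vr[OF xV[OF il(1)]] idx[OF _ il(1) kl] Suc.prems jk(4) by auto
      next
        case 2
        then show ?thesis using l(3) Vr[OF xV[OF il(2)]] idx[OF _ il(2) kl] Suc.prems jk(4) by auto
      next
        case 3
        then have "l t \<in> l ` {0<..<1}" by (rule imageI)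
        then show ?thesis using dis OE_props(5)[OF l(1)] w(1) by (metis IntI empty_iff)
      qed
      then show ?thesis using lt by (simp add: A_def)
    qed
    then have "pathin (subtopology \<Gamma> A) l" using OE_props(1)[OF l(1)] by (simp add: pathin_subtopology)
    then have "path_component_of (subtopology \<Gamma> A) (xs ! i) (xs ! Suc i)"
      unfolding path_component_of_def using l(2,3) by blast
    moreover have "path_component_of (subtopology \<Gamma> A) ?x (xs ! i)" using Suc.IH Suc.prems by simp
    ultimately show ?case using path_component_of_trans by metis
  qed
  obtain \<zeta> where \<zeta>: "pathin (subtopology \<Gamma> A) \<zeta>" "\<zeta> 0 = ?x" "\<zeta> 1 = xs ! j"
    using walk[OF order_refl] unfolding path_component_of_def by blast
  have \<zeta>': "pathin \<Gamma> \<zeta>" "\<And>t. t \<in> {0..1} \<Longrightarrow> \<zeta> t \<in> A" using \<zeta>(1) by (auto simp: pathin_subtopology)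
  obtain q1 q2 q3 where qq: "q1 \<in> OE" "q2 \<in> OE" "q3 \<in> OE" "q1 0 = ?w" "q2 0 = ?w" "q3 0 = ?w" "q1 \<noteq> q2" "q1 \<noteq> q3" "q2 \<noteq> q3"
    using three[OF w(1)] by blast
  show False
  proof (rule not_bypassed[OF r(1) w qq \<zeta>'(1)])
    fix t :: real assume "t \<in> {0..1}"
    then show "\<zeta> t \<noteq> ?w \<and> \<zeta> t \<notin> r ` {0<..<1}" using \<zeta>'(2)[of t] by (simp add: A_def)
  qed (use \<zeta> r in simp_all)
qed

lemma free_factor: has_free_factor
  using leaf_or_loop leaf_free_factor loop_free_factor by blast

end

lemma finite_graph_minimal_structure:
  assumes "finite_graph \<Gamma>"
  shows "\<exists>V E. graph_structure \<Gamma> V E \<and> (\<forall>V' E'. graph_structure \<Gamma> V' E' \<longrightarrow> card V \<le> card V')"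
proof -
  define P where "P n \<longleftrightarrow> (\<exists>V E. graph_structure \<Gamma> V E \<and> card V = n)" for n
  have "\<exists>V E. graph_structure \<Gamma> V E"
    using assms unfolding finite_graph_def graph_structure_def
    by (elim conjE exE) (rule exI, rule exI, (intro conjI; (assumption | blast)))
  then obtain V E where "graph_structure \<Gamma> V E" by blast
  then have "P (card V)" unfolding P_def by blast
  then have "P (Least P)" by (rule LeastI)
  then obtain V0 E0 where "graph_structure \<Gamma> V0 E0" "card V0 = Least P" unfolding P_def by blast
  moreover have "Least P \<le> card V'" if "graph_structure \<Gamma> V' E'" for V' E'
    by (rule Least_le) (use that in \<open>auto simp: P_def\<close>)
  ultimately show ?thesis by metis
qed

theorem theorem4:
  fixes \<Gamma> :: "'a topology" and S :: "(nat \<Rightarrow> 'a) set"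
  assumes "finite_graph \<Gamma>"
    and "connected_space \<Gamma>"
    and "\<forall>m. \<not> \<Gamma> homeomorphic_space theta_graph m"
    and "S \<in> topspace (unordered_configuration_space 3 \<Gamma>)"
    and "hyperbolic_group (graph_braid_group 3 \<Gamma> S)"
  shows "\<exists>H :: (real \<Rightarrow> (nat \<Rightarrow> 'a) set) set monoid.
           group H \<and> graph_braid_group 3 \<Gamma> S \<cong> free_product H integer_group"
proof -
  obtain V E where "graph_structure \<Gamma> V E"
    and "\<And>V' E'. graph_structure \<Gamma> V' E' \<Longrightarrow> card V \<le> card V'"
    using finite_graph_minimal_structure[OF assms(1)] by metis
  then have "minimal_graph \<Gamma> V E S"
    unfolding minimal_graph_def minimal_graph_axioms_def
    using assms(2-5) unfolding graph_braid_group_def by blast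
  then show ?thesis
    unfolding graph_braid_group_def by (rule minimal_graph.free_factor)
qed

end
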